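(* Let $\mu$ be a non-degenerate Mandelbrot measure on $K$, generated by the random vector $W$. Suppose that $T(q)>-\infty$ for some $q>1$. Then, almost surely conditional on $\mu\neq0$, the derivative $\tau_\mu'(1)$ of the $L^q$-spectrum of $\mu$ at $q=1$ exists and $$\tau_\mu'(1)=\dim_e^{\vec\gamma}(\mu)=\gamma_1\dim_e(\mu)+\sum_{i=2}^k\gamma_i\min\big(\dim_e(\mu),h_{\nu_i}(T_i)\big),$$ where $\nu_i=\mathbb E(\Pi_i\mu)$, a Bernoulli product measure on $X_i$.
   Context: Symbolic setting. Let $k\ge2$. For $1\le i\le k$ let $\mathcal A_i$ be a finite alphabet with at least 2 elements, $X_i=\mathcal A_i^{\{1,2,\dots\}}$ and $T_i$ the left shift on $X_i$. For $1\le i\le k-1$ let $\pi_i:\mathcal A_i\to\mathcal A_{i+1}$ be a surjective map, extended letter by letter to finite words and to $X_i$. Set $\Pi_i=\pi_{i-1}\circ\cdots\circ\pi_1$ ($\Pi_1$ the identity). $f\nu$ denotes the push-forward of $\nu$ by $f$. $\mathcal A_i^*$ is the set of finite words (including the empty word $\epsilon$), $[u]$ the cylinder of points with prefix $u$, $x_{|n}$ the prefix of length $n$, $|x\wedge y|$ the length of the longest common prefix. Let $\vec\gamma=(\gamma_1,\dots,\gamma_k)$ with $\gamma_1>0$ and $\gamma_2,\dots,\gamma_k\ge0$. $X_1$ is endowed with $d_{\vec\gamma}(x,y)=\max_{1\le i\le k}\exp(-|\Pi_i(x)\wedge\Pi_i(y)|/(\gamma_1+\cdots+\gamma_i))$.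 Random sponge. Let $A=(c_a)_{a\in\mathcal A_1}$ be a random element of $\{0,1\}^{\mathcal A_1}$, identified with $\{a:c_a=1\}$, with $\mathbb E(\#A)>1$. Let $(A(u))_{u\in\mathcal A_1^*}$ be independent copies of $A$, $K_n=\{x\in X_1:c_{x_j}(x_{|j-1})=1,\ 1\le j\le n\}$, $K=\bigcap_{n\ge1}K_n$. Mandelbrot measures on $K$. Let $W=(W_a)_{a\in\mathcal A_1}$ be a non-negative random vector defined simultaneously with $A$, with $\{W_a>0\}\subset\{c_a=1\}$ for all $a$ and $\mathbb E\sum_aW_a=1$; $T(q)=-\log\mathbb E\sum_aW_a^q$, $q\ge0$. Let $(A(u),W(u))_{u\in\mathcal A_1^*}$ be independent copies of $(A,W)$ ($K$ being built from the $A(u)$), $Q^u(v)=\prod_{j=1}^{|v|}W_{v_j}(u\cdot v_{|j-1})$, $Y(u)=\lim_n\sum_{|v|=n}Q^u(v)$ (a.s. martingale limit). The Mandelbrot measure $\mu$ on $X_1$ is defined by $\mu([u])=Q^\epsilon(u)Y(u)$; it is non-degenerate if $\mathbb P(\mu\ne0)>0$. For non-degenerate $\mu$, a.s. on $\mu\neq0$, the entropy dimension $\dim_e(\mu):=\lim_n-\frac1n\sum_{u\in\mathcal A_1^n}\mu([u])\log\mu([u])$ exists and equals $T'(1^-)$. $h_\nu(T_i)$ is the measure-theoretic entropy. $L^q$-spectrum. Let $\mathcal F_n$ be the partition of $(X_1,d_{\vec\gamma})$ into closed balls of radius $e^{-n/\gamma_1}$. For a finite Borel measure $\nu$ on $X_1$,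 $\tau_\nu(q)=\liminf_{n\to\infty}-\frac{\gamma_1}{n}\log\sum_{B\in\mathcal F_n}\nu(B)^q$, $q\in\mathbb R$, with the convention $0^q=0$.
   Formalization: The entropy dimensions of μ (both dim_e and its weighted version) are taken for the normalised measure μ/‖μ‖, since the unnormalised formula would give ‖μ‖T'(1⁻) with random total mass ‖μ‖ and the claimed equality would fail. *)

theory Defs
  imports "HOL-Probability.Probability"
begin

text \<open>
  All alphabets live in one type, as finite sets \<open>\<A> 1, \<dots>, \<A> k\<close>. Points of \<open>X\<^sub>i\<close> are elements of
  \<open>streams (\<A> i)\<close>, with the letter \<open>x\<^sub>j\<close> written \<open>x !! (j - 1)\<close>; the prefix of length \<open>n\<close> is
  \<open>stake n x\<close>, the left shift is \<open>stl\<close>, and the cylinder of \<open>u\<close> is \<open>sstart (\<A> i) u\<close>. The alphabets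
  being finite, the Borel sets of \<open>X\<^sub>i\<close> are those of \<open>stream_space (count_space (\<A> i))\<close>.
\<close>

definition words :: "'a set \<Rightarrow> nat \<Rightarrow> 'a list set" where
  "words S n = {u \<in> lists S. length u = n}"

text \<open>\<open>\<Pi>\<^sub>i = \<pi>\<^sub>i\<^sub>-\<^sub>1 \<circ> \<cdots> \<circ> \<pi>\<^sub>1\<close> on letters; it acts on points through \<open>smap\<close>.\<close>

definition letter_proj :: "(nat \<Rightarrow> 'a \<Rightarrow> 'a) \<Rightarrow> nat \<Rightarrow> 'a \<Rightarrow> 'a" where
  "letter_proj \<pi> i = fold \<pi> [1..<i]"

definition common_prefix_length :: "'a stream \<Rightarrow> 'a stream \<Rightarrow> nat" where
  "common_prefix_length x y = (LEAST n. x !! n \<noteq> y !! n)"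

text \<open>Two equal points have infinite common prefix, whence the value \<open>0 = exp (- \<infinity>)\<close>.\<close>

definition weighted_dist ::
    "nat \<Rightarrow> (nat \<Rightarrow> 'a \<Rightarrow> 'a) \<Rightarrow> (nat \<Rightarrow> real) \<Rightarrow> 'a stream \<Rightarrow> 'a stream \<Rightarrow> real" where
  "weighted_dist k \<pi> \<gamma> x y =
     Max ((\<lambda>i. let x' = smap (letter_proj \<pi> i) x; y' = smap (letter_proj \<pi> i) y
               in if x' = y' then 0
                  else exp (- (real (common_prefix_length x' y') / (\<Sum>j = 1..i. \<gamma> j)))) ` {1..k})"

definition ball_partition ::
    "nat \<Rightarrow> 'a set \<Rightarrow> (nat \<Rightarrow> 'a \<Rightarrow> 'a) \<Rightarrow> (nat \<Rightarrow> real) \<Rightarrow> nat \<Rightarrow> 'a stream set set" where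
  "ball_partition k S \<pi> \<gamma> n =
     (\<lambda>x. {y \<in> streams S. weighted_dist k \<pi> \<gamma> x y \<le> exp (- (real n / \<gamma> 1))}) ` streams S"

definition Lq_spectrum ::
    "nat \<Rightarrow> 'a set \<Rightarrow> (nat \<Rightarrow> 'a \<Rightarrow> 'a) \<Rightarrow> (nat \<Rightarrow> real) \<Rightarrow> 'a stream measure \<Rightarrow> real \<Rightarrow> ereal" where
  "Lq_spectrum k S \<pi> \<gamma> \<nu> q =
     liminf (\<lambda>n. ereal (- (\<gamma> 1 / real n) *
       ln (\<Sum>B\<in>ball_partition k S \<pi> \<gamma> n. measure \<nu> B powr q)))"

definition has_ereal_derivative :: "(real \<Rightarrow> ereal) \<Rightarrow> real \<Rightarrow> real \<Rightarrow> bool" where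
  "has_ereal_derivative f D x \<longleftrightarrow>
     (\<forall>\<^sub>F q in nhds x. \<bar>f q\<bar> \<noteq> \<infinity>) \<and>
     ((\<lambda>q. real_of_ereal (f q)) has_real_derivative D) (at x)"

definition shannon_entropy :: "'b measure \<Rightarrow> 'b set set \<Rightarrow> real" where
  "shannon_entropy \<nu> P = - (\<Sum>C\<in>P. measure \<nu> C * ln (measure \<nu> C))"

text \<open>
  The entropy dimensions are those of the normalised measure \<open>\<nu> / \<parallel>\<nu>\<parallel>\<close>, which is
  \<open>uniform_measure \<nu> (space \<nu>)\<close>: without this normalisation the limits get multiplied by the total
  mass \<open>\<parallel>\<nu>\<parallel>\<close>, which is random for a Mandelbrot measure. The first one uses cylinders of length \<open>n\<close>,
  the second one the balls of radius \<open>exp (- n / \<gamma> 1)\<close> of the weighted metric.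
\<close>

definition has_entropy_dim :: "'a set \<Rightarrow> 'a stream measure \<Rightarrow> real \<Rightarrow> bool" where
  "has_entropy_dim S \<nu> d \<longleftrightarrow>
     (\<lambda>n. 1 / real n * shannon_entropy (uniform_measure \<nu> (space \<nu>)) (sstart S ` words S n))
       \<longlonglongrightarrow> d"

definition has_weighted_entropy_dim ::
    "nat \<Rightarrow> 'a set \<Rightarrow> (nat \<Rightarrow> 'a \<Rightarrow> 'a) \<Rightarrow> (nat \<Rightarrow> real) \<Rightarrow> 'a stream measure \<Rightarrow> real \<Rightarrow> bool" where
  "has_weighted_entropy_dim k S \<pi> \<gamma> \<nu> d \<longleftrightarrow>
     (\<lambda>n. \<gamma> 1 / real n *
        shannon_entropy (uniform_measure \<nu> (space \<nu>)) (ball_partition k S \<pi> \<gamma> n))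
       \<longlonglongrightarrow> d"

text \<open>Kolmogorov--Sinai entropy of a measure-preserving map of a probability space.\<close>

definition iterated_join :: "'b measure \<Rightarrow> ('b \<Rightarrow> 'b) \<Rightarrow> 'b set set \<Rightarrow> nat \<Rightarrow> 'b set set" where
  "iterated_join \<nu> T P n =
     (\<lambda>f. space \<nu> \<inter> (\<Inter>j<n. (T ^^ j) -` f j)) ` ({..<n} \<rightarrow>\<^sub>E P)"

definition measure_entropy :: "'b measure \<Rightarrow> ('b \<Rightarrow> 'b) \<Rightarrow> ereal" where
  "measure_entropy \<nu> T =
     (SUP P \<in> {P. finite P \<and> P \<subseteq> sets \<nu> \<and> partition_on (space \<nu>) P}.
        ereal (lim (\<lambda>n. 1 / real n * shannon_entropy \<nu> (iterated_join \<nu> T P n))))"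

definition bernoulli_product :: "'a set \<Rightarrow> 'a stream measure \<Rightarrow> bool" where
  "bernoulli_product S \<nu> \<longleftrightarrow>
     (\<exists>p. prob_space p \<and> sets p = sets (count_space S) \<and> \<nu> = stream_space p)"

text \<open>The measure \<open>B \<mapsto> \<E>(\<xi>(B))\<close> on \<open>N\<close>, for a random measure \<open>\<xi>\<close> on \<open>N\<close>.\<close>

definition mean_measure :: "'w measure \<Rightarrow> 'b measure \<Rightarrow> ('w \<Rightarrow> 'b measure) \<Rightarrow> 'b measure" where
  "mean_measure M N \<xi> =
     measure_of (space N) (sets N) (\<lambda>B. \<integral>\<^sup>+ \<omega>. emeasure (\<xi> \<omega>) B \<partial>M)"

text \<open>The space of values of \<open>(A, W)\<close>; a subset of \<open>S\<close> encodes its indicator in \<open>{0,1}\<^sup>S\<close>.\<close>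

abbreviation offspring_space :: "'a set \<Rightarrow> ('a set \<times> ('a \<Rightarrow> real)) measure" where
  "offspring_space S \<equiv> count_space (Pow S) \<Otimes>\<^sub>M (\<Pi>\<^sub>M a\<in>S. borel)"

text \<open>\<open>0 powr q = 0\<close> also for \<open>q = 0\<close>, so that \<open>T 0 = - log \<E> (#{a. W\<^sub>a > 0})\<close>.\<close>

definition cascade_T :: "'w measure \<Rightarrow> 'a set \<Rightarrow> ('w \<Rightarrow> 'a \<Rightarrow> real) \<Rightarrow> real \<Rightarrow> ereal" where
  "cascade_T M S W q =
     (let m = \<integral>\<^sup>+ \<omega>. ennreal (\<Sum>a\<in>S. W \<omega> a powr q) \<partial>M
      in if m = 0 then \<infinity> else if m = \<infinity> then - \<infinity> else ereal (- ln (enn2real m)))"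

definition cascade_Q :: "('a list \<Rightarrow> 'w \<Rightarrow> 'a \<Rightarrow> real) \<Rightarrow> 'w \<Rightarrow> 'a list \<Rightarrow> 'a list \<Rightarrow> real" where
  "cascade_Q Wt \<omega> u v = (\<Prod>j<length v. Wt (u @ take j v) \<omega> (v ! j))"

definition cascade_Y ::
    "'a set \<Rightarrow> ('a list \<Rightarrow> 'w \<Rightarrow> 'a \<Rightarrow> real) \<Rightarrow> 'w \<Rightarrow> 'a list \<Rightarrow> real" where
  "cascade_Y S Wt \<omega> u = lim (\<lambda>n. \<Sum>v\<in>words S n. cascade_Q Wt \<omega> u v)"

text \<open>
  The measure with mass \<open>Q\<^sup>\<epsilon>(u) Y(u)\<close> on each cylinder \<open>[u]\<close>; it is the null measure on the negligible
  event where these masses are not consistent.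
\<close>

definition mandelbrot_measure ::
    "'a set \<Rightarrow> ('a list \<Rightarrow> 'w \<Rightarrow> 'a \<Rightarrow> real) \<Rightarrow> 'w \<Rightarrow> 'a stream measure" where
  "mandelbrot_measure S Wt \<omega> =
     extend_measure (streams S) (lists S) (sstart S)
       (\<lambda>u. ennreal (cascade_Q Wt \<omega> [] u * cascade_Y S Wt \<omega> u))"

text \<open>
  The random sponge \<open>K\<close>. Since almost surely \<open>W\<^sub>a(u) > 0\<close> only for \<open>a \<in> A(u)\<close>, the Mandelbrot measure
  is almost surely carried by \<open>K\<close>.
\<close>

definition sponge_approx :: "'a set \<Rightarrow> ('a list \<Rightarrow> 'w \<Rightarrow> 'a set) \<Rightarrow> 'w \<Rightarrow> nat \<Rightarrow> 'a stream set" where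
  "sponge_approx S At \<omega> n = {x \<in> streams S. \<forall>j\<in>{1..n}. x !! (j - 1) \<in> At (stake (j - 1) x) \<omega>}"

definition random_sponge :: "'a set \<Rightarrow> ('a list \<Rightarrow> 'w \<Rightarrow> 'a set) \<Rightarrow> 'w \<Rightarrow> 'a stream set" where
  "random_sponge S At \<omega> = (\<Inter>n\<in>{1..}. sponge_approx S At \<omega> n)"

end

theory Submission
  imports Defs
begin

text \<open>
  The \<open>L\<^sup>q\<close>-spectrum of \<open>\<mu>\<close> at scale \<open>n\<close> is, up to sign and normalisation, \<open>ln (\<Sum> \<mu>(B)\<^sup>q)\<close>, a convex
  function of \<open>q\<close> that is asymptotically negligible at \<open>q = 1\<close> and whose derivative there is minus the
  entropy of the partition into balls. Hence it suffices to bound \<open>\<Sum> \<mu>(B)\<^sup>q\<close> from above for some \<open>q\<close>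
  arbitrarily close to \<open>1\<close> on each side, and by the Borel--Cantelli argument it is enough to bound
  the expectations.

  A ball is given by the values \<open>g\<^sub>j(x\<^sub>j)\<close> of letter maps \<open>g\<^sub>j\<close>, each of them one of the \<open>\<Pi>\<^sub>i\<close>. Let
  \<open>\<phi>(q) = \<E> (\<Sum> W\<^sub>a\<^sup>q)\<close>, with slope \<open>- dim\<^sub>e(\<mu>)\<close> at \<open>1\<close>, and let \<open>\<phi>\<^sub>g(q) = \<Sum> p\<^sub>c\<^sup>q\<close> for the law \<open>p\<close> of a letter
  under \<open>g\<close> applied to the mean measure, with slope minus the entropy of \<open>p\<close>. Removing the first
  letter, the sum of the \<open>q\<close>-th moments is multiplied for \<open>q > 1\<close> by at most \<open>max (\<phi>(q)) (\<phi>\<^sub>g(q))\<close> up to a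
  linear factor, by an inequality of von Bahr--Esseen type. For \<open>q < 1\<close> one uses subadditivity
  on the first blocks, where the entropy of \<open>p\<close> exceeds \<open>dim\<^sub>e(\<mu>)\<close>, and Jensen's inequality on the
  remaining ones; the entropies of the \<open>\<nu>\<^sub>i\<close> decrease with \<open>i\<close>.

  For \<open>q > 1\<close> close to \<open>1\<close> the total mass \<open>Y\<close> must have a finite \<open>q\<close>-th moment: either \<open>dim\<^sub>e(\<mu>) > 0\<close>, by the
  argument of Kahane and Peyriere, or at most one \<open>W\<^sub>a\<close> is non-zero and then \<open>Y = 1\<close>.
\<close>

subsection \<open>Almost sure convergence of nonnegative martingales\<close>

text \<open>Only upper bounds of \<open>\<Sum> \<mu>(B)\<^sup>q\<close> are ever used: to the right
  of 1 they bound the slope of the spectrum from below, to the left from above, and convexity does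
  the rest. So annealed estimates suffice, and the random sums need no lower bound. The minimum of
  \<open>dim\<^sub>e(\<mu>)\<close> and an entropy has a different origin on each side. To the right
  of 1 the larger of \<open>\<phi>(q)\<close> and \<open>\<phi>\<^sub>g(q)\<close> dominates, which
  is the one that decays more slowly. To the left the smaller one may be chosen letter by letter,
  but subadditivity can only be applied before Jensen's inequality, so the choice has to respect the
  order of the letters. Three objects carry their intended value only after an existence proof:
  \<open>Y\<close> is a \<open>lim\<close>, handled by a martingale argument; the measure is an
  \<open>extend_measure\<close>, null unless some measure with these cylinder masses exists, so one
  is built from Lebesgue measure; and \<open>measure_entropy\<close> is a supremum of
  \<open>lim\<close>s over all finite partitions, compared with the partition by the first
  letter.\<close>

primrec holding :: "real \<Rightarrow> real \<Rightarrow> (nat \<Rightarrow> real) \<Rightarrow> nat \<Rightarrow> bool" where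
  "holding a b x 0 = (x 0 \<le> a)"
| "holding a b x (Suc n) = (if holding a b x n then x (Suc n) < b else x (Suc n) \<le> a)"

primrec upcrossings :: "real \<Rightarrow> real \<Rightarrow> (nat \<Rightarrow> real) \<Rightarrow> nat \<Rightarrow> nat" where
  "upcrossings a b x 0 = 0"
| "upcrossings a b x (Suc n) =
     upcrossings a b x n + (if holding a b x n \<and> b \<le> x (Suc n) then 1 else 0)"

text \<open>The gain of the strategy that buys below \<open>a\<close> and sells above \<open>b\<close>.\<close>

lemma upcrossings_gain:
  assumes "\<And>n. 0 \<le> x n" "0 \<le> a" "a < b"
  shows "(b - a) * real (upcrossings a b x n) - a
    \<le> (\<Sum>i<n. if holding a b x i then x (Suc i) - x i else 0)"
proof -
  \<comment> \<open>The induction needs the unrealised gain \<open>x n - a\<close> of an open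
    position as an extra term; at the end it is at least \<open>- a\<close> because \<open>x\<close>
    is nonnegative.\<close>
  have "(b - a) * real (upcrossings a b x n) + (if holding a b x n then x n - a else 0)
     \<le> (\<Sum>i<n. if holding a b x i then x (Suc i) - x i else 0)"
  proof (induction n)
    case (Suc n)
    consider "holding a b x n" "x (Suc n) < b" | "holding a b x n" "b \<le> x (Suc n)"
      | "\<not> holding a b x n" by linarith
    then show ?case
    proof cases
      case 2
      then have "(b - a) * real (upcrossings a b x (Suc n)) = (b - a) * real (upcrossings a b x n) + (b - a)"
        by (simp add: distrib_left)
      with 2 Suc show ?thesis by simp
    qed (use Suc in auto)
  qed simp
  then show ?thesis using assms(1)[of n] assms(2) by (auto split: if_splits)
qed

text \<open>A bounded count is constant from some time on, so no position is sold afterwards. Then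
  either a position stays open and \<open>x\<close> stays below \<open>b\<close>, or none is opened
  any more and \<open>x\<close> stays above \<open>a\<close>.\<close>

lemma upcrossings_unbounded:
  assumes "frequently (\<lambda>n. x n < a) sequentially" "frequently (\<lambda>n. b < x n) sequentially" "a < b"
  shows "\<exists>n. K < upcrossings a b x n"
proof (rule ccontr)
  assume "\<not> ?thesis"
  then have K: "\<And>n. upcrossings a b x n \<le> K" by (meson not_less)
  define m where "m = Max (range (upcrossings a b x))"
  have fin: "finite (range (upcrossings a b x))"
    by (rule finite_subset[of _ "{..K}"]) (use K in blast, simp)
  have "m \<in> range (upcrossings a b x)" unfolding m_def using fin by (intro Max_in) auto
  then obtain N where N: "upcrossings a b x N = m" by auto
  have ge: "upcrossings a b x n \<ge> m" if "n \<ge> N" for n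
    using that by (induction n rule: dec_induct) (auto simp: N)
  have le: "upcrossings a b x n \<le> m" for n unfolding m_def using fin by (intro Max_ge) auto
  have no: "\<not> (holding a b x n \<and> b \<le> x (Suc n))" if "n \<ge> N" for n
    using ge[of n] le[of "Suc n"] that by (auto split: if_splits)
  show False
  proof (cases "\<exists>n\<ge>N. holding a b x n")
    case True
    then obtain n where n: "n \<ge> N" "holding a b x n" by auto
    have "holding a b x m" if "m \<ge> n" for m
      using that by (induction m rule: dec_induct) (use n no in \<open>auto simp: not_le\<close>)
    with no n have "x (Suc m) < b" if "m \<ge> n" for m using that by (meson le_trans not_le)
    then have "eventually (\<lambda>m. \<not> b < x m) sequentially"
      by (intro eventually_sequentiallyI[of "Suc n"]) (metis Suc_le_D Suc_le_mono not_less_iff_gr_or_eq)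
    then show False using assms(2) by (simp add: frequently_def)
  next
    case False
    then have "\<not> x (Suc n) \<le> a" if "n \<ge> N" for n using that by (metis le_Suc_eq holding.simps(2))
    then have "eventually (\<lambda>m. \<not> x m < a) sequentially"
      by (intro eventually_sequentiallyI[of "Suc N"]) (metis Suc_le_D Suc_le_mono less_imp_le)
    then show False using assms(1) by (simp add: frequently_def)
  qed
qed

text \<open>Two levels strictly between the lower and the upper limit would be crossed infinitely
  often. They can be taken rational, so that countably many almost sure events suffice later.
  Finiteness of the lower limit excludes divergence to infinity, which happens without
  upcrossings.\<close>

lemma convergent_if_upcrossings_bounded:
  assumes nn: "\<And>n. 0 \<le> (x n :: real)" and lim: "liminf (\<lambda>n. ereal (x n)) < \<infinity>"
    and up: "\<And>a b. a \<in> \<rat> \<Longrightarrow> b \<in> \<rat> \<Longrightarrow> 0 \<le> a \<Longrightarrow> a < b \<Longrightarrow> \<exists>K. \<forall>n. upcrossings a b x n \<le> K"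
  shows "convergent x"
proof -
  let ?l = "liminf (\<lambda>n. ereal (x n))" and ?u = "limsup (\<lambda>n. ereal (x n))"
  have l0: "0 \<le> ?l" by (rule Liminf_bounded) (use nn in auto)
  have "?u = ?l"
  proof (rule ccontr)
    assume "?u \<noteq> ?l"
    moreover have "?l \<le> ?u" by (rule Liminf_le_Limsup) simp
    ultimately have "?l < ?u" by auto
    then obtain r where r: "?l < ereal r" "ereal r < ?u" using ereal_dense2 by blast
    then obtain s where s: "r < s" "ereal s < ?u" using ereal_dense2[of "ereal r" ?u] by auto
    from s(1) obtain a where a: "a \<in> \<rat>" "r < a" "a < s" using Rats_dense_in_real by blast
    from a(3) obtain b where b: "b \<in> \<rat>" "a < b" "b < s" using Rats_dense_in_real by blast
    have la: "?l < ereal a" using r a by (meson ereal_less_eq(3) less_imp_le less_le_trans)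
    have ub: "ereal b < ?u" using s b by (meson ereal_less(2) less_ereal.simps(1) less_trans)
    have "0 \<le> a" using l0 la by (metis ereal_less(2) le_less_trans less_imp_le less_ereal.simps(1) zero_ereal_def)
    then obtain K where K: "\<forall>n. upcrossings a b x n \<le> K" using up a b by blast
    have "frequently (\<lambda>n. x n < a) sequentially"
    proof (rule ccontr)
      assume "\<not> ?thesis"
      then have "eventually (\<lambda>n. ereal a \<le> ereal (x n)) sequentially"
        by (simp add: not_frequently not_less)
      then have "ereal a \<le> ?l" by (rule Liminf_bounded)
      then show False using la by simp
    qed
    moreover have "frequently (\<lambda>n. b < x n) sequentially"
    proof (rule ccontr)
      assume "\<not> ?thesis"
      then have "eventually (\<lambda>n. ereal (x n) \<le> ereal b) sequentially"
        by (simp add: not_frequently not_less)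
      then have "?u \<le> ereal b" by (rule Limsup_bounded)
      then show False using ub by simp
    qed
    ultimately show False using upcrossings_unbounded[of x a b K] b(2) K by (meson not_le)
  qed
  moreover obtain c where "?l = ereal c" using l0 lim by (cases ?l) auto
  ultimately have "(\<lambda>n. ereal (x n)) \<longlonglongrightarrow> ereal c"
    by (intro Liminf_eq_Limsup) auto
  then show ?thesis unfolding convergent_def by auto
qed

text \<open>Doob's argument: the buy-and-sell strategy has mean gain 0 against a martingale, and it
  loses at most \<open>a\<close> because \<open>Z\<close> is nonnegative, so the number of
  upcrossings has mean at most \<open>a / (b - a)\<close>. The martingale property is expressed by
  integrals over events of \<open>F n\<close>, the form in which independence provides it.\<close>

lemma (in prob_space) AE_convergent_nonneg_martingale:
  fixes Z :: "nat \<Rightarrow> 'a \<Rightarrow> real" and F :: "nat \<Rightarrow> 'a measure"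
  assumes space: "\<And>n. space (F n) = space M" and sub: "\<And>n. sets (F n) \<subseteq> sets M"
    and mono: "\<And>n. sets (F n) \<subseteq> sets (F (Suc n))"
    and Z[measurable]: "\<And>n. Z n \<in> borel_measurable (F n)" and nn: "\<And>n \<omega>. 0 \<le> Z n \<omega>"
    and fin: "(\<integral>\<^sup>+\<omega>. ennreal (Z 0 \<omega>) \<partial>M) < \<infinity>"
    and mart: "\<And>n B. B \<in> sets (F n) \<Longrightarrow>
      (\<integral>\<^sup>+\<omega>. ennreal (Z (Suc n) \<omega>) * indicator B \<omega> \<partial>M) = (\<integral>\<^sup>+\<omega>. ennreal (Z n \<omega>) * indicator B \<omega> \<partial>M)"
  shows "AE \<omega> in M. convergent (\<lambda>n. Z n \<omega>)"
proof -
  have subM: "measurable (F n) N \<subseteq> measurable M N" for n and N :: "'c measure"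
    by (rule measurable_mono) (use space sub in auto)
  have ZM[measurable]: "Z n \<in> borel_measurable M" for n using Z subM by blast
  have Fle: "sets (F m) \<subseteq> sets (F n)" if "m \<le> n" for m n
    using that by (induction n rule: dec_induct) (use mono in auto)
  have ZF: "Z m \<in> borel_measurable (F n)" if "m \<le> n" for m n
    using Z[of m] measurable_mono[OF order_refl _ Fle[OF that], of borel] space by auto
  have fin': "(\<integral>\<^sup>+\<omega>. ennreal (Z n \<omega>) \<partial>M) = (\<integral>\<^sup>+\<omega>. ennreal (Z 0 \<omega>) \<partial>M)" for n
  proof (induction n)
    case (Suc n)
    have "(\<integral>\<^sup>+\<omega>. ennreal (Z (Suc n) \<omega>) \<partial>M) = (\<integral>\<^sup>+\<omega>. ennreal (Z (Suc n) \<omega>) * indicator (space M) \<omega> \<partial>M)"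
      by (intro nn_integral_cong) auto
    also have "\<dots> = (\<integral>\<^sup>+\<omega>. ennreal (Z n \<omega>) * indicator (space M) \<omega> \<partial>M)"
      using sets.top[of "F n"] space by (intro mart) auto
    also have "\<dots> = (\<integral>\<^sup>+\<omega>. ennreal (Z n \<omega>) \<partial>M)" by (intro nn_integral_cong) auto
    finally show ?case using Suc by simp
  qed simp
  have intZ[simp]: "integrable M (Z n)" for n
    by (rule integrableI_nonneg[OF ZM]) (use nn fin fin'[of n] in simp_all)
  have mart': "(\<integral>\<omega>. Z (Suc n) \<omega> * indicator B \<omega> \<partial>M) = (\<integral>\<omega>. Z n \<omega> * indicator B \<omega> \<partial>M)"
    if B: "B \<in> sets (F n)" for n B
  proof -
    have [measurable]: "B \<in> sets M" using B sub by auto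
    have eq: "(\<integral>\<omega>. Z m \<omega> * indicator B \<omega> \<partial>M) = enn2real (\<integral>\<^sup>+\<omega>. ennreal (Z m \<omega>) * indicator B \<omega> \<partial>M)" for m
      by (subst integral_eq_nn_integral)
         (auto simp: nn ennreal_mult ennreal_indicator intro!: arg_cong[where f=enn2real] nn_integral_cong)
    show ?thesis using mart[OF B] by (simp add: eq)
  qed
  have up: "AE \<omega> in M. \<exists>K. \<forall>n. upcrossings a b (\<lambda>n. Z n \<omega>) n \<le> K" if ab: "0 \<le> a" "a < b" for a b
  proof -
    \<comment> \<open>Whether a position is held at time \<open>n\<close> is decided by
      \<open>Z 0\<close>, ..., \<open>Z n\<close>; the increments of the gain are therefore
      integrated over events of the past, where the martingale property makes them vanish.\<close>
    have H: "{\<omega>\<in>space M. holding a b (\<lambda>n. Z n \<omega>) n} \<in> sets (F n)" for n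
    proof (induction n)
      case 0
      have "{\<omega>\<in>space (F 0). Z 0 \<omega> \<le> a} \<in> sets (F 0)" by measurable
      then show ?case by (simp add: space)
    next
      case (Suc n)
      then have [measurable]: "{\<omega>\<in>space M. holding a b (\<lambda>n. Z n \<omega>) n} \<in> sets (F (Suc n))"
        using mono by auto
      have "{\<omega>\<in>space M. holding a b (\<lambda>n. Z n \<omega>) (Suc n)} =
         ({\<omega>\<in>space M. holding a b (\<lambda>n. Z n \<omega>) n} \<inter> {\<omega>\<in>space (F (Suc n)). Z (Suc n) \<omega> < b}) \<union>
         ({\<omega>\<in>space (F (Suc n)). Z (Suc n) \<omega> \<le> a} - {\<omega>\<in>space M. holding a b (\<lambda>n. Z n \<omega>) n})"
        by (auto simp: space)
      also have "\<dots> \<in> sets (F (Suc n))" by measurable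
      finally show ?case .
    qed
    then have [measurable]: "Measurable.pred M (\<lambda>\<omega>. holding a b (\<lambda>n. Z n \<omega>) n)" for n
      using sub by (auto simp: pred_def)
    have um[measurable]: "(\<lambda>\<omega>. upcrossings a b (\<lambda>n. Z n \<omega>) n) \<in> measurable M (count_space UNIV)" for n
      by (induction n) simp_all
    have gain: "(\<integral>\<omega>. (\<Sum>i<n. if holding a b (\<lambda>n. Z n \<omega>) i then Z (Suc i) \<omega> - Z i \<omega> else 0) \<partial>M) = 0" for n
    proof -
      have *: "(if holding a b (\<lambda>n. Z n \<omega>) i then Z (Suc i) \<omega> - Z i \<omega> else 0) =
         Z (Suc i) \<omega> * indicator {\<omega>\<in>space M. holding a b (\<lambda>n. Z n \<omega>) i} \<omega> -
         Z i \<omega> * indicator {\<omega>\<in>space M. holding a b (\<lambda>n. Z n \<omega>) i} \<omega>" if "\<omega> \<in> space M" for i \<omega>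
        using that by (auto split: split_indicator)
      have i: "integrable M (\<lambda>\<omega>. Z j \<omega> * indicator {\<omega>\<in>space M. holding a b (\<lambda>n. Z n \<omega>) i} \<omega>)" for i j
        by (rule integrable_mult_indicator[where 'b=real, simplified mult.commute real_scaleR_def]) simp_all
      have "(\<integral>\<omega>. (\<Sum>i<n. if holding a b (\<lambda>n. Z n \<omega>) i then Z (Suc i) \<omega> - Z i \<omega> else 0) \<partial>M) =
        (\<integral>\<omega>. (\<Sum>i<n. Z (Suc i) \<omega> * indicator {\<omega>\<in>space M. holding a b (\<lambda>n. Z n \<omega>) i} \<omega> -
         Z i \<omega> * indicator {\<omega>\<in>space M. holding a b (\<lambda>n. Z n \<omega>) i} \<omega>) \<partial>M)"
        by (intro Bochner_Integration.integral_cong refl sum.cong) (use * in auto)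
      also have "\<dots> = (\<Sum>i<n. 0)"
        by (subst Bochner_Integration.integral_sum)
           (auto intro!: sum.cong simp: i mart'[OF H])
      finally show ?thesis by simp
    qed
    have bnd: "(\<integral>\<^sup>+\<omega>. ennreal (real (upcrossings a b (\<lambda>n. Z n \<omega>) n)) \<partial>M) \<le> ennreal (a / (b - a))" for n
    proof -
      let ?G = "\<lambda>\<omega>. (\<Sum>i<n. if holding a b (\<lambda>n. Z n \<omega>) i then Z (Suc i) \<omega> - Z i \<omega> else 0)"
      have iG: "integrable M ?G"
      proof (intro Bochner_Integration.integrable_sum)
        fix i
        show "integrable M (\<lambda>\<omega>. if holding a b (\<lambda>n. Z n \<omega>) i then Z (Suc i) \<omega> - Z i \<omega> else 0)"
          by (rule Bochner_Integration.integrable_bound[of _ "\<lambda>\<omega>. Z (Suc i) \<omega> + Z i \<omega>"])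
             (auto intro!: AE_I2 simp: nn abs_le_iff)
      qed
      have pw: "real (upcrossings a b (\<lambda>n. Z n \<omega>) n) \<le> (?G \<omega> + a) / (b - a)" for \<omega>
        using upcrossings_gain[of "\<lambda>n. Z n \<omega>" a b n] ab nn by (simp add: field_simps)
      have iu: "integrable M (\<lambda>\<omega>. real (upcrossings a b (\<lambda>n. Z n \<omega>) n))"
      proof (rule Bochner_Integration.integrable_bound[of _ "\<lambda>\<omega>. (?G \<omega> + a) / (b - a)"])
        show "integrable M (\<lambda>\<omega>. (?G \<omega> + a) / (b - a))" using iG by simp
        show "AE \<omega> in M. norm (real (upcrossings a b (\<lambda>n. Z n \<omega>) n)) \<le> norm ((?G \<omega> + a) / (b - a))"
          using pw by (intro AE_I2) (metis abs_of_nonneg norm_of_nat of_nat_0_le_iff order_trans real_norm_def)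
      qed simp
      have "(\<integral>\<omega>. real (upcrossings a b (\<lambda>n. Z n \<omega>) n) \<partial>M) \<le> (\<integral>\<omega>. (?G \<omega> + a) / (b - a) \<partial>M)"
        using iG by (intro integral_mono iu) (use pw in auto)
      also have "\<dots> = a / (b - a)" using iG gain[of n] by (simp add: prob_space)
      finally show ?thesis
        by (subst nn_integral_eq_integral[OF iu]) (auto intro: ennreal_leI)
    qed
    have mu: "upcrossings a b x n \<le> upcrossings a b x (Suc n)" for x n by simp
    have "(\<integral>\<^sup>+\<omega>. (SUP n. ennreal (real (upcrossings a b (\<lambda>n. Z n \<omega>) n))) \<partial>M)
        = (SUP n. \<integral>\<^sup>+\<omega>. ennreal (real (upcrossings a b (\<lambda>n. Z n \<omega>) n)) \<partial>M)"
      by (intro nn_integral_monotone_convergence_SUP)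
         (auto simp: incseq_Suc_iff le_fun_def intro!: ennreal_leI)
    also have "\<dots> \<le> ennreal (a / (b - a))" by (intro SUP_least bnd)
    finally have "(\<integral>\<^sup>+\<omega>. (SUP n. ennreal (real (upcrossings a b (\<lambda>n. Z n \<omega>) n))) \<partial>M) \<noteq> \<infinity>"
      by (metis ennreal_neq_top infinity_ennreal_def top.extremum_uniqueI)
    then have "AE \<omega> in M. (SUP n. ennreal (real (upcrossings a b (\<lambda>n. Z n \<omega>) n))) \<noteq> \<infinity>"
      by (intro nn_integral_PInf_AE) auto
    then show ?thesis
    proof eventually_elim
      case (elim \<omega>)
      then obtain r where r: "0 \<le> r" "(SUP n. ennreal (real (upcrossings a b (\<lambda>n. Z n \<omega>) n))) = ennreal r"
        by (metis ennreal_cases infinity_ennreal_def)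
      have "upcrossings a b (\<lambda>n. Z n \<omega>) n \<le> nat \<lceil>r\<rceil>" for n
      proof -
        have "ennreal (real (upcrossings a b (\<lambda>n. Z n \<omega>) n)) \<le> ennreal r"
          unfolding r(2)[symmetric] by (rule SUP_upper) simp
        then show ?thesis using r(1) by (simp add: ennreal_le_iff) linarith
      qed
      then show ?case by blast
    qed
  qed
  have "AE \<omega> in M. \<forall>a\<in>\<rat>. \<forall>b\<in>\<rat>. 0 \<le> a \<longrightarrow> a < b \<longrightarrow> (\<exists>K. \<forall>n. upcrossings a b (\<lambda>n. Z n \<omega>) n \<le> K)"
    by (intro AE_ball_countable' countable_rat AE_impI up) auto
  \<comment> \<open>Fatou's lemma rules out that \<open>Z n\<close> tends to infinity.\<close>
  moreover have "AE \<omega> in M. liminf (\<lambda>n. ennreal (Z n \<omega>)) \<noteq> \<infinity>"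
  proof (rule nn_integral_PInf_AE)
    have "(\<integral>\<^sup>+\<omega>. liminf (\<lambda>n. ennreal (Z n \<omega>)) \<partial>M) \<le> liminf (\<lambda>n. \<integral>\<^sup>+\<omega>. ennreal (Z n \<omega>) \<partial>M)"
      by (rule nn_integral_liminf) simp
    also have "\<dots> = (\<integral>\<^sup>+\<omega>. ennreal (Z 0 \<omega>) \<partial>M)" by (subst ext[of "\<lambda>n. \<integral>\<^sup>+\<omega>. ennreal (Z n \<omega>) \<partial>M", OF fin']) (simp add: Liminf_const)
    finally show "(\<integral>\<^sup>+\<omega>. liminf (\<lambda>n. ennreal (Z n \<omega>)) \<partial>M) \<noteq> \<infinity>" using fin by auto
  qed simp
  ultimately show ?thesis
  proof eventually_elim
    case (elim \<omega>)
    have "liminf (\<lambda>n. ereal (Z n \<omega>)) < \<infinity>"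
    proof (rule ccontr)
      assume "\<not> ?thesis"
      then have "(\<lambda>n. ereal (Z n \<omega>)) \<longlonglongrightarrow> \<infinity>" by (simp flip: Liminf_PInfty)
      then have "(\<lambda>n. ennreal (Z n \<omega>)) \<longlonglongrightarrow> \<infinity>"
        using tendsto_e2ennrealI[of "\<lambda>n. ereal (Z n \<omega>)" \<infinity> sequentially]
        by simp
      then show False using elim(2) lim_imp_Liminf[OF sequentially_bot] by blast
    qed
    then show ?case
      by (intro convergent_if_upcrossings_bounded nn) (use elim in auto)
  qed
qed

subsection \<open>Cascades\<close>

text \<open>The weights at the descendants of \<open>u\<close>, re-rooted at the empty word. The
  restriction to \<open>lists S\<close> makes the value a point of the product space
  \<open>tree_space S\<close>, so that the subtrees at different vertices can be compared in
  law.\<close>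

definition subtree :: "'a set \<Rightarrow> ('a list \<Rightarrow> 'w \<Rightarrow> 'a \<Rightarrow> real) \<Rightarrow> 'a list \<Rightarrow> 'w \<Rightarrow> 'a list \<Rightarrow> 'a \<Rightarrow> real" where
  "subtree S X u \<omega> = (\<lambda>v\<in>lists S. X (u @ v) \<omega>)"

abbreviation tree_space :: "'a set \<Rightarrow> ('a list \<Rightarrow> 'a \<Rightarrow> real) measure" where
  "tree_space S \<equiv> \<Pi>\<^sub>M u\<in>lists S. \<Pi>\<^sub>M a\<in>S. borel"

definition cascade_sum :: "'a set \<Rightarrow> ('a list \<Rightarrow> 'w \<Rightarrow> 'a \<Rightarrow> real) \<Rightarrow> nat \<Rightarrow> 'a list \<Rightarrow> 'w \<Rightarrow> real" where
  "cascade_sum S X n u \<omega> = (\<Sum>v\<in>words S n. cascade_Q X \<omega> u v)"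

section \<open>Words and the recursions for the partial sums at the root and at the last
  level\<close>

lemma words_0[simp]: "words S 0 = {[]}" by (auto simp: words_def)

lemma words_Suc: "words S (Suc n) = (\<lambda>(a, v). a # v) ` (S \<times> words S n)"
  by (auto simp: words_def image_iff length_Suc_conv)

lemma words_Suc': "words S (Suc n) = (\<lambda>(v, a). v @ [a]) ` (words S n \<times> S)"
proof -
  have "u \<in> (\<lambda>(v, a). v @ [a]) ` (words S n \<times> S)" if "u \<in> words S (Suc n)" for u
  proof -
    have "u \<noteq> []" using that by (auto simp: words_def)
    then have "u = butlast u @ [last u]" "last u \<in> S" "butlast u \<in> words S n"
      using that by (auto simp: words_def in_lists_conv_set dest: in_set_butlastD)
    then show ?thesis by force
  qed
  then show ?thesis by (auto simp: words_def)
qed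

lemma sum_words_Suc:
  "finite S \<Longrightarrow> (\<Sum>v\<in>words S (Suc n). f v) = (\<Sum>a\<in>S. \<Sum>v\<in>words S n. f (a # v))"
  by (simp add: words_Suc sum.reindex inj_on_def sum.cartesian_product split_beta)

lemma sum_words_Suc':
  "finite S \<Longrightarrow> (\<Sum>v\<in>words S (Suc n). f v) = (\<Sum>v\<in>words S n. \<Sum>a\<in>S. f (v @ [a]))"
  by (simp add: words_Suc' sum.reindex inj_on_def sum.cartesian_product split_beta)

lemma words_lists: "v \<in> words S n \<Longrightarrow> v \<in> lists S" by (simp add: words_def)

lemma cascade_Q_Nil[simp]: "cascade_Q X \<omega> u [] = 1" by (simp add: cascade_Q_def)

lemma cascade_Q_Cons: "cascade_Q X \<omega> u (a # v) = X u \<omega> a * cascade_Q X \<omega> (u @ [a]) v"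
  unfolding cascade_Q_def
  by (simp only: length_Cons prod.lessThan_Suc_shift) simp

lemma cascade_Q_append: "cascade_Q X \<omega> u (v @ w) = cascade_Q X \<omega> u v * cascade_Q X \<omega> (u @ v) w"
  by (induction v arbitrary: u) (simp_all add: cascade_Q_Cons)

lemma cascade_Q_cong:
  assumes "\<And>v a. v \<in> lists S \<Longrightarrow> a \<in> S \<Longrightarrow> X (u @ v) \<omega> a = X' (u' @ v) \<omega>' a" "v \<in> lists S"
  shows "cascade_Q X \<omega> u v = cascade_Q X' \<omega>' u' v"
  unfolding cascade_Q_def
  by (rule prod.cong[OF refl], rule assms(1))
     (use assms(2) in \<open>auto dest: in_set_takeD\<close>)

lemma cascade_sum_0[simp]: "cascade_sum S X 0 u \<omega> = 1" by (simp add: cascade_sum_def)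

lemma cascade_sum_Suc: "finite S \<Longrightarrow>
  cascade_sum S X (Suc n) u \<omega> = (\<Sum>a\<in>S. X u \<omega> a * cascade_sum S X n (u @ [a]) \<omega>)"
  by (simp add: cascade_sum_def sum_words_Suc cascade_Q_Cons sum_distrib_left)

lemma cascade_sum_Suc': "finite S \<Longrightarrow>
  cascade_sum S X (Suc n) u \<omega> = (\<Sum>v\<in>words S n. cascade_Q X \<omega> u v * (\<Sum>a\<in>S. X (u @ v) \<omega> a))"
  by (simp add: cascade_sum_def sum_words_Suc' cascade_Q_append cascade_Q_Cons sum_distrib_left)

lemma cascade_Y_eq: "cascade_Y S X \<omega> u = lim (\<lambda>n. cascade_sum S X n u \<omega>)"
  by (simp add: cascade_Y_def cascade_sum_def)

text \<open>Nonnegativity is imposed at every sample point to avoid exceptional sets in all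
  monotonicity arguments; weights that are only almost surely nonnegative are truncated at 0
  beforehand. Writing the mean as a nonnegative integral includes integrability.\<close>

locale cascade = prob_space M for M :: "'w measure" +
  fixes S :: "'a set" and X :: "'a list \<Rightarrow> 'w \<Rightarrow> 'a \<Rightarrow> real"
  assumes finite_S: "finite S"
    and indep: "indep_vars (\<lambda>_. \<Pi>\<^sub>M a\<in>S. borel) X (lists S)"
    and law: "\<And>u. u \<in> lists S \<Longrightarrow> distr M (\<Pi>\<^sub>M a\<in>S. borel) (X u) = distr M (\<Pi>\<^sub>M a\<in>S. borel) (X [])"
    and nonneg: "\<And>u \<omega> a. a \<in> S \<Longrightarrow> 0 \<le> X u \<omega> a"
    and mean1: "(\<integral>\<^sup>+\<omega>. ennreal (\<Sum>a\<in>S. X [] \<omega> a) \<partial>M) = 1"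
begin

abbreviation "\<Theta> \<equiv> subtree S X"
abbreviation "TS \<equiv> tree_space S"
abbreviation "B \<equiv> (\<Pi>\<^sub>M a\<in>S. borel :: real measure)"
abbreviation "Yn \<equiv> cascade_sum S X"
abbreviation "Y \<equiv> \<lambda>u \<omega>. cascade_Y S X \<omega> u"
abbreviation "Q \<equiv> \<lambda>u v \<omega>. cascade_Q X \<omega> u v"

section \<open>Measurability and the branching property\<close>

lemma X_meas[measurable]: "u \<in> lists S \<Longrightarrow> X u \<in> measurable M B"
  using indep by (auto simp: indep_vars_def)

lemma X_meas1: "u \<in> lists S \<Longrightarrow> a \<in> S \<Longrightarrow> (\<lambda>\<omega>. X u \<omega> a) \<in> borel_measurable M"
  using measurable_compose[OF X_meas measurable_component_singleton[of a S "\<lambda>_. borel"]] by simp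

lemma countable_lists: "countable (lists S)"
  using finite_S by (intro countable_lists countable_finite)

lemma subtree_meas[measurable]: "u \<in> lists S \<Longrightarrow> \<Theta> u \<in> measurable M TS"
  unfolding subtree_def by (intro measurable_restrict X_meas) auto

text \<open>By independence both laws are products of one-vertex laws, and these are all equal; the
  vertices \<open>u @ v\<close> of the subtree are just renamed to \<open>v\<close>.\<close>

lemma law_subtree:
  assumes u: "u \<in> lists S"
  shows "distr M TS (\<Theta> u) = distr M TS (\<Theta> [])"
proof -
  have *: "distr M TS (\<Theta> u) = (\<Pi>\<^sub>M v\<in>lists S. distr M B (X []))" if u: "u \<in> lists S" for u
  proof -
    have "indep_vars (\<lambda>v. \<Pi>\<^sub>M i\<in>{u @ v}. B) (\<lambda>v \<omega>. \<lambda>i\<in>{u @ v}. X i \<omega>) (lists S)"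
      by (rule indep_vars_restrict[OF indep]) (use u in \<open>auto simp: disjoint_family_on_def\<close>)
    from indep_vars_compose2[OF this, of "\<lambda>v t. t (u @ v)" "\<lambda>_. B"]
    have "indep_vars (\<lambda>_. B) (\<lambda>v. X (u @ v)) (lists S)" by simp
    then have "distr M TS (\<lambda>\<omega>. \<lambda>v\<in>lists S. X (u @ v) \<omega>) = (\<Pi>\<^sub>M v\<in>lists S. distr M B (X (u @ v)))"
      by (subst (asm) indep_vars_iff_distr_eq_PiM') (use u in \<open>auto intro!: X_meas\<close>)
    also have "\<dots> = (\<Pi>\<^sub>M v\<in>lists S. distr M B (X []))"
      by (intro PiM_cong refl law) (use u in auto)
    finally show ?thesis by (simp add: subtree_def[abs_def])
  qed
  show ?thesis using *[OF u] *[of "[]"] by simp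
qed

text \<open>The \<sigma>-algebra generated by the weights at the vertices of \<open>I\<close>,
  packaged as a measure so that \<open>measurable\<close> can refer to it.\<close>

definition G :: "'a list set \<Rightarrow> 'w measure" where
  "G I = vimage_algebra (space M) (\<lambda>\<omega>. \<lambda>v\<in>I. X v \<omega>) (\<Pi>\<^sub>M v\<in>I. B)"

text \<open>The proper ancestors of \<open>u\<close> belong to this set, hence all the factors of
  \<open>cascade_Q\<close> along \<open>u\<close> are measurable with respect to it.\<close>

definition off :: "'a list \<Rightarrow> 'a list set" where
  "off u = {v \<in> lists S. \<not> (\<exists>w. v = u @ w)}"

lemma space_G[simp]: "space (G I) = space M" by (simp add: G_def)

lemma restrict_X_meas: "I \<subseteq> lists S \<Longrightarrow> (\<lambda>\<omega>. \<lambda>v\<in>I. X v \<omega>) \<in> measurable M (\<Pi>\<^sub>M v\<in>I. B)"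
  by (intro measurable_restrict X_meas) auto

lemma X_meas_G: "I \<subseteq> lists S \<Longrightarrow> u \<in> I \<Longrightarrow> X u \<in> measurable (G I) B"
proof -
  assume I: "I \<subseteq> lists S" "u \<in> I"
  have "(\<lambda>\<omega>. \<lambda>v\<in>I. X v \<omega>) \<in> measurable (G I) (\<Pi>\<^sub>M v\<in>I. B)" unfolding G_def
    using restrict_X_meas[OF I(1), THEN measurable_space]
    by (intro measurable_vimage_algebra1 funcsetI) blast
  from measurable_compose[OF this measurable_component_singleton[OF I(2)]] I
  show ?thesis by simp
qed

lemma X_meas1_G: "I \<subseteq> lists S \<Longrightarrow> u \<in> I \<Longrightarrow> a \<in> S \<Longrightarrow> (\<lambda>\<omega>. X u \<omega> a) \<in> borel_measurable (G I)"
  using measurable_compose[OF X_meas_G measurable_component_singleton[of a S "\<lambda>_. borel"]] by simp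

lemma sets_G: "I \<subseteq> lists S \<Longrightarrow> sets (G I) = {(\<lambda>\<omega>. \<lambda>v\<in>I. X v \<omega>) -` A \<inter> space M | A. A \<in> sets (\<Pi>\<^sub>M v\<in>I. B)}"
  unfolding G_def by (rule sets_vimage_algebra2) (use restrict_X_meas[THEN measurable_space] in blast)

lemma sets_G_subset: "I \<subseteq> lists S \<Longrightarrow> sets (G I) \<subseteq> sets M"
  using measurable_sets[OF restrict_X_meas] by (auto simp: sets_G)

lemma sets_G_mono: assumes "I \<subseteq> J" "J \<subseteq> lists S" shows "sets (G I) \<subseteq> sets (G J)"
proof -
  have "(\<lambda>\<omega>. \<lambda>v\<in>I. X v \<omega>) \<in> measurable (G J) (\<Pi>\<^sub>M v\<in>I. B)"
    by (intro measurable_restrict X_meas_G) (use assms in auto)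
  from measurable_sets[OF this] assms show ?thesis by (auto simp: sets_G)
qed

lemma G_measurable_imp: "I \<subseteq> lists S \<Longrightarrow> f \<in> measurable (G I) N \<Longrightarrow> f \<in> measurable M N"
  using sets_G_subset[of I] by (auto simp: measurable_def)

text \<open>The branching property in integrated form. The weights off the subtree of
  \<open>u\<close> and those inside it are disjoint subfamilies of an independent family, and the
  integral over the subtree can be moved to the root because all subtrees have the same law.\<close>

lemma indep_off:
  assumes u: "u \<in> lists S" and f: "f \<in> borel_measurable (G (off u))"
    and g[measurable]: "g \<in> borel_measurable TS"
  shows "(\<integral>\<^sup>+\<omega>. f \<omega> * g (\<Theta> u \<omega>) \<partial>M) = (\<integral>\<^sup>+\<omega>. f \<omega> \<partial>M) * (\<integral>\<^sup>+\<omega>. g (\<Theta> [] \<omega>) \<partial>M :: ennreal)"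
proof -
  have off: "off u \<subseteq> lists S" by (auto simp: off_def)
  let ?J = "(@) u ` lists S"
  have fM[measurable]: "f \<in> borel_measurable M" by (rule G_measurable_imp[OF off f])
  note [measurable] = subtree_meas[OF u] subtree_meas[of "[]"]
  have "indep_var (\<Pi>\<^sub>M v\<in>off u. B) (\<lambda>\<omega>. \<lambda>v\<in>off u. X v \<omega>) (\<Pi>\<^sub>M v\<in>?J. B) (\<lambda>\<omega>. \<lambda>v\<in>?J. X v \<omega>)"
    by (rule indep_var_restrict[OF indep]) (use u in \<open>auto simp: off_def\<close>)
  then have "indep_set (sigma_sets (space M) {(\<lambda>\<omega>. \<lambda>v\<in>off u. X v \<omega>) -` A \<inter> space M | A. A \<in> sets (\<Pi>\<^sub>M v\<in>off u. B)})
     (sigma_sets (space M) {(\<lambda>\<omega>. \<lambda>v\<in>?J. X v \<omega>) -` A \<inter> space M | A. A \<in> sets (\<Pi>\<^sub>M v\<in>?J. B)})"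
    by (simp add: indep_var_eq)
  then have ind: "indep_set (sets (G (off u))) (sigma_sets (space M) {(\<lambda>\<omega>. \<lambda>v\<in>?J. X v \<omega>) -` A \<inter> space M | A. A \<in> sets (\<Pi>\<^sub>M v\<in>?J. B)})"
    using off sets.sigma_sets_eq[of "G (off u)"] by (simp add: sets_G)
  have 1: "sigma_sets (space M) {f -` A \<inter> space M |A. A \<in> sets borel} \<subseteq> sets (G (off u))"
    using sets.sigma_sets_subset[of "{f -` A \<inter> space M |A. A \<in> sets borel}" "G (off u)"]
      measurable_sets[OF f] by force
  have "(\<lambda>t. \<lambda>v\<in>lists S. t (u @ v)) \<in> measurable (\<Pi>\<^sub>M v\<in>?J. B) TS"
    by (intro measurable_restrict measurable_component_singleton) auto
  from measurable_compose[OF this g]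
  have g': "(\<lambda>t. g (\<lambda>v\<in>lists S. t (u @ v))) \<in> borel_measurable (\<Pi>\<^sub>M v\<in>?J. B)" .
  have geq: "(\<lambda>\<omega>. g (\<Theta> u \<omega>)) = (\<lambda>\<omega>. g (\<lambda>v\<in>lists S. (\<lambda>v\<in>?J. X v \<omega>) (u @ v)))"
    by (auto simp: subtree_def intro!: ext arg_cong[of _ _ g])
  have 2: "sigma_sets (space M) {(\<lambda>\<omega>. g (\<Theta> u \<omega>)) -` A \<inter> space M |A. A \<in> sets borel}
    \<subseteq> sigma_sets (space M) {(\<lambda>\<omega>. \<lambda>v\<in>?J. X v \<omega>) -` A \<inter> space M | A. A \<in> sets (\<Pi>\<^sub>M v\<in>?J. B)}"
  proof (intro sigma_sets_subseteq subsetI, safe)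
    fix A :: "ennreal set" assume A: "A \<in> sets borel"
    show "\<exists>A'. (\<lambda>\<omega>. g (\<Theta> u \<omega>)) -` A \<inter> space M = (\<lambda>\<omega>. \<lambda>v\<in>?J. X v \<omega>) -` A' \<inter> space M \<and> A' \<in> sets (\<Pi>\<^sub>M v\<in>?J. B)"
      using measurable_sets[OF g' A] u
      by (intro exI[of _ "(\<lambda>t. g (\<lambda>v\<in>lists S. t (u @ v))) -` A \<inter> space (\<Pi>\<^sub>M v\<in>?J. B)"])
         (auto simp: geq intro!: restrict_X_meas[of ?J, THEN measurable_space])
  qed
  have "indep_var borel f borel (\<lambda>\<omega>. g (\<Theta> u \<omega>))"
    unfolding indep_var_eq
  proof (intro conjI)
    show "indep_set (sigma_sets (space M) {f -` A \<inter> space M |A. A \<in> sets borel})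
     (sigma_sets (space M) {(\<lambda>\<omega>. g (\<Theta> u \<omega>)) -` A \<inter> space M |A. A \<in> sets borel})"
      using ind 1 2 unfolding indep_set_def by (rule_tac indep_sets_mono_sets) (auto split: bool.split)
  qed simp_all
  then have "indep_vars (\<lambda>_. borel) (case_bool f (\<lambda>\<omega>. g (\<Theta> u \<omega>))) UNIV"
    unfolding indep_var_def
    by (subst ext[of "\<lambda>_. borel" "case_bool borel borel"]) (auto split: bool.split)
  then have "(\<integral>\<^sup>+\<omega>. (\<Prod>i\<in>UNIV. case_bool f (\<lambda>\<omega>. g (\<Theta> u \<omega>)) i \<omega>) \<partial>M) = (\<Prod>i\<in>UNIV. \<integral>\<^sup>+\<omega>. case_bool f (\<lambda>\<omega>. g (\<Theta> u \<omega>)) i \<omega> \<partial>M)"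
    by (intro indep_vars_nn_integral) auto
  then have "(\<integral>\<^sup>+\<omega>. f \<omega> * g (\<Theta> u \<omega>) \<partial>M) = (\<integral>\<^sup>+\<omega>. f \<omega> \<partial>M) * (\<integral>\<^sup>+\<omega>. g (\<Theta> u \<omega>) \<partial>M)"
    by (simp add: UNIV_bool mult.commute)
  also have "(\<integral>\<^sup>+\<omega>. g (\<Theta> u \<omega>) \<partial>M) = (\<integral>\<^sup>+t. g t \<partial>distr M TS (\<Theta> u))"
    by (subst nn_integral_distr) simp_all
  also have "\<dots> = (\<integral>\<^sup>+\<omega>. g (\<Theta> [] \<omega>) \<partial>M)"
    by (subst law_subtree[OF u], subst nn_integral_distr) simp_all
  finally show ?thesis .
qed

lemma nn_integral_subtree:
  assumes u: "u \<in> lists S" and g[measurable]: "g \<in> borel_measurable TS"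
  shows "(\<integral>\<^sup>+\<omega>. g (\<Theta> u \<omega>) \<partial>M) = (\<integral>\<^sup>+\<omega>. g (\<Theta> [] \<omega>) \<partial>M)"
proof -
  note [measurable] = subtree_meas[OF u] subtree_meas[of "[]"]
  have "(\<integral>\<^sup>+\<omega>. g (\<Theta> u \<omega>) \<partial>M) = (\<integral>\<^sup>+t. g t \<partial>distr M TS (\<Theta> u))"
    by (subst nn_integral_distr) simp_all
  also have "\<dots> = (\<integral>\<^sup>+\<omega>. g (\<Theta> [] \<omega>) \<partial>M)"
    by (subst law_subtree[OF u], subst nn_integral_distr) simp_all
  finally show ?thesis .
qed

text \<open>Almost sure statements about the root only concern the law of the tree, which is the
  same at every vertex.\<close>

lemma AE_subtree:
  assumes u: "u \<in> lists S" and P[measurable]: "Measurable.pred TS P" and ae: "AE \<omega> in M. P (\<Theta> [] \<omega>)"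
  shows "AE \<omega> in M. P (\<Theta> u \<omega>)"
proof -
  have "AE t in distr M TS (\<Theta> []). P t" using ae by (subst AE_distr_iff) (auto intro: subtree_meas)
  then have "AE t in distr M TS (\<Theta> u). P t" by (subst law_subtree[OF u])
  then show ?thesis by (rule AE_distrD[OF subtree_meas[OF u]])
qed

end

text \<open>The canonical cascade on the space of trees itself:
  \<open>cascade_sum S coord n []\<close> and \<open>cascade_Y S coord t []\<close> are the partial
  sums and the total mass as fixed measurable functions of the tree, to be evaluated at any
  subtree.\<close>

abbreviation coord :: "'a list \<Rightarrow> ('a list \<Rightarrow> 'a \<Rightarrow> real) \<Rightarrow> 'a \<Rightarrow> real" where
  "coord u t \<equiv> t u"

section \<open>The total mass martingale and its limit\<close>

context cascade
begin

lemma nn_mean1: "u \<in> lists S \<Longrightarrow> (\<integral>\<^sup>+\<omega>. ennreal (\<Sum>a\<in>S. X u \<omega> a) \<partial>M) = 1"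
proof -
  assume u: "u \<in> lists S"
  have m: "(\<lambda>t. ennreal (\<Sum>a\<in>S. t [] a)) \<in> borel_measurable TS"
    by (intro measurable_compose[OF _ measurable_ennreal] borel_measurable_sum
        measurable_compose[OF measurable_component_singleton[of "[]"] measurable_component_singleton]) auto
  show ?thesis
    using nn_integral_subtree[OF u m] u mean1 by (simp add: subtree_def)
qed

lemma Q_nonneg: "v \<in> lists S \<Longrightarrow> 0 \<le> Q u v \<omega>"
  unfolding cascade_Q_def by (intro prod_nonneg ballI nonneg) auto

lemma Yn_nonneg: "0 \<le> Yn n u \<omega>"
  unfolding cascade_sum_def by (intro sum_nonneg Q_nonneg words_lists)

lemma cascade_sum_subtree: "u \<in> lists S \<Longrightarrow> Yn n u \<omega> = cascade_sum S coord n [] (\<Theta> u \<omega>)"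
  unfolding cascade_sum_def
  by (intro sum.cong refl cascade_Q_cong[of S]) (auto simp: subtree_def words_def)

lemma Y_subtree: "u \<in> lists S \<Longrightarrow> Y u \<omega> = cascade_Y S coord (\<Theta> u \<omega>) []"
  by (simp add: cascade_Y_eq cascade_sum_subtree)

lemma cascade_sum_meas[measurable]: "cascade_sum S coord n [] \<in> borel_measurable TS"
proof -
  have "cascade_sum S coord n v \<in> borel_measurable TS" if "v \<in> lists S" for v
    using that
  proof (induction n arbitrary: v)
    case 0
    then show ?case by (simp add: cascade_sum_def)
  next
    case (Suc n)
    show ?case
      unfolding cascade_sum_Suc[OF finite_S]
      by (intro borel_measurable_sum borel_measurable_times Suc
        measurable_compose[OF measurable_component_singleton[of v] measurable_component_singleton])
        (use Suc in auto)
  qed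
  then show ?thesis by simp
qed

lemma cascade_Y_meas[measurable]: "(\<lambda>t. cascade_Y S coord t []) \<in> borel_measurable TS"
  unfolding cascade_Y_eq by (intro borel_measurable_lim_metric cascade_sum_meas)

lemma Yn_meas: "u \<in> lists S \<Longrightarrow> Yn n u \<in> borel_measurable M"
  using measurable_compose[OF subtree_meas cascade_sum_meas]
  by (simp add: cascade_sum_subtree cong: measurable_cong)

lemma Y_meas: "u \<in> lists S \<Longrightarrow> Y u \<in> borel_measurable M"
  using measurable_compose[OF subtree_meas cascade_Y_meas]
  by (simp add: Y_subtree cong: measurable_cong)

lemma Q_meas_G:
  assumes "I \<subseteq> lists S" "v \<in> lists S" "\<And>j. j < length v \<Longrightarrow> take j v \<in> I"
  shows "Q [] v \<in> borel_measurable (G I)"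
  unfolding cascade_Q_def by (intro borel_measurable_prod X_meas1_G) (use assms in auto)

lemma Yn_meas_G:
  assumes "I \<subseteq> lists S" "\<And>v. v \<in> lists S \<Longrightarrow> length v < n \<Longrightarrow> v \<in> I"
  shows "Yn n [] \<in> borel_measurable (G I)"
  unfolding cascade_sum_def
  by (intro borel_measurable_sum Q_meas_G assms)
     (auto simp: words_def dest: in_set_takeD)

lemma level_off: "v \<in> words S n \<Longrightarrow> {w \<in> lists S. length w < n} \<subseteq> off v"
  by (auto simp: off_def words_def)

lemma Q_meas_level: "v \<in> words S n \<Longrightarrow> Q [] v \<in> borel_measurable (G {w \<in> lists S. length w < n})"
  by (rule Q_meas_G) (auto simp: words_def dest: in_set_takeD)

lemma measurable_G_mono: "I \<subseteq> J \<Longrightarrow> J \<subseteq> lists S \<Longrightarrow> f \<in> measurable (G I) N \<Longrightarrow> f \<in> measurable (G J) N"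
  using sets_G_mono[of I J] by (auto simp: measurable_def)

lemma nn_integral_level:
  assumes f: "f \<in> borel_measurable (G {w \<in> lists S. length w < n})"
    and g: "g \<in> borel_measurable TS" and v: "v \<in> words S n"
  shows "(\<integral>\<^sup>+\<omega>. ennreal (Q [] v \<omega>) * f \<omega> * g (\<Theta> v \<omega>) \<partial>M) =
    (\<integral>\<^sup>+\<omega>. ennreal (Q [] v \<omega>) * f \<omega> \<partial>M) * (\<integral>\<^sup>+\<omega>. g (\<Theta> [] \<omega>) \<partial>M)"
proof (rule indep_off[OF words_lists[OF v] _ g])
  have "(\<lambda>\<omega>. ennreal (Q [] v \<omega>) * f \<omega>) \<in> borel_measurable (G {w \<in> lists S. length w < n})"
    using Q_meas_level[OF v] f by measurable
  then show "(\<lambda>\<omega>. ennreal (Q [] v \<omega>) * f \<omega>) \<in> borel_measurable (G (off v))"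
    by (rule measurable_G_mono[OF level_off[OF v], rotated]) (auto simp: off_def)
qed

lemma ennreal_Yn: "ennreal (Yn n [] \<omega>) = (\<Sum>v\<in>words S n. ennreal (Q [] v \<omega>))"
  unfolding cascade_sum_def by (subst sum_ennreal) (auto intro!: Q_nonneg words_lists simp del: lists_UNIV in_lists_conv_set)

text \<open>Conditioning on the first \<open>n\<close> levels: given these, the subtrees at level
  \<open>n\<close> have the law of the whole tree. The function \<open>f\<close> stands for an
  arbitrary test function of these levels.\<close>

lemma nn_integral_level_sum:
  assumes f: "f \<in> borel_measurable (G {w \<in> lists S. length w < n})"
    and g: "g \<in> borel_measurable TS"
  shows "(\<integral>\<^sup>+\<omega>. (\<Sum>v\<in>words S n. ennreal (Q [] v \<omega>) * f \<omega> * g (\<Theta> v \<omega>)) \<partial>M) =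
    (\<integral>\<^sup>+\<omega>. ennreal (Yn n [] \<omega>) * f \<omega> \<partial>M) * (\<integral>\<^sup>+\<omega>. g (\<Theta> [] \<omega>) \<partial>M)"
proof -
  have L: "{w \<in> lists S. length w < n} \<subseteq> lists S" by auto
  have fM[measurable]: "f \<in> borel_measurable M" by (rule G_measurable_imp[OF L f])
  have QM[measurable]: "Q [] v \<in> borel_measurable M" if "v \<in> words S n" for v
    by (rule G_measurable_imp[OF L Q_meas_level[OF that]])
  have gM[measurable]: "(\<lambda>\<omega>. g (\<Theta> v \<omega>)) \<in> borel_measurable M" if "v \<in> words S n" for v
    by (rule measurable_compose[OF subtree_meas g]) (use that in \<open>auto simp: words_def\<close>)
  have "(\<integral>\<^sup>+\<omega>. (\<Sum>v\<in>words S n. ennreal (Q [] v \<omega>) * f \<omega> * g (\<Theta> v \<omega>)) \<partial>M) =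
    (\<Sum>v\<in>words S n. \<integral>\<^sup>+\<omega>. ennreal (Q [] v \<omega>) * f \<omega> * g (\<Theta> v \<omega>) \<partial>M)"
    by (intro nn_integral_sum borel_measurable_times_ennreal fM gM measurable_compose[OF QM measurable_ennreal])
  also have "\<dots> = (\<Sum>v\<in>words S n. (\<integral>\<^sup>+\<omega>. ennreal (Q [] v \<omega>) * f \<omega> \<partial>M) * (\<integral>\<^sup>+\<omega>. g (\<Theta> [] \<omega>) \<partial>M))"
    by (rule sum.cong[OF refl], rule nn_integral_level[OF f g])
  also have "\<dots> = (\<integral>\<^sup>+\<omega>. (\<Sum>v\<in>words S n. ennreal (Q [] v \<omega>) * f \<omega>) \<partial>M) * (\<integral>\<^sup>+\<omega>. g (\<Theta> [] \<omega>) \<partial>M)"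
    by (subst nn_integral_sum)
       (auto simp: sum_distrib_right
             intro!: borel_measurable_times_ennreal fM measurable_compose[OF QM measurable_ennreal])
  finally show ?thesis by (simp add: ennreal_Yn sum_distrib_right)
qed

text \<open>One more generation multiplies each \<open>Q [] v\<close> by the sum of the weights at
  \<open>v\<close>, which has mean 1 and is independent of the first \<open>n\<close>
  levels.\<close>

lemma Yn_martingale:
  assumes "f \<in> borel_measurable (G {w \<in> lists S. length w < n})"
  shows "(\<integral>\<^sup>+\<omega>. ennreal (Yn (Suc n) [] \<omega>) * f \<omega> \<partial>M) = (\<integral>\<^sup>+\<omega>. ennreal (Yn n [] \<omega>) * f \<omega> \<partial>M)"
proof -
  define g where "g t = ennreal (\<Sum>a\<in>S. t [] a)" for t :: "'a list \<Rightarrow> 'a \<Rightarrow> real"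
  have g: "g \<in> borel_measurable TS" unfolding g_def
    by (intro measurable_compose[OF _ measurable_ennreal] borel_measurable_sum
        measurable_compose[OF measurable_component_singleton[of "[]"] measurable_component_singleton]) auto
  have "ennreal (Yn (Suc n) [] \<omega>) = (\<Sum>v\<in>words S n. ennreal (Q [] v \<omega>) * g (\<Theta> v \<omega>))" for \<omega>
    unfolding cascade_sum_Suc'[OF finite_S]
    by (subst sum_ennreal[symmetric])
       (auto simp: g_def subtree_def intro!: sum.cong ennreal_mult mult_nonneg_nonneg Q_nonneg sum_nonneg nonneg words_lists)
  then have "(\<integral>\<^sup>+\<omega>. ennreal (Yn (Suc n) [] \<omega>) * f \<omega> \<partial>M) =
     (\<integral>\<^sup>+\<omega>. (\<Sum>v\<in>words S n. ennreal (Q [] v \<omega>) * f \<omega> * g (\<Theta> v \<omega>)) \<partial>M)"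
    by (simp add: sum_distrib_left mult_ac)
  also have "\<dots> = (\<integral>\<^sup>+\<omega>. ennreal (Yn n [] \<omega>) * f \<omega> \<partial>M) * (\<integral>\<^sup>+\<omega>. g (\<Theta> [] \<omega>) \<partial>M)"
    by (rule nn_integral_level_sum[OF assms g])
  also have "(\<integral>\<^sup>+\<omega>. g (\<Theta> [] \<omega>) \<partial>M) = 1" using nn_mean1[of "[]"] by (simp add: g_def subtree_def)
  finally show ?thesis by simp
qed

lemma nn_Yn: "(\<integral>\<^sup>+\<omega>. ennreal (Yn n [] \<omega>) \<partial>M) = 1"
proof (induction n)
  case (Suc n)
  then show ?case using Yn_martingale[of "\<lambda>_. 1" n] by simp
qed (simp add: emeasure_space_1)

lemma AE_convergent_Yn_Nil: "AE \<omega> in M. convergent (\<lambda>n. Yn n [] \<omega>)"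
proof (rule AE_convergent_nonneg_martingale[where F = "\<lambda>n. G {w \<in> lists S. length w < n}"])
  show "sets (G {w \<in> lists S. length w < n}) \<subseteq> sets M" for n by (rule sets_G_subset) auto
  show "sets (G {w \<in> lists S. length w < n}) \<subseteq> sets (G {w \<in> lists S. length w < Suc n})" for n
    by (rule sets_G_mono) auto
  show "Yn n [] \<in> borel_measurable (G {w \<in> lists S. length w < n})" for n
    by (rule Yn_meas_G) auto
qed (auto simp: Yn_nonneg nn_Yn emeasure_space_1 intro!: Yn_martingale)

text \<open>Convergence at all vertices simultaneously. On this almost sure event the limits are
  nonnegative and the cylinder masses are consistent, so that all later statements about a single
  sample point are deterministic.\<close>

definition good :: "'w \<Rightarrow> bool" where
  "good \<omega> \<longleftrightarrow> (\<forall>u\<in>lists S. convergent (\<lambda>n. Yn n u \<omega>))"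

lemma AE_good: "AE \<omega> in M. good \<omega>"
proof -
  have P: "Measurable.pred TS (\<lambda>t. convergent (\<lambda>n. cascade_sum S coord n [] t))"
    unfolding Cauchy_convergent_iff[symmetric] pred_def
    by (intro sets_Collect_Cauchy cascade_sum_meas)
  have "AE \<omega> in M. convergent (\<lambda>n. Yn n u \<omega>)" if u: "u \<in> lists S" for u
    using AE_subtree[OF u P] AE_convergent_Yn_Nil u by (simp add: cascade_sum_subtree)
  then show ?thesis unfolding good_def by (subst AE_ball_countable[OF countable_lists]) auto
qed

lemma good_lim: "good \<omega> \<Longrightarrow> u \<in> lists S \<Longrightarrow> (\<lambda>n. Yn n u \<omega>) \<longlonglongrightarrow> Y u \<omega>"
  by (simp add: good_def cascade_Y_eq convergent_LIMSEQ_iff)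

lemma good_Y_nonneg: "good \<omega> \<Longrightarrow> u \<in> lists S \<Longrightarrow> 0 \<le> Y u \<omega>"
  by (rule LIMSEQ_le_const[OF good_lim]) (auto intro: Yn_nonneg)

lemma good_consistent:
  assumes "good \<omega>" "u \<in> lists S"
  shows "Y u \<omega> = (\<Sum>a\<in>S. X u \<omega> a * Y (u @ [a]) \<omega>)"
proof -
  have "(\<lambda>n. \<Sum>a\<in>S. X u \<omega> a * Yn n (u @ [a]) \<omega>) \<longlonglongrightarrow> (\<Sum>a\<in>S. X u \<omega> a * Y (u @ [a]) \<omega>)"
    by (intro tendsto_intros good_lim) (use assms in auto)
  moreover have "(\<lambda>n. Yn (Suc n) u \<omega>) \<longlonglongrightarrow> Y u \<omega>" by (rule LIMSEQ_Suc[OF good_lim[OF assms]])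
  ultimately show ?thesis by (simp add: cascade_sum_Suc[OF finite_S] LIMSEQ_unique)
qed

lemma good_consistent_n:
  assumes "good \<omega>"
  shows "Y [] \<omega> = (\<Sum>v\<in>words S n. Q [] v \<omega> * Y v \<omega>)"
proof (induction n)
  case (Suc n)
  have "(\<Sum>v\<in>words S (Suc n). Q [] v \<omega> * Y v \<omega>) = (\<Sum>v\<in>words S n. Q [] v \<omega> * (\<Sum>a\<in>S. X v \<omega> a * Y (v @ [a]) \<omega>))"
    by (simp add: sum_words_Suc'[OF finite_S] cascade_Q_append cascade_Q_Cons sum_distrib_left mult_ac)
  also have "\<dots> = (\<Sum>v\<in>words S n. Q [] v \<omega> * Y v \<omega>)"
    by (intro sum.cong refl) (simp add: good_consistent[OF assms words_lists])
  finally show ?case using Suc by simp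
qed simp

definition EY :: ennreal where "EY = (\<integral>\<^sup>+\<omega>. ennreal (Y [] \<omega>) \<partial>M)"

lemma EY_le_1: "EY \<le> 1"
proof -
  have "EY = (\<integral>\<^sup>+\<omega>. liminf (\<lambda>n. ennreal (Yn n [] \<omega>)) \<partial>M)"
    unfolding EY_def using AE_good
    by (intro nn_integral_cong_AE)
       (auto elim!: eventually_mono intro!: lim_imp_Liminf[symmetric] tendsto_ennrealI good_lim)
  also have "\<dots> \<le> liminf (\<lambda>n. \<integral>\<^sup>+\<omega>. ennreal (Yn n [] \<omega>) \<partial>M)"
    by (rule nn_integral_liminf) (use Yn_meas[of "[]"] in measurable)
  finally show ?thesis by (simp add: nn_Yn Liminf_const)
qed

text \<open>Conditioning on the first \<open>n\<close> levels gives \<open>\<E> (Y exp (- Y\<^sub>n)) = \<E> Y \<cdot> \<E> (Y\<^sub>n exp (- Y\<^sub>n))\<close>,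
  and both sides have the same limit up to the factor \<open>\<E> Y\<close>.\<close>

lemma EY_eq_1:
  assumes nd: "\<not> (AE \<omega> in M. Y [] \<omega> = 0)"
  shows "EY = 1"
proof -
  \<comment> \<open>The factor \<open>exp (- y)\<close> keeps \<open>y * exp (- y)\<close> bounded,
    so that dominated convergence applies to the partial sums although their uniform integrability
    is not known yet.\<close>
  define f where "f n \<omega> = ennreal (exp (- Yn n [] \<omega>))" for n \<omega>
  have f: "f n \<in> borel_measurable (G {w \<in> lists S. length w < n})" for n
    unfolding f_def using Yn_meas_G[of "{w \<in> lists S. length w < n}" n] by measurable
  note [measurable] = Y_meas[of "[]", simplified] Yn_meas[of "[]", simplified]
  have eq: "(\<integral>\<^sup>+\<omega>. ennreal (Y [] \<omega>) * f n \<omega> \<partial>M) = (\<integral>\<^sup>+\<omega>. ennreal (Yn n [] \<omega>) * f n \<omega> \<partial>M) * EY" for n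
  proof -
    have "(\<integral>\<^sup>+\<omega>. ennreal (Y [] \<omega>) * f n \<omega> \<partial>M) =
      (\<integral>\<^sup>+\<omega>. (\<Sum>v\<in>words S n. ennreal (Q [] v \<omega>) * f n \<omega> * ennreal (cascade_Y S coord (\<Theta> v \<omega>) [])) \<partial>M)"
    proof (rule nn_integral_cong_AE, use AE_good in eventually_elim)
      fix \<omega> assume good: "good \<omega>"
      have "ennreal (Y [] \<omega>) = (\<Sum>v\<in>words S n. ennreal (Q [] v \<omega>) * ennreal (Y v \<omega>))"
        unfolding good_consistent_n[OF good, of n]
        by (subst sum_ennreal[symmetric])
           (auto intro!: mult_nonneg_nonneg Q_nonneg good_Y_nonneg[OF good] words_lists sum.cong ennreal_mult)
      then show "ennreal (Y [] \<omega>) * f n \<omega> =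
         (\<Sum>v\<in>words S n. ennreal (Q [] v \<omega>) * f n \<omega> * ennreal (cascade_Y S coord (\<Theta> v \<omega>) []))"
        by (simp add: sum_distrib_left Y_subtree[OF words_lists] mult_ac)
    qed
    also have "\<dots> = (\<integral>\<^sup>+\<omega>. ennreal (Yn n [] \<omega>) * f n \<omega> \<partial>M) * (\<integral>\<^sup>+\<omega>. ennreal (cascade_Y S coord (\<Theta> [] \<omega>) []) \<partial>M)"
      by (rule nn_integral_level_sum[OF f]) measurable
    finally show ?thesis by (simp add: EY_def Y_subtree)
  qed
  define L where "L = (\<integral>\<^sup>+\<omega>. ennreal (Y [] \<omega>) * ennreal (exp (- Y [] \<omega>)) \<partial>M)"
  have l1: "(\<lambda>n. \<integral>\<^sup>+\<omega>. ennreal (Y [] \<omega>) * f n \<omega> \<partial>M) \<longlonglongrightarrow> L"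
    unfolding L_def f_def
  proof (rule nn_integral_dominated_convergence[where w = "\<lambda>\<omega>. ennreal (Y [] \<omega>)"])
    show "(\<integral>\<^sup>+\<omega>. ennreal (Y [] \<omega>) \<partial>M) < \<infinity>" using EY_le_1 unfolding EY_def
      by (metis ennreal_one_less_top infinity_ennreal_def le_less_trans)
    show "AE \<omega> in M. ennreal (Y [] \<omega>) * ennreal (exp (- Yn j [] \<omega>)) \<le> ennreal (Y [] \<omega>)" for j
      by (intro AE_I2 mult_left_le) (auto simp: Yn_nonneg)
    show "AE \<omega> in M. (\<lambda>n. ennreal (Y [] \<omega>) * ennreal (exp (- Yn n [] \<omega>))) \<longlonglongrightarrow> ennreal (Y [] \<omega>) * ennreal (exp (- Y [] \<omega>))"
      using AE_good
      by eventually_elim (auto intro!: ennreal_tendsto_cmult tendsto_ennrealI tendsto_intros good_lim)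
  qed measurable
  have l2: "(\<lambda>n. \<integral>\<^sup>+\<omega>. ennreal (Yn n [] \<omega>) * f n \<omega> \<partial>M) \<longlonglongrightarrow> L"
    unfolding L_def f_def
  proof (rule nn_integral_dominated_convergence[where w = "\<lambda>\<omega>. 1"])
    have "y * exp (- y) \<le> 1" for y :: real
    proof -
      have "y \<le> exp y" using exp_ge_add_one_self[of y] by linarith
      then show ?thesis by (simp add: exp_minus field_simps)
    qed
    then show "AE \<omega> in M. ennreal (Yn j [] \<omega>) * ennreal (exp (- Yn j [] \<omega>)) \<le> 1" for j
      by (intro AE_I2) (simp flip: ennreal_mult'' add: ennreal_le_1)
    show "AE \<omega> in M. (\<lambda>n. ennreal (Yn n [] \<omega>) * ennreal (exp (- Yn n [] \<omega>))) \<longlonglongrightarrow> ennreal (Y [] \<omega>) * ennreal (exp (- Y [] \<omega>))"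
      using AE_good
      by eventually_elim
         (auto simp flip: ennreal_mult'' intro!: tendsto_ennrealI tendsto_intros good_lim)
  qed (auto simp: emeasure_space_1)
  have "(\<lambda>n. (\<integral>\<^sup>+\<omega>. ennreal (Yn n [] \<omega>) * f n \<omega> \<partial>M) * EY) \<longlonglongrightarrow> L * EY"
    using ennreal_tendsto_cmult[OF _ l2, of EY] EY_le_1
    by (simp add: mult.commute ennreal_one_less_top le_less_trans)
  then have "L = L * EY" using l1 by (simp add: eq LIMSEQ_unique)
  moreover have "L \<le> EY" unfolding L_def EY_def
    by (intro nn_integral_mono_AE, use AE_good in eventually_elim)
       (auto intro!: mult_left_le simp: good_Y_nonneg)
  then have "L \<noteq> \<top>" using EY_le_1 by (auto simp: top_unique)
  moreover have "L \<noteq> 0"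
  proof
    assume "L = 0"
    then have "AE \<omega> in M. ennreal (Y [] \<omega>) * ennreal (exp (- Y [] \<omega>)) = 0"
      unfolding L_def by (subst (asm) nn_integral_0_iff_AE) measurable
    then have "AE \<omega> in M. Y [] \<omega> = 0" using AE_good
      by eventually_elim (auto simp: ennreal_eq_0_iff dest: good_Y_nonneg[of _ "[]"])
    then show False using nd by blast
  qed
  ultimately show ?thesis
    by (metis ennreal_mult_cancel_left mult.right_neutral)
qed

end

subsection \<open>Moment inequalities for one branching step\<close>

lemma powr_le_tangent:
  fixes u r :: real
  assumes "0 \<le> u" "0 \<le> r" "r \<le> 1"
  shows "u powr r \<le> 1 + r * (u - 1)"
proof (cases "u = 0")
  case False
  then have u: "0 < u" using assms by simp
  have "convex_on UNIV (exp :: real \<Rightarrow> real)" by (rule exp_convex)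
  from convex_onD[OF this, of r 0 "ln u"] assms
  have "exp (r * ln u) \<le> (1 - r) * exp 0 + r * exp (ln u)" by simp
  then show ?thesis using u by (simp add: powr_def algebra_simps)
qed (use assms in auto)

text \<open>The tangent at \<open>s\<close> of a concave power. The negative part of the linear term
  is kept on the left, so that both sides are nonnegative and can be integrated in
  \<open>ennreal\<close>.\<close>

lemma powr_le_tangent_at:
  fixes s t r :: real
  assumes "0 \<le> t" "0 < s" "0 \<le> r" "r \<le> 1"
  shows "t powr r + r * s powr r \<le> s powr r + r * (s powr (r - 1) * t)"
proof -
  have "(t / s) powr r \<le> 1 + r * (t / s - 1)" using assms by (intro powr_le_tangent) auto
  then have "s powr r * (t / s) powr r \<le> s powr r * (1 + r * (t / s - 1))"
    by (intro mult_left_mono) auto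
  moreover have "s powr r * (t / s) powr r = t powr r" using assms by (simp add: powr_divide)
  moreover have "s powr (r - 1) = s powr r / s" using assms by (simp add: powr_diff)
  ultimately show ?thesis using assms by (simp add: algebra_simps)
qed

text \<open>For the ratio \<open>t = y / x\<close> the tangent at 1 gives
  \<open>(1 + t) powr h \<le> 1 + h * t\<close>, and \<open>t \<le> t powr h\<close> on the unit
  interval. The factor \<open>h\<close> at the smaller term is a gain of order \<open>1 - h\<close>
  over subadditivity.\<close>

lemma powr_add_le_defect:
  fixes x y h :: real
  assumes "0 \<le> y" "y \<le> x" "0 < h" "h \<le> 1"
  shows "(x + y) powr h \<le> x powr h + h * y powr h"
proof (cases "x = 0")
  case False
  then have x: "0 < x" using assms by simp
  define t where "t = y / x"
  have t: "0 \<le> t" "t \<le> 1" using assms x by (auto simp: t_def)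
  have "(1 + t) powr h \<le> 1 + h * t" using powr_le_tangent[of "1 + t" h] t assms by simp
  also have "t \<le> t powr h" using t assms powr_mono'[of h 1 t] by (cases "t = 0") auto
  finally have "(1 + t) powr h \<le> 1 + h * t powr h" using assms by simp
  then have "x powr h * (1 + t) powr h \<le> x powr h * (1 + h * t powr h)"
    by (intro mult_left_mono) auto
  moreover have "x powr h * (1 + t) powr h = (x + y) powr h"
    using x t assms by (simp add: powr_mult[symmetric] t_def distrib_left)
  moreover have "x powr h * t powr h = y powr h"
    using x t assms by (simp add: powr_mult[symmetric] t_def)
  ultimately show ?thesis by (simp add: algebra_simps)
qed (use assms in auto)

lemma powr_add_le:
  fixes x y h :: real
  assumes "0 \<le> x" "0 \<le> y" "0 < h" "h \<le> 1"
  shows "(x + y) powr h \<le> x powr h + y powr h"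
proof -
  have *: "(x + y) powr h \<le> x powr h + y powr h" if "0 \<le> y" "y \<le> x" for x y
  proof -
    have "h * y powr h \<le> y powr h" using assms by (intro mult_left_le_one_le) auto
    then show ?thesis using powr_add_le_defect[OF that assms(3,4)] by linarith
  qed
  show ?thesis using *[of x y] *[of y x] assms by (cases "y \<le> x") (auto simp: add.commute)
qed

lemma powr_sum_le:
  fixes x :: "'b \<Rightarrow> real"
  assumes "finite A" "\<And>a. a \<in> A \<Longrightarrow> 0 \<le> x a" "0 < h" "h \<le> 1"
  shows "(\<Sum>a\<in>A. x a) powr h \<le> (\<Sum>a\<in>A. x a powr h)"
  using assms(1,2)
proof (induction A rule: finite_induct)
  case (insert a A)
  have "(x a + sum x A) powr h \<le> x a powr h + (sum x A) powr h"
    using insert assms by (intro powr_add_le sum_nonneg) auto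
  then show ?case using insert by simp
qed simp

text \<open>The gain is realised for one pair of terms, the others being split off by plain
  subadditivity. This is the source of strictness in \<open>dimen_pos\<close>.\<close>

lemma powr_sum_le_defect:
  fixes x :: "'b \<Rightarrow> real"
  assumes A: "finite A" "\<And>a. a \<in> A \<Longrightarrow> 0 \<le> x a" and h: "0 < h" "h \<le> 1"
    and ab: "a \<in> A" "b \<in> A" "a \<noteq> b"
  shows "(\<Sum>a\<in>A. x a) powr h + (1 - h) * min (x a) (x b) powr h \<le> (\<Sum>a\<in>A. x a powr h)"
proof -
  let ?R = "A - {a, b}"
  have s: "(\<Sum>a\<in>A. f a) = f a + f b + (\<Sum>c\<in>?R. f c)" for f :: "'b \<Rightarrow> real"
  proof -
    have "?R = A - {a} - {b}" by blast
    then show ?thesis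
      using sum.remove[of A a f] sum.remove[of "A - {a}" b f] A(1) ab by (simp add: add.assoc)
  qed
  have "(\<Sum>a\<in>A. x a) powr h \<le> (x a + x b) powr h + (\<Sum>c\<in>?R. x c) powr h"
    unfolding s using A ab h by (intro powr_add_le sum_nonneg add_nonneg_nonneg) auto
  also have "(\<Sum>c\<in>?R. x c) powr h \<le> (\<Sum>c\<in>?R. x c powr h)"
    using A h by (intro powr_sum_le) auto
  also have "(x a + x b) powr h \<le> x a powr h + x b powr h - (1 - h) * min (x a) (x b) powr h"
    using powr_add_le_defect[of "x a" "x b" h] powr_add_le_defect[of "x b" "x a" h] A(2)[of a] A(2)[of b] ab h
    by (auto simp: min_def algebra_simps)
  finally show ?thesis unfolding s by simp
qed

text \<open>Write the \<open>q\<close>-th power of the sum \<open>s\<close> as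
  \<open>\<Sum>a\<in>A. x a * s powr (q - 1)\<close>; since \<open>q - 1 \<le> 1\<close>,
  subadditivity separates \<open>x a\<close> from the rest of \<open>s\<close>. In the cross term
  \<open>x a\<close> meets only the other summands, which carry independent subtrees.\<close>

lemma powr_sum_le_split:
  fixes x :: "'b \<Rightarrow> real"
  assumes A: "finite A" "\<And>a. a \<in> A \<Longrightarrow> 0 \<le> x a" and q: "1 < q" "q \<le> 2"
  shows "(\<Sum>a\<in>A. x a) powr q \<le> (\<Sum>a\<in>A. x a powr q + x a * (\<Sum>b\<in>A - {a}. x b) powr (q - 1))"
proof -
  let ?s = "\<Sum>a\<in>A. x a"
  have "?s powr q = ?s * ?s powr (q - 1)"
    using sum_nonneg[of A x] A by (cases "?s = 0") (auto simp: powr_mult_base)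
  also have "\<dots> = (\<Sum>a\<in>A. x a * ?s powr (q - 1))" by (simp add: sum_distrib_right)
  also have "\<dots> \<le> (\<Sum>a\<in>A. x a powr q + x a * (\<Sum>b\<in>A - {a}. x b) powr (q - 1))"
  proof (rule sum_mono)
    fix a assume a: "a \<in> A"
    have "?s powr (q - 1) \<le> x a powr (q - 1) + (\<Sum>b\<in>A - {a}. x b) powr (q - 1)"
      unfolding sum.remove[OF A(1) a] using A a q by (intro powr_add_le sum_nonneg) auto
    then have "x a * ?s powr (q - 1) \<le> x a * (x a powr (q - 1) + (\<Sum>b\<in>A - {a}. x b) powr (q - 1))"
      using A a by (intro mult_left_mono) auto
    moreover have "x a * x a powr (q - 1) = x a powr q"
      using A(2)[OF a] by (cases "x a = 0") (auto simp: powr_mult_base)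
    ultimately show "x a * ?s powr (q - 1) \<le> x a powr q + x a * (\<Sum>b\<in>A - {a}. x b) powr (q - 1)"
      by (simp add: distrib_left)
  qed
  finally show ?thesis .
qed

section \<open>One branching step: means, concave powers and conditional Jensen inequality\<close>

context cascade
begin

lemma X_Nil_meas_off: "a \<in> S \<Longrightarrow> b \<in> S \<Longrightarrow> (\<lambda>\<omega>. X [] \<omega> b) \<in> borel_measurable (G (off [a]))"
  by (rule X_meas1_G) (auto simp: off_def)

lemma subtree_meas_off:
  assumes "a \<in> S" "b \<in> S" "a \<noteq> b"
  shows "\<Theta> [b] \<in> measurable (G (off [a])) TS"
  unfolding subtree_def by (intro measurable_restrict X_meas_G) (use assms in \<open>auto simp: off_def\<close>)

lemma X_Nil_meas[measurable]: "a \<in> S \<Longrightarrow> (\<lambda>\<omega>. X [] \<omega> a) \<in> borel_measurable M"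
  by (rule X_meas1) auto

lemma subtree1_meas: "a \<in> S \<Longrightarrow> \<Theta> [a] \<in> measurable M TS"
  by (rule subtree_meas) auto

lemma nn_one_step:
  assumes a: "a \<in> S" and f: "f \<in> borel_measurable (G (off [a]))" and g: "g \<in> borel_measurable TS"
  shows "(\<integral>\<^sup>+\<omega>. f \<omega> * g (\<Theta> [a] \<omega>) \<partial>M) = (\<integral>\<^sup>+\<omega>. f \<omega> \<partial>M) * (\<integral>\<^sup>+\<omega>. g (\<Theta> [] \<omega>) \<partial>M :: ennreal)"
  by (rule indep_off[OF _ f g]) (use a in auto)

lemma one_step_mean:
  assumes A: "A \<subseteq> S" and g[measurable]: "g \<in> borel_measurable TS" and g0: "\<And>t. 0 \<le> g t"
  shows "(\<integral>\<^sup>+\<omega>. ennreal (\<Sum>a\<in>A. X [] \<omega> a * g (\<Theta> [a] \<omega>)) \<partial>M) =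
    (\<Sum>a\<in>A. \<integral>\<^sup>+\<omega>. ennreal (X [] \<omega> a) \<partial>M) * (\<integral>\<^sup>+\<omega>. ennreal (g (\<Theta> [] \<omega>)) \<partial>M)"
proof -
  have fin: "finite A" using A finite_S finite_subset by blast
  have "(\<integral>\<^sup>+\<omega>. ennreal (\<Sum>a\<in>A. X [] \<omega> a * g (\<Theta> [a] \<omega>)) \<partial>M) =
    (\<integral>\<^sup>+\<omega>. (\<Sum>a\<in>A. ennreal (X [] \<omega> a) * ennreal (g (\<Theta> [a] \<omega>))) \<partial>M)"
    using A by (intro nn_integral_cong, subst sum_ennreal[symmetric])
      (auto intro!: mult_nonneg_nonneg nonneg g0 sum.cong ennreal_mult)
  also have "\<dots> = (\<Sum>a\<in>A. \<integral>\<^sup>+\<omega>. ennreal (X [] \<omega> a) * ennreal (g (\<Theta> [a] \<omega>)) \<partial>M)"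
    using A by (intro nn_integral_sum borel_measurable_times_ennreal measurable_compose[OF _ measurable_ennreal]
        X_Nil_meas measurable_compose[OF subtree1_meas g]) auto
  also have "\<dots> = (\<Sum>a\<in>A. (\<integral>\<^sup>+\<omega>. ennreal (X [] \<omega> a) \<partial>M) * (\<integral>\<^sup>+\<omega>. ennreal (g (\<Theta> [] \<omega>)) \<partial>M))"
    by (intro sum.cong refl nn_one_step[where g = "\<lambda>t. ennreal (g t)"]
        measurable_compose[OF X_Nil_meas_off measurable_ennreal]) (use A in auto)
  finally show ?thesis by (simp add: sum_distrib_right)
qed

lemma one_step_powr:
  assumes A: "A \<subseteq> S" and g[measurable]: "g \<in> borel_measurable TS" and g0: "\<And>t. 0 \<le> g t"
  shows "(\<integral>\<^sup>+\<omega>. ennreal (\<Sum>a\<in>A. (X [] \<omega> a * g (\<Theta> [a] \<omega>)) powr h) \<partial>M) =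
    (\<Sum>a\<in>A. \<integral>\<^sup>+\<omega>. ennreal (X [] \<omega> a powr h) \<partial>M) * (\<integral>\<^sup>+\<omega>. ennreal (g (\<Theta> [] \<omega>) powr h) \<partial>M)"
proof -
  have fin: "finite A" using A finite_S finite_subset by blast
  have [measurable]: "(\<lambda>t. ennreal (g t powr h)) \<in> borel_measurable TS" by measurable
  have "(\<integral>\<^sup>+\<omega>. ennreal (\<Sum>a\<in>A. (X [] \<omega> a * g (\<Theta> [a] \<omega>)) powr h) \<partial>M) =
    (\<integral>\<^sup>+\<omega>. (\<Sum>a\<in>A. ennreal (X [] \<omega> a powr h) * ennreal (g (\<Theta> [a] \<omega>) powr h)) \<partial>M)"
    using A by (intro nn_integral_cong, subst sum_ennreal[symmetric])
      (auto intro!: sum.cong simp: ennreal_mult powr_mult nonneg g0 subset_iff)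
  also have "\<dots> = (\<Sum>a\<in>A. \<integral>\<^sup>+\<omega>. ennreal (X [] \<omega> a powr h) * ennreal (g (\<Theta> [a] \<omega>) powr h) \<partial>M)"
    using A by (intro nn_integral_sum borel_measurable_times_ennreal measurable_compose[OF _ measurable_ennreal]
        powr_real_measurable borel_measurable_const
        X_Nil_meas measurable_compose[OF subtree1_meas g]) auto
  also have "\<dots> = (\<Sum>a\<in>A. (\<integral>\<^sup>+\<omega>. ennreal (X [] \<omega> a powr h) \<partial>M) * (\<integral>\<^sup>+\<omega>. ennreal (g (\<Theta> [] \<omega>) powr h) \<partial>M))"
    by (intro sum.cong refl nn_one_step[where g = "\<lambda>t. ennreal (g t powr h)"]
        measurable_compose[OF _ measurable_ennreal] powr_real_measurable borel_measurable_const X_Nil_meas_off)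
      (use A in auto)
  finally show ?thesis by (simp add: sum_distrib_right)
qed

lemma one_step_le_1:
  assumes A: "A \<subseteq> S" and g: "g \<in> borel_measurable TS" and g0: "\<And>t. 0 \<le> g t" and h: "0 < h" "h \<le> 1"
  shows "(\<integral>\<^sup>+\<omega>. ennreal ((\<Sum>a\<in>A. X [] \<omega> a * g (\<Theta> [a] \<omega>)) powr h) \<partial>M) \<le>
    (\<Sum>a\<in>A. \<integral>\<^sup>+\<omega>. ennreal (X [] \<omega> a powr h) \<partial>M) * (\<integral>\<^sup>+\<omega>. ennreal (g (\<Theta> [] \<omega>) powr h) \<partial>M)"
  unfolding one_step_powr[OF A g g0, symmetric]
  using A finite_subset[OF A finite_S] h
  by (intro nn_integral_mono ennreal_leI powr_sum_le) (auto intro!: mult_nonneg_nonneg nonneg g0)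

text \<open>Jensen's inequality conditionally on the weights at the root: the random masses
  \<open>g (\<Theta> [b] \<omega>)\<close> are replaced by their mean \<open>m\<close> inside a
  concave power. Conditional expectations are avoided by integrating the tangent at the point
  \<open>s\<close>, itself a function of the root weights.\<close>

lemma one_step_jensen:
  assumes a: "a \<in> S" and A: "A \<subseteq> S" and g[measurable]: "g \<in> borel_measurable TS" and g0: "\<And>t. 0 \<le> g t"
    and m: "(\<integral>\<^sup>+\<omega>. ennreal (g (\<Theta> [] \<omega>)) \<partial>M) = ennreal m" "0 < m" and r: "0 < r" "r \<le> 1"
    and aA: "a \<notin> A" and fin: "(\<integral>\<^sup>+\<omega>. ennreal (X [] \<omega> a * (\<Sum>b\<in>A. X [] \<omega> b) powr r) \<partial>M) < \<infinity>"
  shows "(\<integral>\<^sup>+\<omega>. ennreal (X [] \<omega> a * (\<Sum>b\<in>A. X [] \<omega> b * g (\<Theta> [b] \<omega>)) powr r) \<partial>M)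
    \<le> ennreal (m powr r) * (\<integral>\<^sup>+\<omega>. ennreal (X [] \<omega> a * (\<Sum>b\<in>A. X [] \<omega> b) powr r) \<partial>M)"
proof -
  have finA: "finite A" using A finite_S finite_subset by blast
  define s where "s \<omega> = m * (\<Sum>b\<in>A. X [] \<omega> b)" for \<omega>
  define t where "t \<omega> = (\<Sum>b\<in>A. X [] \<omega> b * g (\<Theta> [b] \<omega>))" for \<omega>
  have XA: "0 \<le> X [] \<omega> b" if "b \<in> A" for b \<omega> using nonneg A that by auto
  have s0: "0 \<le> s \<omega>" for \<omega> unfolding s_def using m XA by (intro mult_nonneg_nonneg sum_nonneg) auto
  have t0: "0 \<le> t \<omega>" for \<omega> unfolding t_def using XA g0 by (intro sum_nonneg mult_nonneg_nonneg) auto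
  note [measurable] = X_Nil_meas[OF a]
  have XM: "(\<lambda>\<omega>. X [] \<omega> b) \<in> borel_measurable M" if "b \<in> A" for b using A that by (intro X_Nil_meas) auto
  have sM[measurable]: "s \<in> borel_measurable M" unfolding s_def[abs_def]
    by (intro borel_measurable_times borel_measurable_const borel_measurable_sum XM)
  have gM: "(\<lambda>\<omega>. g (\<Theta> [b] \<omega>)) \<in> borel_measurable M" if "b \<in> A" for b
    using A that by (intro measurable_compose[OF subtree1_meas g]) auto
  have tM[measurable]: "t \<in> borel_measurable M" unfolding t_def[abs_def]
    by (intro borel_measurable_times borel_measurable_sum XM gM)
  have pw: "X [] \<omega> a * t \<omega> powr r + r * (X [] \<omega> a * s \<omega> powr r)
      \<le> X [] \<omega> a * s \<omega> powr r + r * (X [] \<omega> a * s \<omega> powr (r - 1) * t \<omega>)" for \<omega>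
  proof (cases "s \<omega> = 0")
    case True
    then have "X [] \<omega> b = 0" if "b \<in> A" for b
      using m that finA XA by (simp add: s_def sum_nonneg_eq_0_iff)
    then have "t \<omega> = 0" by (simp add: t_def)
    then show ?thesis using True by simp
  next
    case False
    then have "t \<omega> powr r + r * s \<omega> powr r \<le> s \<omega> powr r + r * (s \<omega> powr (r - 1) * t \<omega>)"
      using s0[of \<omega>] t0 r by (intro powr_le_tangent_at) auto
    from mult_left_mono[OF this nonneg[OF a, of "[]" \<omega>]] show ?thesis by (simp add: algebra_simps)
  qed
  have spow: "s \<omega> powr r = s \<omega> powr (r - 1) * s \<omega>" for \<omega>
    using s0[of \<omega>] by (cases "s \<omega> = 0") (auto simp: powr_diff)
  let ?I = "\<integral>\<^sup>+\<omega>. ennreal (X [] \<omega> a * s \<omega> powr r) \<partial>M"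
  \<comment> \<open>As \<open>s\<close> depends on the root weights only, each mass in
    \<open>t\<close> is independent of its coefficient and can be replaced by \<open>m\<close>,
    which turns \<open>t\<close> into \<open>s\<close>. So the linear term of the tangent integrates
    to the same value as at \<open>t = s\<close>.\<close>
  have key: "(\<integral>\<^sup>+\<omega>. ennreal (X [] \<omega> a * s \<omega> powr (r - 1) * t \<omega>) \<partial>M) = ?I"
  proof -
    let ?f = "\<lambda>b \<omega>. ennreal (X [] \<omega> a * s \<omega> powr (r - 1) * X [] \<omega> b)"
    have "(\<integral>\<^sup>+\<omega>. ennreal (X [] \<omega> a * s \<omega> powr (r - 1) * t \<omega>) \<partial>M) =
       (\<integral>\<^sup>+\<omega>. (\<Sum>b\<in>A. ?f b \<omega> * ennreal (g (\<Theta> [b] \<omega>))) \<partial>M)"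
    proof (intro nn_integral_cong)
      fix \<omega>
      have "X [] \<omega> a * s \<omega> powr (r - 1) * t \<omega> = (\<Sum>b\<in>A. X [] \<omega> a * s \<omega> powr (r - 1) * X [] \<omega> b * g (\<Theta> [b] \<omega>))"
        by (simp add: t_def sum_distrib_left mult_ac)
      then show "ennreal (X [] \<omega> a * s \<omega> powr (r - 1) * t \<omega>) = (\<Sum>b\<in>A. ?f b \<omega> * ennreal (g (\<Theta> [b] \<omega>)))"
        by (simp add: XA nonneg[OF a] g0 ennreal_mult mult_nonneg_nonneg flip: sum_ennreal)
    qed
    also have "\<dots> = (\<Sum>b\<in>A. \<integral>\<^sup>+\<omega>. ?f b \<omega> * ennreal (g (\<Theta> [b] \<omega>)) \<partial>M)"
      by (intro nn_integral_sum borel_measurable_times_ennreal measurable_compose[OF _ measurable_ennreal]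
        borel_measurable_times powr_real_measurable borel_measurable_const XM gM sM X_Nil_meas[OF a])
    also have "\<dots> = (\<Sum>b\<in>A. (\<integral>\<^sup>+\<omega>. ?f b \<omega> \<partial>M) * ennreal m)"
    proof (intro sum.cong refl)
      fix b assume b: "b \<in> A"
      have 1: "(\<lambda>\<omega>. X [] \<omega> c) \<in> borel_measurable (G (off [b]))" if "c \<in> S" for c
        using A b that by (intro X_Nil_meas_off) auto
      have 2: "s \<in> borel_measurable (G (off [b]))" unfolding s_def[abs_def]
        by (intro borel_measurable_times borel_measurable_const borel_measurable_sum 1) (use A in auto)
      have "(\<integral>\<^sup>+\<omega>. ?f b \<omega> * ennreal (g (\<Theta> [b] \<omega>)) \<partial>M) = (\<integral>\<^sup>+\<omega>. ?f b \<omega> \<partial>M) * (\<integral>\<^sup>+\<omega>. ennreal (g (\<Theta> [] \<omega>)) \<partial>M)"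
        by (rule nn_one_step[where g = "\<lambda>t. ennreal (g t)"])
          (use A b a in \<open>auto intro!: measurable_compose[OF _ measurable_ennreal]
            borel_measurable_times powr_real_measurable 1 2\<close>)
      then show "(\<integral>\<^sup>+\<omega>. ?f b \<omega> * ennreal (g (\<Theta> [b] \<omega>)) \<partial>M) = (\<integral>\<^sup>+\<omega>. ?f b \<omega> \<partial>M) * ennreal m"
        by (simp add: m)
    qed
    also have "\<dots> = (\<integral>\<^sup>+\<omega>. (\<Sum>b\<in>A. ?f b \<omega>) \<partial>M) * ennreal m"
      by (subst nn_integral_sum)
        (auto simp: sum_distrib_right intro!: measurable_compose[OF _ measurable_ennreal]
         borel_measurable_times powr_real_measurable XM X_Nil_meas[OF a])
    also have "\<dots> = (\<integral>\<^sup>+\<omega>. (\<Sum>b\<in>A. ?f b \<omega>) * ennreal m \<partial>M)"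
      by (subst nn_integral_multc)
         (auto intro!: borel_measurable_sum measurable_compose[OF _ measurable_ennreal]
           borel_measurable_times powr_real_measurable XM X_Nil_meas[OF a])
    also have "\<dots> = ?I"
    proof (intro nn_integral_cong)
      fix \<omega>
      have "(\<Sum>b\<in>A. ?f b \<omega>) * ennreal m = ennreal ((\<Sum>b\<in>A. X [] \<omega> a * s \<omega> powr (r - 1) * X [] \<omega> b) * m)"
      proof -
        have "0 \<le> X [] \<omega> a * s \<omega> powr (r - 1) * X [] \<omega> b" if "b \<in> A" for b
          using XA[OF that] nonneg[OF a] by simp
        then show ?thesis using m by (simp only: sum_ennreal ennreal_mult[OF sum_nonneg] less_imp_le)
      qed
      also have "(\<Sum>b\<in>A. X [] \<omega> a * s \<omega> powr (r - 1) * X [] \<omega> b) * m = X [] \<omega> a * s \<omega> powr r"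
        unfolding spow by (subst sum_distrib_left[symmetric]) (simp add: s_def mult_ac)
      finally show "(\<Sum>b\<in>A. ?f b \<omega>) * ennreal m = ennreal (X [] \<omega> a * s \<omega> powr r)" .
    qed
    finally show ?thesis .
  qed
  have Ieq: "?I = ennreal (m powr r) * (\<integral>\<^sup>+\<omega>. ennreal (X [] \<omega> a * (\<Sum>b\<in>A. X [] \<omega> b) powr r) \<partial>M)"
  proof -
    have "?I = (\<integral>\<^sup>+\<omega>. ennreal (m powr r) * ennreal (X [] \<omega> a * (\<Sum>b\<in>A. X [] \<omega> b) powr r) \<partial>M)"
    proof (intro nn_integral_cong)
      fix \<omega>
      have "X [] \<omega> a * s \<omega> powr r = m powr r * (X [] \<omega> a * (\<Sum>b\<in>A. X [] \<omega> b) powr r)"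
        using m by (simp add: s_def powr_mult sum_nonneg[OF XA])
      then show "ennreal (X [] \<omega> a * s \<omega> powr r) = ennreal (m powr r) * ennreal (X [] \<omega> a * (\<Sum>b\<in>A. X [] \<omega> b) powr r)"
        by (simp only: ennreal_mult'[OF powr_ge_zero])
    qed
    also have "\<dots> = ennreal (m powr r) * (\<integral>\<^sup>+\<omega>. ennreal (X [] \<omega> a * (\<Sum>b\<in>A. X [] \<omega> b) powr r) \<partial>M)"
      by (intro nn_integral_cmult measurable_compose[OF _ measurable_ennreal])
         (auto intro!: borel_measurable_times powr_real_measurable borel_measurable_sum XM X_Nil_meas[OF a])
    finally show ?thesis .
  qed
  have Ifin: "?I < \<infinity>"
    unfolding Ieq infinity_ennreal_def ennreal_mult_less_top using fin by simp
  have lin: "(\<integral>\<^sup>+\<omega>. ennreal (f \<omega> + r * k \<omega>) \<partial>M) = (\<integral>\<^sup>+\<omega>. ennreal (f \<omega>) \<partial>M) + ennreal r * (\<integral>\<^sup>+\<omega>. ennreal (k \<omega>) \<partial>M)"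
    if [measurable]: "f \<in> borel_measurable M" "k \<in> borel_measurable M" and "\<And>\<omega>. 0 \<le> f \<omega>" "\<And>\<omega>. 0 \<le> k \<omega>" for f k
  proof -
    have "(\<integral>\<^sup>+\<omega>. ennreal (f \<omega> + r * k \<omega>) \<partial>M) = (\<integral>\<^sup>+\<omega>. ennreal (f \<omega>) + ennreal r * ennreal (k \<omega>) \<partial>M)"
      using that(3,4) r by (intro nn_integral_cong) (simp only: ennreal_mult ennreal_plus mult_nonneg_nonneg less_imp_le)
    also have "\<dots> = (\<integral>\<^sup>+\<omega>. ennreal (f \<omega>) \<partial>M) + (\<integral>\<^sup>+\<omega>. ennreal r * ennreal (k \<omega>) \<partial>M)"
      by (rule nn_integral_add) measurable
    also have "(\<integral>\<^sup>+\<omega>. ennreal r * ennreal (k \<omega>) \<partial>M) = ennreal r * (\<integral>\<^sup>+\<omega>. ennreal (k \<omega>) \<partial>M)"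
      by (rule nn_integral_cmult) measurable
    finally show ?thesis .
  qed
  \<comment> \<open>The common summand \<open>ennreal r * ?I\<close> is finite and is cancelled at
    the end.\<close>
  have "(\<integral>\<^sup>+\<omega>. ennreal (X [] \<omega> a * t \<omega> powr r) \<partial>M) + ennreal r * ?I =
     (\<integral>\<^sup>+\<omega>. ennreal (X [] \<omega> a * t \<omega> powr r + r * (X [] \<omega> a * s \<omega> powr r)) \<partial>M)"
    by (rule lin[symmetric]) (auto simp: nonneg[OF a])
  also have "\<dots> \<le> (\<integral>\<^sup>+\<omega>. ennreal (X [] \<omega> a * s \<omega> powr r + r * (X [] \<omega> a * s \<omega> powr (r - 1) * t \<omega>)) \<partial>M)"
    by (intro nn_integral_mono ennreal_leI pw)
  also have "\<dots> = ?I + ennreal r * (\<integral>\<^sup>+\<omega>. ennreal (X [] \<omega> a * s \<omega> powr (r - 1) * t \<omega>) \<partial>M)"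
    by (rule lin) (auto simp: nonneg[OF a] t0)
  also have "\<dots> = ?I + ennreal r * ?I" by (simp only: key)
  finally have "(\<integral>\<^sup>+\<omega>. ennreal (X [] \<omega> a * t \<omega> powr r) \<partial>M) \<le> ?I"
    using Ifin by (simp only: add.commute[of _ "ennreal r * ?I"] ennreal_add_left_cancel_le)
      (auto simp: ennreal_mult_eq_top_iff)
  then show ?thesis by (simp only: Ieq t_def)
qed

end

text \<open>Both are \<open>1 + s \<le> exp s\<close> for \<open>s = (q - 1) * ln x\<close> and for
  \<open>- s\<close>. On either side of 1 the difference quotient of \<open>x powr q\<close> is thus
  enclosed between \<open>x * ln x\<close> and \<open>x powr q * ln x\<close>.\<close>

lemma powr_diff_bounds:
  fixes x q :: real
  assumes "0 \<le> x"
  shows "x * ((q - 1) * ln x) \<le> x powr q - x" "x powr q - x \<le> x powr q * ((q - 1) * ln x)"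
proof -
  have "x * ((q - 1) * ln x) \<le> x powr q - x \<and> x powr q - x \<le> x powr q * ((q - 1) * ln x)"
  proof (cases "x = 0")
    case False
    then have x: "0 < x" using assms by simp
    define s where "s = (q - 1) * ln x"
    have e: "x powr q = x * exp s" using x by (simp add: s_def powr_def left_diff_distrib exp_diff)
    have "x * (1 + s) \<le> x * exp s" using x by (intro mult_left_mono exp_ge_add_one_self) auto
    have "x powr q * (1 - s) \<le> x powr q * exp (- s)"
      using exp_ge_add_one_self[of "- s"] by (intro mult_left_mono) auto
    moreover have "x powr q * exp (- s) = x" unfolding e using exp_minus_inverse[of s] by (simp add: mult.assoc)
    ultimately have "x powr q * (1 - s) \<le> x" by linarith
    with \<open>x * (1 + s) \<le> x * exp s\<close> show ?thesis unfolding s_def[symmetric] e by (simp add: algebra_simps)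
  qed simp
  then show "x * ((q - 1) * ln x) \<le> x powr q - x" "x powr q - x \<le> x powr q * ((q - 1) * ln x)" by auto
qed

text \<open>A dominating function uniform in \<open>q\<close> near 1. Below 1 the logarithm is at
  most \<open>2 * x powr (- 1/2)\<close> in absolute value, which \<open>q \<ge> 1 / 2\<close>
  absorbs; above 1 it is at most \<open>x powr p / p\<close>, and this second \<open>p\<close> leads
  to the exponent \<open>1 + 2 * p\<close>.\<close>

lemma powr_ln_bound:
  fixes x q p :: real
  assumes "0 \<le> x" "1 / 2 \<le> q" "q \<le> 1 + p" "0 < p"
  shows "\<bar>x powr q * ln x\<bar> \<le> 2 + x powr (1 + 2 * p) / p"
proof (cases "x \<le> 1")
  case True
  show ?thesis
  proof (cases "x = 0")
    case False
    then have x: "0 < x" "ln x \<le> 0" using True assms by auto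
    have "- ln x = 2 * ln (x powr (- 1/2))" using x by (simp add: ln_powr)
    also have "\<dots> \<le> 2 * (x powr (- 1/2))" using x ln_bound[of "x powr (- 1/2)"] by simp
    finally have "x powr (1/2) * (- ln x) \<le> x powr (1/2) * (2 * x powr (- 1/2))"
      by (intro mult_left_mono) auto
    also have "\<dots> = 2" using x by (simp add: powr_add[symmetric])
    finally have 1: "x powr (1/2) * (- ln x) \<le> 2" .
    have "x powr q \<le> x powr (1/2)" using assms x True by (intro powr_mono') auto
    then have "x powr q * (- ln x) \<le> x powr (1/2) * (- ln x)" using x by (intro mult_right_mono) auto
    moreover have "\<bar>x powr q * ln x\<bar> = x powr q * (- ln x)" using x by (simp add: abs_mult)
    moreover have "0 \<le> x powr (1 + 2 * p) / p" using assms by simp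
    ultimately show ?thesis using 1 by linarith
  qed (use assms in auto)
next
  case False
  then have x: "1 < x" by simp
  have "p * ln x = ln (x powr p)" using x by (simp add: ln_powr)
  also have "\<dots> \<le> x powr p" using x ln_bound[of "x powr p"] by simp
  finally have "ln x \<le> x powr p / p" using assms by (simp add: field_simps)
  then have "x powr q * ln x \<le> x powr (1 + p) * (x powr p / p)"
    using x assms by (intro mult_mono powr_mono) auto
  also have "\<dots> = x powr (1 + 2 * p) / p"
    unfolding times_divide_eq_right powr_add[symmetric] by (simp add: algebra_simps)
  finally show ?thesis using x by simp
qed

lemma powr_le_one_plus:
  fixes x q q0 :: real
  assumes "0 \<le> x" "0 < q" "q \<le> q0"
  shows "x powr q \<le> 1 + x powr q0"
proof (cases "x \<le> 1")
  case True
  then have "x powr q \<le> 1" using assms by (intro powr_le1) auto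
  then show ?thesis by (smt (verit) powr_ge_zero)
next
  case False
  then have "x powr q \<le> x powr q0" using assms by (intro powr_mono) auto
  then show ?thesis by simp
qed

lemma powr_sum_le_card:
  fixes x :: "'b \<Rightarrow> real"
  assumes A: "finite A" "\<And>a. a \<in> A \<Longrightarrow> 0 \<le> x a" and q: "0 < q"
  shows "(\<Sum>a\<in>A. x a) powr q \<le> real (card A) powr q * (\<Sum>a\<in>A. x a powr q)"
proof (cases "A = {}")
  case False
  define m where "m = Max (x ` A)"
  have "m \<in> x ` A" unfolding m_def using A False by (intro Max_in) auto
  then obtain a where a: "a \<in> A" "m = x a" by auto
  have "(\<Sum>a\<in>A. x a) \<le> real (card A) * m"
    unfolding m_def using A by (intro sum_bounded_above Max_ge) auto
  then have "(\<Sum>a\<in>A. x a) powr q \<le> (real (card A) * m) powr q"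
    using A q by (intro powr_mono2 sum_nonneg) auto
  also have "\<dots> = real (card A) powr q * m powr q" using a A by (simp add: powr_mult)
  also have "m powr q \<le> (\<Sum>a\<in>A. x a powr q)" using a A by (auto intro!: member_le_sum)
  finally show ?thesis by (simp add: mult_left_mono)
qed simp

text \<open>Dominated convergence for the difference quotients: \<open>powr_diff_bounds\<close>
  encloses them and \<open>powr_ln_bound\<close> dominates the two enclosing functions for all
  exponents in the neighbourhood \<open>?I\<close> of 1.\<close>

lemma (in prob_space) has_derivative_moment:
  fixes f :: "'a \<Rightarrow> real"
  assumes f[measurable]: "f \<in> borel_measurable M" and f0: "\<And>\<omega>. 0 \<le> f \<omega>"
    and p: "0 < p" and int: "integrable M (\<lambda>\<omega>. f \<omega> powr (1 + 2 * p))"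
  shows "((\<lambda>q. \<integral>\<omega>. f \<omega> powr q \<partial>M) has_real_derivative (\<integral>\<omega>. f \<omega> * ln (f \<omega>) \<partial>M)) (at 1)"
proof -
  have intq: "integrable M (\<lambda>\<omega>. f \<omega> powr q)" if "0 < q" "q \<le> 1 + 2 * p" for q
    by (rule Bochner_Integration.integrable_bound[of M "\<lambda>\<omega>. 1 + f \<omega> powr (1 + 2 * p)"])
       (use int that powr_le_one_plus[OF f0] in \<open>auto intro!: AE_I2\<close>)
  let ?I = "{1/2..1 + p}"
  have "((\<lambda>q. ((\<integral>\<omega>. f \<omega> powr q \<partial>M) - (\<integral>\<omega>. f \<omega> powr 1 \<partial>M)) / (q - 1)) \<longlongrightarrow> (\<integral>\<omega>. f \<omega> * ln (f \<omega>) \<partial>M)) (at 1 within ?I)"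
    unfolding tendsto_at_iff_sequentially comp_def
  proof (intro allI impI)
    fix q :: "nat \<Rightarrow> real" assume q: "\<forall>i. q i \<in> ?I - {1}" "q \<longlonglongrightarrow> 1"
    have 1: "((\<integral>\<omega>. f \<omega> powr (q i) \<partial>M) - (\<integral>\<omega>. f \<omega> powr 1 \<partial>M)) / (q i - 1)
      = (\<integral>\<omega>. (f \<omega> powr (q i) - f \<omega>) / (q i - 1) \<partial>M)" for i
    proof -
      have "q i \<in> ?I - {1}" using q by blast
      then show ?thesis using intq[of "q i"] intq[of 1] p f0 by (simp add: Bochner_Integration.integral_diff)
    qed
    have bnd: "min (f \<omega> * ln (f \<omega>)) (f \<omega> powr (q i) * ln (f \<omega>)) \<le> (f \<omega> powr (q i) - f \<omega>) / (q i - 1) \<and>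
      (f \<omega> powr (q i) - f \<omega>) / (q i - 1) \<le> max (f \<omega> * ln (f \<omega>)) (f \<omega> powr (q i) * ln (f \<omega>))" for i \<omega>
    proof -
      have "q i \<noteq> 1" using q by blast
      then consider "q i > 1" | "q i < 1" by linarith
      then show ?thesis
      proof cases
        case 1
        then show ?thesis using powr_diff_bounds[OF f0[of \<omega>], of "q i"]
          by (simp add: min_le_iff_disj le_max_iff_disj pos_le_divide_eq pos_divide_le_eq algebra_simps)
      next
        case 2
        then show ?thesis using powr_diff_bounds[OF f0[of \<omega>], of "q i"]
          by (simp add: min_le_iff_disj le_max_iff_disj neg_le_divide_eq neg_divide_le_eq algebra_simps)
      qed
    qed
    show "(\<lambda>i. ((\<integral>\<omega>. f \<omega> powr (q i) \<partial>M) - (\<integral>\<omega>. f \<omega> powr 1 \<partial>M)) / (q i - 1)) \<longlonglongrightarrow> (\<integral>\<omega>. f \<omega> * ln (f \<omega>) \<partial>M)"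
      unfolding 1
    proof (rule integral_dominated_convergence[where w = "\<lambda>\<omega>. 2 + f \<omega> powr (1 + 2 * p) / p"])
      show "integrable M (\<lambda>\<omega>. 2 + f \<omega> powr (1 + 2 * p) / p)" using int by simp
      show "AE \<omega> in M. (\<lambda>i. (f \<omega> powr (q i) - f \<omega>) / (q i - 1)) \<longlonglongrightarrow> f \<omega> * ln (f \<omega>)"
      proof (rule AE_I2)
        fix \<omega>
        have t: "(\<lambda>i. f \<omega> powr (q i) * ln (f \<omega>)) \<longlonglongrightarrow> f \<omega> * ln (f \<omega>)"
        proof (cases "f \<omega> = 0")
          case False
          then have "(\<lambda>i. f \<omega> powr (q i) * ln (f \<omega>)) \<longlonglongrightarrow> f \<omega> powr 1 * ln (f \<omega>)"
            using f0[of \<omega>] by (intro tendsto_intros q) auto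
          then show ?thesis using f0[of \<omega>] by simp
        qed simp
        show "(\<lambda>i. (f \<omega> powr (q i) - f \<omega>) / (q i - 1)) \<longlonglongrightarrow> f \<omega> * ln (f \<omega>)"
        proof (rule tendsto_sandwich)
          show "(\<lambda>i. min (f \<omega> * ln (f \<omega>)) (f \<omega> powr (q i) * ln (f \<omega>))) \<longlonglongrightarrow> f \<omega> * ln (f \<omega>)"
            using tendsto_min[OF tendsto_const t, of "f \<omega> * ln (f \<omega>)"] by simp
          show "(\<lambda>i. max (f \<omega> * ln (f \<omega>)) (f \<omega> powr (q i) * ln (f \<omega>))) \<longlonglongrightarrow> f \<omega> * ln (f \<omega>)"
            using tendsto_max[OF tendsto_const t, of "f \<omega> * ln (f \<omega>)"] by simp
        qed (use bnd in auto)
      qed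
      show "AE \<omega> in M. norm ((f \<omega> powr (q i) - f \<omega>) / (q i - 1)) \<le> 2 + f \<omega> powr (1 + 2 * p) / p" for i
      proof (rule AE_I2)
        fix \<omega>
        have "q i \<in> ?I" using q by blast
        then have "\<bar>f \<omega> powr (q i) * ln (f \<omega>)\<bar> \<le> 2 + f \<omega> powr (1 + 2 * p) / p"
          using p f0 by (intro powr_ln_bound) auto
        moreover have "\<bar>f \<omega> powr 1 * ln (f \<omega>)\<bar> \<le> 2 + f \<omega> powr (1 + 2 * p) / p"
          using p f0 by (intro powr_ln_bound) auto
        then have "\<bar>f \<omega> * ln (f \<omega>)\<bar> \<le> 2 + f \<omega> powr (1 + 2 * p) / p" using f0[of \<omega>] by simp
        ultimately show "norm ((f \<omega> powr (q i) - f \<omega>) / (q i - 1)) \<le> 2 + f \<omega> powr (1 + 2 * p) / p"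
          using bnd[of \<omega> i] unfolding real_norm_def by linarith
      qed
    qed measurable
  qed
  moreover have "at (1::real) within ?I = at 1" using p by (intro at_within_interior) auto
  ultimately show ?thesis by (simp add: has_field_derivative_iff)
qed

text \<open>The inequality \<open>1 + s \<le> exp s\<close> converts the first-order expansion at 1
  into exponential bounds, which can be multiplied over the letters.\<close>

lemma exp_bounds_of_derivative:
  fixes \<phi> :: "real \<Rightarrow> real"
  assumes d: "(\<phi> has_real_derivative - d) (at 1)" and 1: "\<phi> 1 = 1" and e: "0 < \<epsilon>"
  shows "\<forall>\<^sub>F q in at_right 1. \<phi> q \<le> exp (- (d - \<epsilon>) * (q - 1))"
    and "\<forall>\<^sub>F q in at_left 1. \<phi> q \<le> exp ((d + \<epsilon>) * (1 - q))"
proof -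
  have t: "((\<lambda>q. (\<phi> q - 1) / (q - 1)) \<longlongrightarrow> - d) (at 1)"
    using d 1 by (simp add: has_field_derivative_iff)
  have "\<forall>\<^sub>F q in at 1. (\<phi> q - 1) / (q - 1) < - d + \<epsilon>"
    using e by (intro order_tendstoD(2)[OF t]) auto
  then have "\<forall>\<^sub>F q in at_right 1. (\<phi> q - 1) / (q - 1) < - d + \<epsilon>" by (simp add: eventually_at_split)
  moreover have "\<forall>\<^sub>F q::real in at_right 1. q > 1" by (simp add: eventually_at_filter)
  ultimately show "\<forall>\<^sub>F q in at_right 1. \<phi> q \<le> exp (- (d - \<epsilon>) * (q - 1))"
  proof eventually_elim
    case (elim q)
    then have "\<phi> q - 1 < (- d + \<epsilon>) * (q - 1)" by (subst (asm) pos_divide_less_eq) auto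
    then have "\<phi> q \<le> 1 + (- (d - \<epsilon>) * (q - 1))" by (simp add: algebra_simps)
    then show ?case using exp_ge_add_one_self order_trans by blast
  qed
  have "\<forall>\<^sub>F q in at 1. - d - \<epsilon> < (\<phi> q - 1) / (q - 1)"
    using e by (intro order_tendstoD(1)[OF t]) auto
  then have "\<forall>\<^sub>F q in at_left 1. - d - \<epsilon> < (\<phi> q - 1) / (q - 1)" by (simp add: eventually_at_split)
  moreover have "\<forall>\<^sub>F q::real in at_left 1. q < 1" by (simp add: eventually_at_filter)
  ultimately show "\<forall>\<^sub>F q in at_left 1. \<phi> q \<le> exp ((d + \<epsilon>) * (1 - q))"
  proof eventually_elim
    case (elim q)
    then have "\<phi> q - 1 < (- d - \<epsilon>) * (q - 1)" by (subst (asm) neg_less_divide_eq) auto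
    then have "\<phi> q \<le> 1 + ((d + \<epsilon>) * (1 - q))" by (simp add: algebra_simps)
    then show ?case using exp_ge_add_one_self order_trans by blast
  qed
qed

section \<open>One branching step: exponents between 1 and 2\<close>

context cascade
begin

text \<open>The inequality of von Bahr--Esseen type. Diagonal terms retain the \<open>q\<close>-th
  moment of \<open>g\<close>. In a cross term one factor \<open>g\<close> is independent of the
  others and contributes its mean \<open>m\<close>, while conditional Jensen turns the others into
  \<open>m powr (q - 1)\<close>; together they see only the mean.\<close>

lemma one_step_gt_1:
  assumes A: "A \<subseteq> S" and g[measurable]: "g \<in> borel_measurable TS" and g0: "\<And>t. 0 \<le> g t"
    and m: "(\<integral>\<^sup>+\<omega>. ennreal (g (\<Theta> [] \<omega>)) \<partial>M) = ennreal m" "0 \<le> m" and q: "1 < q" "q \<le> 2"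
    and fin: "(\<integral>\<^sup>+\<omega>. ennreal ((\<Sum>b\<in>A. X [] \<omega> b) powr q) \<partial>M) < \<infinity>"
  shows "(\<integral>\<^sup>+\<omega>. ennreal ((\<Sum>a\<in>A. X [] \<omega> a * g (\<Theta> [a] \<omega>)) powr q) \<partial>M)
    \<le> (\<Sum>a\<in>A. \<integral>\<^sup>+\<omega>. ennreal (X [] \<omega> a powr q) \<partial>M) * (\<integral>\<^sup>+\<omega>. ennreal (g (\<Theta> [] \<omega>) powr q) \<partial>M)
      + ennreal (m powr q) * (\<integral>\<^sup>+\<omega>. ennreal ((\<Sum>a\<in>A. X [] \<omega> a) powr q) \<partial>M)"
proof (cases "m = 0")
  case True
  have "AE \<omega> in M. g (\<Theta> [] \<omega>) = 0"
  proof -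
    have "AE \<omega> in M. ennreal (g (\<Theta> [] \<omega>)) = 0"
      using m True measurable_compose[OF subtree_meas g, of "[]"]
      by (subst nn_integral_0_iff_AE[symmetric]) simp_all
    then show ?thesis by eventually_elim (metis ennreal_eq_0_iff g0 order_antisym)
  qed
  have "AE \<omega> in M. g (\<Theta> [a] \<omega>) = 0" if "a \<in> A" for a
  proof (rule AE_subtree[where P = "\<lambda>t. g t = 0"])
    show "[a] \<in> lists S" using A that by auto
    show "Measurable.pred TS (\<lambda>t. g t = 0)" by measurable
  qed fact
  then have "AE \<omega> in M. \<forall>a\<in>A. g (\<Theta> [a] \<omega>) = 0"
    using finite_subset[OF A finite_S] by (intro AE_finite_allI) auto
  then have "(\<integral>\<^sup>+\<omega>. ennreal ((\<Sum>a\<in>A. X [] \<omega> a * g (\<Theta> [a] \<omega>)) powr q) \<partial>M) = (\<integral>\<^sup>+\<omega>. 0 \<partial>M)"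
    by (intro nn_integral_cong_AE) (elim eventually_mono, simp)
  then show ?thesis by simp
next
  case False
  then have m0: "0 < m" using m by simp
  have finA: "finite A" using A finite_S finite_subset by blast
  have XA: "0 \<le> X [] \<omega> b" if "b \<in> A" for b \<omega> using nonneg A that by auto
  have XM[measurable]: "(\<lambda>\<omega>. X [] \<omega> b) \<in> borel_measurable M" if "b \<in> A" for b using A that by (intro X_Nil_meas) auto
  have gM[measurable]: "(\<lambda>\<omega>. g (\<Theta> [b] \<omega>)) \<in> borel_measurable M" if "b \<in> A" for b
    using A that by (intro measurable_compose[OF subtree1_meas g]) auto
  let ?Z = "\<lambda>a \<omega>. (\<Sum>b\<in>A - {a}. X [] \<omega> b * g (\<Theta> [b] \<omega>)) powr (q - 1)"
  have ZM[measurable]: "?Z a \<in> borel_measurable M" for a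
    by (intro powr_real_measurable borel_measurable_sum borel_measurable_times) (auto intro: XM gM)
  have le: "X [] \<omega> a * (\<Sum>b\<in>A - {a}. X [] \<omega> b) powr (q - 1) \<le> X [] \<omega> a * (\<Sum>b\<in>A. X [] \<omega> b) powr (q - 1)"
    if "a \<in> A" for a \<omega>
    using XA that q finA by (intro mult_left_mono powr_mono2 sum_mono2 sum_nonneg) auto
  have sumq: "(\<Sum>a\<in>A. X [] \<omega> a * (\<Sum>b\<in>A. X [] \<omega> b) powr (q - 1)) = (\<Sum>b\<in>A. X [] \<omega> b) powr q" for \<omega>
    using sum_nonneg[of A "X [] \<omega>"] XA
    by (subst sum_distrib_right[symmetric], cases "(\<Sum>b\<in>A. X [] \<omega> b) = 0") (auto simp: powr_mult_base)
  have fin1: "(\<integral>\<^sup>+\<omega>. ennreal (X [] \<omega> a * (\<Sum>b\<in>A - {a}. X [] \<omega> b) powr (q - 1)) \<partial>M) < \<infinity>" if a: "a \<in> A" for a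
  proof (rule le_less_trans[OF nn_integral_mono fin], rule ennreal_leI)
    fix \<omega>
    have "X [] \<omega> a * (\<Sum>b\<in>A. X [] \<omega> b) powr (q - 1) \<le> (\<Sum>b\<in>A. X [] \<omega> b) powr q"
      unfolding sumq[symmetric] using a finA XA by (intro member_le_sum) auto
    then show "X [] \<omega> a * (\<Sum>b\<in>A - {a}. X [] \<omega> b) powr (q - 1) \<le> (\<Sum>b\<in>A. X [] \<omega> b) powr q"
      using le[OF a, of \<omega>] by linarith
  qed
  have "(\<integral>\<^sup>+\<omega>. ennreal ((\<Sum>a\<in>A. X [] \<omega> a * g (\<Theta> [a] \<omega>)) powr q) \<partial>M) \<le>
    (\<integral>\<^sup>+\<omega>. ennreal (\<Sum>a\<in>A. (X [] \<omega> a * g (\<Theta> [a] \<omega>)) powr q) + (\<Sum>a\<in>A. ennreal (X [] \<omega> a * ?Z a \<omega>) * ennreal (g (\<Theta> [a] \<omega>))) \<partial>M)"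
  proof (rule nn_integral_mono)
    fix \<omega>
    let ?x = "\<lambda>a. X [] \<omega> a * g (\<Theta> [a] \<omega>)"
    have "ennreal ((\<Sum>a\<in>A. ?x a) powr q) \<le> ennreal ((\<Sum>a\<in>A. ?x a powr q) + (\<Sum>a\<in>A. X [] \<omega> a * ?Z a \<omega> * g (\<Theta> [a] \<omega>)))"
      using powr_sum_le_split[OF finA, of ?x q] XA g0 q by (intro ennreal_leI) (simp add: sum.distrib mult_ac)
    also have "\<dots> = ennreal (\<Sum>a\<in>A. ?x a powr q) + ennreal (\<Sum>a\<in>A. X [] \<omega> a * ?Z a \<omega> * g (\<Theta> [a] \<omega>))"
      using XA g0 by (intro ennreal_plus sum_nonneg) auto
    also have "ennreal (\<Sum>a\<in>A. X [] \<omega> a * ?Z a \<omega> * g (\<Theta> [a] \<omega>)) = (\<Sum>a\<in>A. ennreal (X [] \<omega> a * ?Z a \<omega> * g (\<Theta> [a] \<omega>)))"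
      using XA g0 by (intro sum_ennreal[symmetric]) auto
    also have "\<dots> = (\<Sum>a\<in>A. ennreal (X [] \<omega> a * ?Z a \<omega>) * ennreal (g (\<Theta> [a] \<omega>)))"
      using XA g0 by (intro sum.cong refl ennreal_mult) auto
    finally show "ennreal ((\<Sum>a\<in>A. ?x a) powr q) \<le> ennreal (\<Sum>a\<in>A. ?x a powr q) +
       (\<Sum>a\<in>A. ennreal (X [] \<omega> a * ?Z a \<omega>) * ennreal (g (\<Theta> [a] \<omega>)))" .
  qed
  also have "\<dots> = (\<integral>\<^sup>+\<omega>. ennreal (\<Sum>a\<in>A. (X [] \<omega> a * g (\<Theta> [a] \<omega>)) powr q) \<partial>M) +
     (\<integral>\<^sup>+\<omega>. (\<Sum>a\<in>A. ennreal (X [] \<omega> a * ?Z a \<omega>) * ennreal (g (\<Theta> [a] \<omega>))) \<partial>M)"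
    by (rule nn_integral_add)
      (intro borel_measurable_sum borel_measurable_times_ennreal measurable_compose[OF _ measurable_ennreal]
        borel_measurable_times powr_real_measurable borel_measurable_const XM gM ZM; assumption?)+
  also have "(\<integral>\<^sup>+\<omega>. (\<Sum>a\<in>A. ennreal (X [] \<omega> a * ?Z a \<omega>) * ennreal (g (\<Theta> [a] \<omega>))) \<partial>M) =
     (\<Sum>a\<in>A. \<integral>\<^sup>+\<omega>. ennreal (X [] \<omega> a * ?Z a \<omega>) * ennreal (g (\<Theta> [a] \<omega>)) \<partial>M)"
    by (rule nn_integral_sum)
      (intro borel_measurable_times_ennreal measurable_compose[OF _ measurable_ennreal]
        borel_measurable_times XM gM ZM)
  also have "\<dots> = (\<Sum>a\<in>A. (\<integral>\<^sup>+\<omega>. ennreal (X [] \<omega> a * ?Z a \<omega>) \<partial>M) * ennreal m)"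
  proof (intro sum.cong refl)
    fix a assume a: "a \<in> A"
    have 1: "(\<lambda>\<omega>. X [] \<omega> c) \<in> borel_measurable (G (off [a]))" if "c \<in> S" for c
      using A a that by (intro X_Nil_meas_off) auto
    have 2: "(\<lambda>\<omega>. g (\<Theta> [b] \<omega>)) \<in> borel_measurable (G (off [a]))" if "b \<in> A - {a}" for b
      using A a that by (intro measurable_compose[OF subtree_meas_off g]) auto
    have "(\<integral>\<^sup>+\<omega>. ennreal (X [] \<omega> a * ?Z a \<omega>) * ennreal (g (\<Theta> [a] \<omega>)) \<partial>M) =
      (\<integral>\<^sup>+\<omega>. ennreal (X [] \<omega> a * ?Z a \<omega>) \<partial>M) * (\<integral>\<^sup>+\<omega>. ennreal (g (\<Theta> [] \<omega>)) \<partial>M)"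
      by (rule nn_one_step[where g = "\<lambda>t. ennreal (g t)"])
        (use A a in \<open>auto intro!: measurable_compose[OF _ measurable_ennreal]
            borel_measurable_times powr_real_measurable borel_measurable_sum 1 2\<close>)
    then show "(\<integral>\<^sup>+\<omega>. ennreal (X [] \<omega> a * ?Z a \<omega>) * ennreal (g (\<Theta> [a] \<omega>)) \<partial>M) =
      (\<integral>\<^sup>+\<omega>. ennreal (X [] \<omega> a * ?Z a \<omega>) \<partial>M) * ennreal m" by (simp only: m)
  qed
  also have "\<dots> \<le> (\<Sum>a\<in>A. ennreal (m powr q) * (\<integral>\<^sup>+\<omega>. ennreal (X [] \<omega> a * (\<Sum>b\<in>A. X [] \<omega> b) powr (q - 1)) \<partial>M))"
  proof (rule sum_mono)
    fix a assume a: "a \<in> A"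
    have "(\<integral>\<^sup>+\<omega>. ennreal (X [] \<omega> a * ?Z a \<omega>) \<partial>M) * ennreal m \<le>
      (ennreal (m powr (q - 1)) * (\<integral>\<^sup>+\<omega>. ennreal (X [] \<omega> a * (\<Sum>b\<in>A - {a}. X [] \<omega> b) powr (q - 1)) \<partial>M)) * ennreal m"
      using a A q by (intro mult_right_mono one_step_jensen g g0 m0 m(1) fin1) auto
    also have "\<dots> = ennreal (m powr q) * (\<integral>\<^sup>+\<omega>. ennreal (X [] \<omega> a * (\<Sum>b\<in>A - {a}. X [] \<omega> b) powr (q - 1)) \<partial>M)"
    proof -
      have "m powr (q - 1) * m = m powr q"
        using m0 powr_mult_base[of m "q - 1"] by (simp add: mult.commute)
      then have "ennreal (m powr (q - 1)) * ennreal m = ennreal (m powr q)"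
        by (metis ennreal_mult' powr_ge_zero)
      moreover have "a * b * c = a * c * b" for a b c :: ennreal by (simp only: mult_ac)
      ultimately show ?thesis by (simp only:)
    qed
    also have "\<dots> \<le> ennreal (m powr q) * (\<integral>\<^sup>+\<omega>. ennreal (X [] \<omega> a * (\<Sum>b\<in>A. X [] \<omega> b) powr (q - 1)) \<partial>M)"
      by (intro mult_left_mono nn_integral_mono ennreal_leI le a) simp
    finally show "(\<integral>\<^sup>+\<omega>. ennreal (X [] \<omega> a * ?Z a \<omega>) \<partial>M) * ennreal m \<le>
      ennreal (m powr q) * (\<integral>\<^sup>+\<omega>. ennreal (X [] \<omega> a * (\<Sum>b\<in>A. X [] \<omega> b) powr (q - 1)) \<partial>M)" .
  qed
  also have "\<dots> = ennreal (m powr q) * (\<integral>\<^sup>+\<omega>. (\<Sum>a\<in>A. ennreal (X [] \<omega> a * (\<Sum>b\<in>A. X [] \<omega> b) powr (q - 1))) \<partial>M)"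
    by (subst nn_integral_sum) (auto simp: sum_distrib_left intro!: measurable_compose[OF _ measurable_ennreal]
        borel_measurable_times powr_real_measurable borel_measurable_sum XM)
  also have "(\<integral>\<^sup>+\<omega>. (\<Sum>a\<in>A. ennreal (X [] \<omega> a * (\<Sum>b\<in>A. X [] \<omega> b) powr (q - 1))) \<partial>M) =
      (\<integral>\<^sup>+\<omega>. ennreal ((\<Sum>a\<in>A. X [] \<omega> a) powr q) \<partial>M)"
    by (intro nn_integral_cong) (use XA in \<open>simp add: sumq[symmetric]\<close>)
  finally show ?thesis unfolding one_step_powr[OF A g g0]
    by (simp add: add_left_mono)
qed

end

subsection \<open>Moments of the total mass\<close>

context cascade
begin

text \<open>Being a \<open>lim\<close>, \<open>cascade_Y\<close> has an arbitrary value, possibly negative, where the partial sums diverge.\<close>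

definition V :: "'a list \<Rightarrow> 'w \<Rightarrow> real" where
  "V u \<omega> = max 0 (Y u \<omega>)"

abbreviation vt :: "('a list \<Rightarrow> 'a \<Rightarrow> real) \<Rightarrow> real" where
  "vt t \<equiv> max 0 (cascade_Y S coord t [])"

lemma vt_meas[measurable]: "vt \<in> borel_measurable TS" by measurable

lemma V_subtree: "u \<in> lists S \<Longrightarrow> V u \<omega> = vt (\<Theta> u \<omega>)"
  by (simp add: V_def Y_subtree)

lemma V_nonneg[simp]: "0 \<le> V u \<omega>" by (simp add: V_def)

lemma V_meas[measurable]: "u \<in> lists S \<Longrightarrow> V u \<in> borel_measurable M"
  unfolding V_def[abs_def] by (intro borel_measurable_max borel_measurable_const Y_meas)

lemma good_V: "good \<omega> \<Longrightarrow> u \<in> lists S \<Longrightarrow> V u \<omega> = Y u \<omega>"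
  using good_Y_nonneg by (simp add: V_def max_def)

lemma good_V_consistent: "good \<omega> \<Longrightarrow> u \<in> lists S \<Longrightarrow> V u \<omega> = (\<Sum>a\<in>S. X u \<omega> a * V (u @ [a]) \<omega>)"
  using good_consistent by (simp add: good_V)

end

text \<open>The bound \<open>q0 \<le> 2\<close> ensures \<open>q - 1 \<le> 1\<close> for all
  exponents in use, so that powers of order \<open>q - 1\<close> are subadditive and concave. It is
  no loss of generality because lower moments are finite as well.\<close>

locale cascade_moment = cascade M S X
  for M :: "'w measure" and S :: "'a set" and X :: "'a list \<Rightarrow> 'w \<Rightarrow> 'a \<Rightarrow> real" +
  fixes q0 :: real
  assumes q0: "1 < q0" "q0 \<le> 2"
    and moment: "(\<integral>\<^sup>+\<omega>. ennreal (\<Sum>a\<in>S. X [] \<omega> a powr q0) \<partial>M) < \<infinity>"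
    and nondeg: "\<not> (AE \<omega> in M. Y [] \<omega> = 0)"
begin

definition \<phi> :: "real \<Rightarrow> real" where "\<phi> q = (\<integral>\<omega>. (\<Sum>a\<in>S. X [] \<omega> a powr q) \<partial>M)"

text \<open>This is \<open>T'(1)\<close>: as \<open>T = - ln \<phi>\<close> and
  \<open>\<phi> 1 = 1\<close>, it equals minus the derivative of \<open>\<phi>\<close> at 1. It
  turns out to be the entropy dimension of the Mandelbrot measure.\<close>

definition dimen :: real where "dimen = - (\<integral>\<omega>. (\<Sum>a\<in>S. X [] \<omega> a * ln (X [] \<omega> a)) \<partial>M)"

lemma integrable_powr_q0: "a \<in> S \<Longrightarrow> integrable M (\<lambda>\<omega>. X [] \<omega> a powr q0)"
proof (rule integrableI_nonneg)
  assume a: "a \<in> S"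
  have "(\<integral>\<^sup>+\<omega>. ennreal (X [] \<omega> a powr q0) \<partial>M) \<le> (\<integral>\<^sup>+\<omega>. ennreal (\<Sum>a\<in>S. X [] \<omega> a powr q0) \<partial>M)"
    using a finite_S by (intro nn_integral_mono ennreal_leI member_le_sum) auto
  then show "(\<integral>\<^sup>+\<omega>. ennreal (X [] \<omega> a powr q0) \<partial>M) < \<infinity>" using moment by (rule le_less_trans)
qed auto

lemma integrable_powr: "a \<in> S \<Longrightarrow> 0 < q \<Longrightarrow> q \<le> q0 \<Longrightarrow> integrable M (\<lambda>\<omega>. X [] \<omega> a powr q)"
  by (rule Bochner_Integration.integrable_bound[of M "\<lambda>\<omega>. 1 + X [] \<omega> a powr q0"])
    (use integrable_powr_q0 powr_le_one_plus[OF nonneg] in \<open>auto intro!: AE_I2\<close>)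

lemma integrable_X: "a \<in> S \<Longrightarrow> integrable M (\<lambda>\<omega>. X [] \<omega> a)"
  using integrable_powr[of a 1] q0 nonneg by simp

lemma nn_powr: "a \<in> S \<Longrightarrow> 0 < q \<Longrightarrow> q \<le> q0 \<Longrightarrow>
  (\<integral>\<^sup>+\<omega>. ennreal (X [] \<omega> a powr q) \<partial>M) = ennreal (\<integral>\<omega>. X [] \<omega> a powr q \<partial>M)"
  by (intro nn_integral_eq_integral integrable_powr) auto

lemma sum_nn_powr:
  assumes "A \<subseteq> S" "0 < q" "q \<le> q0"
  shows "(\<Sum>a\<in>A. \<integral>\<^sup>+\<omega>. ennreal (X [] \<omega> a powr q) \<partial>M) = ennreal (\<Sum>a\<in>A. \<integral>\<omega>. X [] \<omega> a powr q \<partial>M)"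
proof -
  have "(\<Sum>a\<in>A. \<integral>\<^sup>+\<omega>. ennreal (X [] \<omega> a powr q) \<partial>M) = (\<Sum>a\<in>A. ennreal (\<integral>\<omega>. X [] \<omega> a powr q \<partial>M))"
    using assms by (intro sum.cong refl nn_powr) auto
  then show ?thesis by (simp add: Bochner_Integration.integral_nonneg)
qed

lemma \<phi>_eq: "0 < q \<Longrightarrow> q \<le> q0 \<Longrightarrow> \<phi> q = (\<Sum>a\<in>S. \<integral>\<omega>. X [] \<omega> a powr q \<partial>M)"
  unfolding \<phi>_def by (intro Bochner_Integration.integral_sum integrable_powr)

lemma nn_\<phi>: "0 < q \<Longrightarrow> q \<le> q0 \<Longrightarrow> (\<Sum>a\<in>S. \<integral>\<^sup>+\<omega>. ennreal (X [] \<omega> a powr q) \<partial>M) = ennreal (\<phi> q)"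
  by (simp add: sum_nn_powr \<phi>_eq)

lemma \<phi>_nonneg: "0 \<le> \<phi> q" unfolding \<phi>_def by (intro Bochner_Integration.integral_nonneg sum_nonneg) auto

lemma \<phi>_1: "\<phi> 1 = 1"
proof -
  have "ennreal (\<phi> 1) = (\<Sum>a\<in>S. \<integral>\<^sup>+\<omega>. ennreal (X [] \<omega> a) \<partial>M)"
    using nn_\<phi>[of 1] q0 nonneg by simp
  also have "\<dots> = (\<integral>\<^sup>+\<omega>. (\<Sum>a\<in>S. ennreal (X [] \<omega> a)) \<partial>M)"
    by (intro nn_integral_sum[symmetric] measurable_compose[OF X_Nil_meas measurable_ennreal])
  also have "\<dots> = 1" using mean1 by (simp add: nonneg)
  finally show ?thesis by simp
qed

lemma \<phi>_has_derivative: "(\<phi> has_real_derivative - dimen) (at 1)"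
proof -
  define p where "p = (q0 - 1) / 2"
  have p: "0 < p" "1 + 2 * p = q0" using q0 by (auto simp: p_def field_simps)
  have "((\<lambda>q. \<Sum>a\<in>S. \<integral>\<omega>. X [] \<omega> a powr q \<partial>M) has_real_derivative (\<Sum>a\<in>S. \<integral>\<omega>. X [] \<omega> a * ln (X [] \<omega> a) \<partial>M)) (at 1)"
    by (intro DERIV_sum has_derivative_moment[where p = p]) (use p nonneg integrable_powr_q0 in auto)
  moreover have "\<forall>\<^sub>F q in nhds 1. (\<Sum>a\<in>S. \<integral>\<omega>. X [] \<omega> a powr q \<partial>M) = \<phi> q"
    using q0 by (intro eventually_nhds_in_open[of "{0<..<q0}", THEN eventually_mono]) (auto simp: \<phi>_eq)
  moreover have "(\<Sum>a\<in>S. \<integral>\<omega>. X [] \<omega> a * ln (X [] \<omega> a) \<partial>M) = - dimen"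
  proof -
    have "integrable M (\<lambda>\<omega>. X [] \<omega> a * ln (X [] \<omega> a))" if a: "a \<in> S" for a
    proof (rule Bochner_Integration.integrable_bound[of M "\<lambda>\<omega>. 2 + X [] \<omega> a powr q0 / p"])
      show "AE \<omega> in M. norm (X [] \<omega> a * ln (X [] \<omega> a)) \<le> norm (2 + X [] \<omega> a powr q0 / p)"
      proof (rule AE_I2)
        fix \<omega>
        have "\<bar>X [] \<omega> a powr 1 * ln (X [] \<omega> a)\<bar> \<le> 2 + X [] \<omega> a powr (1 + 2 * p) / p"
          using p nonneg[OF a] by (intro powr_ln_bound) auto
        then show "norm (X [] \<omega> a * ln (X [] \<omega> a)) \<le> norm (2 + X [] \<omega> a powr q0 / p)"
          using nonneg[OF a, of "[]" \<omega>] p by simp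
      qed
    qed (use a integrable_powr_q0 in auto)
    then show ?thesis unfolding dimen_def by (subst Bochner_Integration.integral_sum) auto
  qed
  ultimately show ?thesis
    by (simp add: DERIV_cong_ev[OF refl _ refl])
qed

lemma nn_V: "(\<integral>\<^sup>+\<omega>. ennreal (V [] \<omega>) \<partial>M) = 1"
proof -
  have "(\<integral>\<^sup>+\<omega>. ennreal (V [] \<omega>) \<partial>M) = EY"
    unfolding EY_def using AE_good by (intro nn_integral_cong_AE) (elim eventually_mono, simp add: good_V)
  then show ?thesis using EY_eq_1[OF nondeg] by simp
qed

lemma V_nonzero: "\<not> (AE \<omega> in M. V [] \<omega> = 0)"
proof
  assume "AE \<omega> in M. V [] \<omega> = 0"
  then have "(\<integral>\<^sup>+\<omega>. ennreal (V [] \<omega>) \<partial>M) = (\<integral>\<^sup>+\<omega>. 0 \<partial>M)"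
    by (intro nn_integral_cong_AE) (elim eventually_mono, simp)
  then show False using nn_V by simp
qed

definition mV :: "real \<Rightarrow> ennreal" where "mV h = (\<integral>\<^sup>+\<omega>. ennreal (V [] \<omega> powr h) \<partial>M)"

lemma mV_le_2: "0 < h \<Longrightarrow> h \<le> 1 \<Longrightarrow> mV h \<le> 2"
proof -
  assume h: "0 < h" "h \<le> 1"
  have "mV h \<le> (\<integral>\<^sup>+\<omega>. 1 + ennreal (V [] \<omega>) \<partial>M)" unfolding mV_def
  proof (rule nn_integral_mono)
    fix \<omega>
    have "V [] \<omega> powr h \<le> 1 + V [] \<omega>" using powr_le_one_plus[of "V [] \<omega>" h 1] h by simp
    then have "ennreal (V [] \<omega> powr h) \<le> ennreal (1 + V [] \<omega>)" by (rule ennreal_leI)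
    then show "ennreal (V [] \<omega> powr h) \<le> 1 + ennreal (V [] \<omega>)" by simp
  qed
  also have "\<dots> = (\<integral>\<^sup>+\<omega>. 1 \<partial>M) + (\<integral>\<^sup>+\<omega>. ennreal (V [] \<omega>) \<partial>M)"
    by (rule nn_integral_add) (auto intro!: measurable_compose[OF V_meas measurable_ennreal])
  also have "\<dots> = 2" by (simp add: nn_V emeasure_space_1 one_add_one)
  finally show ?thesis .
qed

lemma mV_pos: "0 < h \<Longrightarrow> mV h \<noteq> 0"
proof
  assume h: "0 < h" and "mV h = 0"
  then have "AE \<omega> in M. ennreal (V [] \<omega> powr h) = 0"
    unfolding mV_def using V_meas[of "[]"] by (subst (asm) nn_integral_0_iff_AE) auto
  then have "AE \<omega> in M. V [] \<omega> = 0" by eventually_elim (auto simp: ennreal_eq_0_iff)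
  then show False using V_nonzero by simp
qed

text \<open>Equality, because the powers of the single branches are summed here instead of the power
  of their sum; subadditivity is the only loss when passing to \<open>mV h\<close>.\<close>

lemma mV_step:
  assumes h: "0 < h" "h \<le> 1"
  shows "(\<integral>\<^sup>+\<omega>. ennreal (\<Sum>a\<in>S. (X [] \<omega> a * V [a] \<omega>) powr h) \<partial>M) = ennreal (\<phi> h) * mV h"
proof -
  have "(\<integral>\<^sup>+\<omega>. ennreal (\<Sum>a\<in>S. (X [] \<omega> a * V [a] \<omega>) powr h) \<partial>M)
    = (\<integral>\<^sup>+\<omega>. ennreal (\<Sum>a\<in>S. (X [] \<omega> a * vt (\<Theta> [a] \<omega>)) powr h) \<partial>M)"
    by (intro nn_integral_cong) (simp add: V_subtree)
  also have "\<dots> = (\<Sum>a\<in>S. \<integral>\<^sup>+\<omega>. ennreal (X [] \<omega> a powr h) \<partial>M) * (\<integral>\<^sup>+\<omega>. ennreal (vt (\<Theta> [] \<omega>) powr h) \<partial>M)"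
    by (rule one_step_powr) auto
  finally show ?thesis using h q0 by (simp add: nn_\<phi> mV_def V_subtree)
qed

text \<open>Kahane and Peyriere: the loss of subadditivity in \<open>\<E> Y\<^sup>h \<le> \<phi>(h) \<E> Y\<^sup>h\<close> is of order \<open>1 - h\<close>.\<close>

lemma dimen_pos:
  assumes ab: "a \<in> S" "b \<in> S" "a \<noteq> b" and pos: "\<not> (AE \<omega> in M. X [] \<omega> a = 0 \<or> X [] \<omega> b = 0)"
  shows "0 < dimen"
proof -
  define k where "k \<omega> = min (X [] \<omega> a * V [a] \<omega>) (X [] \<omega> b * V [b] \<omega>)" for \<omega>
  have [measurable]: "V [a] \<in> borel_measurable M" "V [b] \<in> borel_measurable M" using ab by (auto intro!: V_meas)
  note [measurable] = X_Nil_meas[OF ab(1)] X_Nil_meas[OF ab(2)]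
  have k[measurable]: "k \<in> borel_measurable M" unfolding k_def[abs_def] by measurable
  have k0: "0 \<le> k \<omega>" for \<omega> unfolding k_def using ab nonneg by simp
  \<comment> \<open>Truncation at 1 gives \<open>min 1 (k \<omega>) \<le> k \<omega> powr h\<close>
    for every \<open>h\<close> in the unit interval, so the gain \<open>(1 - h) * c\<close> has a
    constant independent of \<open>h\<close>.\<close>
  define c where "c = (\<integral>\<omega>. min 1 (k \<omega>) \<partial>M)"
  have ic: "integrable M (\<lambda>\<omega>. min 1 (k \<omega>))"
    by (rule integrable_const_bound[of _ 1]) (use k0 in auto)
  have c0: "0 < c"
  proof (rule ccontr)
    assume "\<not> 0 < c"
    moreover have "0 \<le> c" unfolding c_def using k0 by (intro Bochner_Integration.integral_nonneg) auto
    ultimately have "c = 0" by simp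
    then have "AE \<omega> in M. min 1 (k \<omega>) = 0"
      unfolding c_def using ic k0 by (subst (asm) integral_nonneg_eq_0_iff_AE) auto
    then have k0: "AE \<omega> in M. k \<omega> = 0" by eventually_elim (auto simp: min_def split: if_splits)
    \<comment> \<open>\<open>f\<close> indicates that both weights are non-zero and \<open>g\<close>
      that a subtree has non-zero mass. If \<open>k\<close> vanished almost surely, the product of
      these three independent indicators would have mean 0, hence one of the factors would.\<close>
    define f where "f \<omega> = (if X [] \<omega> a = 0 \<or> X [] \<omega> b = 0 then 0 else 1 :: ennreal)" for \<omega>
    define g where "g t = (if vt t = 0 then 0 else 1 :: ennreal)" for t
    have g[measurable]: "g \<in> borel_measurable TS" unfolding g_def[abs_def] by measurable
    have gV: "g (\<Theta> u \<omega>) = (if V u \<omega> = 0 then 0 else 1)" if "u \<in> lists S" for u \<omega>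
      using that by (simp add: g_def V_subtree)
    have eq: "(\<integral>\<^sup>+\<omega>. (f \<omega> * g (\<Theta> [b] \<omega>)) * g (\<Theta> [a] \<omega>) \<partial>M) = (\<integral>\<^sup>+\<omega>. f \<omega> \<partial>M) * (\<integral>\<^sup>+\<omega>. g (\<Theta> [] \<omega>) \<partial>M) * (\<integral>\<^sup>+\<omega>. g (\<Theta> [] \<omega>) \<partial>M)"
    proof -
      have 1: "f \<in> borel_measurable (G (off [c]))" if "c \<in> S" for c
      proof -
        note [measurable] = X_Nil_meas_off[OF that ab(1)] X_Nil_meas_off[OF that ab(2)]
        show ?thesis unfolding f_def[abs_def] by measurable
      qed
      have "(\<integral>\<^sup>+\<omega>. (f \<omega> * g (\<Theta> [b] \<omega>)) * g (\<Theta> [a] \<omega>) \<partial>M) = (\<integral>\<^sup>+\<omega>. f \<omega> * g (\<Theta> [b] \<omega>) \<partial>M) * (\<integral>\<^sup>+\<omega>. g (\<Theta> [] \<omega>) \<partial>M)"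
        using ab by (intro nn_one_step borel_measurable_times_ennreal 1 g measurable_compose[OF subtree_meas_off g]) auto
      also have "(\<integral>\<^sup>+\<omega>. f \<omega> * g (\<Theta> [b] \<omega>) \<partial>M) = (\<integral>\<^sup>+\<omega>. f \<omega> \<partial>M) * (\<integral>\<^sup>+\<omega>. g (\<Theta> [] \<omega>) \<partial>M)"
        using ab by (intro nn_one_step 1 g)
      finally show ?thesis .
    qed
    have "(\<integral>\<^sup>+\<omega>. (f \<omega> * g (\<Theta> [b] \<omega>)) * g (\<Theta> [a] \<omega>) \<partial>M) = (\<integral>\<^sup>+\<omega>. 0 \<partial>M)"
    proof (rule nn_integral_cong_AE, use k0 in eventually_elim)
      fix \<omega> assume "k \<omega> = 0"
      then show "(f \<omega> * g (\<Theta> [b] \<omega>)) * g (\<Theta> [a] \<omega>) = 0"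
        using ab by (auto simp: k_def f_def gV min_def split: if_splits)
    qed
    with eq have "(\<integral>\<^sup>+\<omega>. f \<omega> \<partial>M) = 0 \<or> (\<integral>\<^sup>+\<omega>. g (\<Theta> [] \<omega>) \<partial>M) = 0" by auto
    then show False
    proof
      assume "(\<integral>\<^sup>+\<omega>. f \<omega> \<partial>M) = 0"
      then have "AE \<omega> in M. f \<omega> = 0" by (subst (asm) nn_integral_0_iff_AE) (auto simp: f_def[abs_def])
      then have "AE \<omega> in M. X [] \<omega> a = 0 \<or> X [] \<omega> b = 0"
        by eventually_elim (auto simp: f_def split: if_splits)
      then show False using pos by simp
    next
      assume "(\<integral>\<^sup>+\<omega>. g (\<Theta> [] \<omega>) \<partial>M) = 0"
      then have "AE \<omega> in M. g (\<Theta> [] \<omega>) = 0"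
        using measurable_compose[OF subtree_meas g, of "[]"] by (subst (asm) nn_integral_0_iff_AE) auto
      then have "AE \<omega> in M. V [] \<omega> = 0" by eventually_elim (auto simp: gV split: if_splits)
      then show False using V_nonzero by simp
    qed
  qed
  \<comment> \<open>The loss \<open>(1 - h) * c\<close> is compared with \<open>mV h\<close>, which
    is at most 2; this is where \<open>c / 2\<close> comes from.\<close>
  have main: "1 + (1 - h) * (c / 2) \<le> \<phi> h" if h: "0 < h" "h < 1" for h
  proof -
    obtain m where m: "0 \<le> m" "mV h = ennreal m"
      using mV_le_2[of h] h by (cases "mV h") (auto simp: top_unique)
    have m2: "m \<le> 2" using mV_le_2[of h] h m by (simp add: ennreal_le_iff2 flip: ennreal_numeral)
    have "mV h + ennreal ((1 - h) * c) \<le> ennreal (\<phi> h) * mV h"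
    proof -
      have "mV h + ennreal ((1 - h) * c) =
        (\<integral>\<^sup>+\<omega>. ennreal (V [] \<omega> powr h) \<partial>M) + (\<integral>\<^sup>+\<omega>. ennreal ((1 - h) * min 1 (k \<omega>)) \<partial>M)"
        unfolding mV_def c_def using h k0 ic
        by (subst nn_integral_eq_integral) (auto simp: Bochner_Integration.integral_nonneg intro!: integrable_mult_right)
      also have "\<dots> = (\<integral>\<^sup>+\<omega>. ennreal (V [] \<omega> powr h) + ennreal ((1 - h) * min 1 (k \<omega>)) \<partial>M)"
        by (rule nn_integral_add[symmetric])
          (auto intro!: measurable_compose[OF _ measurable_ennreal] powr_real_measurable V_meas)
      also have "\<dots> \<le> (\<integral>\<^sup>+\<omega>. ennreal (\<Sum>c\<in>S. (X [] \<omega> c * V [c] \<omega>) powr h) \<partial>M)"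
      proof (rule nn_integral_mono_AE, use AE_good in eventually_elim)
        fix \<omega> assume good: "good \<omega>"
        have kh: "min 1 (k \<omega>) \<le> k \<omega> powr h"
        proof (cases "k \<omega> \<le> 1")
          case True
          then show ?thesis using k0[of \<omega>] h powr_mono'[of h 1 "k \<omega>"] by (cases "k \<omega> = 0") auto
        next
          case False
          then show ?thesis using h ge_one_powr_ge_zero[of "k \<omega>" h] by simp
        qed
        have "V [] \<omega> powr h + (1 - h) * min 1 (k \<omega>) \<le> (\<Sum>c\<in>S. X [] \<omega> c * V [c] \<omega>) powr h + (1 - h) * k \<omega> powr h"
          using good_V_consistent[OF good, of "[]"] mult_left_mono[OF kh, of "1 - h"] h by simp
        also have "\<dots> \<le> (\<Sum>c\<in>S. (X [] \<omega> c * V [c] \<omega>) powr h)"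
          unfolding k_def using finite_S nonneg h ab by (intro powr_sum_le_defect) auto
        finally show "ennreal (V [] \<omega> powr h) + ennreal ((1 - h) * min 1 (k \<omega>)) \<le> ennreal (\<Sum>c\<in>S. (X [] \<omega> c * V [c] \<omega>) powr h)"
          using h k0[of \<omega>] by (simp flip: ennreal_plus add: ennreal_leI)
      qed
      also have "\<dots> = ennreal (\<phi> h) * mV h" using h by (intro mV_step) auto
      finally show ?thesis .
    qed
    then have "m + (1 - h) * c \<le> \<phi> h * m"
      using m h c0 \<phi>_nonneg by (simp add: ennreal_mult[symmetric] ennreal_plus[symmetric] ennreal_le_iff del: ennreal_plus)
    then have 1: "(1 - h) * c \<le> (\<phi> h - 1) * m" by (simp add: algebra_simps)
    have "0 < (1 - h) * c" using h c0 by simp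
    with 1 have "0 < (\<phi> h - 1) * m" by linarith
    then have "0 < \<phi> h - 1" using m by (simp add: zero_less_mult_iff)
    then have "(\<phi> h - 1) * m \<le> (\<phi> h - 1) * 2" using m2 by (intro mult_left_mono) auto
    with 1 show ?thesis by simp
  qed
  have "((\<lambda>q. (\<phi> q - 1) / (q - 1)) \<longlongrightarrow> - dimen) (at_left 1)"
    using \<phi>_has_derivative \<phi>_1 by (simp add: has_field_derivative_iff filterlim_at_split)
  moreover have "\<forall>\<^sub>F q in at_left 1. (\<phi> q - 1) / (q - 1) \<le> - (c / 2)"
  proof -
    have "\<forall>\<^sub>F q::real in at_left 1. q \<in> {0<..<1}" by (rule eventually_at_leftI[of 0]) auto
    then show ?thesis
    proof eventually_elim
      case (elim q)
      have "- (c / 2) * (q - 1) = (1 - q) * (c / 2)" by (simp add: field_simps)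
      also have "\<dots> \<le> \<phi> q - 1" using main[of q] elim by simp
      finally show ?case using elim by (subst neg_divide_le_eq) auto
    qed
  qed
  ultimately have "- dimen \<le> - (c / 2)" by (rule tendsto_upperbound) simp
  then show ?thesis using c0 by simp
qed

text \<open>If at most one term is non-zero, taking powers commutes with the sum, so
  \<open>mV (1/2) = \<phi> (1/2) * mV (1/2)\<close> and \<open>\<phi> (1/2) = 1\<close>. With
  \<open>R\<close> the sum of the weights at a vertex, both \<open>R\<close> and
  \<open>sqrt R\<close> then have mean 1, so \<open>(sqrt R - 1)\<^sup>2\<close> has mean 0 and
  \<open>R = 1\<close> almost surely, at every vertex.\<close>

lemma degenerate:
  assumes deg: "\<And>a b. a \<in> S \<Longrightarrow> b \<in> S \<Longrightarrow> a \<noteq> b \<Longrightarrow> AE \<omega> in M. X [] \<omega> a = 0 \<or> X [] \<omega> b = 0"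
  shows "AE \<omega> in M. V [] \<omega> = 1"
proof -
  have one: "(\<Sum>a\<in>S. x a) powr h = (\<Sum>a\<in>S. x a powr h)"
    if "\<And>a b. a \<in> S \<Longrightarrow> b \<in> S \<Longrightarrow> a \<noteq> b \<Longrightarrow> x a = 0 \<or> x b = 0" for x :: "_ \<Rightarrow> real" and h :: real
  proof (cases "\<exists>a\<in>S. x a \<noteq> 0")
    case True
    then obtain a where a: "a \<in> S" "x a \<noteq> 0" by auto
    then have "x b = 0" if "b \<in> S - {a}" for b using \<open>\<And>a b. a \<in> S \<Longrightarrow> b \<in> S \<Longrightarrow> a \<noteq> b \<Longrightarrow> x a = 0 \<or> x b = 0\<close>[of a b] that by auto
    then show ?thesis using a by (simp add: sum.remove[OF finite_S a(1)])
  qed simp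
  have D: "AE \<omega> in M. \<forall>a\<in>S. \<forall>b\<in>S. a \<noteq> b \<longrightarrow> X [] \<omega> a = 0 \<or> X [] \<omega> b = 0"
    using finite_S deg by (intro AE_finite_allI AE_impI) auto
  have "mV (1/2) = (\<integral>\<^sup>+\<omega>. ennreal (\<Sum>a\<in>S. (X [] \<omega> a * V [a] \<omega>) powr (1/2)) \<partial>M)"
    unfolding mV_def
  proof (rule nn_integral_cong_AE, use AE_good D in eventually_elim)
    fix \<omega> assume "good \<omega>" and *: "\<forall>a\<in>S. \<forall>b\<in>S. a \<noteq> b \<longrightarrow> X [] \<omega> a = 0 \<or> X [] \<omega> b = 0"
    then have "V [] \<omega> = (\<Sum>a\<in>S. X [] \<omega> a * V [a] \<omega>)" using good_V_consistent[of \<omega> "[]"] by simp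
    also have "\<dots> powr (1/2) = (\<Sum>a\<in>S. (X [] \<omega> a * V [a] \<omega>) powr (1/2))" by (rule one) (use * in auto)
    finally show "ennreal (V [] \<omega> powr (1/2)) = ennreal (\<Sum>a\<in>S. (X [] \<omega> a * V [a] \<omega>) powr (1/2))" by simp
  qed
  then have m: "mV (1/2) = ennreal (\<phi> (1/2)) * mV (1/2)" by (simp add: mV_step)
  obtain m' where m': "0 \<le> m'" "mV (1/2) = ennreal m'"
    using mV_le_2[of "1/2"] by (cases "mV (1/2)") (auto simp: top_unique)
  then have "m' \<noteq> 0" using mV_pos[of "1/2"] by auto
  have "ennreal m' = ennreal (\<phi> (1/2) * m')" using m m' \<phi>_nonneg by (simp add: ennreal_mult)
  then have "m' = \<phi> (1/2) * m'" using m' \<phi>_nonneg by simp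
  then have phi: "\<phi> (1/2) = 1" using \<open>m' \<noteq> 0\<close> by simp
  have iX: "integrable M (\<lambda>\<omega>. \<Sum>a\<in>S. X [] \<omega> a)" by (intro Bochner_Integration.integrable_sum integrable_X)
  have ih: "integrable M (\<lambda>\<omega>. \<Sum>a\<in>S. X [] \<omega> a powr (1/2))"
    by (intro Bochner_Integration.integrable_sum integrable_powr) (use q0 in auto)
  have sq: "AE \<omega> in M. (\<Sum>a\<in>S. X [] \<omega> a) + 1 - 2 * (\<Sum>a\<in>S. X [] \<omega> a powr (1/2)) = ((\<Sum>a\<in>S. X [] \<omega> a powr (1/2)) - 1)\<^sup>2"
  proof (use D in eventually_elim)
    fix \<omega> assume *: "\<forall>a\<in>S. \<forall>b\<in>S. a \<noteq> b \<longrightarrow> X [] \<omega> a = 0 \<or> X [] \<omega> b = 0"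
    have "(\<Sum>a\<in>S. X [] \<omega> a powr (1/2)) = (\<Sum>a\<in>S. X [] \<omega> a) powr (1/2)" by (rule one[symmetric]) (use * in auto)
    moreover have "((\<Sum>a\<in>S. X [] \<omega> a) powr (1/2))\<^sup>2 = (\<Sum>a\<in>S. X [] \<omega> a)"
      using nonneg by (simp add: powr_half_sqrt sum_nonneg)
    ultimately show "(\<Sum>a\<in>S. X [] \<omega> a) + 1 - 2 * (\<Sum>a\<in>S. X [] \<omega> a powr (1/2)) = ((\<Sum>a\<in>S. X [] \<omega> a powr (1/2)) - 1)\<^sup>2"
      by (simp add: power2_diff)
  qed
  have i1: "integrable M (\<lambda>\<omega>. ((\<Sum>a\<in>S. X [] \<omega> a powr (1/2)) - 1)\<^sup>2)"
    by (rule integrable_cong_AE_imp[OF _ _ sq]) (use iX ih in auto)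
  have "(\<integral>\<omega>. ((\<Sum>a\<in>S. X [] \<omega> a powr (1/2)) - 1)\<^sup>2 \<partial>M) = (\<integral>\<omega>. (\<Sum>a\<in>S. X [] \<omega> a) + 1 - 2 * (\<Sum>a\<in>S. X [] \<omega> a powr (1/2)) \<partial>M)"
    using sq by (intro integral_cong_AE) (auto elim: eventually_mono)
  also have "\<dots> = (\<integral>\<omega>. (\<Sum>a\<in>S. X [] \<omega> a) \<partial>M) + 1 - 2 * \<phi> (1/2)"
    using iX ih by (simp add: \<phi>_def prob_space)
  also have "(\<integral>\<omega>. (\<Sum>a\<in>S. X [] \<omega> a) \<partial>M) = \<phi> 1" by (simp add: \<phi>_def nonneg)
  finally have "(\<integral>\<omega>. ((\<Sum>a\<in>S. X [] \<omega> a powr (1/2)) - 1)\<^sup>2 \<partial>M) = 0" by (simp add: phi \<phi>_1)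
  then have "AE \<omega> in M. ((\<Sum>a\<in>S. X [] \<omega> a powr (1/2)) - 1)\<^sup>2 = 0"
    using i1 by (subst (asm) integral_nonneg_eq_0_iff_AE) auto
  with sq have "AE \<omega> in M. (\<Sum>a\<in>S. X [] \<omega> a) = 1" by eventually_elim auto
  then have s1: "AE \<omega> in M. (\<Sum>a\<in>S. \<Theta> [] \<omega> [] a) = 1" by (simp add: subtree_def)
  have s2: "Measurable.pred TS (\<lambda>t. (\<Sum>a\<in>S. t [] a) = 1)"
  proof -
    have "(\<lambda>t. t [] a) \<in> borel_measurable TS" if "a \<in> S" for a
      using that by (intro measurable_compose[OF measurable_component_singleton[of "[]"] measurable_component_singleton]) auto
    then have [measurable]: "(\<lambda>t. \<Sum>a\<in>S. t [] a) \<in> borel_measurable TS" by (rule borel_measurable_sum)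
    show ?thesis by measurable
  qed
  have "AE \<omega> in M. (\<Sum>a\<in>S. \<Theta> u \<omega> [] a) = 1" if "u \<in> lists S" for u
    by (rule AE_subtree[OF that s2 s1])
  then have "AE \<omega> in M. \<forall>u\<in>lists S. (\<Sum>a\<in>S. X u \<omega> a) = 1"
    by (subst AE_ball_countable[OF countable_lists]) (simp add: subtree_def)
  then show ?thesis using AE_good
  proof eventually_elim
    case (elim \<omega>)
    have "Yn n [] \<omega> = 1" for n
    proof (induction n)
      case (Suc n)
      have "Yn (Suc n) [] \<omega> = (\<Sum>v\<in>words S n. Q [] v \<omega> * 1)"
        unfolding cascade_sum_Suc'[OF finite_S]
        by (intro sum.cong refl arg_cong2[of _ _ _ _ "(*)"]) (use elim words_lists in fastforce)
      then show ?case using Suc by (simp add: cascade_sum_def)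
    qed simp
    then have "Y [] \<omega> = 1" using good_lim[OF elim(2), of "[]"] by (simp add: LIMSEQ_const_iff)
    then show ?case by (simp add: V_def)
  qed
qed

lemma nn_sum_powr_finite:
  assumes A: "A \<subseteq> S" and q: "0 < q" "q \<le> q0"
  shows "(\<integral>\<^sup>+\<omega>. ennreal ((\<Sum>a\<in>A. X [] \<omega> a) powr q) \<partial>M) < \<infinity>"
proof -
  have fin: "finite A" using A finite_S finite_subset by blast
  have "(\<integral>\<^sup>+\<omega>. ennreal ((\<Sum>a\<in>A. X [] \<omega> a) powr q) \<partial>M) \<le> (\<integral>\<^sup>+\<omega>. ennreal (real (card A) powr q * (\<Sum>a\<in>A. X [] \<omega> a powr q)) \<partial>M)"
    by (intro nn_integral_mono ennreal_leI powr_sum_le_card fin) (use A nonneg q in auto)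
  also have "\<dots> = ennreal (\<integral>\<omega>. real (card A) powr q * (\<Sum>a\<in>A. X [] \<omega> a powr q) \<partial>M)"
    by (intro nn_integral_eq_integral integrable_mult_right Bochner_Integration.integrable_sum integrable_powr)
       (use A q in \<open>auto intro!: mult_nonneg_nonneg sum_nonneg\<close>)
  finally show ?thesis by (rule le_less_trans) simp
qed

text \<open>The slope of \<open>\<phi>\<close> at 1 is \<open>- dimen < 0\<close>, hence
  \<open>\<phi> q < 1\<close> slightly to the right of 1. The \<open>q\<close>-th moments of the
  partial sums then obey a contracting recursion, and Fatou's lemma carries their bound to the
  limit.\<close>

lemma V_moment_pos:
  assumes d: "0 < dimen"
  shows "\<forall>\<^sub>F q in at_right 1. mV q < \<infinity>"
proof -
  have "\<forall>\<^sub>F q in at_right 1. \<phi> q \<le> exp (- (dimen - dimen / 2) * (q - 1))"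
    by (rule exp_bounds_of_derivative[OF \<phi>_has_derivative \<phi>_1]) (use d in auto)
  moreover have "\<forall>\<^sub>F q in at_right 1. q \<in> {1<..<q0}" using q0 by (intro eventually_at_rightI[of 1 q0]) auto
  ultimately show ?thesis
  proof eventually_elim
    case (elim q)
    then have q: "1 < q" "q \<le> q0" by auto
    have "exp (- (dimen - dimen / 2) * (q - 1)) < 1" using d q by (simp add: mult_pos_pos)
    then have phi: "\<phi> q < 1" using elim by linarith
    have "(\<integral>\<^sup>+\<omega>. ennreal ((\<Sum>a\<in>S. X [] \<omega> a) powr q) \<partial>M) < \<infinity>" using q by (intro nn_sum_powr_finite) auto
    then obtain K where K: "0 \<le> K" "(\<integral>\<^sup>+\<omega>. ennreal ((\<Sum>a\<in>S. X [] \<omega> a) powr q) \<partial>M) = ennreal K"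
      by (cases "\<integral>\<^sup>+\<omega>. ennreal ((\<Sum>a\<in>S. X [] \<omega> a) powr q) \<partial>M") auto
    \<comment> \<open>The fixed point of \<open>r \<mapsto> \<phi> q * r + K\<close>, raised by 1 so
      as to bound also the initial moment, which is 1.\<close>
    define R where "R = 1 + K / (1 - \<phi> q)"
    have R: "\<phi> q * R + K \<le> R" "1 \<le> R" "0 \<le> R"
    proof -
      define l where "l = K / (1 - \<phi> q)"
      have l: "0 \<le> l" "K = l * (1 - \<phi> q)" using phi K by (auto simp: l_def)
      have "R = 1 + l" by (simp add: R_def l_def)
      moreover have "\<phi> q * (1 + l) + l * (1 - \<phi> q) = \<phi> q + l" by (simp add: algebra_simps)
      ultimately show "\<phi> q * R + K \<le> R" "1 \<le> R" "0 \<le> R"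
        unfolding l(2) using phi l(1) by simp_all
    qed
    have bd: "(\<integral>\<^sup>+\<omega>. ennreal (Yn n [] \<omega> powr q) \<partial>M) \<le> ennreal R" for n
    proof (induction n)
      case 0
      then show ?case using R by (simp add: emeasure_space_1)
    next
      case (Suc n)
      define g where "g t = max 0 (cascade_sum S coord n [] t)" for t
      have g: "g \<in> borel_measurable TS" unfolding g_def[abs_def] by measurable
      have gY: "g (\<Theta> u \<omega>) = Yn n u \<omega>" if "u \<in> lists S" for u \<omega>
        using that Yn_nonneg[of n u \<omega>] by (simp add: g_def cascade_sum_subtree)
      have "(\<integral>\<^sup>+\<omega>. ennreal (Yn (Suc n) [] \<omega> powr q) \<partial>M) = (\<integral>\<^sup>+\<omega>. ennreal ((\<Sum>a\<in>S. X [] \<omega> a * g (\<Theta> [a] \<omega>)) powr q) \<partial>M)"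
        by (intro nn_integral_cong) (simp add: cascade_sum_Suc[OF finite_S] gY)
      also have "\<dots> \<le> (\<Sum>a\<in>S. \<integral>\<^sup>+\<omega>. ennreal (X [] \<omega> a powr q) \<partial>M) * (\<integral>\<^sup>+\<omega>. ennreal (g (\<Theta> [] \<omega>) powr q) \<partial>M)
        + ennreal (1 powr q) * (\<integral>\<^sup>+\<omega>. ennreal ((\<Sum>a\<in>S. X [] \<omega> a) powr q) \<partial>M)"
        using q q0 K by (intro one_step_gt_1 g) (auto simp: g_def[abs_def] gY[unfolded g_def] nn_Yn)
      also have "\<dots> = ennreal (\<phi> q) * (\<integral>\<^sup>+\<omega>. ennreal (Yn n [] \<omega> powr q) \<partial>M) + ennreal K"
        using q by (simp add: nn_\<phi> gY K)
      also have "\<dots> \<le> ennreal (\<phi> q) * ennreal R + ennreal K" by (intro add_mono mult_left_mono Suc) auto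
      also have "\<dots> = ennreal (\<phi> q * R + K)" using R K \<phi>_nonneg[of q] by (simp add: ennreal_mult)
      also have "\<dots> \<le> ennreal R" using R by (intro ennreal_leI)
      finally show ?case .
    qed
    have "mV q = (\<integral>\<^sup>+\<omega>. liminf (\<lambda>n. ennreal (Yn n [] \<omega> powr q)) \<partial>M)"
      unfolding mV_def
    proof (rule nn_integral_cong_AE, use AE_good in eventually_elim)
      fix \<omega> assume good: "good \<omega>"
      have "(\<lambda>n. Yn n [] \<omega> powr q) \<longlonglongrightarrow> V [] \<omega> powr q"
        using q good_lim[OF good, of "[]"] good_V[OF good, of "[]"]
        by (intro tendsto_powr2) (auto simp: Yn_nonneg)
      then show "ennreal (V [] \<omega> powr q) = liminf (\<lambda>n. ennreal (Yn n [] \<omega> powr q))"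
        by (intro lim_imp_Liminf[symmetric] tendsto_ennrealI) auto
    qed
    also have "\<dots> \<le> liminf (\<lambda>n. \<integral>\<^sup>+\<omega>. ennreal (Yn n [] \<omega> powr q) \<partial>M)"
      by (intro nn_integral_liminf measurable_compose[OF _ measurable_ennreal] powr_real_measurable Yn_meas) auto
    also have "\<dots> \<le> ennreal R"
      by (rule order_trans[OF Liminf_mono[OF always_eventually[OF allI[OF bd]]]]) (simp add: Liminf_const)
    finally show ?case by (rule le_less_trans) simp
  qed
qed

lemma V_moment: "\<forall>\<^sub>F q in at_right 1. mV q < \<infinity>"
proof (cases "\<exists>a b. a \<in> S \<and> b \<in> S \<and> a \<noteq> b \<and> \<not> (AE \<omega> in M. X [] \<omega> a = 0 \<or> X [] \<omega> b = 0)")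
  case True
  then show ?thesis using dimen_pos V_moment_pos by blast
next
  case False
  then have "AE \<omega> in M. V [] \<omega> = 1" by (intro degenerate) auto
  then have "mV q = (\<integral>\<^sup>+\<omega>. 1 \<partial>M)" for q
    unfolding mV_def by (intro nn_integral_cong_AE) (elim eventually_mono, simp)
  then show ?thesis by (simp add: emeasure_space_1)
qed

end

subsection \<open>Moments of the masses of generalised cylinders\<close>

text \<open>The mass, relative to \<open>cascade_Q\<close> at \<open>u\<close>, of the points below
  \<open>u\<close> whose letters after \<open>u\<close> have the images \<open>cs\<close> under the
  maps \<open>gs\<close>; \<open>L\<close> supplies the masses at the final vertices. The recursion
  removes the first letter, in accordance with one branching step, and lists of different lengths
  get mass 0.\<close>

fun cyl_mass :: "'a set \<Rightarrow> ('a list \<Rightarrow> 'w \<Rightarrow> 'a \<Rightarrow> real) \<Rightarrow> ('a list \<Rightarrow> 'w \<Rightarrow> real) \<Rightarrow>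
    ('a \<Rightarrow> 'b) list \<Rightarrow> 'b list \<Rightarrow> 'a list \<Rightarrow> 'w \<Rightarrow> real" where
  "cyl_mass S X L [] [] u \<omega> = L u \<omega>"
| "cyl_mass S X L (g # gs) (c # cs) u \<omega> =
     (\<Sum>a | a \<in> S \<and> g a = c. X u \<omega> a * cyl_mass S X L gs cs (u @ [a]) \<omega>)"
| "cyl_mass S X L _ _ u \<omega> = 0"

definition codes :: "'a set \<Rightarrow> ('a \<Rightarrow> 'b) list \<Rightarrow> 'b list set" where
  "codes S gs = listset (map (\<lambda>g. g ` S) gs)"

lemma codes_Nil[simp]: "codes S [] = {[]}" by (simp add: codes_def)

lemma codes_Cons: "codes S (g # gs) = (\<lambda>(c, cs). c # cs) ` (g ` S \<times> codes S gs)"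
  by (auto simp: codes_def set_Cons_def)

lemma finite_codes: "finite S \<Longrightarrow> finite (codes S gs)"
  by (induction gs) (auto simp: codes_Cons)

lemma sum_codes_Cons:
  "(\<Sum>cs\<in>codes S (g # gs). f cs) = (\<Sum>c\<in>g ` S. \<Sum>cs\<in>codes S gs. f (c # cs))"
  unfolding codes_Cons by (subst sum.reindex) (auto simp: inj_on_def sum.cartesian_product split_beta)

lemma subtree_subtree: "v \<in> lists S \<Longrightarrow> subtree S coord v (subtree S X u \<omega>) = subtree S X (u @ v) \<omega>"
  by (auto simp: subtree_def fun_eq_iff)

context cascade
begin

text \<open>Quantities given at every vertex by one and the same nonnegative measurable function of
  the subtree: exactly what the one-step inequalities accept in the place of
  \<open>g\<close>.\<close>

definition functional :: "('a list \<Rightarrow> 'w \<Rightarrow> real) \<Rightarrow> bool" where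
  "functional Z \<longleftrightarrow> (\<exists>g\<in>borel_measurable TS. (\<forall>t. 0 \<le> g t) \<and> (\<forall>u\<in>lists S. \<forall>\<omega>. Z u \<omega> = g (\<Theta> u \<omega>)))"

lemma functional_meas: "functional Z \<Longrightarrow> u \<in> lists S \<Longrightarrow> Z u \<in> borel_measurable M"
proof -
  assume Z: "functional Z" and u: "u \<in> lists S"
  then obtain g where g: "g \<in> borel_measurable TS" "\<And>\<omega>. Z u \<omega> = g (\<Theta> u \<omega>)"
    unfolding functional_def by blast
  have "Z u = (\<lambda>\<omega>. g (\<Theta> u \<omega>))" using g(2) by (rule ext)
  then show ?thesis using measurable_compose[OF subtree_meas[OF u] g(1)] by simp
qed

lemma functional_nonneg: "functional Z \<Longrightarrow> u \<in> lists S \<Longrightarrow> 0 \<le> Z u \<omega>"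
  unfolding functional_def by metis

lemma functional_V: "functional V"
  unfolding functional_def by (intro bexI[of _ vt]) (auto simp: V_subtree)

text \<open>The outer \<open>max 0\<close> only serves to make the function nonnegative on all
  trees; on trees of weights the sum is nonnegative anyway.\<close>

lemma functional_step:
  assumes "functional Z" "A \<subseteq> S"
  shows "functional (\<lambda>u \<omega>. \<Sum>a\<in>A. X u \<omega> a * Z (u @ [a]) \<omega>)"
proof -
  obtain g where g[measurable]: "g \<in> borel_measurable TS" "\<And>t. 0 \<le> g t" "\<And>u \<omega>. u \<in> lists S \<Longrightarrow> Z u \<omega> = g (\<Theta> u \<omega>)"
    using assms(1) unfolding functional_def by auto
  let ?h = "\<lambda>t. max 0 (\<Sum>a\<in>A. t [] a * g (subtree S coord [a] t))"
  have 1: "subtree S coord [a] \<in> measurable TS TS" if "a \<in> S" for a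
    unfolding subtree_def by (intro measurable_restrict measurable_component_singleton) (use that in auto)
  have "?h \<in> borel_measurable TS"
    by (intro borel_measurable_max borel_measurable_const borel_measurable_sum borel_measurable_times
        measurable_compose[OF 1 g(1)]
        measurable_compose[OF measurable_component_singleton[of "[]"] measurable_component_singleton])
       (use assms(2) in auto)
  moreover have "(\<Sum>a\<in>A. X u \<omega> a * Z (u @ [a]) \<omega>) = ?h (\<Theta> u \<omega>)" if u: "u \<in> lists S" for u \<omega>
  proof -
    have "(\<Sum>a\<in>A. X u \<omega> a * Z (u @ [a]) \<omega>) = (\<Sum>a\<in>A. \<Theta> u \<omega> [] a * g (subtree S coord [a] (\<Theta> u \<omega>)))"
    proof (rule sum.cong[OF refl])
      fix a assume "a \<in> A"
      then have a: "[a] \<in> lists S" "u @ [a] \<in> lists S" using assms(2) u by auto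
      have "\<Theta> u \<omega> [] = X u \<omega>" by (simp add: subtree_def)
      then show "X u \<omega> a * Z (u @ [a]) \<omega> = \<Theta> u \<omega> [] a * g (subtree S coord [a] (\<Theta> u \<omega>))"
        by (simp only: subtree_subtree[OF a(1)] g(3)[OF a(2)])
    qed
    moreover have "0 \<le> (\<Sum>a\<in>A. X u \<omega> a * Z (u @ [a]) \<omega>)"
      using assms(2) u by (intro sum_nonneg mult_nonneg_nonneg nonneg functional_nonneg[OF assms(1)]) auto
    ultimately show ?thesis by simp
  qed
  ultimately show ?thesis unfolding functional_def by (intro bexI[of _ ?h]) auto
qed

abbreviation cm :: "('a \<Rightarrow> 'c) list \<Rightarrow> 'c list \<Rightarrow> 'a list \<Rightarrow> 'w \<Rightarrow> real" where
  "cm \<equiv> cyl_mass S X V"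

lemma functional_cm: "functional (cm gs cs)"
proof (induction gs arbitrary: cs)
  case Nil
  show ?case
  proof (cases cs)
    case Nil
    then have "cm [] cs = V" by (intro ext) simp
    then show ?thesis using functional_V by simp
  next
    case (Cons c cs')
    then have "cm [] cs = (\<lambda>_ _. 0)" by (intro ext) simp
    then show ?thesis unfolding functional_def by (auto intro!: bexI[of _ "\<lambda>_. 0"])
  qed
next
  case (Cons g gs)
  show ?case
  proof (cases cs)
    case Nil
    then have "cm (g # gs) cs = (\<lambda>_ _. 0)" by (intro ext) simp
    then show ?thesis unfolding functional_def by (auto intro!: bexI[of _ "\<lambda>_. 0"])
  next
    case (Cons c cs')
    then have "cm (g # gs) cs = (\<lambda>u \<omega>. \<Sum>a | a \<in> S \<and> g a = c. X u \<omega> a * cm gs cs' (u @ [a]) \<omega>)"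
      by (intro ext) simp
    then show ?thesis using functional_step[OF Cons.IH, of "{a. a \<in> S \<and> g a = c}"] by auto
  qed
qed

lemma cm_nonneg: "u \<in> lists S \<Longrightarrow> 0 \<le> cm gs cs u \<omega>"
  by (rule functional_nonneg[OF functional_cm])

lemma cm_meas[measurable]: "u \<in> lists S \<Longrightarrow> cm gs cs u \<in> borel_measurable M"
  by (rule functional_meas[OF functional_cm])

end

section \<open>Recursions for the moment sums over generalised cylinders\<close>

context cascade_moment
begin

text \<open>The law \<open>p\<close> of a letter under \<open>g\<close> in the mean measure;
  \<open>\<phi>m g\<close> is the function \<open>\<phi>\<^sub>g\<close> of the overview and
  \<open>entm g\<close> the entropy of \<open>p\<close>.\<close>

definition wt :: "('a \<Rightarrow> 'c) \<Rightarrow> 'c \<Rightarrow> real" where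
  "wt g c = (\<Sum>a | a \<in> S \<and> g a = c. \<integral>\<omega>. X [] \<omega> a \<partial>M)"

definition \<phi>m :: "('a \<Rightarrow> 'c) \<Rightarrow> real \<Rightarrow> real" where
  "\<phi>m g q = (\<Sum>c\<in>g ` S. wt g c powr q)"

definition entm :: "('a \<Rightarrow> 'c) \<Rightarrow> real" where
  "entm g = - (\<Sum>c\<in>g ` S. wt g c * ln (wt g c))"

definition Fm :: "real \<Rightarrow> ('a \<Rightarrow> 'c) list \<Rightarrow> ennreal" where
  "Fm q gs = (\<Sum>cs\<in>codes S gs. \<integral>\<^sup>+\<omega>. ennreal (cm gs cs [] \<omega> powr q) \<partial>M)"

lemma wt_nonneg: "0 \<le> wt g c"
  unfolding wt_def by (intro sum_nonneg Bochner_Integration.integral_nonneg nonneg) auto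

lemma \<phi>m_nonneg: "0 \<le> \<phi>m g q" unfolding \<phi>m_def by (intro sum_nonneg) auto

lemma sum_fibres: "(\<Sum>c\<in>g ` S. \<Sum>a | a \<in> S \<and> g a = c. f a) = (\<Sum>a\<in>S. f a :: 'b :: comm_monoid_add)"
  using sum.image_gen[OF finite_S, of f g] by simp

lemma sum_wt: "(\<Sum>c\<in>g ` S. wt g c) = 1"
  unfolding wt_def sum_fibres using \<phi>_1 \<phi>_eq[of 1] q0 nonneg by simp

lemma \<phi>m_1: "\<phi>m g 1 = 1" proof -
  have "wt g c powr 1 = wt g c" for c using wt_nonneg[of g c] by simp
  then show ?thesis unfolding \<phi>m_def by (simp only: sum_wt)
qed

lemma \<phi>m_has_derivative: "(\<phi>m g has_real_derivative - entm g) (at 1)"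
proof -
  have "((\<lambda>q. wt g c powr q) has_real_derivative wt g c * ln (wt g c)) (at 1)" for c
  proof (cases "wt g c = 0")
    case False
    then have "0 < wt g c" using wt_nonneg[of g c] by simp
    then show ?thesis by (auto intro!: derivative_eq_intros)
  qed simp
  then have "((\<lambda>q. \<Sum>c\<in>g ` S. wt g c powr q) has_real_derivative (\<Sum>c\<in>g ` S. wt g c * ln (wt g c))) (at 1)"
    by (intro DERIV_sum) auto
  then show ?thesis unfolding \<phi>m_def[abs_def] entm_def by simp
qed

text \<open>Every letter is an independent factor, and the mass at the end has mean 1 by
  non-degeneracy. So the mean measure gives generalised cylinders product masses.\<close>

lemma nn_cm_mean:
  "length cs = length gs \<Longrightarrow>
   (\<integral>\<^sup>+\<omega>. ennreal (cm gs cs [] \<omega>) \<partial>M) = ennreal (prod_list (map2 wt gs cs))"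
proof (induction gs cs rule: list_induct2')
  case 1
  then show ?case by (simp add: nn_V)
next
  case (4 g gs c cs)
  let ?A = "{a. a \<in> S \<and> g a = c}"
  obtain h where h: "h \<in> borel_measurable TS" "\<And>t. 0 \<le> h t" "\<And>u \<omega>. u \<in> lists S \<Longrightarrow> cm gs cs u \<omega> = h (\<Theta> u \<omega>)"
    using functional_cm[of gs cs] unfolding functional_def by auto
  have "(\<integral>\<^sup>+\<omega>. ennreal (cm (g # gs) (c # cs) [] \<omega>) \<partial>M) = (\<integral>\<^sup>+\<omega>. ennreal (\<Sum>a\<in>?A. X [] \<omega> a * h (\<Theta> [a] \<omega>)) \<partial>M)"
    using h(3) by (intro nn_integral_cong) (auto intro!: sum.cong arg_cong[of _ _ ennreal])
  also have "\<dots> = (\<Sum>a\<in>?A. \<integral>\<^sup>+\<omega>. ennreal (X [] \<omega> a) \<partial>M) * (\<integral>\<^sup>+\<omega>. ennreal (cm gs cs [] \<omega>) \<partial>M)"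
    using h by (subst one_step_mean) auto
  also have "(\<Sum>a\<in>?A. \<integral>\<^sup>+\<omega>. ennreal (X [] \<omega> a) \<partial>M) = ennreal (wt g c)"
  proof -
    have 1: "(\<lambda>\<omega>. X [] \<omega> a) = (\<lambda>\<omega>. X [] \<omega> a powr 1)" if "a \<in> ?A" for a using nonneg that by auto
    have "(\<Sum>a\<in>?A. \<integral>\<^sup>+\<omega>. ennreal (X [] \<omega> a) \<partial>M) = (\<Sum>a\<in>?A. \<integral>\<^sup>+\<omega>. ennreal (X [] \<omega> a powr 1) \<partial>M)"
      by (intro sum.cong refl arg_cong[of _ _ "\<lambda>f. \<integral>\<^sup>+\<omega>. ennreal (f \<omega>) \<partial>M"] 1)
    also have "\<dots> = ennreal (\<Sum>a\<in>?A. \<integral>\<omega>. X [] \<omega> a powr 1 \<partial>M)" using q0 by (intro sum_nn_powr) auto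
    also have "(\<Sum>a\<in>?A. \<integral>\<omega>. X [] \<omega> a powr 1 \<partial>M) = wt g c"
      unfolding wt_def by (intro sum.cong refl arg_cong[of _ _ "\<lambda>f. \<integral>\<omega>. f \<omega> \<partial>M"] 1[symmetric])
    finally show ?thesis .
  qed
  finally show ?case using 4 by (simp add: ennreal_mult' wt_nonneg)
qed auto

lemma prod_wt_nonneg: "0 \<le> prod_list (map2 wt gs cs)"
  by (induction gs cs rule: list_induct2') (auto simp: wt_nonneg)

lemma sum_prod_wt: "(\<Sum>cs\<in>codes S gs. prod_list (map2 wt gs cs) powr q) = prod_list (map (\<lambda>g. \<phi>m g q) gs)"
proof (induction gs)
  case (Cons g gs)
  have "(\<Sum>cs\<in>codes S (g # gs). prod_list (map2 wt (g # gs) cs) powr q) =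
    (\<Sum>c\<in>g ` S. \<Sum>cs\<in>codes S gs. wt g c powr q * prod_list (map2 wt gs cs) powr q)"
    unfolding sum_codes_Cons by (simp add: powr_mult wt_nonneg prod_wt_nonneg)
  then show ?case by (simp add: Cons sum_distrib_left[symmetric] sum_distrib_right[symmetric] \<phi>m_def)
qed simp

lemma codes_length: "cs \<in> codes S gs \<Longrightarrow> length cs = length gs"
  by (induction gs arbitrary: cs) (auto simp: codes_Cons)

lemma prod_\<phi>m_nonneg: "0 \<le> prod_list (map (\<lambda>g. \<phi>m g q) gs)"
  by (induction gs) (auto simp: \<phi>m_nonneg)

lemma Fm_Nil: "Fm q [] = mV q" by (simp add: Fm_def mV_def)

text \<open>\<open>one_step_gt_1\<close> on every fibre of \<open>g\<close>, summed over the codes.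
  The cross terms involve only the means of the remaining cylinders, whose \<open>q\<close>-th
  powers sum to a product; \<open>card S powr q\<close> bounds the power of a sum of weights by the
  sum of their powers.\<close>

lemma Fm_Cons_gt_1:
  assumes q: "1 < q" "q \<le> q0"
  shows "Fm q (g # gs) \<le> ennreal (\<phi> q) * Fm q gs
    + ennreal (real (card S) powr q * \<phi> q) * ennreal (prod_list (map (\<lambda>g. \<phi>m g q) gs))"
proof -
  let ?A = "\<lambda>c. {a. a \<in> S \<and> g a = c}"
  let ?m = "\<lambda>cs. prod_list (map2 wt gs cs)"
  let ?I = "\<lambda>c. \<Sum>a\<in>?A c. \<integral>\<omega>. X [] \<omega> a powr q \<partial>M"
  let ?C = "real (card S) powr q"
  have I0: "0 \<le> ?I c" for c by (intro sum_nonneg Bochner_Integration.integral_nonneg) auto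
  have step: "(\<integral>\<^sup>+\<omega>. ennreal (cm (g # gs) (c # cs) [] \<omega> powr q) \<partial>M) \<le>
     ennreal (?I c) * (\<integral>\<^sup>+\<omega>. ennreal (cm gs cs [] \<omega> powr q) \<partial>M) + ennreal (?C * ?I c) * ennreal (?m cs powr q)"
    if cs: "cs \<in> codes S gs" for c cs
  proof -
    obtain h where h: "h \<in> borel_measurable TS" "\<And>t. 0 \<le> h t" "\<And>u \<omega>. u \<in> lists S \<Longrightarrow> cm gs cs u \<omega> = h (\<Theta> u \<omega>)"
      using functional_cm[of gs cs] unfolding functional_def by auto
    have fin: "(\<integral>\<^sup>+\<omega>. ennreal ((\<Sum>a\<in>?A c. X [] \<omega> a) powr q) \<partial>M) \<le> ennreal (?C * ?I c)"
    proof -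
      have "(\<integral>\<^sup>+\<omega>. ennreal ((\<Sum>a\<in>?A c. X [] \<omega> a) powr q) \<partial>M) \<le> (\<integral>\<^sup>+\<omega>. ennreal (?C * (\<Sum>a\<in>?A c. X [] \<omega> a powr q)) \<partial>M)"
      proof (intro nn_integral_mono ennreal_leI)
        fix \<omega>
        have "(\<Sum>a\<in>?A c. X [] \<omega> a) powr q \<le> real (card (?A c)) powr q * (\<Sum>a\<in>?A c. X [] \<omega> a powr q)"
          using q nonneg finite_S by (intro powr_sum_le_card) auto
        also have "\<dots> \<le> ?C * (\<Sum>a\<in>?A c. X [] \<omega> a powr q)"
          using q finite_S by (intro mult_right_mono powr_mono2 sum_nonneg) (auto intro!: card_mono)
        finally show "(\<Sum>a\<in>?A c. X [] \<omega> a) powr q \<le> ?C * (\<Sum>a\<in>?A c. X [] \<omega> a powr q)" .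
      qed
      also have "\<dots> = ennreal (\<integral>\<omega>. ?C * (\<Sum>a\<in>?A c. X [] \<omega> a powr q) \<partial>M)"
        using q by (intro nn_integral_eq_integral integrable_mult_right Bochner_Integration.integrable_sum integrable_powr)
          (auto intro!: mult_nonneg_nonneg sum_nonneg)
      also have "(\<integral>\<omega>. ?C * (\<Sum>a\<in>?A c. X [] \<omega> a powr q) \<partial>M) = ?C * ?I c"
        using q by (subst integral_mult_right_zero, subst Bochner_Integration.integral_sum) (auto intro!: integrable_powr)
      finally show ?thesis .
    qed
    have "(\<integral>\<^sup>+\<omega>. ennreal (cm (g # gs) (c # cs) [] \<omega> powr q) \<partial>M) = (\<integral>\<^sup>+\<omega>. ennreal ((\<Sum>a\<in>?A c. X [] \<omega> a * h (\<Theta> [a] \<omega>)) powr q) \<partial>M)"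
      using h(3) by (intro nn_integral_cong) (auto intro!: sum.cong arg_cong[of _ _ "\<lambda>x. ennreal (x powr q)"])
    also have "\<dots> \<le> (\<Sum>a\<in>?A c. \<integral>\<^sup>+\<omega>. ennreal (X [] \<omega> a powr q) \<partial>M) * (\<integral>\<^sup>+\<omega>. ennreal (h (\<Theta> [] \<omega>) powr q) \<partial>M)
      + ennreal (?m cs powr q) * (\<integral>\<^sup>+\<omega>. ennreal ((\<Sum>a\<in>?A c. X [] \<omega> a) powr q) \<partial>M)"
    proof (rule one_step_gt_1)
      show "(\<integral>\<^sup>+\<omega>. ennreal (h (\<Theta> [] \<omega>)) \<partial>M) = ennreal (?m cs)"
        using nn_cm_mean[OF codes_length[OF cs]] h(3)[of "[]"] by simp
      show "(\<integral>\<^sup>+\<omega>. ennreal ((\<Sum>a\<in>?A c. X [] \<omega> a) powr q) \<partial>M) < \<infinity>"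
        by (rule le_less_trans[OF fin]) simp
    qed (use h q q0 prod_wt_nonneg in auto)
    also have "(\<Sum>a\<in>?A c. \<integral>\<^sup>+\<omega>. ennreal (X [] \<omega> a powr q) \<partial>M) = ennreal (?I c)"
      using q by (intro sum_nn_powr) auto
    also have "ennreal (?I c) * (\<integral>\<^sup>+\<omega>. ennreal (h (\<Theta> [] \<omega>) powr q) \<partial>M)
      + ennreal (?m cs powr q) * (\<integral>\<^sup>+\<omega>. ennreal ((\<Sum>a\<in>?A c. X [] \<omega> a) powr q) \<partial>M)
      \<le> ennreal (?I c) * (\<integral>\<^sup>+\<omega>. ennreal (h (\<Theta> [] \<omega>) powr q) \<partial>M) + ennreal (?m cs powr q) * ennreal (?C * ?I c)"
      by (intro add_left_mono mult_left_mono fin) auto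
    finally show ?thesis using h(3)[of "[]"] by (simp add: mult.commute)
  qed
  have "Fm q (g # gs) = (\<Sum>c\<in>g ` S. \<Sum>cs\<in>codes S gs. \<integral>\<^sup>+\<omega>. ennreal (cm (g # gs) (c # cs) [] \<omega> powr q) \<partial>M)"
    unfolding Fm_def sum_codes_Cons ..
  also have "\<dots> \<le> (\<Sum>c\<in>g ` S. \<Sum>cs\<in>codes S gs. ennreal (?I c) * (\<integral>\<^sup>+\<omega>. ennreal (cm gs cs [] \<omega> powr q) \<partial>M) + ennreal (?C * ?I c) * ennreal (?m cs powr q))"
    by (intro sum_mono step)
  also have "\<dots> = (\<Sum>c\<in>g ` S. ennreal (?I c)) * Fm q gs + (\<Sum>c\<in>g ` S. ennreal (?C * ?I c)) * (\<Sum>cs\<in>codes S gs. ennreal (?m cs powr q))"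
    by (simp only: Fm_def sum.distrib sum_distrib_left[symmetric] sum_distrib_right[symmetric])
  also have "(\<Sum>c\<in>g ` S. ennreal (?I c)) = ennreal (\<phi> q)"
    using q by (simp add: I0 sum_fibres \<phi>_eq)
  also have "(\<Sum>c\<in>g ` S. ennreal (?C * ?I c)) = ennreal (?C * \<phi> q)"
    using q by (simp add: I0 sum_distrib_left[symmetric] sum_fibres \<phi>_eq)
  also have "(\<Sum>cs\<in>codes S gs. ennreal (?m cs powr q)) = ennreal (prod_list (map (\<lambda>g. \<phi>m g q) gs))"
    by (simp add: sum_prod_wt)
  finally show ?thesis .
qed

lemma prod_list_mono_real:
  "(\<And>g. g \<in> set gs \<Longrightarrow> 0 \<le> f g \<and> f g \<le> (h g :: real)) \<Longrightarrow> prod_list (map f gs) \<le> prod_list (map h gs)"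
proof (induction gs)
  case (Cons g gs)
  have "0 \<le> prod_list (map f gs)" using Cons.prems by (intro prod_list_nonneg) auto
  then show ?case using Cons by (auto intro!: mult_mono order_trans[of 0 "f g" "h g"])
qed simp

text \<open>With the maxima as factors, both terms of the recursion are controlled by the same
  product, and each letter adds only one more \<open>card S powr q\<close> to the prefactor. So the
  prefactor grows linearly, which does not affect the exponential rate.\<close>

lemma Fm_gt_1:
  assumes q: "1 < q" "q \<le> q0" and m: "mV q = ennreal m" "0 \<le> m"
  shows "Fm q gs \<le> ennreal ((m + real (card S) powr q * real (length gs)) * prod_list (map (\<lambda>g. max (\<phi> q) (\<phi>m g q)) gs))"
proof (induction gs)
  case Nil
  then show ?case by (simp add: Fm_Nil m)
next
  case (Cons g gs)
  let ?C = "real (card S) powr q"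
  let ?L = "m + ?C * real (length gs)"
  let ?P = "prod_list (map (\<lambda>g. max (\<phi> q) (\<phi>m g q)) gs)"
  have P: "prod_list (map (\<lambda>g. \<phi>m g q) gs) \<le> ?P" by (rule prod_list_mono_real) (auto simp: \<phi>m_nonneg)
  have P0: "0 \<le> ?P" using P prod_\<phi>m_nonneg[of q gs] by linarith
  have L0: "0 \<le> ?L" using m by simp
  have "Fm q (g # gs) \<le> ennreal (\<phi> q) * ennreal (?L * ?P) + ennreal (?C * \<phi> q) * ennreal ?P"
    by (rule order_trans[OF Fm_Cons_gt_1[OF q]]) (intro add_mono mult_left_mono Cons ennreal_leI P, simp_all)
  also have "\<dots> = ennreal (\<phi> q * (?L * ?P) + ?C * \<phi> q * ?P)"
    using L0 P0 \<phi>_nonneg[of q]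
    by (simp only: ennreal_mult[symmetric] ennreal_plus[symmetric] mult_nonneg_nonneg powr_ge_zero)
  also have "\<dots> \<le> ennreal ((m + ?C * real (length (g # gs))) * prod_list (map (\<lambda>g. max (\<phi> q) (\<phi>m g q)) (g # gs)))"
  proof (rule ennreal_leI)
    have "\<phi> q * (?L * ?P) + ?C * \<phi> q * ?P = \<phi> q * ((?L + ?C) * ?P)" by (simp add: algebra_simps)
    also have "\<dots> \<le> max (\<phi> q) (\<phi>m g q) * ((?L + ?C) * ?P)"
      using P0 add_nonneg_nonneg[OF L0, of ?C] by (intro mult_right_mono mult_nonneg_nonneg) auto
    finally show "\<phi> q * (?L * ?P) + ?C * \<phi> q * ?P \<le> (m + ?C * real (length (g # gs))) * prod_list (map (\<lambda>g. max (\<phi> q) (\<phi>m g q)) (g # gs))"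
      by (simp add: algebra_simps)
  qed
  finally show ?case .
qed

lemma Fm_Cons_le_1:
  assumes q: "0 < q" "q \<le> 1"
  shows "Fm q (g # gs) \<le> ennreal (\<phi> q) * Fm q gs"
proof -
  let ?A = "\<lambda>c. {a. a \<in> S \<and> g a = c}"
  let ?I = "\<lambda>c. \<Sum>a\<in>?A c. \<integral>\<omega>. X [] \<omega> a powr q \<partial>M"
  have I0: "0 \<le> ?I c" for c by (intro sum_nonneg Bochner_Integration.integral_nonneg) auto
  have step: "(\<integral>\<^sup>+\<omega>. ennreal (cm (g # gs) (c # cs) [] \<omega> powr q) \<partial>M) \<le>
     ennreal (?I c) * (\<integral>\<^sup>+\<omega>. ennreal (cm gs cs [] \<omega> powr q) \<partial>M)" for c cs
  proof -
    obtain h where h: "h \<in> borel_measurable TS" "\<And>t. 0 \<le> h t" "\<And>u \<omega>. u \<in> lists S \<Longrightarrow> cm gs cs u \<omega> = h (\<Theta> u \<omega>)"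
      using functional_cm[of gs cs] unfolding functional_def by auto
    have "(\<integral>\<^sup>+\<omega>. ennreal (cm (g # gs) (c # cs) [] \<omega> powr q) \<partial>M) = (\<integral>\<^sup>+\<omega>. ennreal ((\<Sum>a\<in>?A c. X [] \<omega> a * h (\<Theta> [a] \<omega>)) powr q) \<partial>M)"
      using h(3) by (intro nn_integral_cong) (auto intro!: sum.cong arg_cong[of _ _ "\<lambda>x. ennreal (x powr q)"])
    also have "\<dots> \<le> (\<Sum>a\<in>?A c. \<integral>\<^sup>+\<omega>. ennreal (X [] \<omega> a powr q) \<partial>M) * (\<integral>\<^sup>+\<omega>. ennreal (h (\<Theta> [] \<omega>) powr q) \<partial>M)"
      by (rule one_step_le_1) (use h q in auto)
    also have "(\<Sum>a\<in>?A c. \<integral>\<^sup>+\<omega>. ennreal (X [] \<omega> a powr q) \<partial>M) = ennreal (?I c)"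
      using q q0 by (intro sum_nn_powr) auto
    finally show ?thesis using h(3)[of "[]"] by simp
  qed
  have "Fm q (g # gs) = (\<Sum>c\<in>g ` S. \<Sum>cs\<in>codes S gs. \<integral>\<^sup>+\<omega>. ennreal (cm (g # gs) (c # cs) [] \<omega> powr q) \<partial>M)"
    unfolding Fm_def sum_codes_Cons ..
  also have "\<dots> \<le> (\<Sum>c\<in>g ` S. \<Sum>cs\<in>codes S gs. ennreal (?I c) * (\<integral>\<^sup>+\<omega>. ennreal (cm gs cs [] \<omega> powr q) \<partial>M))"
    by (intro sum_mono step)
  also have "\<dots> = (\<Sum>c\<in>g ` S. ennreal (?I c)) * Fm q gs"
    by (simp only: Fm_def sum_distrib_left[symmetric] sum_distrib_right[symmetric])
  also have "(\<Sum>c\<in>g ` S. ennreal (?I c)) = ennreal (\<phi> q)"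
    using q q0 by (simp add: I0 sum_fibres \<phi>_eq)
  finally show ?thesis .
qed

text \<open>The tangent at the mean is integrated, with the finite term \<open>q * m powr q\<close>
  kept on the left until it can be cancelled. There is no tangent at mean 0, where the function
  vanishes almost surely.\<close>

lemma nn_powr_jensen:
  assumes f[measurable]: "f \<in> borel_measurable M" and f0: "\<And>\<omega>. 0 \<le> f \<omega>" and q: "0 < q" "q \<le> 1"
    and m: "(\<integral>\<^sup>+\<omega>. ennreal (f \<omega>) \<partial>M) = ennreal m" "0 \<le> m"
  shows "(\<integral>\<^sup>+\<omega>. ennreal (f \<omega> powr q) \<partial>M) \<le> ennreal (m powr q)"
proof (cases "m = 0")
  case True
  then have "AE \<omega> in M. ennreal (f \<omega>) = 0" using m by (subst nn_integral_0_iff_AE[symmetric]) auto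
  then have "(\<integral>\<^sup>+\<omega>. ennreal (f \<omega> powr q) \<partial>M) = (\<integral>\<^sup>+\<omega>. 0 \<partial>M)"
    by (intro nn_integral_cong_AE, elim eventually_mono) (use f0 in \<open>simp add: ennreal_eq_0_iff order_antisym_conv\<close>)
  then show ?thesis by simp
next
  case False
  then have m0: "0 < m" using m by simp
  have "(\<integral>\<^sup>+\<omega>. ennreal (f \<omega> powr q) \<partial>M) + ennreal (q * m powr q) = (\<integral>\<^sup>+\<omega>. ennreal (f \<omega> powr q) + ennreal (q * m powr q) \<partial>M)"
    by (subst nn_integral_add) (auto simp: emeasure_space_1)
  also have "\<dots> \<le> (\<integral>\<^sup>+\<omega>. ennreal (m powr q) + ennreal (q * m powr (q - 1)) * ennreal (f \<omega>) \<partial>M)"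
  proof (rule nn_integral_mono)
    fix \<omega>
    have "f \<omega> powr q + q * m powr q \<le> m powr q + q * m powr (q - 1) * f \<omega>"
      using powr_le_tangent_at[OF f0 m0, of q \<omega>] q by (simp add: mult.assoc)
    then have "ennreal (f \<omega> powr q + q * m powr q) \<le> ennreal (m powr q + q * m powr (q - 1) * f \<omega>)"
      by (rule ennreal_leI)
    then show "ennreal (f \<omega> powr q) + ennreal (q * m powr q) \<le> ennreal (m powr q) + ennreal (q * m powr (q - 1)) * ennreal (f \<omega>)"
      using q f0 by (simp add: ennreal_mult'')
  qed
  also have "\<dots> = ennreal (m powr q) + ennreal (q * m powr (q - 1)) * ennreal m"
    by (subst nn_integral_add) (auto simp: emeasure_space_1 nn_integral_cmult m)
  also have "ennreal (q * m powr (q - 1)) * ennreal m = ennreal (q * m powr q)"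
    using m0 q powr_mult_base[of m "q - 1"] by (simp add: ennreal_mult''[symmetric] mult_ac)
  finally show ?thesis
    by (simp only: add.commute[of _ "ennreal (q * m powr q)"] ennreal_add_left_cancel_le) auto
qed

lemma Fm_le_1_jensen:
  assumes q: "0 < q" "q \<le> 1"
  shows "Fm q gs \<le> ennreal (prod_list (map (\<lambda>g. \<phi>m g q) gs))"
proof -
  have "Fm q gs \<le> (\<Sum>cs\<in>codes S gs. ennreal (prod_list (map2 wt gs cs) powr q))"
    unfolding Fm_def using q
    by (intro sum_mono nn_powr_jensen nn_cm_mean codes_length prod_wt_nonneg cm_nonneg cm_meas) auto
  then show ?thesis by (simp add: sum_prod_wt)
qed

text \<open>Subadditivity strips letters one at a time from the front, while Jensen's inequality
  deals with all that remains at once; therefore the factors \<open>\<phi> q\<close> necessarily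
  precede the factors \<open>\<phi>m g q\<close>.\<close>

lemma Fm_le_1:
  assumes q: "0 < q" "q \<le> 1"
  shows "Fm q (gs1 @ gs2) \<le> ennreal (\<phi> q ^ length gs1 * prod_list (map (\<lambda>g. \<phi>m g q) gs2))"
proof (induction gs1)
  case Nil
  then show ?case using Fm_le_1_jensen[OF q] by simp
next
  case (Cons g gs1)
  have "Fm q ((g # gs1) @ gs2) \<le> ennreal (\<phi> q) * ennreal (\<phi> q ^ length gs1 * prod_list (map (\<lambda>g. \<phi>m g q) gs2))"
    using order_trans[OF Fm_Cons_le_1[OF q, of g "gs1 @ gs2"] mult_left_mono[OF Cons]] by simp
  also have "\<dots> = ennreal (\<phi> q ^ length (g # gs1) * prod_list (map (\<lambda>g. \<phi>m g q) gs2))"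
    using \<phi>_nonneg by (simp add: ennreal_mult'[symmetric] mult.assoc)
  finally show ?case .
qed

end

subsection \<open>Almost sure bounds\<close>

text \<open>A Borel--Cantelli argument: the series of \<open>f n * exp (r n)\<close> has finite
  mean, hence converges almost surely, and its terms are eventually below 1. The bound on the
  expectations holds only eventually, whence the shift by \<open>N\<close>.\<close>

lemma (in prob_space) AE_eventually_le_of_summable:
  fixes f :: "nat \<Rightarrow> 'a \<Rightarrow> real"
  assumes f[measurable]: "\<And>n. f n \<in> borel_measurable M" and f0: "\<And>n \<omega>. 0 \<le> f n \<omega>"
    and le: "\<forall>\<^sub>F n in sequentially. (\<integral>\<^sup>+\<omega>. ennreal (f n \<omega>) \<partial>M) \<le> ennreal (c n)"
    and sum: "summable (\<lambda>n. c n * exp (r n))" and c0: "\<And>n. 0 \<le> c n"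
  shows "AE \<omega> in M. \<forall>\<^sub>F n in sequentially. f n \<omega> \<le> exp (- r n)"
proof -
  obtain N where N: "\<And>n. n \<ge> N \<Longrightarrow> (\<integral>\<^sup>+\<omega>. ennreal (f n \<omega>) \<partial>M) \<le> ennreal (c n)"
    using le by (auto simp: eventually_sequentially)
  have "(\<integral>\<^sup>+\<omega>. (\<Sum>n. ennreal (f (n + N) \<omega> * exp (r (n + N)))) \<partial>M) =
    (\<Sum>n. \<integral>\<^sup>+\<omega>. ennreal (f (n + N) \<omega> * exp (r (n + N))) \<partial>M)"
    by (rule nn_integral_suminf) measurable
  also have "\<dots> \<le> (\<Sum>n. ennreal (c (n + N) * exp (r (n + N))))"
  proof (rule suminf_le)
    fix n
    have "(\<integral>\<^sup>+\<omega>. ennreal (f (n + N) \<omega> * exp (r (n + N))) \<partial>M) = (\<integral>\<^sup>+\<omega>. ennreal (f (n + N) \<omega>) \<partial>M) * ennreal (exp (r (n + N)))"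
      by (simp add: ennreal_mult'' nn_integral_multc)
    also have "\<dots> \<le> ennreal (c (n + N)) * ennreal (exp (r (n + N)))"
      using N[of "n + N"] by (intro mult_right_mono) auto
    finally show "(\<integral>\<^sup>+\<omega>. ennreal (f (n + N) \<omega> * exp (r (n + N))) \<partial>M) \<le> ennreal (c (n + N) * exp (r (n + N)))"
      by (simp add: ennreal_mult'')
  qed auto
  also have "\<dots> < \<infinity>"
  proof -
    have "summable (\<lambda>n. c (n + N) * exp (r (n + N)))"
      using sum by (subst summable_iff_shift[of "\<lambda>n. c n * exp (r n)" N])
    then show ?thesis using c0 by (subst suminf_ennreal2) auto
  qed
  finally have "AE \<omega> in M. (\<Sum>n. ennreal (f (n + N) \<omega> * exp (r (n + N)))) \<noteq> \<infinity>"
    by (intro nn_integral_PInf_AE) auto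
  then show ?thesis
  proof eventually_elim
    case (elim \<omega>)
    then have "summable (\<lambda>n. f (n + N) \<omega> * exp (r (n + N)))"
      using f0 by (intro summable_suminf_not_top) auto
    then have "(\<lambda>n. f (n + N) \<omega> * exp (r (n + N))) \<longlonglongrightarrow> 0" by (rule summable_LIMSEQ_zero)
    then have "\<forall>\<^sub>F n in sequentially. f (n + N) \<omega> * exp (r (n + N)) < 1" by (rule order_tendstoD) simp
    then have "\<forall>\<^sub>F n in sequentially. f (n + N) \<omega> \<le> exp (- r (n + N))"
      by eventually_elim (simp add: exp_minus field_simps)
    then show ?case
      using eventually_sequentially_seg[of "\<lambda>n. f n \<omega> \<le> exp (- r n)" N] by simp
  qed
qed

lemma summable_affine_exp:
  assumes "0 < (s :: real)"
  shows "summable (\<lambda>n. (A + B * real (Suc n)) * exp (- (s * real n)))"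
proof -
  define z where "z = exp (- s)"
  have z: "norm z < 1" using assms by (simp add: z_def)
  have e: "exp (- (s * real n)) = z ^ n" for n
    unfolding z_def exp_of_nat_mult[symmetric] by (simp add: mult.commute)
  have "summable (\<lambda>n. real (Suc n) * z ^ n)" using geometric_deriv_sums[OF z] by (auto simp: sums_iff)
  then have "summable (\<lambda>n. A * z ^ n + B * (real (Suc n) * z ^ n))"
    using z by (intro summable_add summable_mult summable_geometric)
  then show ?thesis unfolding e by (simp add: algebra_simps)
qed

section \<open>Exponential rates of the moment sums\<close>

context cascade_moment
begin

definition Msum :: "('a \<Rightarrow> 'c) list \<Rightarrow> real \<Rightarrow> 'w \<Rightarrow> real" where
  "Msum gs q \<omega> = (\<Sum>cs\<in>codes S gs. cm gs cs [] \<omega> powr q)"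

lemma Msum_nonneg: "0 \<le> Msum gs q \<omega>" unfolding Msum_def by (intro sum_nonneg) auto

lemma Msum_meas[measurable]: "Msum gs q \<in> borel_measurable M"
  unfolding Msum_def[abs_def]
  by (intro borel_measurable_sum powr_real_measurable cm_meas) auto

lemma nn_Msum: "(\<integral>\<^sup>+\<omega>. ennreal (Msum gs q \<omega>) \<partial>M) = Fm q gs"
proof -
  have "(\<integral>\<^sup>+\<omega>. ennreal (Msum gs q \<omega>) \<partial>M) = (\<integral>\<^sup>+\<omega>. (\<Sum>cs\<in>codes S gs. ennreal (cm gs cs [] \<omega> powr q)) \<partial>M)"
    unfolding Msum_def by (intro nn_integral_cong sum_ennreal[symmetric]) auto
  also have "\<dots> = Fm q gs"
    unfolding Fm_def by (intro nn_integral_sum measurable_compose[OF _ measurable_ennreal] powr_real_measurable cm_meas) auto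
  finally show ?thesis .
qed

text \<open>The predicted entropy of the partition described by \<open>gs\<close>, one term per
  letter.\<close>

definition minent :: "('a \<Rightarrow> 'c) list \<Rightarrow> real" where
  "minent gs = (\<Sum>g\<leftarrow>gs. min dimen (entm g))"

lemma prod_list_exp: "prod_list (map (\<lambda>g. exp (f g)) gs) = exp (\<Sum>g\<leftarrow>gs. f g :: real)"
  by (induction gs) (simp_all add: exp_add)

lemma sum_list_affine: "(\<Sum>g\<leftarrow>gs. (f g + e) * c) = ((\<Sum>g\<leftarrow>gs. f g) + e * real (length gs)) * (c :: real)"
  by (induction gs) (simp_all add: algebra_simps)

text \<open>As only finitely many letter maps occur, \<open>q\<close> and the constants
  \<open>A\<close>, \<open>b\<close> can be chosen before the list \<open>gs\<close>, hence
  simultaneously for all scales.\<close>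

lemma Fm_bound_right:
  assumes fin: "finite Gs" and e: "0 < \<epsilon>"
  shows "\<forall>\<^sub>F q in at_right 1. \<exists>A b. 0 \<le> A \<and> 0 \<le> b \<and> (\<forall>gs. set gs \<subseteq> Gs \<longrightarrow>
    Fm q gs \<le> ennreal ((A + b * real (length gs)) * exp ((- minent gs + \<epsilon> * real (length gs)) * (q - 1))))"
proof -
  have "\<forall>\<^sub>F q in at_right 1. \<phi> q \<le> exp (- (dimen - \<epsilon>) * (q - 1))"
    by (rule exp_bounds_of_derivative[OF \<phi>_has_derivative \<phi>_1 e])
  moreover have "\<forall>\<^sub>F q in at_right 1. \<forall>g\<in>Gs. \<phi>m g q \<le> exp (- (entm g - \<epsilon>) * (q - 1))"
    by (intro eventually_ball_finite fin ballI exp_bounds_of_derivative[OF \<phi>m_has_derivative \<phi>m_1 e])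
  moreover have "\<forall>\<^sub>F q in at_right 1. q \<in> {1<..<q0}" using q0 by (intro eventually_at_rightI[of 1 q0]) auto
  moreover note V_moment
  ultimately show ?thesis
  proof eventually_elim
    case (elim q)
    then have q: "1 < q" "q \<le> q0" by auto
    obtain m where m: "mV q = ennreal m" "0 \<le> m" using elim(4) by (cases "mV q") auto
    have "Fm q gs \<le> ennreal ((m + real (card S) powr q * real (length gs)) * exp ((- minent gs + \<epsilon> * real (length gs)) * (q - 1)))"
      if gs: "set gs \<subseteq> Gs" for gs
    proof (rule order_trans[OF Fm_gt_1[OF q m]], rule ennreal_leI, rule mult_left_mono)
      have "prod_list (map (\<lambda>g. max (\<phi> q) (\<phi>m g q)) gs) \<le> prod_list (map (\<lambda>g. exp ((- min dimen (entm g) + \<epsilon>) * (q - 1))) gs)"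
      proof (rule prod_list_mono_real)
        fix g assume g: "g \<in> set gs"
        have "- (dimen - \<epsilon>) * (q - 1) \<le> (- min dimen (entm g) + \<epsilon>) * (q - 1)"
             "- (entm g - \<epsilon>) * (q - 1) \<le> (- min dimen (entm g) + \<epsilon>) * (q - 1)"
          using q by (auto intro!: mult_right_mono)
        then have "\<phi> q \<le> exp ((- min dimen (entm g) + \<epsilon>) * (q - 1))" "\<phi>m g q \<le> exp ((- min dimen (entm g) + \<epsilon>) * (q - 1))"
          using elim(1,2) g gs by (meson exp_le_cancel_iff order_trans subsetD)+
        then show "0 \<le> max (\<phi> q) (\<phi>m g q) \<and> max (\<phi> q) (\<phi>m g q) \<le> exp ((- min dimen (entm g) + \<epsilon>) * (q - 1))"
          using \<phi>_nonneg[of q] by (simp add: le_max_iff_disj)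
      qed
      also have "\<dots> = exp ((- minent gs + \<epsilon> * real (length gs)) * (q - 1))"
        unfolding prod_list_exp sum_list_affine minent_def by (simp add: uminus_sum_list_map comp_def)
      finally show "prod_list (map (\<lambda>g. max (\<phi> q) (\<phi>m g q)) gs) \<le> exp ((- minent gs + \<epsilon> * real (length gs)) * (q - 1))" .
    qed (use m in simp)
    then show ?case using m by (intro exI[of _ m] exI[of _ "real (card S) powr q"]) auto
  qed
qed

text \<open>The letters for which subadditivity is the better bound come before those for which
  Jensen's inequality is, as \<open>Fm_le_1\<close> demands.\<close>

definition split_sorted :: "('a \<Rightarrow> 'c) list \<Rightarrow> bool" where
  "split_sorted gs \<longleftrightarrow> (\<exists>gs1 gs2. gs = gs1 @ gs2 \<and> (\<forall>g\<in>set gs1. dimen \<le> entm g) \<and> (\<forall>g\<in>set gs2. entm g \<le> dimen))"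

text \<open>On the first part \<open>dimen\<close> is the smaller slope and the factor is
  \<open>\<phi> q\<close>; on the second part it is the entropy, with factor
  \<open>\<phi>m g q\<close>. So every letter contributes the same \<open>min dimen (entm g)\<close>
  as to the right of 1.\<close>

lemma Fm_bound_left:
  assumes fin: "finite Gs" and e: "0 < \<epsilon>"
  shows "\<forall>\<^sub>F q in at_left 1. \<forall>gs. set gs \<subseteq> Gs \<and> split_sorted gs \<longrightarrow>
    Fm q gs \<le> ennreal (exp ((minent gs + \<epsilon> * real (length gs)) * (1 - q)))"
proof -
  have "\<forall>\<^sub>F q in at_left 1. \<phi> q \<le> exp ((dimen + \<epsilon>) * (1 - q))"
    by (rule exp_bounds_of_derivative[OF \<phi>_has_derivative \<phi>_1 e])
  moreover have "\<forall>\<^sub>F q in at_left 1. \<forall>g\<in>Gs. \<phi>m g q \<le> exp ((entm g + \<epsilon>) * (1 - q))"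
    by (intro eventually_ball_finite fin ballI exp_bounds_of_derivative[OF \<phi>m_has_derivative \<phi>m_1 e])
  moreover have "\<forall>\<^sub>F q::real in at_left 1. q \<in> {0<..<1}" by (rule eventually_at_leftI[of 0]) auto
  ultimately show ?thesis
  proof eventually_elim
    case (elim q)
    show ?case
    proof (intro allI impI)
      fix gs assume gs: "set gs \<subseteq> Gs \<and> split_sorted gs"
      then obtain gs1 gs2 where g12: "gs = gs1 @ gs2" "\<forall>g\<in>set gs1. dimen \<le> entm g" "\<forall>g\<in>set gs2. entm g \<le> dimen"
        unfolding split_sorted_def by auto
      have "Fm q gs \<le> ennreal (\<phi> q ^ length gs1 * prod_list (map (\<lambda>g. \<phi>m g q) gs2))"
        unfolding g12 using elim by (intro Fm_le_1) auto
      also have "\<dots> \<le> ennreal (exp ((minent gs + \<epsilon> * real (length gs)) * (1 - q)))"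
      proof (rule ennreal_leI)
        have "\<phi> q ^ length gs1 = prod_list (map (\<lambda>g. \<phi> q) gs1)" by (induction gs1) auto
        also have "\<dots> \<le> prod_list (map (\<lambda>g. exp ((min dimen (entm g) + \<epsilon>) * (1 - q))) gs1)"
          using g12 elim \<phi>_nonneg by (intro prod_list_mono_real) (auto simp: min_def)
        also have "\<dots> = exp ((minent gs1 + \<epsilon> * real (length gs1)) * (1 - q))"
          unfolding prod_list_exp sum_list_affine minent_def ..
        finally have 1: "\<phi> q ^ length gs1 \<le> exp ((minent gs1 + \<epsilon> * real (length gs1)) * (1 - q))" .
        have "prod_list (map (\<lambda>g. \<phi>m g q) gs2) \<le> prod_list (map (\<lambda>g. exp ((min dimen (entm g) + \<epsilon>) * (1 - q))) gs2)"
        proof (rule prod_list_mono_real)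
          fix g assume "g \<in> set gs2"
          then have "g \<in> Gs" "min dimen (entm g) = entm g" using gs g12 by (auto simp: min_def)
          then show "0 \<le> \<phi>m g q \<and> \<phi>m g q \<le> exp ((min dimen (entm g) + \<epsilon>) * (1 - q))"
            using elim \<phi>m_nonneg by simp
        qed
        also have "\<dots> = exp ((minent gs2 + \<epsilon> * real (length gs2)) * (1 - q))"
          unfolding prod_list_exp sum_list_affine minent_def ..
        finally have "\<phi> q ^ length gs1 * prod_list (map (\<lambda>g. \<phi>m g q) gs2) \<le>
          exp ((minent gs1 + \<epsilon> * real (length gs1)) * (1 - q)) * exp ((minent gs2 + \<epsilon> * real (length gs2)) * (1 - q))"
          using 1 by (intro mult_mono) (auto simp: prod_\<phi>m_nonneg)
        then show "\<phi> q ^ length gs1 * prod_list (map (\<lambda>g. \<phi>m g q) gs2) \<le> exp ((minent gs + \<epsilon> * real (length gs)) * (1 - q))"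
          by (simp add: g12 minent_def algebra_simps flip: exp_add)
      qed
      finally show "Fm q gs \<le> ennreal (exp ((minent gs + \<epsilon> * real (length gs)) * (1 - q)))" .
    qed
  qed
qed

lemma AE_Msum_bound:
  assumes len: "\<And>n. real (length (gs n)) \<le> C * real (Suc n)" and C: "0 \<le> C"
    and D: "(\<lambda>n. minent (gs n) / real n) \<longlonglongrightarrow> D" and q: "q \<noteq> 1" and e: "0 < \<epsilon>"
    and A: "0 \<le> A" "0 \<le> b"
    and F: "\<And>n. Fm q (gs n) \<le> ennreal ((A + b * real (length (gs n))) *
      exp (- minent (gs n) * (q - 1) + \<epsilon> * real (length (gs n)) * \<bar>q - 1\<bar>))"
  shows "AE \<omega> in M. \<forall>\<^sub>F n in sequentially.
    Msum (gs n) q \<omega> \<le> exp (- ((D * (q - 1) - (C + 2) * \<epsilon> * \<bar>q - 1\<bar>) * real n))"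
proof (rule AE_eventually_le_of_summable[OF Msum_meas Msum_nonneg])
  \<comment> \<open>Of the multiples of \<open>\<epsilon>\<close>, one pays for replacing
    \<open>minent (gs n)\<close> by \<open>D * n\<close> and \<open>C\<close> of them for the error
    per letter; the one remaining in the claim leaves exponential decay for the summation. The
    constant exponential accounts for \<open>Suc n\<close> in the bound on the length.\<close>
  let ?c = "\<lambda>n. (A + b * C * real (Suc n)) * exp (\<epsilon> * C * \<bar>q - 1\<bar>) *
    exp (- ((D * (q - 1) - (C + 1) * \<epsilon> * \<bar>q - 1\<bar>) * real n))"
  show "0 \<le> ?c n" for n using A C by (intro mult_nonneg_nonneg add_nonneg_nonneg) auto
  have "\<forall>\<^sub>F n in sequentially. \<bar>minent (gs n) / real n - D\<bar> < \<epsilon>"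
    using tendstoD[OF D e] by (simp add: dist_real_def)
  then show "\<forall>\<^sub>F n in sequentially. (\<integral>\<^sup>+\<omega>. ennreal (Msum (gs n) q \<omega>) \<partial>M) \<le> ennreal (?c n)"
    using eventually_gt_at_top[of 0]
  proof eventually_elim
    case (elim n)
    have "- minent (gs n) * (q - 1) = - (D * real n * (q - 1)) - (minent (gs n) / real n - D) * real n * (q - 1)"
      using elim by (simp add: algebra_simps)
    also have "\<dots> \<le> - (D * real n * (q - 1)) + \<epsilon> * real n * \<bar>q - 1\<bar>"
    proof -
      have "- ((minent (gs n) / real n - D) * real n * (q - 1)) \<le> \<bar>(minent (gs n) / real n - D) * real n * (q - 1)\<bar>"
        by (rule abs_ge_minus_self)
      also have "\<dots> = \<bar>minent (gs n) / real n - D\<bar> * real n * \<bar>q - 1\<bar>" by (simp add: abs_mult)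
      also have "\<dots> \<le> \<epsilon> * real n * \<bar>q - 1\<bar>" using elim by (intro mult_right_mono) auto
      finally show ?thesis by linarith
    qed
    finally have 1: "- minent (gs n) * (q - 1) \<le> - (D * real n * (q - 1)) + \<epsilon> * real n * \<bar>q - 1\<bar>" .
    have 2: "\<epsilon> * real (length (gs n)) * \<bar>q - 1\<bar> \<le> \<epsilon> * (C * real (Suc n)) * \<bar>q - 1\<bar>"
      using e len by (intro mult_right_mono mult_left_mono) auto
    have "exp (- minent (gs n) * (q - 1) + \<epsilon> * real (length (gs n)) * \<bar>q - 1\<bar>) \<le>
      exp (\<epsilon> * C * \<bar>q - 1\<bar> + - ((D * (q - 1) - (C + 1) * \<epsilon> * \<bar>q - 1\<bar>) * real n))"
      using 1 2 by (simp add: algebra_simps)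
    moreover have "A + b * real (length (gs n)) \<le> A + b * C * real (Suc n)"
      using len[of n] A mult_left_mono[of "real (length (gs n))" "C * real (Suc n)" b] by (simp add: mult.assoc)
    ultimately have "(A + b * real (length (gs n))) * exp (- minent (gs n) * (q - 1) + \<epsilon> * real (length (gs n)) * \<bar>q - 1\<bar>) \<le>
      (A + b * C * real (Suc n)) * exp (\<epsilon> * C * \<bar>q - 1\<bar> + - ((D * (q - 1) - (C + 1) * \<epsilon> * \<bar>q - 1\<bar>) * real n))"
      using A C by (intro mult_mono) auto
    also have "\<dots> = ?c n" by (simp only: exp_add mult.assoc)
    finally show ?case unfolding nn_Msum by (intro order_trans[OF F] ennreal_leI)
  qed
  have "?c n * exp ((D * (q - 1) - (C + 2) * \<epsilon> * \<bar>q - 1\<bar>) * real n) =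
    exp (\<epsilon> * C * \<bar>q - 1\<bar>) * ((A + b * C * real (Suc n)) * exp (- ((\<epsilon> * \<bar>q - 1\<bar>) * real n)))" for n
  proof -
    have "exp (- ((D * (q - 1) - (C + 1) * \<epsilon> * \<bar>q - 1\<bar>) * real n)) * exp ((D * (q - 1) - (C + 2) * \<epsilon> * \<bar>q - 1\<bar>) * real n)
      = exp (- ((\<epsilon> * \<bar>q - 1\<bar>) * real n))"
      unfolding exp_add[symmetric] by (simp add: algebra_simps)
    then show ?thesis by (simp add: mult_ac)
  qed
  moreover have "summable (\<lambda>n. exp (\<epsilon> * C * \<bar>q - 1\<bar>) * ((A + b * C * real (Suc n)) * exp (- ((\<epsilon> * \<bar>q - 1\<bar>) * real n))))"
    by (intro summable_mult summable_affine_exp) (use e q in auto)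
  ultimately show "summable (\<lambda>n. ?c n * exp ((D * (q - 1) - (C + 2) * \<epsilon> * \<bar>q - 1\<bar>) * real n))"
    by (simp only:)
qed

theorem AE_Msum_asymptotics:
  assumes fin: "finite Gs" and gs: "\<And>n. set (gs n) \<subseteq> Gs" "\<And>n. split_sorted (gs n)"
    and len: "\<And>n. real (length (gs n)) \<le> C * real (Suc n)" and C: "0 \<le> C"
    and D: "(\<lambda>n. minent (gs n) / real n) \<longlonglongrightarrow> D"
  shows "AE \<omega> in M. \<forall>\<epsilon>>0.
    (\<exists>q>1. \<forall>\<^sub>F n in sequentially. Msum (gs n) q \<omega> \<le> exp (- ((D - \<epsilon>) * (q - 1) * real n))) \<and>
    (\<exists>q\<in>{0<..<1}. \<forall>\<^sub>F n in sequentially. Msum (gs n) q \<omega> \<le> exp ((D + \<epsilon>) * (1 - q) * real n))"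
proof -
  have *: "AE \<omega> in M.
    (\<exists>q>1. \<forall>\<^sub>F n in sequentially. Msum (gs n) q \<omega> \<le> exp (- ((D - \<epsilon>) * (q - 1) * real n))) \<and>
    (\<exists>q\<in>{0<..<1}. \<forall>\<^sub>F n in sequentially. Msum (gs n) q \<omega> \<le> exp ((D + \<epsilon>) * (1 - q) * real n))"
    if e: "0 < \<epsilon>" for \<epsilon>
  proof (rule AE_conjI)
    define \<delta> where "\<delta> = \<epsilon> / (C + 2)"
    have d: "0 < \<delta>" "(C + 2) * \<delta> = \<epsilon>" using e C by (auto simp: \<delta>_def)
    have "\<forall>\<^sub>F q::real in at_right 1. 1 < q" by (simp add: eventually_at_filter)
    from eventually_happens[OF eventually_conj[OF Fm_bound_right[OF fin d(1)] this]]
    obtain q A b where q: "1 < q" and AB: "0 \<le> A" "0 \<le> b" "\<And>gs. set gs \<subseteq> Gs \<Longrightarrow>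
      Fm q gs \<le> ennreal ((A + b * real (length gs)) * exp ((- minent gs + \<delta> * real (length gs)) * (q - 1)))"
      by auto
    have "AE \<omega> in M. \<forall>\<^sub>F n in sequentially. Msum (gs n) q \<omega> \<le> exp (- ((D * (q - 1) - (C + 2) * \<delta> * \<bar>q - 1\<bar>) * real n))"
    proof (rule AE_Msum_bound[OF len C D _ d(1) AB(1,2)])
      show "Fm q (gs n) \<le> ennreal ((A + b * real (length (gs n))) *
          exp (- minent (gs n) * (q - 1) + \<delta> * real (length (gs n)) * \<bar>q - 1\<bar>))" for n
        using AB(3)[OF gs(1)[of n]] q by (simp add: algebra_simps)
    qed (use q in auto)
    then show "AE \<omega> in M. \<exists>q>1. \<forall>\<^sub>F n in sequentially. Msum (gs n) q \<omega> \<le> exp (- ((D - \<epsilon>) * (q - 1) * real n))"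
    proof eventually_elim
      case (elim \<omega>)
      have "D * (q - 1) - (C + 2) * \<delta> * \<bar>q - 1\<bar> = (D - \<epsilon>) * (q - 1)"
        using q unfolding d(2) by (simp add: algebra_simps)
      then show ?case using elim q by (intro exI[of _ q]) (simp only: simp_thms)
    qed
    have "\<forall>\<^sub>F q::real in at_left 1. q \<in> {0<..<1}" by (rule eventually_at_leftI[of 0]) auto
    from eventually_happens[OF eventually_conj[OF Fm_bound_left[OF fin d(1)] this]]
    obtain q where q: "0 < q" "q < 1" and AB: "\<And>gs. set gs \<subseteq> Gs \<Longrightarrow> split_sorted gs \<Longrightarrow>
      Fm q gs \<le> ennreal (exp ((minent gs + \<delta> * real (length gs)) * (1 - q)))"
      by auto
    have "AE \<omega> in M. \<forall>\<^sub>F n in sequentially. Msum (gs n) q \<omega> \<le> exp (- ((D * (q - 1) - (C + 2) * \<delta> * \<bar>q - 1\<bar>) * real n))"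
    proof (rule AE_Msum_bound[OF len C D _ d(1), of q 1 0])
      show "Fm q (gs n) \<le> ennreal ((1 + 0 * real (length (gs n))) *
          exp (- minent (gs n) * (q - 1) + \<delta> * real (length (gs n)) * \<bar>q - 1\<bar>))" for n
        using AB[OF gs(1)[of n] gs(2)[of n]] q by (simp add: algebra_simps)
    qed (use q in auto)
    then show "AE \<omega> in M. \<exists>q\<in>{0<..<1}. \<forall>\<^sub>F n in sequentially. Msum (gs n) q \<omega> \<le> exp ((D + \<epsilon>) * (1 - q) * real n)"
    proof eventually_elim
      case (elim \<omega>)
      have "- ((D * (q - 1) - (C + 2) * \<delta> * \<bar>q - 1\<bar>) * real n) = (D + \<epsilon>) * (1 - q) * real n" for n
        using q unfolding d(2) by (simp add: algebra_simps)
      then show ?case using elim q by (intro bexI[of _ q]) (simp_all only: greaterThanLessThan_iff simp_thms)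
    qed
  qed
  \<comment> \<open>The bounds weaken as \<open>\<epsilon>\<close> grows, so the countably many
    values \<open>1 / Suc m\<close> suffice and the exceptional set does not depend on
    \<open>\<epsilon>\<close>.\<close>
  have "AE \<omega> in M. \<forall>m::nat.
    (\<exists>q>1. \<forall>\<^sub>F n in sequentially. Msum (gs n) q \<omega> \<le> exp (- ((D - 1 / real (Suc m)) * (q - 1) * real n))) \<and>
    (\<exists>q\<in>{0<..<1}. \<forall>\<^sub>F n in sequentially. Msum (gs n) q \<omega> \<le> exp ((D + 1 / real (Suc m)) * (1 - q) * real n))"
    unfolding AE_all_countable by (intro allI *) simp
  then show ?thesis
  proof eventually_elim
    case (elim \<omega>)
    show ?case
    proof (intro allI impI)
      fix \<epsilon> :: real assume "0 < \<epsilon>"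
      then obtain m where m: "1 / real (Suc m) < \<epsilon>" using reals_Archimedean[of \<epsilon>] by (auto simp: divide_inverse)
      obtain q1 q2 where q: "1 < q1" "0 < q2" "q2 < 1"
        and F: "\<forall>\<^sub>F n in sequentially. Msum (gs n) q1 \<omega> \<le> exp (- ((D - 1 / real (Suc m)) * (q1 - 1) * real n))"
          "\<forall>\<^sub>F n in sequentially. Msum (gs n) q2 \<omega> \<le> exp ((D + 1 / real (Suc m)) * (1 - q2) * real n)"
        using elim[rule_format, of m] by auto
      have 1: "exp (- ((D - 1 / real (Suc m)) * (q1 - 1) * real n)) \<le> exp (- ((D - \<epsilon>) * (q1 - 1) * real n))" for n
        unfolding exp_le_cancel_iff neg_le_iff_le using m q by (intro mult_right_mono) auto
      have 2: "exp ((D + 1 / real (Suc m)) * (1 - q2) * real n) \<le> exp ((D + \<epsilon>) * (1 - q2) * real n)" for n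
        unfolding exp_le_cancel_iff using m q by (intro mult_right_mono) auto
      have "\<forall>\<^sub>F n in sequentially. Msum (gs n) q1 \<omega> \<le> exp (- ((D - \<epsilon>) * (q1 - 1) * real n))"
        by (rule eventually_mono[OF F(1)], rule order_trans[OF _ 1])
      moreover have "\<forall>\<^sub>F n in sequentially. Msum (gs n) q2 \<omega> \<le> exp ((D + \<epsilon>) * (1 - q2) * real n)"
        by (rule eventually_mono[OF F(2)], rule order_trans[OF _ 2])
      ultimately show "(\<exists>q>1. \<forall>\<^sub>F n in sequentially. Msum (gs n) q \<omega> \<le> exp (- ((D - \<epsilon>) * (q - 1) * real n))) \<and>
        (\<exists>q\<in>{0<..<1}. \<forall>\<^sub>F n in sequentially. Msum (gs n) q \<omega> \<le> exp ((D + \<epsilon>) * (1 - q) * real n))"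
        using q by auto
    qed
  qed
qed

end

subsection \<open>Slopes of the spectrum and entropy\<close>

text \<open>The convex function \<open>q \<mapsto> ln (\<Sum>i\<in>I. y i powr q)\<close> vanishes
  at 1 and lies above its tangent there, whose slope is minus the entropy. The proof is Jensen's
  inequality for \<open>exp\<close>, by its tangent at the mean \<open>s\<close>.\<close>

lemma ln_sum_powr_ge:
  fixes y :: "'i \<Rightarrow> real"
  assumes I: "finite I" and y: "\<And>i. i \<in> I \<Longrightarrow> 0 \<le> y i" "(\<Sum>i\<in>I. y i) = 1"
  shows "0 < (\<Sum>i\<in>I. y i powr q)" and "(q - 1) * (\<Sum>i\<in>I. y i * ln (y i)) \<le> ln (\<Sum>i\<in>I. y i powr q)"
proof -
  define s where "s = (\<Sum>i\<in>I. y i * ((q - 1) * ln (y i)))"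
  have "exp s * (y i * (1 + ((q - 1) * ln (y i) - s))) \<le> y i powr q" if "i \<in> I" for i
  proof (cases "y i = 0")
    case False
    then have yi: "0 < y i" using y that by force
    have "exp s * (y i * (1 + ((q - 1) * ln (y i) - s))) \<le> exp s * (y i * exp ((q - 1) * ln (y i) - s))"
      using yi by (intro mult_left_mono exp_ge_add_one_self) auto
    also have "\<dots> = y i * exp ((q - 1) * ln (y i))" by (simp add: exp_diff)
    also have "\<dots> = y i powr q" using yi by (simp add: powr_def left_diff_distrib exp_diff)
    finally show ?thesis .
  qed simp
  then have "(\<Sum>i\<in>I. exp s * (y i * (1 + ((q - 1) * ln (y i) - s)))) \<le> (\<Sum>i\<in>I. y i powr q)"
    by (rule sum_mono)
  also have "(\<Sum>i\<in>I. exp s * (y i * (1 + ((q - 1) * ln (y i) - s)))) = exp s * ((\<Sum>i\<in>I. y i) + s - s * (\<Sum>i\<in>I. y i))"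
  proof -
    have "(\<Sum>i\<in>I. y i * (1 + (t i - s'))) = (\<Sum>i\<in>I. y i) + (\<Sum>i\<in>I. y i * t i) - s' * (\<Sum>i\<in>I. y i)" for t s'
      by (simp add: algebra_simps sum.distrib sum_subtractf sum_distrib_left)
    from this[of "\<lambda>i. (q - 1) * ln (y i)" s] show ?thesis
      by (simp only: sum_distrib_left[symmetric] s_def[symmetric])
  qed
  finally have "exp s \<le> (\<Sum>i\<in>I. y i powr q)" using y by simp
  then show pos: "0 < (\<Sum>i\<in>I. y i powr q)" using exp_gt_zero[of s] by linarith
  have "s \<le> ln (\<Sum>i\<in>I. y i powr q)" using \<open>exp s \<le> _\<close> pos by (simp add: ln_ge_iff)
  moreover have "s = (q - 1) * (\<Sum>i\<in>I. y i * ln (y i))" unfolding s_def by (simp add: sum_distrib_left mult_ac)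
  ultimately show "(q - 1) * (\<Sum>i\<in>I. y i * ln (y i)) \<le> ln (\<Sum>i\<in>I. y i powr q)" by simp
qed

text \<open>Convexity between 1, where the logarithm vanishes, and \<open>r\<close>: the exponent
  \<open>q\<close> divides this segment in the proportion \<open>\<theta>\<close>. Pointwise it is
  the tangent of the concave power of order \<open>\<theta>\<close> at the total sum
  \<open>s\<close>.\<close>

lemma ln_sum_powr_interpolate:
  fixes y :: "'i \<Rightarrow> real"
  assumes I: "finite I" and y: "\<And>i. i \<in> I \<Longrightarrow> 0 \<le> y i" "(\<Sum>i\<in>I. y i) = 1"
    and \<theta>: "0 \<le> \<theta>" "\<theta> \<le> 1" and q: "q - 1 = \<theta> * (r - 1)"
  shows "ln (\<Sum>i\<in>I. y i powr q) \<le> \<theta> * ln (\<Sum>i\<in>I. y i powr r)"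
proof -
  define s where "s = (\<Sum>i\<in>I. y i powr r)"
  have s: "0 < s" unfolding s_def by (rule ln_sum_powr_ge[OF I y])
  have "y i powr q \<le> y i * (s powr \<theta> * (1 - \<theta>)) + \<theta> * s powr (\<theta> - 1) * y i powr r" if "i \<in> I" for i
  proof (cases "y i = 0")
    case False
    then have yi: "0 < y i" using y that by force
    have "(y i powr (r - 1)) powr \<theta> + \<theta> * s powr \<theta> \<le> s powr \<theta> + \<theta> * (s powr (\<theta> - 1) * y i powr (r - 1))"
      using \<theta> s by (intro powr_le_tangent_at) auto
    then have "y i * (y i powr (r - 1)) powr \<theta> \<le> y i * (s powr \<theta> * (1 - \<theta>) + \<theta> * (s powr (\<theta> - 1) * y i powr (r - 1)))"
      using yi by (intro mult_left_mono) (auto simp: algebra_simps)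
    moreover have "y i * (y i powr (r - 1)) powr \<theta> = y i powr q"
    proof -
      have "q = 1 + (r - 1) * \<theta>" using q by (simp add: algebra_simps)
      then show ?thesis using yi by (simp add: powr_powr powr_add)
    qed
    moreover have "y i powr r = y i * y i powr (r - 1)" using yi by (simp add: powr_diff)
    ultimately show ?thesis by (simp add: algebra_simps)
  qed simp
  then have "(\<Sum>i\<in>I. y i powr q) \<le> (\<Sum>i\<in>I. y i * (s powr \<theta> * (1 - \<theta>)) + \<theta> * s powr (\<theta> - 1) * y i powr r)"
    by (rule sum_mono)
  also have "\<dots> = s powr \<theta> * (1 - \<theta>) + \<theta> * s powr (\<theta> - 1) * s"
    unfolding sum.distrib sum_distrib_left[symmetric] sum_distrib_right[symmetric] y(2) s_def by simp
  also have "\<dots> = s powr \<theta>" using s by (simp add: powr_diff algebra_simps)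
  finally have "(\<Sum>i\<in>I. y i powr q) \<le> s powr \<theta>" .
  moreover have "0 < (\<Sum>i\<in>I. y i powr q)" by (rule ln_sum_powr_ge[OF I y])
  ultimately have "ln (\<Sum>i\<in>I. y i powr q) \<le> ln (s powr \<theta>)" by (subst ln_le_cancel_iff) (use s in simp_all)
  then show ?thesis using s by (simp add: ln_powr s_def)
qed

text \<open>By convexity of \<open>q \<mapsto> ln (\<Sum> x\<^sup>q)\<close>, upper bounds at one exponent on each side of \<open>1\<close> control the
  slopes in a neighbourhood of \<open>1\<close> as well as the entropy, which is minus the derivative at \<open>1\<close>.\<close>

locale slope_bounds =
  fixes I :: "nat \<Rightarrow> 'i set" and x :: "nat \<Rightarrow> 'i \<Rightarrow> real" and m D :: real
  assumes fin: "\<And>n. finite (I n)" and x0: "\<And>n i. i \<in> I n \<Longrightarrow> 0 \<le> x n i"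
    and mass: "\<And>n. (\<Sum>i\<in>I n. x n i) = m" and m0: "0 < m"
    and upper: "\<And>\<epsilon>. 0 < \<epsilon> \<Longrightarrow> \<exists>q>1. \<forall>\<^sub>F n in sequentially. (\<Sum>i\<in>I n. x n i powr q) \<le> exp (- ((D - \<epsilon>) * (q - 1) * real n))"
    and lower: "\<And>\<epsilon>. 0 < \<epsilon> \<Longrightarrow> \<exists>q\<in>{0<..<1}. \<forall>\<^sub>F n in sequentially. (\<Sum>i\<in>I n. x n i powr q) \<le> exp ((D + \<epsilon>) * (1 - q) * real n)"
begin

definition H :: "nat \<Rightarrow> real" where "H n = - (\<Sum>i\<in>I n. x n i / m * ln (x n i / m))"

definition L :: "real \<Rightarrow> nat \<Rightarrow> real" where "L q n = ln (\<Sum>i\<in>I n. (x n i / m) powr q)"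

lemma norm_mass: "(\<Sum>i\<in>I n. x n i / m) = 1"
  using mass[of n] m0 by (simp add: sum_divide_distrib[symmetric])

lemma norm_nonneg: "i \<in> I n \<Longrightarrow> 0 \<le> x n i / m" using x0 m0 by simp

lemma L_ge: "- (q - 1) * H n \<le> L q n"
  using ln_sum_powr_ge(2)[OF fin norm_nonneg norm_mass, of n q]
  unfolding H_def L_def minus_mult_minus .

lemma ln_sum_eq: "ln (\<Sum>i\<in>I n. x n i powr q) = L q n + q * ln m"
proof -
  have "(\<Sum>i\<in>I n. x n i powr q) = (\<Sum>i\<in>I n. (x n i / m) powr q * m powr q)"
    using m0 x0 by (intro sum.cong refl) (simp add: powr_divide)
  also have "\<dots> = (\<Sum>i\<in>I n. (x n i / m) powr q) * m powr q" by (simp add: sum_distrib_right)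
  finally show ?thesis
    using ln_sum_powr_ge(1)[OF fin norm_nonneg norm_mass, of n q] m0 by (simp add: L_def ln_mult ln_powr)
qed

lemma sum_pos: "0 < (\<Sum>i\<in>I n. x n i powr q)"
proof -
  have "(\<Sum>i\<in>I n. x n i powr q) = (\<Sum>i\<in>I n. (x n i / m) powr q * m powr q)"
    using m0 x0 by (intro sum.cong refl) (simp add: powr_divide)
  then show ?thesis
    using ln_sum_powr_ge(1)[OF fin norm_nonneg norm_mass, of n q] m0 by (simp flip: sum_distrib_right)
qed

lemma L_upper: "0 < \<epsilon> \<Longrightarrow> \<exists>q>1. \<forall>\<^sub>F n in sequentially. L q n \<le> - ((D - \<epsilon>) * (q - 1) * real n) - q * ln m"
proof -
  assume "0 < \<epsilon>"
  from upper[OF this] obtain q where q: "q > 1"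
    "\<forall>\<^sub>F n in sequentially. (\<Sum>i\<in>I n. x n i powr q) \<le> exp (- ((D - \<epsilon>) * (q - 1) * real n))" by blast
  from q(2) have "\<forall>\<^sub>F n in sequentially. L q n \<le> - ((D - \<epsilon>) * (q - 1) * real n) - q * ln m"
  proof eventually_elim
    case (elim n)
    then have "ln (\<Sum>i\<in>I n. x n i powr q) \<le> - ((D - \<epsilon>) * (q - 1) * real n)"
      using sum_pos[of n q] by (metis ln_exp ln_le_cancel_iff exp_gt_zero)
    then show ?case by (simp add: ln_sum_eq)
  qed
  then show ?thesis using q by blast
qed

lemma L_lower: "0 < \<epsilon> \<Longrightarrow> \<exists>q\<in>{0<..<1}. \<forall>\<^sub>F n in sequentially. L q n \<le> (D + \<epsilon>) * (1 - q) * real n - q * ln m"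
proof -
  assume "0 < \<epsilon>"
  from lower[OF this] obtain q where q: "q \<in> {0<..<1}"
    "\<forall>\<^sub>F n in sequentially. (\<Sum>i\<in>I n. x n i powr q) \<le> exp ((D + \<epsilon>) * (1 - q) * real n)" by blast
  from q(2) have "\<forall>\<^sub>F n in sequentially. L q n \<le> (D + \<epsilon>) * (1 - q) * real n - q * ln m"
  proof eventually_elim
    case (elim n)
    then have "ln (\<Sum>i\<in>I n. x n i powr q) \<le> (D + \<epsilon>) * (1 - q) * real n"
      using sum_pos[of n q] by (metis ln_exp ln_le_cancel_iff exp_gt_zero)
    then show ?case by (simp add: ln_sum_eq)
  qed
  then show ?thesis using q by blast
qed

lemma const_over_n: "0 < \<epsilon> \<Longrightarrow> \<forall>\<^sub>F n in sequentially. \<bar>c\<bar> \<le> \<epsilon> * real n"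
proof -
  assume e: "0 < \<epsilon>"
  obtain N where "\<bar>c\<bar> / \<epsilon> \<le> real N" using real_arch_simple by blast
  then have "\<forall>n\<ge>N. \<bar>c\<bar> \<le> \<epsilon> * real n"
    using e by (auto simp: pos_divide_le_eq mult.commute intro: order_trans mult_left_mono)
  then show ?thesis by (auto simp: eventually_sequentially)
qed

text \<open>The tangent bound \<open>L_ge\<close> at one exponent above 1 bounds the entropy from
  below, at one below 1 from above.\<close>

lemma entropy_limit: "(\<lambda>n. 1 / real n * H n) \<longlonglongrightarrow> D"
proof (rule tendstoI)
  fix \<epsilon> :: real assume e: "0 < \<epsilon>"
  \<comment> \<open>One \<open>\<delta>\<close> is the error of the exponential bound, a second one
    absorbs the constants \<open>q * ln m\<close> and \<open>r * ln m\<close> of the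
    normalisation.\<close>
  define \<delta> where "\<delta> = \<epsilon> / 3"
  have d: "0 < \<delta>" "2 * \<delta> < \<epsilon>" using e by (auto simp: \<delta>_def)
  obtain q where q: "q > 1" "\<forall>\<^sub>F n in sequentially. L q n \<le> - ((D - \<delta>) * (q - 1) * real n) - q * ln m"
    using L_upper[OF d(1)] by blast
  obtain r where r: "r \<in> {0<..<1}" "\<forall>\<^sub>F n in sequentially. L r n \<le> (D + \<delta>) * (1 - r) * real n - r * ln m"
    using L_lower[OF d(1)] by blast
  have "\<forall>\<^sub>F n in sequentially. \<bar>q * ln m\<bar> \<le> \<delta> * (q - 1) * real n"
    using q d by (intro const_over_n) auto
  moreover have "\<forall>\<^sub>F n in sequentially. \<bar>r * ln m\<bar> \<le> \<delta> * (1 - r) * real n"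
    using r d by (intro const_over_n) auto
  ultimately show "\<forall>\<^sub>F n in sequentially. dist (1 / real n * H n) D < \<epsilon>"
    using q(2) r(2) eventually_gt_at_top[of 0]
  proof eventually_elim
    case (elim n)
    have "(q - 1) * ((D - 2 * \<delta>) * real n) \<le> (q - 1) * H n"
      using L_ge[of q n] elim by (simp add: algebra_simps)
    then have 1: "(D - 2 * \<delta>) * real n \<le> H n" using q by simp
    have "(1 - r) * H n \<le> (1 - r) * ((D + 2 * \<delta>) * real n)"
      using L_ge[of r n] elim by (simp add: algebra_simps)
    then have 2: "H n \<le> (D + 2 * \<delta>) * real n" using r by simp
    have "\<bar>1 / real n * H n - D\<bar> \<le> 2 * \<delta>"
      using 1 2 elim by (simp add: abs_le_iff field_simps)
    then show ?case using d by (simp add: dist_real_def)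
  qed
qed

section \<open>The spectrum near the exponent 1\<close>

context
  fixes \<gamma> :: real
  assumes \<gamma>: "0 < \<gamma>"
begin

definition \<tau> :: "real \<Rightarrow> ereal" where
  "\<tau> q = liminf (\<lambda>n. ereal (- (\<gamma> / real n) * ln (\<Sum>i\<in>I n. x n i powr q)))"

text \<open>The sign change in the spectrum turns the lower tangent bound for the logarithms into an
  upper one, valid for all \<open>q\<close>; the entropy limit supplies its slope.\<close>

lemma \<tau>_upper: "\<tau> q \<le> ereal (\<gamma> * D * (q - 1))"
proof -
  have lim: "(\<lambda>n. \<gamma> * (q - 1) * (1 / real n * H n) - \<gamma> * q * ln m * (1 / real n)) \<longlonglongrightarrow> \<gamma> * (q - 1) * D - \<gamma> * q * ln m * 0"
    by (intro tendsto_intros entropy_limit lim_1_over_n)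
  have "\<tau> q \<le> liminf (\<lambda>n. ereal (\<gamma> * (q - 1) * (1 / real n * H n) - \<gamma> * q * ln m * (1 / real n)))"
    unfolding \<tau>_def
  proof (rule Liminf_mono, rule always_eventually, rule allI)
    fix n
    have 1: "\<gamma> / real n * (- (q - 1) * H n) \<le> \<gamma> / real n * L q n"
      using \<gamma> by (intro mult_left_mono L_ge) auto
    have "- (\<gamma> / real n) * (L q n + q * ln m) = - (\<gamma> / real n * L q n) - \<gamma> * q * ln m * (1 / real n)"
      by (simp add: algebra_simps add_divide_distrib)
    moreover have "\<gamma> * (q - 1) * (1 / real n * H n) = - (\<gamma> / real n * (- (q - 1) * H n))"
      by (simp add: algebra_simps diff_divide_distrib)
    ultimately have "- (\<gamma> / real n) * (L q n + q * ln m) \<le>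
      \<gamma> * (q - 1) * (1 / real n * H n) - \<gamma> * q * ln m * (1 / real n)" using 1 by linarith
    then show "ereal (- (\<gamma> / real n) * ln (\<Sum>i\<in>I n. x n i powr q)) \<le>
      ereal (\<gamma> * (q - 1) * (1 / real n * H n) - \<gamma> * q * ln m * (1 / real n))"
      unfolding ln_sum_eq by simp
  qed
  also have "\<dots> = ereal (\<gamma> * (q - 1) * D - \<gamma> * q * ln m * 0)"
    using lim by (intro lim_imp_Liminf) auto
  finally show ?thesis by (simp add: mult_ac)
qed

text \<open>Between 1 and \<open>r\<close> the function \<open>L\<close> stays below its chord. The
  total mass \<open>m\<close>, not normalised in the spectrum, contributes only terms of order
  \<open>1 / n\<close>.\<close>

lemma \<tau>_lower:
  assumes \<theta>: "0 \<le> \<theta>" "\<theta> \<le> 1" and q: "q - 1 = \<theta> * (r - 1)"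
    and L: "\<forall>\<^sub>F n in sequentially. L r n \<le> - (E * (r - 1) * real n) - r * ln m"
  shows "ereal (\<gamma> * E * (q - 1)) \<le> \<tau> q"
proof -
  have lim: "(\<lambda>n. \<gamma> * E * (q - 1) + \<gamma> * (\<theta> * r - q) * ln m * (1 / real n)) \<longlonglongrightarrow> \<gamma> * E * (q - 1) + \<gamma> * (\<theta> * r - q) * ln m * 0"
    by (intro tendsto_intros lim_1_over_n)
  have "ereal (\<gamma> * E * (q - 1) + \<gamma> * (\<theta> * r - q) * ln m * 0) =
    liminf (\<lambda>n. ereal (\<gamma> * E * (q - 1) + \<gamma> * (\<theta> * r - q) * ln m * (1 / real n)))"
    using lim by (intro lim_imp_Liminf[symmetric]) auto
  also have "\<dots> \<le> \<tau> q"
    unfolding \<tau>_def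
  proof (rule Liminf_mono, use L eventually_gt_at_top[of 0] in eventually_elim)
    case (elim n)
    have "L q n \<le> \<theta> * L r n"
      unfolding L_def by (rule ln_sum_powr_interpolate[OF fin norm_nonneg norm_mass \<theta> q])
    also have "\<dots> \<le> \<theta> * (- (E * (r - 1) * real n) - r * ln m)" using elim \<theta> by (intro mult_left_mono) auto
    also have "\<dots> = - (E * (q - 1) * real n) - \<theta> * r * ln m" unfolding q by (simp add: algebra_simps)
    finally have "ln (\<Sum>i\<in>I n. x n i powr q) \<le> - (E * (q - 1) * real n) - (\<theta> * r - q) * ln m"
      unfolding ln_sum_eq by (simp add: algebra_simps)
    then have "\<gamma> / real n * ln (\<Sum>i\<in>I n. x n i powr q) \<le> \<gamma> / real n * (- (E * (q - 1) * real n) - (\<theta> * r - q) * ln m)"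
      using \<gamma> by (intro mult_left_mono) auto
    also have "\<dots> = - (\<gamma> * E * (q - 1) + \<gamma> * (\<theta> * r - q) * ln m * (1 / real n))"
      using elim by (simp add: field_simps)
    finally show ?case by simp
  qed
  finally show ?thesis by simp
qed

lemma \<tau>_near_1:
  assumes e: "0 < \<epsilon>"
  shows "\<forall>\<^sub>F q in nhds 1. ereal (\<gamma> * D * (q - 1) - \<gamma> * \<epsilon> * \<bar>q - 1\<bar>) \<le> \<tau> q"
proof -
  obtain r where r: "r > 1" "\<forall>\<^sub>F n in sequentially. L r n \<le> - ((D - \<epsilon>) * (r - 1) * real n) - r * ln m"
    using L_upper[OF e] by blast
  obtain s where s: "s \<in> {0<..<1}" "\<forall>\<^sub>F n in sequentially. L s n \<le> (D + \<epsilon>) * (1 - s) * real n - s * ln m"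
    using L_lower[OF e] by blast
  have s2: "\<forall>\<^sub>F n in sequentially. L s n \<le> - ((D + \<epsilon>) * (s - 1) * real n) - s * ln m"
    using s(2) by (simp add: algebra_simps)
  have "\<forall>\<^sub>F q in nhds 1. q \<in> {s<..<r}" using r s by (intro eventually_nhds_in_open) auto
  then show ?thesis
  proof eventually_elim
    case (elim q)
    show ?case
    proof (cases "q \<ge> 1")
      case True
      have "ereal (\<gamma> * (D - \<epsilon>) * (q - 1)) \<le> \<tau> q"
        by (rule \<tau>_lower[of "(q - 1) / (r - 1)" q r, OF _ _ _ r(2)]) (use r(1) elim True in auto)
      then show ?thesis using True by (simp add: algebra_simps)
    next
      case False
      have "ereal (\<gamma> * (D + \<epsilon>) * (q - 1)) \<le> \<tau> q"
        by (rule \<tau>_lower[of "(q - 1) / (s - 1)" q s, OF _ _ _ s2]) (use s(1) elim False in \<open>auto simp: divide_simps\<close>)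
      then show ?thesis using False by (simp add: algebra_simps)
    qed
  qed
qed

theorem has_ereal_derivative_\<tau>: "has_ereal_derivative \<tau> (\<gamma> * D) 1"
  unfolding has_ereal_derivative_def
proof
  from \<tau>_near_1[of 1] show "\<forall>\<^sub>F q in nhds 1. \<bar>\<tau> q\<bar> \<noteq> \<infinity>"
  proof (rule eventually_mono)
    fix q assume "ereal (\<gamma> * D * (q - 1) - \<gamma> * 1 * \<bar>q - 1\<bar>) \<le> \<tau> q"
    then show "\<bar>\<tau> q\<bar> \<noteq> \<infinity>" using \<tau>_upper[of q] by (cases "\<tau> q") auto
  qed simp
  have "ereal (\<gamma> * D * (1 - 1) - \<gamma> * 1 * \<bar>1 - 1\<bar>) \<le> \<tau> 1"
    by (rule eventually_nhds_x_imp_x[OF \<tau>_near_1]) simp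
  then have t1: "\<tau> 1 = 0" using \<tau>_upper[of 1] by (simp add: zero_ereal_def[symmetric])
  show "((\<lambda>q. real_of_ereal (\<tau> q)) has_real_derivative \<gamma> * D) (at 1)"
    unfolding has_field_derivative_iff
  proof (rule tendstoI)
    fix \<epsilon> :: real assume e: "0 < \<epsilon>"
    define \<delta> where "\<delta> = \<epsilon> / (2 * \<gamma>)"
    have d: "0 < \<delta>" "\<gamma> * \<delta> < \<epsilon>" using e \<gamma> by (auto simp: \<delta>_def)
    have "\<forall>\<^sub>F q in at 1. ereal (\<gamma> * D * (q - 1) - \<gamma> * \<delta> * \<bar>q - 1\<bar>) \<le> \<tau> q"
      using \<tau>_near_1[OF d(1)] by (simp add: eventually_nhds_conv_at)
    moreover have "\<forall>\<^sub>F q::real in at 1. q \<noteq> 1" by (simp add: eventually_at_filter)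
    ultimately show "\<forall>\<^sub>F q in at 1. dist ((real_of_ereal (\<tau> q) - real_of_ereal (\<tau> 1)) / (q - 1)) (\<gamma> * D) < \<epsilon>"
    proof eventually_elim
      case (elim q)
      then obtain t where t: "\<tau> q = ereal t" using \<tau>_upper[of q] by (cases "\<tau> q") auto
      have "\<bar>t - \<gamma> * D * (q - 1)\<bar> \<le> \<gamma> * \<delta> * \<bar>q - 1\<bar>" using elim \<tau>_upper[of q] unfolding t by auto
      then have "\<bar>t - \<gamma> * D * (q - 1)\<bar> / \<bar>q - 1\<bar> \<le> \<gamma> * \<delta>" using elim by (simp add: pos_divide_le_eq)
      moreover have "\<bar>t / (q - 1) - \<gamma> * D\<bar> = \<bar>t - \<gamma> * D * (q - 1)\<bar> / \<bar>q - 1\<bar>"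
        using elim by (simp add: abs_divide[symmetric] diff_divide_distrib)
      ultimately show ?case using d by (simp add: dist_real_def t t1)
    qed
  qed
qed

end

end

subsection \<open>Entropy of finite-valued random variables\<close>

definition entropy_term :: "real \<Rightarrow> real" where "entropy_term t = - (t * ln t)"

lemma entropy_term_0[simp]: "entropy_term 0 = 0" by (simp add: entropy_term_def)

text \<open>A modulus of continuity at 0, from \<open>ln y \<le> y\<close> at
  \<open>y = 1 / sqrt t\<close>.\<close>

lemma entropy_term_le_sqrt: "0 \<le> t \<Longrightarrow> entropy_term t \<le> 2 * sqrt t"
proof (cases "t = 0")
  case False
  assume "0 \<le> t"
  with False have t: "0 < t" by simp
  have "- ln t = 2 * ln (1 / sqrt t)" using t by (simp add: ln_div ln_sqrt)
  also have "\<dots> \<le> 2 * (1 / sqrt t)" using t ln_bound[of "1 / sqrt t"] by simp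
  finally have "t * (- ln t) \<le> t * (2 * (1 / sqrt t))" using t by (intro mult_left_mono) auto
  also have "\<dots> = 2 * (t / sqrt t)" by simp
  also have "\<dots> = 2 * sqrt t" using t by (simp only: real_div_sqrt less_imp_le)
  finally show ?thesis by (simp add: entropy_term_def)
qed simp

context prob_space
begin

definition ent :: "('a \<Rightarrow> 'b) \<Rightarrow> real" where
  "ent X = (\<Sum>x\<in>X ` space M. entropy_term (prob (X -` {x} \<inter> space M)))"

lemma ent_superset:
  assumes "finite A" "X ` space M \<subseteq> A"
  shows "ent X = (\<Sum>x\<in>A. entropy_term (prob (X -` {x} \<inter> space M)))"
  unfolding ent_def
proof (rule sum.mono_neutral_left[OF assms], rule ballI)
  fix x assume "x \<in> A - X ` space M"
  then have "X -` {x} \<inter> space M = {}" by auto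
  then show "entropy_term (prob (X -` {x} \<inter> space M)) = 0" by simp
qed

lemma prob_sum_fibres:
  assumes Z: "simple_function M Z" and C: "finite C" "Z ` space M \<subseteq> C" and U: "U \<in> events"
  shows "prob U = (\<Sum>z\<in>C. prob (U \<inter> (Z -` {z} \<inter> space M)))"
proof -
  have m: "Z -` {z} \<inter> space M \<in> events" for z using simple_functionD(2)[OF Z] .
  have "prob (\<Union>z\<in>C. U \<inter> (Z -` {z} \<inter> space M)) = (\<Sum>z\<in>C. prob (U \<inter> (Z -` {z} \<inter> space M)))"
    by (rule finite_measure_finite_Union) (use C U m in \<open>auto simp: disjoint_family_on_def\<close>)
  moreover have "(\<Union>z\<in>C. U \<inter> (Z -` {z} \<inter> space M)) = U"
    using C(2) sets.sets_into_space[OF U] by auto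
  ultimately show ?thesis by simp
qed

text \<open>Merging values enlarges the probability inside the logarithm, and \<open>- ln\<close> is
  decreasing.\<close>

lemma ent_data_processing:
  assumes X: "simple_function M X"
  shows "ent (\<lambda>x. f (X x)) \<le> ent X"
proof -
  let ?A = "X ` space M"
  let ?p = "\<lambda>a. prob (X -` {a} \<inter> space M)"
  let ?q = "\<lambda>y. prob ((\<lambda>x. f (X x)) -` {y} \<inter> space M)"
  have A: "finite ?A" using X by (rule simple_functionD)
  have m: "X -` S \<inter> space M \<in> events" for S using simple_functionD(2)[OF X] .
  have ev: "(\<lambda>x. f (X x)) -` {y} \<inter> space M \<in> events" for y
  proof -
    have "(\<lambda>x. f (X x)) -` {y} \<inter> space M = X -` (f -` {y}) \<inter> space M" by auto
    then show ?thesis using m by simp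
  qed
  have q: "?q y = (\<Sum>a | a \<in> ?A \<and> f a = y. ?p a)" for y
  proof -
    have "?q y = (\<Sum>a\<in>?A. prob ((\<lambda>x. f (X x)) -` {y} \<inter> space M \<inter> (X -` {a} \<inter> space M)))"
      by (rule prob_sum_fibres[OF X A order_refl ev])
    also have "\<dots> = (\<Sum>a\<in>?A. if f a = y then ?p a else 0)"
    proof (intro sum.cong refl)
      fix a
      have "(\<lambda>x. f (X x)) -` {y} \<inter> space M \<inter> (X -` {a} \<inter> space M) = (if f a = y then X -` {a} \<inter> space M else {})"
        by auto
      then show "prob ((\<lambda>x. f (X x)) -` {y} \<inter> space M \<inter> (X -` {a} \<inter> space M)) = (if f a = y then ?p a else 0)"
        by simp
    qed
    finally show ?thesis using A by (simp add: sum.If_cases Int_def)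
  qed
  have "(\<lambda>x. f (X x)) ` space M = f ` ?A" by auto
  then have "ent (\<lambda>x. f (X x)) = (\<Sum>y\<in>f ` ?A. - (\<Sum>a | a \<in> ?A \<and> f a = y. ?p a) * ln (?q y))"
    unfolding ent_def entropy_term_def by (simp add: q)
  also have "\<dots> = (\<Sum>y\<in>f ` ?A. \<Sum>a | a \<in> ?A \<and> f a = y. - (?p a * ln (?q (f a))))"
    by (intro sum.cong refl) (simp add: sum_distrib_right sum_negf)
  also have "\<dots> = (\<Sum>a\<in>?A. - (?p a * ln (?q (f a))))"
    using sum.image_gen[OF A, of "\<lambda>a. - (?p a * ln (?q (f a)))" f] by simp
  also have "\<dots> \<le> ent X" unfolding ent_def entropy_term_def
  proof (rule sum_mono)
    fix a assume a: "a \<in> ?A"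
    show "- (?p a * ln (?q (f a))) \<le> - (?p a * ln (?p a))"
    proof (cases "?p a = 0")
      case False
      then have pa: "0 < ?p a" using measure_nonneg[of M] by (metis less_eq_real_def)
      have "?p a \<le> ?q (f a)" by (intro finite_measure_mono ev) auto
      then show ?thesis using pa by (simp add: mult_left_mono)
    qed simp
  qed
  finally show ?thesis .
qed

text \<open>Nonnegativity of the conditional mutual information of \<open>X\<close> and
  \<open>Z\<close> given \<open>Y\<close>: for each triple use \<open>ln t \<le> t - 1\<close> with
  \<open>t\<close> the ratio of \<open>rab a b * rbc b c\<close> to \<open>rb b * r a b c\<close>,
  then sum with the weights \<open>r a b c\<close>.\<close>

lemma ent_strong_subadditive:
  assumes X: "simple_function M X" and Y: "simple_function M Y" and Z: "simple_function M Z"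
  shows "ent (\<lambda>x. (X x, Y x, Z x)) + ent Y \<le> ent (\<lambda>x. (X x, Y x)) + ent (\<lambda>x. (Y x, Z x))"
proof -
  let ?A = "X ` space M" and ?B = "Y ` space M" and ?C = "Z ` space M"
  have fin: "finite ?A" "finite ?B" "finite ?C" using X Y Z by (auto dest: simple_functionD)
  define UX where "UX a = X -` {a} \<inter> space M" for a
  define UY where "UY b = Y -` {b} \<inter> space M" for b
  define UZ where "UZ c = Z -` {c} \<inter> space M" for c
  have ev[simp]: "UX a \<in> events" "UY b \<in> events" "UZ c \<in> events" for a b c
    unfolding UX_def UY_def UZ_def using X Y Z by (auto dest: simple_functionD)
  define r where "r a b c = prob (UX a \<inter> UY b \<inter> UZ c)" for a b c
  define rab where "rab a b = prob (UX a \<inter> UY b)" for a b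
  define rbc where "rbc b c = prob (UY b \<inter> UZ c)" for b c
  define rb where "rb b = prob (UY b)" for b
  have nn: "0 \<le> r a b c" "0 \<le> rab a b" "0 \<le> rbc b c" "0 \<le> rb b" for a b c
    by (auto simp: r_def rab_def rbc_def rb_def)
  have s_c: "rab a b = (\<Sum>c\<in>?C. r a b c)" for a b
    unfolding rab_def r_def UZ_def by (rule prob_sum_fibres[OF Z fin(3) order_refl]) (intro sets.Int ev)
  have s_a: "rbc b c = (\<Sum>a\<in>?A. r a b c)" for b c
  proof -
    have "rbc b c = (\<Sum>a\<in>?A. prob ((UY b \<inter> UZ c) \<inter> (X -` {a} \<inter> space M)))"
      unfolding rbc_def by (rule prob_sum_fibres[OF X fin(1) order_refl]) (intro sets.Int ev)
    then show ?thesis unfolding r_def UX_def[symmetric] by (simp add: Int_ac)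
  qed
  have sb_a: "rb b = (\<Sum>a\<in>?A. rab a b)" for b
  proof -
    have "rb b = (\<Sum>a\<in>?A. prob (UY b \<inter> (X -` {a} \<inter> space M)))"
      unfolding rb_def by (rule prob_sum_fibres[OF X fin(1) order_refl]) (intro sets.Int ev)
    then show ?thesis unfolding rab_def UX_def[symmetric] by (simp add: Int_ac)
  qed
  have sb_c: "rb b = (\<Sum>c\<in>?C. rbc b c)" for b
    unfolding rb_def rbc_def UZ_def by (rule prob_sum_fibres[OF Z fin(3) order_refl]) (intro sets.Int ev)
  have pos: "0 < rab a b \<and> 0 < rbc b c \<and> 0 < rb b" if "0 < r a b c" for a b c
  proof -
    have "r a b c \<le> rab a b" "r a b c \<le> rbc b c" "r a b c \<le> rb b"
      unfolding r_def rab_def rbc_def rb_def by (auto intro!: finite_measure_mono)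
    then show ?thesis using that by linarith
  qed
  have eXYZ: "ent (\<lambda>x. (X x, Y x, Z x)) = (\<Sum>a\<in>?A. \<Sum>b\<in>?B. \<Sum>c\<in>?C. - (r a b c * ln (r a b c)))"
  proof -
    have "ent (\<lambda>x. (X x, Y x, Z x)) = (\<Sum>t\<in>?A \<times> ?B \<times> ?C. entropy_term (prob ((\<lambda>x. (X x, Y x, Z x)) -` {t} \<inter> space M)))"
      by (rule ent_superset) (use fin in auto)
    also have "\<dots> = (\<Sum>(a, b, c)\<in>?A \<times> ?B \<times> ?C. - (r a b c * ln (r a b c)))"
    proof (intro sum.cong refl, clarify)
      fix a b c
      have "(\<lambda>x. (X x, Y x, Z x)) -` {(a, b, c)} \<inter> space M = UX a \<inter> UY b \<inter> UZ c"
        by (auto simp: UX_def UY_def UZ_def)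
      then show "entropy_term (prob ((\<lambda>x. (X x, Y x, Z x)) -` {(a, b, c)} \<inter> space M)) = - (r a b c * ln (r a b c))"
        by (simp add: r_def entropy_term_def)
    qed
    finally show ?thesis by (simp add: sum.cartesian_product')
  qed
  have eXY: "ent (\<lambda>x. (X x, Y x)) = (\<Sum>a\<in>?A. \<Sum>b\<in>?B. - (rab a b * ln (rab a b)))"
  proof -
    have "ent (\<lambda>x. (X x, Y x)) = (\<Sum>t\<in>?A \<times> ?B. entropy_term (prob ((\<lambda>x. (X x, Y x)) -` {t} \<inter> space M)))"
      by (rule ent_superset) (use fin in auto)
    also have "\<dots> = (\<Sum>(a, b)\<in>?A \<times> ?B. - (rab a b * ln (rab a b)))"
    proof (intro sum.cong refl, clarify)
      fix a b
      have "(\<lambda>x. (X x, Y x)) -` {(a, b)} \<inter> space M = UX a \<inter> UY b" by (auto simp: UX_def UY_def)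
      then show "entropy_term (prob ((\<lambda>x. (X x, Y x)) -` {(a, b)} \<inter> space M)) = - (rab a b * ln (rab a b))"
        by (simp add: rab_def entropy_term_def)
    qed
    finally show ?thesis by (simp add: sum.cartesian_product')
  qed
  have eYZ: "ent (\<lambda>x. (Y x, Z x)) = (\<Sum>b\<in>?B. \<Sum>c\<in>?C. - (rbc b c * ln (rbc b c)))"
  proof -
    have "ent (\<lambda>x. (Y x, Z x)) = (\<Sum>t\<in>?B \<times> ?C. entropy_term (prob ((\<lambda>x. (Y x, Z x)) -` {t} \<inter> space M)))"
      by (rule ent_superset) (use fin in auto)
    also have "\<dots> = (\<Sum>(b, c)\<in>?B \<times> ?C. - (rbc b c * ln (rbc b c)))"
    proof (intro sum.cong refl, clarify)
      fix b c
      have "(\<lambda>x. (Y x, Z x)) -` {(b, c)} \<inter> space M = UY b \<inter> UZ c" by (auto simp: UY_def UZ_def)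
      then show "entropy_term (prob ((\<lambda>x. (Y x, Z x)) -` {(b, c)} \<inter> space M)) = - (rbc b c * ln (rbc b c))"
        by (simp add: rbc_def entropy_term_def)
    qed
    finally show ?thesis by (simp add: sum.cartesian_product')
  qed
  have eY: "ent Y = (\<Sum>b\<in>?B. - (rb b * ln (rb b)))"
    unfolding ent_def entropy_term_def rb_def UY_def ..
  have pw: "r a b c * ln (rab a b) + r a b c * ln (rbc b c) - r a b c * ln (rb b) - r a b c * ln (r a b c)
      \<le> rab a b * rbc b c / rb b - r a b c" for a b c
  proof (cases "r a b c = 0")
    case False
    then have r: "0 < r a b c" using nn(1)[of a b c] by linarith
    note p = pos[OF r]
    let ?t = "rab a b * rbc b c / (rb b * r a b c)"
    have "ln ?t \<le> ?t - 1" using p r by (intro ln_le_minus_one) auto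
    then have "r a b c * ln ?t \<le> r a b c * (?t - 1)" using r by (intro mult_left_mono) auto
    also have "\<dots> = rab a b * rbc b c / rb b - r a b c" using r p by (simp add: field_simps)
    finally show ?thesis using p r by (simp add: ln_div ln_mult algebra_simps)
  qed (use nn in auto)
  have "(\<Sum>a\<in>?A. \<Sum>b\<in>?B. \<Sum>c\<in>?C. r a b c * ln (rab a b) + r a b c * ln (rbc b c) - r a b c * ln (rb b) - r a b c * ln (r a b c))
    \<le> (\<Sum>a\<in>?A. \<Sum>b\<in>?B. \<Sum>c\<in>?C. rab a b * rbc b c / rb b - r a b c)"
    by (intro sum_mono pw)
  also have "\<dots> = (\<Sum>a\<in>?A. \<Sum>b\<in>?B. \<Sum>c\<in>?C. rab a b * rbc b c / rb b) - (\<Sum>a\<in>?A. \<Sum>b\<in>?B. \<Sum>c\<in>?C. r a b c)"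
    by (simp add: sum_subtractf)
  \<comment> \<open>If \<open>rb b = 0\<close>, division by zero yields 0, the right value because
    \<open>rab a b \<le> rb b\<close>.\<close>
  also have "(\<Sum>a\<in>?A. \<Sum>b\<in>?B. \<Sum>c\<in>?C. rab a b * rbc b c / rb b) = (\<Sum>a\<in>?A. \<Sum>b\<in>?B. rab a b)"
  proof (intro sum.cong refl)
    fix a b
    have "(\<Sum>c\<in>?C. rab a b * rbc b c / rb b) = rab a b * rb b / rb b"
      by (simp add: sb_c sum_distrib_left[symmetric] sum_divide_distrib[symmetric])
    moreover have "rab a b \<le> rb b" unfolding rab_def rb_def by (intro finite_measure_mono) auto
    ultimately show "(\<Sum>c\<in>?C. rab a b * rbc b c / rb b) = rab a b"
      using nn(2)[of a b] by (cases "rb b = 0") auto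
  qed
  also have "(\<Sum>a\<in>?A. \<Sum>b\<in>?B. rab a b) - (\<Sum>a\<in>?A. \<Sum>b\<in>?B. \<Sum>c\<in>?C. r a b c) = 0" by (simp add: s_c)
  finally have main: "(\<Sum>a\<in>?A. \<Sum>b\<in>?B. \<Sum>c\<in>?C. r a b c * ln (rab a b)) + (\<Sum>a\<in>?A. \<Sum>b\<in>?B. \<Sum>c\<in>?C. r a b c * ln (rbc b c))
     - (\<Sum>a\<in>?A. \<Sum>b\<in>?B. \<Sum>c\<in>?C. r a b c * ln (rb b)) - (\<Sum>a\<in>?A. \<Sum>b\<in>?B. \<Sum>c\<in>?C. r a b c * ln (r a b c)) \<le> 0"
    by (simp add: sum.distrib sum_subtractf)
  have 1: "(\<Sum>a\<in>?A. \<Sum>b\<in>?B. \<Sum>c\<in>?C. r a b c * ln (rab a b)) = - ent (\<lambda>x. (X x, Y x))"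
    unfolding eXY by (simp add: s_c sum_distrib_right sum_negf)
  have 2: "(\<Sum>a\<in>?A. \<Sum>b\<in>?B. \<Sum>c\<in>?C. r a b c * ln (rbc b c)) = - ent (\<lambda>x. (Y x, Z x))"
  proof -
    have "(\<Sum>a\<in>?A. \<Sum>b\<in>?B. \<Sum>c\<in>?C. r a b c * ln (rbc b c)) = (\<Sum>b\<in>?B. \<Sum>c\<in>?C. \<Sum>a\<in>?A. r a b c * ln (rbc b c))"
      by (subst sum.swap, intro sum.cong refl, rule sum.swap)
    then show ?thesis unfolding eYZ by (simp add: s_a sum_distrib_right sum_negf)
  qed
  have 3: "(\<Sum>a\<in>?A. \<Sum>b\<in>?B. \<Sum>c\<in>?C. r a b c * ln (rb b)) = - ent Y"
  proof -
    have "(\<Sum>a\<in>?A. \<Sum>b\<in>?B. \<Sum>c\<in>?C. r a b c * ln (rb b)) = (\<Sum>b\<in>?B. \<Sum>a\<in>?A. \<Sum>c\<in>?C. r a b c * ln (rb b))"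
      by (rule sum.swap)
    then show ?thesis unfolding eY by (simp add: sb_a s_c sum_distrib_right sum_negf)
  qed
  have 4: "(\<Sum>a\<in>?A. \<Sum>b\<in>?B. \<Sum>c\<in>?C. r a b c * ln (r a b c)) = - ent (\<lambda>x. (X x, Y x, Z x))"
    unfolding eXYZ by (simp add: sum_negf)
  show ?thesis using main unfolding 1 2 3 4 by linarith
qed

lemma ent_const: "ent (\<lambda>x. c) = 0"
proof -
  have "ent (\<lambda>x. c) = (\<Sum>x\<in>{c}. entropy_term (prob ((\<lambda>x. c) -` {x} \<inter> space M)))"
    by (rule ent_superset) auto
  then show ?thesis by (simp add: prob_space entropy_term_def)
qed

lemma ent_le_compose:
  assumes "simple_function M Y" "\<And>x. x \<in> space M \<Longrightarrow> X x = f (Y x)"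
  shows "ent X \<le> ent Y"
proof -
  have "X -` {a} \<inter> space M = (\<lambda>x. f (Y x)) -` {a} \<inter> space M" for a using assms(2) by auto
  moreover have "X ` space M = (\<lambda>x. f (Y x)) ` space M" using assms(2) by auto
  ultimately have "ent X = ent (\<lambda>x. f (Y x))" by (simp add: ent_def)
  then show ?thesis using ent_data_processing[OF assms(1)] by simp
qed

lemma ent_eqI:
  assumes "simple_function M X" "simple_function M Y"
    and "\<And>x. x \<in> space M \<Longrightarrow> X x = f (Y x)" "\<And>x. x \<in> space M \<Longrightarrow> Y x = g (X x)"
  shows "ent X = ent Y"
proof -
  have "ent X \<le> ent Y" by (rule ent_le_compose[where f = f]) (use assms in auto)
  moreover have "ent Y \<le> ent X" by (rule ent_le_compose[where f = g]) (use assms in auto)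
  ultimately show ?thesis by simp
qed

text \<open>Strong subadditivity with a constant as middle variable.\<close>

lemma ent_subadditive:
  assumes "simple_function M X" "simple_function M Z"
  shows "ent (\<lambda>x. (X x, Z x)) \<le> ent X + ent Z"
proof -
  have c: "simple_function M (\<lambda>_. ())" by simp
  have "ent (\<lambda>x. (X x, (), Z x)) + ent (\<lambda>_. ()) \<le> ent (\<lambda>x. (X x, ())) + ent (\<lambda>x. ((), Z x))"
    by (rule ent_strong_subadditive[OF assms(1) c assms(2)])
  moreover have "ent (\<lambda>x. (X x, (), Z x)) = ent (\<lambda>x. (X x, Z x))"
    by (rule ent_eqI[where f = "\<lambda>(a, b). (a, (), b)" and g = "\<lambda>(a, _, b). (a, b)"])
      (use assms in \<open>auto intro!: simple_function_Pair\<close>)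
  moreover have "ent (\<lambda>x. (X x, ())) = ent X"
    by (rule ent_eqI[where f = "\<lambda>a. (a, ())" and g = fst]) (use assms in \<open>auto intro!: simple_function_Pair\<close>)
  moreover have "ent (\<lambda>x. ((), Z x)) = ent Z"
    by (rule ent_eqI[where f = "\<lambda>a. ((), a)" and g = snd]) (use assms in \<open>auto intro!: simple_function_Pair\<close>)
  ultimately show ?thesis by (simp add: ent_const)
qed

text \<open>A crude form of Fano's inequality for the conditional entropy of \<open>X\<close> given
  \<open>Z\<close>. Each off-diagonal pair has probability at most \<open>\<epsilon>\<close> and
  contributes at most \<open>2 * sqrt \<epsilon>\<close>; a diagonal pair contributes at most
  \<open>rz a - r a a\<close>, and these sum to the probability of
  \<open>X \<noteq> Z\<close>.\<close>

lemma ent_pair_approx: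
  assumes X: "simple_function M X" and Z: "simple_function M Z" and P: "finite P"
    and in_P: "X ` space M \<subseteq> P" "Z ` space M \<subseteq> P"
    and e: "prob {x\<in>space M. X x \<noteq> Z x} \<le> \<epsilon>"
  shows "ent (\<lambda>x. (X x, Z x)) - ent Z \<le> 2 * (real (card P))\<^sup>2 * sqrt \<epsilon> + \<epsilon>"
proof -
  define UX where "UX a = X -` {a} \<inter> space M" for a
  define UZ where "UZ b = Z -` {b} \<inter> space M" for b
  have ev[simp]: "UX a \<in> events" "UZ b \<in> events" for a b
    unfolding UX_def UZ_def using X Z by (auto dest: simple_functionD)
  have ne: "{x\<in>space M. X x \<noteq> Z x} \<in> events"
  proof -
    have "{x\<in>space M. X x \<noteq> Z x} = (\<Union>a\<in>P. UX a - UZ a)"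
      using in_P by (auto simp: UX_def UZ_def)
    then show ?thesis using P by (simp only:) (intro sets.finite_UN sets.Diff ev)
  qed
  have e0: "0 \<le> \<epsilon>" using e measure_nonneg order_trans by blast
  define r where "r a b = prob (UX a \<inter> UZ b)" for a b
  define rz where "rz b = prob (UZ b)" for b
  have r0: "0 \<le> r a b" "0 \<le> rz b" "r a b \<le> rz b" for a b
    unfolding r_def rz_def by (auto intro!: finite_measure_mono)
  have rz: "rz b = (\<Sum>a\<in>P. r a b)" for b
  proof -
    have "rz b = (\<Sum>a\<in>P. prob (UZ b \<inter> (X -` {a} \<inter> space M)))"
      unfolding rz_def by (rule prob_sum_fibres[OF X P in_P(1)]) (intro ev)
    then show ?thesis unfolding r_def UX_def[symmetric] by (simp add: Int_ac)
  qed
  have "ent (\<lambda>x. (X x, Z x)) = (\<Sum>t\<in>P \<times> P. entropy_term (prob ((\<lambda>x. (X x, Z x)) -` {t} \<inter> space M)))"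
    by (rule ent_superset) (use P in_P in auto)
  also have "\<dots> = (\<Sum>(a, b)\<in>P \<times> P. entropy_term (r a b))"
  proof (intro sum.cong refl, clarify)
    fix a b
    have "(\<lambda>x. (X x, Z x)) -` {(a, b)} \<inter> space M = UX a \<inter> UZ b" by (auto simp: UX_def UZ_def)
    then show "entropy_term (prob ((\<lambda>x. (X x, Z x)) -` {(a, b)} \<inter> space M)) = entropy_term (r a b)"
      by (simp add: r_def)
  qed
  finally have 1: "ent (\<lambda>x. (X x, Z x)) = (\<Sum>a\<in>P. \<Sum>b\<in>P. entropy_term (r a b))"
    by (simp add: sum.cartesian_product')
  have "ent Z = (\<Sum>b\<in>P. entropy_term (rz b))"
    unfolding rz_def UZ_def by (rule ent_superset[OF P in_P(2)])
  also have "\<dots> = (\<Sum>b\<in>P. \<Sum>a\<in>P. - (r a b * ln (rz b)))"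
    unfolding entropy_term_def by (simp add: rz sum_distrib_right sum_negf)
  also have "\<dots> = (\<Sum>a\<in>P. \<Sum>b\<in>P. - (r a b * ln (rz b)))" by (rule sum.swap)
  finally have 2: "ent Z = (\<Sum>a\<in>P. \<Sum>b\<in>P. - (r a b * ln (rz b)))" .
  have "ent (\<lambda>x. (X x, Z x)) - ent Z = (\<Sum>a\<in>P. \<Sum>b\<in>P. entropy_term (r a b) + r a b * ln (rz b))"
    unfolding 1 2 by (simp add: sum.distrib sum_negf)
  also have "\<dots> \<le> (\<Sum>a\<in>P. \<Sum>b\<in>P. 2 * sqrt \<epsilon> + (if a = b then rz a - r a a else 0))"
  proof (intro sum_mono)
    fix a b
    show "entropy_term (r a b) + r a b * ln (rz b) \<le> 2 * sqrt \<epsilon> + (if a = b then rz a - r a a else 0)"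
    proof (cases "r a b = 0")
      case False
      then have r: "0 < r a b" "0 < rz b" using r0(1)[of a b] r0(3)[of a b] by linarith+
      show ?thesis
      proof (cases "a = b")
        case True
        have "ln (rz b / r a b) \<le> rz b / r a b - 1" using r by (intro ln_le_minus_one) auto
        then have "r a b * ln (rz b / r a b) \<le> r a b * (rz b / r a b - 1)" using r by (intro mult_left_mono) auto
        also have "\<dots> = rz b - r a b" using r by (simp add: field_simps)
        finally have "entropy_term (r a b) + r a b * ln (rz b) \<le> rz b - r a b"
          using r by (simp add: ln_div entropy_term_def algebra_simps)
        then show ?thesis using True e0 by (simp add: add_increasing)
      next
        case ab: False
        have "rz b \<le> 1" unfolding rz_def by simp
        then have "r a b * ln (rz b) \<le> 0" using r by (simp add: mult_nonneg_nonpos)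
        moreover have "entropy_term (r a b) \<le> 2 * sqrt (r a b)" using r by (intro entropy_term_le_sqrt) auto
        moreover have "r a b \<le> \<epsilon>"
        proof -
          have "r a b \<le> prob {x\<in>space M. X x \<noteq> Z x}"
            unfolding r_def using ab ne by (intro finite_measure_mono) (auto simp: UX_def UZ_def)
          then show ?thesis using e by linarith
        qed
        then have "sqrt (r a b) \<le> sqrt \<epsilon>" by (rule real_sqrt_le_mono)
        ultimately have "entropy_term (r a b) + r a b * ln (rz b) \<le> 2 * sqrt \<epsilon>" by linarith
        then show ?thesis using ab by simp
      qed
    qed (use e0 r0(3)[of a a] in auto)
  qed
  also have "\<dots> = 2 * (real (card P))\<^sup>2 * sqrt \<epsilon> + (\<Sum>a\<in>P. rz a - r a a)"
    using P by (simp add: sum.distrib sum.delta power2_eq_square)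
  also have "(\<Sum>a\<in>P. rz a - r a a) = (\<Sum>a\<in>P. prob (UZ a - UX a))"
  proof (intro sum.cong refl)
    fix a
    have "prob (UZ a - UX a) = prob (UZ a) - prob (UZ a \<inter> UX a)" by (rule finite_measure_Diff') auto
    then show "rz a - r a a = prob (UZ a - UX a)" by (simp add: rz_def r_def Int_commute)
  qed
  also have "\<dots> = prob (\<Union>a\<in>P. UZ a - UX a)"
  proof (rule finite_measure_finite_Union[symmetric, OF P])
    show "(\<lambda>a. UZ a - UX a) ` P \<subseteq> events" by (intro image_subsetI sets.Diff ev)
    show "disjoint_family_on (\<lambda>a. UZ a - UX a) P" by (auto simp: disjoint_family_on_def UZ_def)
  qed
  also have "\<dots> \<le> prob {x\<in>space M. X x \<noteq> Z x}"
    using ne by (intro finite_measure_mono) (auto simp: UX_def UZ_def)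
  also have "\<dots> \<le> \<epsilon>" by (rule e)
  finally show ?thesis by simp
qed

end

text \<open>Fekete's lemma; the limit is the infimum of the quotients. It makes the
  \<open>lim\<close> in \<open>measure_entropy\<close> a genuine limit for every partition. In the
  proof \<open>B\<close> bounds the remainder after division by \<open>k\<close>.\<close>

lemma subadditive_limit:
  fixes a :: "nat \<Rightarrow> real"
  assumes sub: "\<And>m n. a (m + n) \<le> a m + a n" and nn: "\<And>n. 0 \<le> a n"
  shows "\<exists>l. (\<lambda>n. 1 / real n * a n) \<longlonglongrightarrow> l"
proof -
  let ?R = "(\<lambda>n. a n / real n) ` {1..}"
  define l where "l = Inf ?R"
  have bdd: "bdd_below ?R" using nn by (intro bdd_belowI[of _ 0]) auto
  have low: "l \<le> a n / real n" if "n \<ge> 1" for n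
    unfolding l_def using that by (intro cInf_lower bdd) auto
  have mult: "a (q * k) \<le> real q * a k" if "q \<ge> 1" for q k
    using that
  proof (induction q rule: dec_induct)
    case (step q)
    have "a (Suc q * k) \<le> a k + a (q * k)" using sub[of k "q * k"] by simp
    then show ?case using step by (simp add: algebra_simps)
  qed simp
  have "(\<lambda>n. 1 / real n * a n) \<longlonglongrightarrow> l"
  proof (rule tendstoI)
    fix \<epsilon> :: real assume e: "0 < \<epsilon>"
    have "l < l + \<epsilon> / 2" using e by simp
    then obtain k where k: "k \<ge> 1" "a k / real k < l + \<epsilon> / 2"
      unfolding l_def using cInf_lessD[of ?R "Inf ?R + \<epsilon> / 2"] by auto
    define B where "B = (\<Sum>r<k. a r) + a 0"
    have B: "a r \<le> B" if "r < k" for r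
      unfolding B_def using that member_le_sum[of r "{..<k}" a] nn by (auto intro: add_increasing2)
    obtain N where N: "N \<ge> 1" "N \<ge> k" "2 * B / \<epsilon> < real N"
      using reals_Archimedean2[of "max (real k) (2 * B / \<epsilon>)"] k by (metis le_trans less_imp_le_nat max_less_iff_conj of_nat_less_iff)
    have "\<forall>n\<ge>N. dist (1 / real n * a n) l < \<epsilon>"
    proof (intro allI impI)
      fix n assume n: "n \<ge> N"
      then have n0: "n \<ge> 1" "real n > 0" using N by auto
      have q1: "n div k \<ge> 1" using n N k by (simp add: div_greater_zero_iff Suc_le_eq)
      have "a n \<le> a (n div k * k) + a (n mod k)" using sub[of "n div k * k" "n mod k"] by simp
      also have "\<dots> \<le> real (n div k) * a k + B"
        using mult[OF q1, of k] B[of "n mod k"] k by (intro add_mono) auto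
      also have "\<dots> \<le> real n * (a k / real k) + B"
      proof -
        have "real (n div k) * real k \<le> real n" by (metis div_times_less_eq_dividend of_nat_le_iff of_nat_mult)
        then have "real (n div k) * real k * (a k / real k) \<le> real n * (a k / real k)"
          using nn k by (intro mult_right_mono) auto
        then show ?thesis using k by simp
      qed
      finally have "a n / real n \<le> a k / real k + B / real n"
        using n0 by (simp add: field_simps)
      moreover have "B / real n < \<epsilon> / 2"
      proof -
        have "2 * B / \<epsilon> < real n" using N n by (meson less_le_trans of_nat_le_iff)
        then show ?thesis using e n0 by (simp add: field_simps)
      qed
      ultimately have "a n / real n < l + \<epsilon>" using k by linarith
      then show "dist (1 / real n * a n) l < \<epsilon>" using low[OF n0(1)] by (simp add: dist_real_def)
    qed
    then show "\<forall>\<^sub>F n in sequentially. dist (1 / real n * a n) l < \<epsilon>" by (auto simp: eventually_sequentially)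
  qed
  then show ?thesis by blast
qed

section \<open>Names of orbits and iterated joins of a partition\<close>

locale measure_preserving = prob_space M for M :: "'b measure" +
  fixes T :: "'b \<Rightarrow> 'b"
  assumes T_meas[measurable]: "T \<in> measurable M M"
    and T_prob: "\<And>A. A \<in> sets M \<Longrightarrow> measure M (T -` A \<inter> space M) = measure M A"
begin

lemma Tn_meas[measurable]: "(T ^^ n) \<in> measurable M M"
  by (induction n) (auto simp: funpow_Suc_right intro: measurable_comp measurable_ident)

lemma Tn_space: "x \<in> space M \<Longrightarrow> (T ^^ n) x \<in> space M"
  using measurable_space[OF Tn_meas] .

lemma Tn_prob: "A \<in> sets M \<Longrightarrow> measure M ((T ^^ n) -` A \<inter> space M) = measure M A"
proof (induction n)
  case (Suc n)
  have "(T ^^ Suc n) -` A \<inter> space M = T -` ((T ^^ n) -` A \<inter> space M) \<inter> space M"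
    using measurable_space[OF T_meas] by (auto simp: funpow_Suc_right simp del: funpow.simps)
  then show ?case using T_prob[OF measurable_sets[OF Tn_meas Suc.prems]] Suc by (simp only:)
qed simp

lemma simple_Tn: "simple_function M X \<Longrightarrow> simple_function M (\<lambda>x. X ((T ^^ n) x))"
proof -
  assume X: "simple_function M X"
  show ?thesis unfolding simple_function_def
  proof (intro conjI ballI)
    show "finite ((\<lambda>x. X ((T ^^ n) x)) ` space M)"
      by (rule finite_subset[OF _ simple_functionD(1)[OF X]]) (auto simp: Tn_space)
    fix y
    have "(\<lambda>x. X ((T ^^ n) x)) -` {y} \<inter> space M = (T ^^ n) -` (X -` {y} \<inter> space M) \<inter> space M"
      by (auto simp: Tn_space)
    then show "(\<lambda>x. X ((T ^^ n) x)) -` {y} \<inter> space M \<in> sets M"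
      using measurable_sets[OF Tn_meas simple_functionD(2)[OF X]] by simp
  qed
qed

lemma ent_Tn: "simple_function M X \<Longrightarrow> ent (\<lambda>x. X ((T ^^ n) x)) = ent X"
proof -
  assume X: "simple_function M X"
  have "ent (\<lambda>x. X ((T ^^ n) x)) = (\<Sum>x\<in>X ` space M. entropy_term (prob ((\<lambda>x. X ((T ^^ n) x)) -` {x} \<inter> space M)))"
    by (rule ent_superset[OF simple_functionD(1)[OF X]]) (auto simp: Tn_space)
  also have "\<dots> = ent X" unfolding ent_def
  proof (intro sum.cong refl)
    fix y
    have "(\<lambda>x. X ((T ^^ n) x)) -` {y} \<inter> space M = (T ^^ n) -` (X -` {y} \<inter> space M) \<inter> space M"
      by (auto simp: Tn_space)
    then show "entropy_term (prob ((\<lambda>x. X ((T ^^ n) x)) -` {y} \<inter> space M)) = entropy_term (prob (X -` {y} \<inter> space M))"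
      using Tn_prob[OF simple_functionD(2)[OF X]] by simp
  qed
  finally show ?thesis .
qed

text \<open>The itinerary of \<open>x\<close> during the first \<open>n\<close> steps. For
  \<open>X\<close> the cell of a partition, its fibres are the non-empty members of the iterated
  join.\<close>

definition name :: "('b \<Rightarrow> 'c) \<Rightarrow> nat \<Rightarrow> 'b \<Rightarrow> 'c list" where
  "name X n x = map (\<lambda>j. X ((T ^^ j) x)) [0..<n]"

lemma name_0[simp]: "name X 0 x = []" by (simp add: name_def)

lemma name_Suc: "name X (Suc n) x = name X n x @ [X ((T ^^ n) x)]" by (simp add: name_def)

lemma name_add: "name X (m + n) x = name X m x @ name X n ((T ^^ m) x)"
proof (induction n)
  case (Suc n)
  have "(T ^^ (m + n)) x = (T ^^ n) ((T ^^ m) x)" by (simp add: add.commute[of m n] funpow_add)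
  then show ?case using Suc by (simp add: name_Suc)
qed simp

lemma length_name[simp]: "length (name X n x) = n" by (simp add: name_def)

lemma simple_name: "simple_function M X \<Longrightarrow> simple_function M (name X n)"
proof (induction n)
  case 0
  have "name X 0 = (\<lambda>_. [])" by (rule ext) simp
  then show ?case by simp
next
  case (Suc n)
  have "name X (Suc n) = (\<lambda>x. case (name X n x, X ((T ^^ n) x)) of (l, a) \<Rightarrow> l @ [a])"
    by (rule ext) (simp add: name_Suc)
  then show ?case
    using simple_function_compose[OF simple_function_Pair[OF Suc.IH[OF Suc.prems] simple_Tn[OF Suc.prems]],
      of "\<lambda>(l, a). l @ [a]"] by (simp add: comp_def)
qed

lemma ent_name_limit:
  assumes X: "simple_function M X"
  shows "\<exists>l. (\<lambda>n. 1 / real n * ent (name X n)) \<longlonglongrightarrow> l"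
proof (rule subadditive_limit)
  have p: "0 \<le> entropy_term t" if "0 \<le> t" "t \<le> 1" for t
    using that by (cases "t = 0") (auto simp: entropy_term_def mult_nonneg_nonpos)
  show "0 \<le> ent (name X n)" for n unfolding ent_def by (intro sum_nonneg p) auto
  fix m n
  have s: "simple_function M (name X m)" "simple_function M (\<lambda>x. name X n ((T ^^ m) x))"
    using X by (auto intro: simple_name simple_Tn)
  have "ent (name X (m + n)) \<le> ent (\<lambda>x. (name X m x, name X n ((T ^^ m) x)))"
    by (rule ent_le_compose[where f = "\<lambda>(a, b). a @ b"]) (use s in \<open>auto intro!: simple_function_Pair simp: name_add\<close>)
  also have "\<dots> \<le> ent (name X m) + ent (\<lambda>x. name X n ((T ^^ m) x))" by (rule ent_subadditive[OF s])
  also have "ent (\<lambda>x. name X n ((T ^^ m) x)) = ent (name X n)" by (rule ent_Tn[OF simple_name[OF X]])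
  finally show "ent (name X (m + n)) \<le> ent (name X m) + ent (name X n)" .
qed

text \<open>The difference \<open>ent (\<lambda>x. (X x, Z x)) - ent Z\<close> is the conditional
  entropy of \<open>X\<close> given \<open>Z\<close>. Given the name of \<open>Z\<close>, each
  letter of the name of \<open>X\<close> costs at most this much, by strong subadditivity and
  invariance.\<close>

lemma ent_name_le:
  assumes X: "simple_function M X" and Z: "simple_function M Z"
  shows "ent (name X n) \<le> ent (name Z n) + real n * (ent (\<lambda>x. (X x, Z x)) - ent Z)"
proof -
  let ?X = "\<lambda>n x. X ((T ^^ n) x)" and ?Z = "\<lambda>n x. Z ((T ^^ n) x)"
  have main: "ent (\<lambda>x. (name X n x, name Z n x)) \<le> ent (name Z n) + real n * (ent (\<lambda>x. (X x, Z x)) - ent Z)"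
  proof (induction n)
    case 0
    then show ?case by (simp add: ent_const)
  next
    case (Suc n)
    let ?V = "\<lambda>x. (name X n x, name Z n x)"
    have sX: "simple_function M (?X n)" and sZ: "simple_function M (?Z n)" using X Z by (auto intro: simple_Tn)
    have nX: "simple_function M (name X n)" and nZ: "simple_function M (name Z n)" using X Z by (auto intro: simple_name)
    have nX1: "simple_function M (name X (Suc n))" and nZ1: "simple_function M (name Z (Suc n))" using X Z by (auto intro: simple_name)
    have sV: "simple_function M ?V" by (rule simple_function_Pair[OF nX nZ])
    \<comment> \<open>The new letter of \<open>X\<close>, given the past and the new letter of
      \<open>Z\<close>, costs at most its entropy given the latter. In the next step the new letter
      of \<open>Z\<close>, given both pasts, costs at most its entropy given the past of
      \<open>Z\<close>.\<close>
    have 1: "ent (\<lambda>x. (?X n x, ?Z n x, ?V x)) + ent (?Z n) \<le> ent (\<lambda>x. (?X n x, ?Z n x)) + ent (\<lambda>x. (?Z n x, ?V x))"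
      by (rule ent_strong_subadditive[OF sX sZ sV])
    have 2: "ent (\<lambda>x. (?Z n x, name Z n x, name X n x)) + ent (name Z n) \<le>
        ent (\<lambda>x. (?Z n x, name Z n x)) + ent (\<lambda>x. (name Z n x, name X n x))"
      by (rule ent_strong_subadditive[OF sZ nZ nX])
    have 3: "ent (\<lambda>x. (?X n x, ?Z n x)) = ent (\<lambda>x. (X x, Z x))"
      using ent_Tn[OF simple_function_Pair[OF X Z], of n] .
    have 4: "ent (?Z n) = ent Z" by (rule ent_Tn[OF Z])
    have 5: "ent (\<lambda>x. (name X (Suc n) x, name Z (Suc n) x)) \<le> ent (\<lambda>x. (?X n x, ?Z n x, ?V x))"
      by (rule ent_le_compose[where f = "\<lambda>(a, b, c, d). (c @ [a], d @ [b])"])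
         (use sX sZ sV in \<open>auto intro!: simple_function_Pair simp: name_Suc\<close>)
    have 6: "ent (\<lambda>x. (?Z n x, ?V x)) = ent (\<lambda>x. (?Z n x, name Z n x, name X n x))"
      by (rule ent_eqI[where f = "\<lambda>(a, b, c). (a, c, b)" and g = "\<lambda>(a, b, c). (a, c, b)"])
         (use sZ nX nZ in \<open>auto intro!: simple_function_Pair\<close>)
    have 7: "ent (\<lambda>x. (?Z n x, name Z n x)) \<le> ent (name Z (Suc n))"
      by (rule ent_le_compose[where f = "\<lambda>l. (last l, butlast l)"]) (use nZ1 in \<open>auto simp: name_Suc\<close>)
    have 8: "ent (\<lambda>x. (name Z n x, name X n x)) = ent ?V"
      by (rule ent_eqI[where f = "\<lambda>(a, b). (b, a)" and g = "\<lambda>(a, b). (b, a)"])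
         (use nX nZ in \<open>auto intro!: simple_function_Pair\<close>)
    show ?case using 1 2 5 7 Suc unfolding 3 4 6 8 by (simp add: algebra_simps)
  qed
  have "ent (name X n) \<le> ent (\<lambda>x. (name X n x, name Z n x))"
    by (rule ent_le_compose[where f = fst]) (use X Z in \<open>auto intro!: simple_function_Pair simple_name\<close>)
  then show ?thesis using main by linarith
qed

definition cell :: "'b set set \<Rightarrow> 'b \<Rightarrow> 'b set" where
  "cell P x = (THE C. C \<in> P \<and> x \<in> C)"

context
  fixes P assumes P: "finite P" "P \<subseteq> sets M" "partition_on (space M) P"
begin

lemma cell_eq: "C \<in> P \<Longrightarrow> x \<in> C \<Longrightarrow> cell P x = C"
  unfolding cell_def
  using P(3) by (intro the_equality) (auto simp: partition_on_def disjoint_def)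

lemma cell_in: "x \<in> space M \<Longrightarrow> cell P x \<in> P \<and> x \<in> cell P x"
proof -
  assume "x \<in> space M"
  then obtain C where "C \<in> P" "x \<in> C" using P(3) by (auto simp: partition_on_def)
  then show ?thesis using cell_eq by auto
qed

lemma cell_vimage: "C \<in> P \<Longrightarrow> cell P -` {C} \<inter> space M = C"
  using cell_in cell_eq P(3) by (auto simp: partition_on_def)

lemma simple_cell: "simple_function M (cell P)"
  unfolding simple_function_def
proof (intro conjI ballI)
  show "finite (cell P ` space M)" using cell_in by (intro finite_subset[OF _ P(1)]) auto
  fix C assume "C \<in> cell P ` space M"
  then have "C \<in> P" using cell_in by auto
  then show "cell P -` {C} \<inter> space M \<in> sets M" using cell_vimage P(2) by auto
qed

lemma shannon_entropy_iterated_join: "shannon_entropy M (iterated_join M T P n) = ent (name (cell P) n)"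
proof -
  let ?F = "{..<n} \<rightarrow>\<^sub>E P"
  let ?c = "\<lambda>f. space M \<inter> (\<Inter>j<n. (T ^^ j) -` f j)"
  have finF: "finite ?F" using P by (intro finite_PiE) auto
  have pre: "name (cell P) n -` {map f [0..<n]} \<inter> space M = ?c f" if f: "f \<in> ?F" for f
  proof -
    have "name (cell P) n x = map f [0..<n] \<longleftrightarrow> (\<forall>j<n. (T ^^ j) x \<in> f j)" if x: "x \<in> space M" for x
    proof -
      have "cell P ((T ^^ j) x) = f j \<longleftrightarrow> (T ^^ j) x \<in> f j" if "j < n" for j
      proof -
        have "f j \<in> P" using f that by auto
        then show ?thesis using cell_in[OF Tn_space[OF x, of j]] cell_eq[of "f j"] by auto
      qed
      then show ?thesis by (auto simp: name_def)
    qed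
    then show ?thesis by auto
  qed
  have "ent (name (cell P) n) = (\<Sum>l\<in>(\<lambda>f. map f [0..<n]) ` ?F. entropy_term (prob (name (cell P) n -` {l} \<inter> space M)))"
  proof (rule ent_superset)
    show "name (cell P) n ` space M \<subseteq> (\<lambda>f. map f [0..<n]) ` ?F"
    proof
      fix l assume "l \<in> name (cell P) n ` space M"
      then obtain x where x: "x \<in> space M" "l = name (cell P) n x" by auto
      have "(\<lambda>j\<in>{..<n}. cell P ((T ^^ j) x)) \<in> ?F" using cell_in[OF Tn_space[OF x(1)]] by auto
      moreover have "l = map (\<lambda>j\<in>{..<n}. cell P ((T ^^ j) x)) [0..<n]" by (simp add: x name_def)
      ultimately show "l \<in> (\<lambda>f. map f [0..<n]) ` ?F" by blast
    qed
  qed (use finF in auto)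
  also have "\<dots> = (\<Sum>f\<in>?F. entropy_term (prob (name (cell P) n -` {map f [0..<n]} \<inter> space M)))"
  proof (rule sum.reindex_cong[OF _ refl refl])
    show "inj_on (\<lambda>f. map f [0..<n]) ?F"
    proof (rule inj_onI)
      fix f g assume fg: "f \<in> ?F" "g \<in> ?F" "map f [0..<n] = map g [0..<n]"
      then show "f = g" by (intro PiE_ext[of f "{..<n}" "\<lambda>_. P" g]) auto
    qed
  qed
  also have "\<dots> = (\<Sum>f\<in>?F. entropy_term (prob (?c f)))" by (intro sum.cong refl) (simp add: pre)
  \<comment> \<open>The join is a set of sets, so equal cells are counted once. Different
    \<open>f\<close> can only produce the same set if it is empty, and the empty set has no
    entropy.\<close>
  also have "\<dots> = (\<Sum>C\<in>?c ` ?F. entropy_term (prob C))"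
  proof (rule sum.reindex_nontrivial[OF finF, unfolded comp_def, symmetric])
    fix f g assume fg: "f \<in> ?F" "g \<in> ?F" "f \<noteq> g" "?c f = ?c g"
    have "?c f = {}"
    proof (rule ccontr)
      assume "?c f \<noteq> {}"
      then obtain x where x: "x \<in> ?c f" by blast
      then have "x \<in> ?c g" using fg(4) by simp
      then have "map f [0..<n] = map g [0..<n]"
        using x unfolding pre[OF fg(1), symmetric] pre[OF fg(2), symmetric] by simp
      then have "f = g" using fg by (intro PiE_ext[of f "{..<n}" "\<lambda>_. P" g]) auto
      then show False using fg by simp
    qed
    then show "entropy_term (prob (?c f)) = 0" by simp
  qed
  finally show ?thesis
    unfolding shannon_entropy_def iterated_join_def entropy_term_def by (simp add: sum_negf)
qed

end

end

subsection \<open>Bernoulli shifts\<close>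

locale bernoulli_shift = prob_space p for p :: "'a measure" +
  fixes S :: "'a set"
  assumes finite_S: "finite S" and sets_p: "sets p = sets (count_space S)"
begin

abbreviation "\<beta> \<equiv> stream_space p"

definition shift_entropy :: real where "shift_entropy = (\<Sum>a\<in>S. entropy_term (measure p {a}))"

lemma space_p: "space p = S" using sets_eq_imp_space_eq[OF sets_p] by simp

lemma S_nonempty: "S \<noteq> {}" using not_empty space_p by simp

lemma space_\<beta>: "space \<beta> = streams S" by (simp add: space_stream_space space_p)

lemma sets_\<beta>: "sets \<beta> = sigma_sets (streams S) (sstart S ` lists S \<union> {{}})"
proof -
  have "sets \<beta> = sets (stream_space (count_space S))" by (rule sets_stream_space_cong[OF sets_p])
  also have "\<dots> = sets (sigma (streams S) (sstart S ` lists S \<union> {{}}))"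
    by (rule sets_stream_space_sstart) (use finite_S in \<open>auto intro: countable_finite\<close>)
  finally show ?thesis by (simp add: image_subset_iff sstart_in_streams)
qed

lemma prob_space_\<beta>: "prob_space \<beta>" by (rule prob_space_stream_space)

lemma measure_preserving_\<beta>: "measure_preserving \<beta> stl"
proof -
  interpret \<beta>: prob_space \<beta> by (rule prob_space_\<beta>)
  show ?thesis
  proof
    fix A assume A: "A \<in> sets \<beta>"
    have eq: "{x \<in> space \<beta>. t ## x \<in> stl -` A \<inter> space \<beta>} = A" if "t \<in> space p" for t
      using that sets.sets_into_space[OF A] by (auto simp: space_stream_space streams_Stream)
    have "emeasure \<beta> (stl -` A \<inter> space \<beta>) = (\<integral>\<^sup>+t. emeasure \<beta> {x \<in> space \<beta>. t ## x \<in> stl -` A \<inter> space \<beta>} \<partial>p)"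
      by (rule emeasure_stream_space) (rule measurable_sets[OF measurable_stl A])
    also have "\<dots> = (\<integral>\<^sup>+t. emeasure \<beta> A \<partial>p)" by (rule nn_integral_cong) (simp only: eq)
    finally show "measure \<beta> (stl -` A \<inter> space \<beta>) = measure \<beta> A"
      by (simp add: emeasure_space_1 measure_def)
  qed (rule measurable_stl)
qed

sublocale \<beta>: measure_preserving \<beta> stl by (rule measure_preserving_\<beta>)

lemma funpow_stl: "(stl ^^ n) x = sdrop n x"
  by (induction n arbitrary: x) (auto simp: funpow_swap1 simp del: funpow.simps(2) simp: funpow_Suc_right)

lemma name_shd: "\<beta>.name shd n = stake n"
proof
  fix x
  show "\<beta>.name shd n x = stake n x"
    by (rule nth_equalityI) (auto simp: \<beta>.name_def funpow_stl)
qed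

lemma simple_shd: "simple_function \<beta> shd"
  unfolding simple_function_def
proof (intro conjI ballI)
  have i: "shd ` space \<beta> \<subseteq> S" unfolding space_\<beta> by (auto simp: streams_shd)
  then show "finite (shd ` space \<beta>)" using finite_S finite_subset by blast
  fix a assume "a \<in> shd ` space \<beta>"
  then have "{a} \<in> sets p" using i by (auto simp: sets_p)
  then show "shd -` {a} \<inter> space \<beta> \<in> sets \<beta>" by (rule measurable_sets[OF measurable_shd])
qed

lemma simple_stake: "simple_function \<beta> (stake n)"
  using \<beta>.simple_name[OF simple_shd, of n] by (simp add: name_shd)

lemma emeasure_word:
  "v \<in> lists S \<Longrightarrow> emeasure \<beta> (stake (length v) -` {v} \<inter> space \<beta>) = (\<Prod>a\<leftarrow>v. emeasure p {a})"
proof (induction v)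
  case Nil
  then show ?case using prob_space.emeasure_space_1[OF prob_space_\<beta>] by simp
next
  case (Cons a v)
  have "emeasure \<beta> (stake (length (a # v)) -` {a # v} \<inter> space \<beta>) =
    (\<integral>\<^sup>+t. emeasure \<beta> {x \<in> space \<beta>. t ## x \<in> stake (length (a # v)) -` {a # v} \<inter> space \<beta>} \<partial>p)"
    by (rule emeasure_stream_space[OF simple_functionD(2)[OF simple_stake]])
  also have "\<dots> = (\<integral>\<^sup>+t. emeasure \<beta> (stake (length v) -` {v} \<inter> space \<beta>) * indicator {a} t \<partial>p)"
  proof (rule nn_integral_cong)
    fix t assume t: "t \<in> space p"
    have "{x \<in> space \<beta>. t ## x \<in> stake (length (a # v)) -` {a # v} \<inter> space \<beta>} =
      (if t = a then stake (length v) -` {v} \<inter> space \<beta> else {})"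
      using t by (auto simp: space_stream_space streams_Stream)
    then show "emeasure \<beta> {x \<in> space \<beta>. t ## x \<in> stake (length (a # v)) -` {a # v} \<inter> space \<beta>} =
      emeasure \<beta> (stake (length v) -` {v} \<inter> space \<beta>) * indicator {a} t" by simp
  qed
  also have "\<dots> = emeasure \<beta> (stake (length v) -` {v} \<inter> space \<beta>) * emeasure p {a}"
    using Cons.prems by (intro nn_integral_cmult_indicator) (simp add: sets_p)
  also have "\<dots> = (\<Prod>a\<leftarrow>a # v. emeasure p {a})" using Cons by (simp add: mult.commute)
  finally show ?case .
qed

lemma measure_word:
  "v \<in> lists S \<Longrightarrow> measure \<beta> (stake (length v) -` {v} \<inter> space \<beta>) = (\<Prod>a\<leftarrow>v. measure p {a})"
proof -
  assume v: "v \<in> lists S"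
  have "(\<Prod>a\<leftarrow>v. emeasure p {a}) = ennreal (\<Prod>a\<leftarrow>v. measure p {a})" for v
    by (induction v) (simp_all add: emeasure_eq_measure ennreal_mult')
  moreover have "0 \<le> (\<Prod>a\<leftarrow>v. measure p {a})" by (rule prod_list_nonneg) auto
  ultimately show ?thesis
    unfolding measure_def[of \<beta>] emeasure_word[OF v] by (simp only: enn2real_ennreal)
qed

lemma sum_p: "(\<Sum>a\<in>S. measure p {a}) = 1"
proof -
  have "(\<Sum>a\<in>S. measure p {a}) = measure p S"
    by (rule finite_measure_eq_sum_singleton[OF finite_S, symmetric]) (auto simp: sets_p)
  then show ?thesis using prob_space space_p by simp
qed

lemma sum_words: "(\<Sum>v\<in>words S n. (\<Prod>a\<leftarrow>v. measure p {a})) = 1 \<and>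
  (\<Sum>v\<in>words S n. entropy_term (\<Prod>a\<leftarrow>v. measure p {a})) = real n * shift_entropy"
proof (induction n)
  case 0
  show ?case by (simp add: words_def entropy_term_def cong: conj_cong)
next
  case (Suc n)
  have w: "words S (Suc n) = (\<lambda>(a, v). a # v) ` (S \<times> words S n)"
    by (auto simp: words_def image_iff length_Suc_conv)
  have s: "(\<Sum>v\<in>words S (Suc n). f v) = (\<Sum>a\<in>S. \<Sum>v\<in>words S n. f (a # v))" for f :: "'a list \<Rightarrow> real"
    unfolding w by (subst sum.reindex) (auto simp: inj_on_def sum.cartesian_product split_beta)
  let ?P = "\<lambda>v. \<Prod>a\<leftarrow>v. measure p {a}"
  have et: "entropy_term (x * y) = x * entropy_term y + y * entropy_term x" if "0 \<le> x" "0 \<le> y" for x y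
    using that by (cases "x = 0"; cases "y = 0") (auto simp: entropy_term_def ln_mult algebra_simps)
  have P0: "0 \<le> ?P v" for v by (rule prod_list_nonneg) auto
  have "(\<Sum>v\<in>words S (Suc n). ?P v) = (\<Sum>a\<in>S. measure p {a} * (\<Sum>v\<in>words S n. ?P v))"
    unfolding s by (simp add: sum_distrib_left)
  then have 1: "(\<Sum>v\<in>words S (Suc n). ?P v) = 1" using Suc sum_p by simp
  have "(\<Sum>v\<in>words S (Suc n). entropy_term (?P v)) =
    (\<Sum>a\<in>S. \<Sum>v\<in>words S n. measure p {a} * entropy_term (?P v) + ?P v * entropy_term (measure p {a}))"
    unfolding s by (simp add: et P0)
  also have "\<dots> = (\<Sum>a\<in>S. measure p {a} * (\<Sum>v\<in>words S n. entropy_term (?P v)) + (\<Sum>v\<in>words S n. ?P v) * entropy_term (measure p {a}))"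
    by (simp add: sum.distrib sum_distrib_left sum_distrib_right)
  also have "\<dots> = (\<Sum>a\<in>S. measure p {a}) * (real n * shift_entropy) + shift_entropy"
    using Suc by (simp add: sum.distrib sum_distrib_right shift_entropy_def)
  finally show ?case using 1 sum_p by (simp add: algebra_simps)
qed

lemma ent_stake: "\<beta>.ent (stake n) = real n * shift_entropy"
proof -
  have f: "finite (words S n)" using finite_lists_length_eq[OF finite_S] by (simp add: words_def lists_eq_set Collect_conj_eq)
  have "stake n ` space \<beta> \<subseteq> words S n"
    unfolding space_\<beta> words_def by (auto simp: in_set_conv_nth streams_iff_snth)
  then have "\<beta>.ent (stake n) = (\<Sum>v\<in>words S n. entropy_term (measure \<beta> (stake n -` {v} \<inter> space \<beta>)))"
    by (rule \<beta>.ent_superset[OF f])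
  also have "\<dots> = (\<Sum>v\<in>words S n. entropy_term (\<Prod>a\<leftarrow>v. measure p {a}))"
  proof (intro sum.cong refl)
    fix v assume "v \<in> words S n"
    then have v: "v \<in> lists S" "n = length v" by (auto simp: words_def)
    show "entropy_term (measure \<beta> (stake n -` {v} \<inter> space \<beta>)) = entropy_term (\<Prod>a\<leftarrow>v. measure p {a})"
      unfolding v(2) measure_word[OF v(1)] ..
  qed
  finally show ?thesis using sum_words by simp
qed

text \<open>The sets determined by the first \<open>n\<close> letters. \<open>U\<close> may be any
  set of lists, so that the complement is obtained simply from \<open>- U\<close>.\<close>

definition Cyl :: "nat \<Rightarrow> 'a list set \<Rightarrow> 'a stream set" where
  "Cyl n U = {x \<in> streams S. stake n x \<in> U}"

lemma Cyl_sets[measurable]: "Cyl n U \<in> sets \<beta>"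
proof -
  have "Cyl n U = stake n -` U \<inter> space \<beta>" by (auto simp: Cyl_def space_\<beta>)
  then show ?thesis using simple_functionD(2)[OF simple_stake] by simp
qed

lemma sstart_Cyl: "v \<in> lists S \<Longrightarrow> sstart S v = Cyl (length v) {v}"
proof -
  assume "v \<in> lists S"
  then have "sstart S v \<subseteq> streams S" by (rule sstart_in_streams)
  moreover have "x \<in> sstart S v \<longleftrightarrow> stake (length v) x = v" if "x \<in> streams S" for x
    using sstart_eq[OF that, of v] by (auto simp: list_eq_iff_nth_eq)
  ultimately show ?thesis by (auto simp: Cyl_def)
qed

abbreviation sdiff :: "'b set \<Rightarrow> 'b set \<Rightarrow> 'b set" where "sdiff A B \<equiv> (A - B) \<union> (B - A)"

definition err :: "'a stream set \<Rightarrow> nat \<Rightarrow> 'a list set \<Rightarrow> real" where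
  "err A n U = measure \<beta> (sdiff A (Cyl n U))"

text \<open>The sets that can be approximated in measure by finite unions of cylinders form a
  \<sigma>-algebra: for a countable union, pass to a finite one by continuity from below and use a
  common word length.\<close>

lemma Cyl_approx:
  assumes "A \<in> sets \<beta>" "0 < \<epsilon>"
  shows "\<exists>n U. err A n U < \<epsilon>"
proof -
  have "A \<in> sigma_sets (streams S) (sstart S ` lists S \<union> {{}})" using assms(1) sets_\<beta> by simp
  then show ?thesis using assms(2)
  proof (induction arbitrary: \<epsilon>)
    case (Basic a)
    then consider v where "v \<in> lists S" "a = sstart S v" | "a = {}" by auto
    then show ?case
    proof cases
      case 1
      then show ?thesis using Basic.prems sstart_Cyl
        by (intro exI[of _ "length v"] exI[of _ "{v}"]) (simp add: err_def)
    next
      case 2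
      then show ?thesis using Basic.prems by (intro exI[of _ 0] exI[of _ "{}"]) (simp add: Cyl_def err_def)
    qed
  next
    case Empty
    then show ?case by (intro exI[of _ 0] exI[of _ "{}"]) (simp add: Cyl_def err_def)
  next
    case (Compl a)
    obtain n U where nU: "err a n U < \<epsilon>" using Compl.IH[OF Compl.prems] by blast
    have "a \<subseteq> streams S"
      by (rule sigma_sets_into_sp[OF _ Compl.hyps]) (use sstart_in_streams[of _ S] in force)
    then have "sdiff (streams S - a) (Cyl n (- U)) = sdiff a (Cyl n U)" by (auto simp: Cyl_def)
    then show ?case using nU by (intro exI[of _ n] exI[of _ "- U"]) (simp add: err_def)
  next
    case (Union a)
    have a[measurable]: "a i \<in> sets \<beta>" for i using Union.hyps sets_\<beta> by simp
    have "(\<lambda>N. measure \<beta> (\<Union>i<N. a i)) \<longlonglongrightarrow> measure \<beta> (\<Union>N. \<Union>i<N. a i)"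
    proof (rule \<beta>.finite_Lim_measure_incseq)
      show "incseq (\<lambda>N. \<Union>i<N. a i)" by (intro monoI UN_mono) auto
    qed auto
    moreover have "(\<Union>N. \<Union>i<N. a i) = (\<Union>i. a i)" by auto
    ultimately have "\<forall>\<^sub>F N in sequentially. measure \<beta> (\<Union>i. a i) - \<epsilon> / 2 < measure \<beta> (\<Union>i<N. a i)"
      using Union.prems by (intro order_tendstoD(1)) auto
    then obtain N where N: "measure \<beta> (\<Union>i. a i) - \<epsilon> / 2 < measure \<beta> (\<Union>i<N. a i)"
      by (auto simp: eventually_sequentially)
    have "\<forall>i. \<exists>n U. err (a i) n U < \<epsilon> / (2 * real (Suc N))"
      using Union by simp
    then obtain n U where nU: "\<And>i. err (a i) (n i) (U i) < \<epsilon> / (2 * real (Suc N))"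
      by metis
    define m where "m = (\<Sum>i<N. n i)"
    have m: "n i \<le> m" if "i < N" for i unfolding m_def using that by (intro member_le_sum) auto
    define V where "V = {w. \<exists>i<N. take (n i) w \<in> U i}"
    have V: "Cyl m V = (\<Union>i<N. Cyl (n i) (U i))"
      using m by (auto simp: Cyl_def V_def take_stake min_def)
    have "measure \<beta> (sdiff (\<Union>i. a i) (Cyl m V)) \<le>
      measure \<beta> (((\<Union>i. a i) - (\<Union>i<N. a i)) \<union> (\<Union>i<N. sdiff (a i) (Cyl (n i) (U i))))"
      by (rule \<beta>.finite_measure_mono) (auto simp: V)
    also have "\<dots> \<le> measure \<beta> ((\<Union>i. a i) - (\<Union>i<N. a i)) + measure \<beta> (\<Union>i<N. sdiff (a i) (Cyl (n i) (U i)))"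
      by (rule measure_Un_le) auto
    also have "measure \<beta> ((\<Union>i. a i) - (\<Union>i<N. a i)) = measure \<beta> (\<Union>i. a i) - measure \<beta> (\<Union>i<N. a i)"
      by (rule \<beta>.finite_measure_Diff) auto
    also have "measure \<beta> (\<Union>i<N. sdiff (a i) (Cyl (n i) (U i))) \<le> (\<Sum>i<N. err (a i) (n i) (U i))"
      unfolding err_def by (rule measure_UNION_le) auto
    also have "\<dots> \<le> (\<Sum>i<N. \<epsilon> / (2 * real (Suc N)))" using nU by (intro sum_mono) (auto intro: less_imp_le)
    also have "\<dots> \<le> \<epsilon> / 2" using Union.prems by (simp add: field_simps)
    finally have "err (\<Union>i. a i) m V < \<epsilon>" using N by (simp add: err_def)
    then show ?case by (intro exI)
  qed
qed

text \<open>The cell of a point is guessed from its first \<open>m\<close> letters; the guess is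
  wrong only on the symmetric differences between the cells and the cylinder sets approximating
  them.\<close>

lemma partition_approx:
  assumes P: "finite P" "P \<subseteq> sets \<beta>" "partition_on (space \<beta>) P" and e: "0 < \<epsilon>"
  shows "\<exists>m \<Phi>. (\<forall>w. \<Phi> w \<in> P) \<and> measure \<beta> {x \<in> space \<beta>. \<beta>.cell P x \<noteq> \<Phi> (stake m x)} \<le> \<epsilon>"
proof -
  have ne: "P \<noteq> {}" using P(3) \<beta>.not_empty by (auto simp: partition_on_def)
  then have K: "0 < card P" using P(1) by (simp add: card_gt_0_iff)
  have "\<forall>C\<in>P. \<exists>n U. err C n U < \<epsilon> / real (card P)"
    using P(2) e K by (intro ballI Cyl_approx) auto
  then obtain n U where nU: "\<And>C. C \<in> P \<Longrightarrow> err C (n C) (U C) < \<epsilon> / real (card P)"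
    by metis
  define m where "m = (\<Sum>C\<in>P. n C)"
  have m: "n C \<le> m" if "C \<in> P" for C unfolding m_def using that P(1) by (intro member_le_sum) auto
  \<comment> \<open>The approximating cylinder sets need neither be disjoint nor cover the space:
    where they do not single out one cell, an arbitrary cell is taken.\<close>
  define \<Phi> where "\<Phi> w = (if \<exists>!C. C \<in> P \<and> take (n C) w \<in> U C then THE C. C \<in> P \<and> take (n C) w \<in> U C
     else SOME C. C \<in> P)" for w
  have \<Phi>P: "\<Phi> w \<in> P" for w
  proof (cases "\<exists>!C. C \<in> P \<and> take (n C) w \<in> U C")
    case True
    then show ?thesis using theI'[OF True] by (simp add: \<Phi>_def)
  next
    case False
    then have "\<Phi> w = (SOME C. C \<in> P)" unfolding \<Phi>_def by (rule if_not_P)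
    then show ?thesis using ne some_in_eq[of P] by simp
  qed
  have sub: "{x \<in> space \<beta>. \<beta>.cell P x \<noteq> \<Phi> (stake m x)} \<subseteq> (\<Union>C\<in>P. sdiff C (Cyl (n C) (U C)))"
  proof (rule subsetI, rule ccontr)
    fix x assume x: "x \<in> {x \<in> space \<beta>. \<beta>.cell P x \<noteq> \<Phi> (stake m x)}" and "x \<notin> (\<Union>C\<in>P. sdiff C (Cyl (n C) (U C)))"
    then have iff: "x \<in> C \<longleftrightarrow> take (n C) (stake m x) \<in> U C" if "C \<in> P" for C
      using m[OF that] that by (auto simp: Cyl_def space_\<beta> take_stake min_def)
    have c: "\<beta>.cell P x \<in> P \<and> x \<in> \<beta>.cell P x" using x \<beta>.cell_in[OF P] by blast
    have "\<Phi> (stake m x) = \<beta>.cell P x"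
    proof -
      have u: "\<exists>!C. C \<in> P \<and> take (n C) (stake m x) \<in> U C"
        using c iff \<beta>.cell_eq[OF P] by (intro ex1I[of _ "\<beta>.cell P x"]) auto
      have "(THE C. C \<in> P \<and> take (n C) (stake m x) \<in> U C) = \<beta>.cell P x"
        by (rule the1_equality[OF u]) (use c iff in auto)
      then show ?thesis unfolding \<Phi>_def using u by simp
    qed
    then show False using x by simp
  qed
  have [measurable]: "C \<in> sets \<beta>" if "C \<in> P" for C using that P(2) by auto
  have "measure \<beta> {x \<in> space \<beta>. \<beta>.cell P x \<noteq> \<Phi> (stake m x)} \<le> measure \<beta> (\<Union>C\<in>P. sdiff C (Cyl (n C) (U C)))"
    by (rule \<beta>.finite_measure_mono[OF sub]) (use P(1,2) in \<open>auto intro!: sets.finite_UN\<close>)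
  also have "\<dots> \<le> (\<Sum>C\<in>P. err C (n C) (U C))"
    unfolding err_def using P(1,2) by (intro measure_UNION_le) auto
  also have "\<dots> \<le> (\<Sum>C\<in>P. \<epsilon> / real (card P))" using nU by (intro sum_mono) (auto intro: less_imp_le)
  also have "\<dots> = \<epsilon>" using K by simp
  finally show ?thesis using \<Phi>P by blast
qed

text \<open>The partition is approximated by a function \<open>Z\<close> of the first
  \<open>m\<close> letters. The \<open>Z\<close>-name of length \<open>n\<close> is determined by
  \<open>n + m\<close> letters, whose entropy is \<open>n + m\<close> times that of a letter, and
  the approximation costs at most \<open>\<delta>\<close> per step.\<close>

lemma ent_cell_limit_le:
  assumes P: "finite P" "P \<subseteq> sets \<beta>" "partition_on (space \<beta>) P"
    and l: "(\<lambda>n. 1 / real n * \<beta>.ent (\<beta>.name (\<beta>.cell P) n)) \<longlonglongrightarrow> l"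
  shows "l \<le> shift_entropy"
proof (rule field_le_epsilon)
  fix \<delta> :: real assume d: "0 < \<delta>"
  define k where "k = 2 * (real (card P))\<^sup>2 + 1"
  have k: "1 \<le> k" unfolding k_def by simp
  define s where "s = min 1 (\<delta> / k)"
  have s: "0 < s" "s \<le> 1" "k * s \<le> \<delta>" using d k by (auto simp: s_def min_def field_simps)
  obtain m \<Phi> where \<Phi>: "\<And>w. \<Phi> w \<in> P" "measure \<beta> {x \<in> space \<beta>. \<beta>.cell P x \<noteq> \<Phi> (stake m x)} \<le> s\<^sup>2"
    using partition_approx[OF P, of "s\<^sup>2"] s by auto
  define Z where "Z x = \<Phi> (stake m x)" for x
  have sZ: "simple_function \<beta> Z"
    using simple_function_compose[OF simple_stake, of \<Phi> m] by (simp add: Z_def[abs_def] comp_def)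
  have sX: "simple_function \<beta> (\<beta>.cell P)" by (rule \<beta>.simple_cell[OF P])
  have "\<beta>.ent (\<lambda>x. (\<beta>.cell P x, Z x)) - \<beta>.ent Z \<le> 2 * (real (card P))\<^sup>2 * sqrt (s\<^sup>2) + s\<^sup>2"
    by (rule \<beta>.ent_pair_approx[OF sX sZ P(1)]) (use \<Phi> \<beta>.cell_in[OF P] in \<open>auto simp: Z_def\<close>)
  also have "\<dots> \<le> k * s" using s by (simp add: k_def algebra_simps power2_eq_square)
  also have "\<dots> \<le> \<delta>" by (rule s)
  finally have c: "\<beta>.ent (\<lambda>x. (\<beta>.cell P x, Z x)) - \<beta>.ent Z \<le> \<delta>" .
  have nZ: "\<beta>.ent (\<beta>.name Z n) \<le> real (n + m) * shift_entropy" for n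
  proof -
    have "\<beta>.ent (\<beta>.name Z n) \<le> \<beta>.ent (stake (n + m))"
    proof (rule \<beta>.ent_le_compose[OF simple_stake])
      fix x :: "'a stream"
      have "take m (drop j (stake (n + m) x)) = stake m (sdrop j x)" if "j < n" for j
        using that by (simp add: drop_stake take_stake min_absorb1)
      then show "\<beta>.name Z n x = (\<lambda>w. map (\<lambda>j. \<Phi> (take m (drop j w))) [0..<n]) (stake (n + m) x)"
        by (simp add: \<beta>.name_def Z_def funpow_stl)
    qed
    then show ?thesis by (simp add: ent_stake)
  qed
  have "l \<le> shift_entropy + real m * shift_entropy * 0 + \<delta>"
  proof (rule LIMSEQ_le[OF l])
    show "(\<lambda>n. shift_entropy + real m * shift_entropy * (1 / real n) + \<delta>) \<longlonglongrightarrow> shift_entropy + real m * shift_entropy * 0 + \<delta>"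
      by (intro tendsto_intros lim_1_over_n)
    have "1 / real n * \<beta>.ent (\<beta>.name (\<beta>.cell P) n) \<le> shift_entropy + real m * shift_entropy * (1 / real n) + \<delta>"
      if n: "n \<ge> 1" for n
    proof -
      have "\<beta>.ent (\<beta>.name (\<beta>.cell P) n) \<le> \<beta>.ent (\<beta>.name Z n) + real n * (\<beta>.ent (\<lambda>x. (\<beta>.cell P x, Z x)) - \<beta>.ent Z)"
        by (rule \<beta>.ent_name_le[OF sX sZ])
      also have "\<dots> \<le> real (n + m) * shift_entropy + real n * \<delta>"
        by (intro add_mono nZ mult_left_mono c) auto
      finally have "1 / real n * \<beta>.ent (\<beta>.name (\<beta>.cell P) n) \<le> 1 / real n * (real (n + m) * shift_entropy + real n * \<delta>)"
        by (intro mult_left_mono) auto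
      also have "\<dots> = shift_entropy + real m * shift_entropy * (1 / real n) + \<delta>"
        using n by (simp add: field_simps)
      finally show ?thesis .
    qed
    then show "\<exists>N. \<forall>n\<ge>N. 1 / real n * \<beta>.ent (\<beta>.name (\<beta>.cell P) n) \<le> shift_entropy + real m * shift_entropy * (1 / real n) + \<delta>"
      by blast
  qed
  then show "l \<le> shift_entropy + \<delta>" by simp
qed

theorem measure_entropy_bernoulli_shift: "measure_entropy \<beta> stl = ereal shift_entropy"
proof (rule antisym)
  show "measure_entropy \<beta> stl \<le> ereal shift_entropy"
    unfolding measure_entropy_def
  proof (rule SUP_least)
    fix P assume "P \<in> {P. finite P \<and> P \<subseteq> sets \<beta> \<and> partition_on (space \<beta>) P}"
    then have P: "finite P" "P \<subseteq> sets \<beta>" "partition_on (space \<beta>) P" by auto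
    obtain l where l: "(\<lambda>n. 1 / real n * \<beta>.ent (\<beta>.name (\<beta>.cell P) n)) \<longlonglongrightarrow> l"
      using \<beta>.ent_name_limit[OF \<beta>.simple_cell[OF P]] by blast
    then have "lim (\<lambda>n. 1 / real n * shannon_entropy \<beta> (iterated_join \<beta> stl P n)) = l"
      by (simp add: \<beta>.shannon_entropy_iterated_join[OF P] limI)
    then show "ereal (lim (\<lambda>n. 1 / real n * shannon_entropy \<beta> (iterated_join \<beta> stl P n))) \<le> ereal shift_entropy"
      using ent_cell_limit_le[OF P l] by simp
  qed
  \<comment> \<open>The partition by the first letter attains the supremum: its names carry the same
    information as the prefixes \<open>stake n x\<close>.\<close>
  define c where "c a = shd -` {a} \<inter> space \<beta>" for a
  have ne: "c a \<noteq> {}" if "a \<in> S" for a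
  proof -
    have "sconst a \<in> c a" using that by (simp add: c_def space_\<beta> sconst_streams)
    then show ?thesis by blast
  qed
  have cs: "c a \<in> sets \<beta>" for a unfolding c_def by (rule simple_functionD(2)[OF simple_shd])
  define P where "P = c ` S"
  have P: "finite P" "P \<subseteq> sets \<beta>" "partition_on (space \<beta>) P"
    using finite_S cs ne
    by (auto simp: P_def partition_on_def disjoint_def c_def space_\<beta> streams_shd)
  have cell: "\<beta>.cell P x = c (shd x)" if "x \<in> space \<beta>" for x
    using that by (intro \<beta>.cell_eq[OF P]) (auto simp: P_def c_def space_\<beta> streams_shd)
  have eq: "\<beta>.ent (\<beta>.name (\<beta>.cell P) n) = real n * shift_entropy" for n
  proof -
    have "\<beta>.ent (\<beta>.name (\<beta>.cell P) n) = \<beta>.ent (stake n)"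
    proof (rule \<beta>.ent_eqI[OF \<beta>.simple_name[OF \<beta>.simple_cell[OF P]] simple_stake,
        where f = "map c" and g = "map (\<lambda>C. shd (SOME x. x \<in> C))"])
      fix x assume x: "x \<in> space \<beta>"
      have n: "\<beta>.name (\<beta>.cell P) n x = map (\<lambda>j. c (shd ((stl ^^ j) x))) [0..<n]"
        unfolding \<beta>.name_def using cell \<beta>.Tn_space[OF x] by simp
      show n': "\<beta>.name (\<beta>.cell P) n x = map c (stake n x)"
        unfolding n name_shd[symmetric] by (simp add: \<beta>.name_def)
      have "shd (SOME y. y \<in> c (x !! j)) = x !! j" if "j < n" for j
      proof -
        have "x !! j \<in> S" using x by (simp add: space_\<beta> streams_iff_snth)
        then have "(SOME y. y \<in> c (x !! j)) \<in> c (x !! j)" using ne some_in_eq by blast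
        then show ?thesis by (simp add: c_def)
      qed
      then show "stake n x = map (\<lambda>C. shd (SOME x. x \<in> C)) (\<beta>.name (\<beta>.cell P) n x)"
        unfolding n' by (intro nth_equalityI) auto
    qed
    then show ?thesis by (simp add: ent_stake)
  qed
  have "(\<lambda>n. 1 / real n * shannon_entropy \<beta> (iterated_join \<beta> stl P n)) \<longlonglongrightarrow> shift_entropy"
  proof (rule Lim_transform_eventually[OF tendsto_const])
    show "\<forall>\<^sub>F n in sequentially. shift_entropy = 1 / real n * shannon_entropy \<beta> (iterated_join \<beta> stl P n)"
      using eventually_gt_at_top[of 0]
      by eventually_elim (simp add: \<beta>.shannon_entropy_iterated_join[OF P] eq)
  qed
  then have "ereal shift_entropy = ereal (lim (\<lambda>n. 1 / real n * shannon_entropy \<beta> (iterated_join \<beta> stl P n)))"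
    by (simp add: limI)
  also have "\<dots> \<le> measure_entropy \<beta> stl"
    unfolding measure_entropy_def by (rule SUP_upper) (use P in auto)
  finally show "ereal shift_entropy \<le> measure_entropy \<beta> stl" .
qed

end

subsection \<open>Measures with prescribed cylinder masses\<close>

lemma partial_sum_interval:
  fixes f :: "nat \<Rightarrow> real"
  assumes "\<And>i. 0 \<le> f i" "0 \<le> t" "t < (\<Sum>j<k. f j)"
  shows "\<exists>!i. i < k \<and> (\<Sum>j<i. f j) \<le> t \<and> t < (\<Sum>j<Suc i. f j)"
proof -
  have "\<exists>i. i < k \<and> (\<Sum>j<i. f j) \<le> t \<and> t < (\<Sum>j<Suc i. f j)"
    using assms(3)
  proof (induction k)
    case (Suc k)
    show ?case
    proof (cases "t < (\<Sum>j<k. f j)")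
      case True
      then show ?thesis using Suc.IH less_SucI by blast
    next
      case False
      then show ?thesis using Suc.prems by (intro exI[of _ k]) auto
    qed
  qed (use assms(2) in simp)
  moreover have "i = i'" if "(\<Sum>j<i. f j) \<le> t" "t < (\<Sum>j<Suc i. f j)" "(\<Sum>j<i'. f j) \<le> t" "t < (\<Sum>j<Suc i'. f j)" for i i'
  proof (rule ccontr)
    have mono: "(\<Sum>j<m. f j) \<le> (\<Sum>j<n. f j)" if "m \<le> n" for m n
      using that assms(1) by (intro sum_mono2) auto
    assume "i \<noteq> i'"
    then consider "Suc i \<le> i'" | "Suc i' \<le> i" by linarith
    then show False using mono[of "Suc i" i'] mono[of "Suc i'" i] that by cases linarith+
  qed
  ultimately show ?thesis by blast
qed

text \<open>A point of \<open>[0, w [])\<close> is coded by successively subdividing the interval of length \<open>w u\<close> into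
  intervals of lengths \<open>w (u @ [a])\<close>; the wanted measure is the image of Lebesgue measure.\<close>

locale cylinder_masses =
  fixes S :: "'a set" and w :: "'a list \<Rightarrow> real" and h :: "nat \<Rightarrow> 'a" and k :: nat
  assumes h: "bij_betw h {..<k} S"
    and w0: "\<And>u. u \<in> lists S \<Longrightarrow> 0 \<le> w u"
    and w_sum: "\<And>u. u \<in> lists S \<Longrightarrow> w u = (\<Sum>a\<in>S. w (u @ [a]))"
begin

definition offset :: "'a list \<Rightarrow> nat \<Rightarrow> real" where "offset u i = (\<Sum>j<i. w (u @ [h j]))"

definition choice :: "'a list \<Rightarrow> real \<Rightarrow> nat" where
  "choice u t = (THE i. i < k \<and> offset u i \<le> t \<and> t < offset u (Suc i))"

text \<open>The argument \<open>t\<close> is measured from the left end of the interval of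
  \<open>u\<close>, hence the offset is subtracted at each step.\<close>

primcorec path :: "'a list \<Rightarrow> real \<Rightarrow> 'a stream" where
  "shd (path u t) = h (choice u t)"
| "stl (path u t) = path (u @ [h (choice u t)]) (t - offset u (choice u t))"

lemma finite_S: "finite S" using h bij_betw_finite by blast

lemma h_in: "i < k \<Longrightarrow> h i \<in> S" using h by (auto simp: bij_betw_def)

lemma w_offset: "u \<in> lists S \<Longrightarrow> w u = offset u k"
  unfolding w_sum offset_def using sum.reindex_bij_betw[OF h, of "\<lambda>a. w (u @ [a])"] by simp

lemma offset_Suc: "offset u (Suc i) = offset u i + w (u @ [h i])" by (simp add: offset_def)

lemma choice_unique:
  assumes "u \<in> lists S" "0 \<le> t" "t < w u"
  shows "\<exists>!i. i < k \<and> offset u i \<le> t \<and> t < offset u (Suc i)"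
proof -
  \<comment> \<open>Lengths are extended by 0 beyond \<open>k\<close>, since
    \<open>partial_sum_interval\<close> asks for a sequence that is nonnegative at all
    indices.\<close>
  have "\<exists>!i. i < k \<and> (\<Sum>j<i. if j < k then w (u @ [h j]) else 0) \<le> t \<and> t < (\<Sum>j<Suc i. if j < k then w (u @ [h j]) else 0)"
    using assms w0 h_in w_offset[OF assms(1)] by (intro partial_sum_interval) (auto simp: offset_def)
  moreover have "(\<Sum>j<i. if j < k then w (u @ [h j]) else 0) = offset u i" if "i \<le> k" for i
    unfolding offset_def using that by (intro sum.cong) auto
  ultimately show ?thesis by (metis (no_types, lifting) Suc_leI less_imp_le_nat)
qed

lemma choice_iff:
  assumes "u \<in> lists S" "0 \<le> t" "t < w u" "i < k"
  shows "choice u t = i \<longleftrightarrow> offset u i \<le> t \<and> t < offset u (Suc i)"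
  using theI'[OF choice_unique[OF assms(1-3)]] choice_unique[OF assms(1-3)] assms(4)
  unfolding choice_def[symmetric] by blast

lemma choice_less: "u \<in> lists S \<Longrightarrow> 0 \<le> t \<Longrightarrow> t < w u \<Longrightarrow> choice u t < k"
  using theI'[OF choice_unique] unfolding choice_def[symmetric] by blast

lemma offset_bounds:
  assumes "u \<in> lists S" "i < k"
  shows "0 \<le> offset u i" "offset u (Suc i) \<le> w u"
proof -
  show "0 \<le> offset u i" unfolding offset_def using assms w0 h_in by (intro sum_nonneg) auto
  show "offset u (Suc i) \<le> w u"
    unfolding w_offset[OF assms(1)] offset_def using assms w0 h_in by (intro sum_mono2) auto
qed

lemma path_in_streams:
  assumes "u \<in> lists S" "0 \<le> t" "t < w u"
  shows "path u t \<in> streams S"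
  using assms
proof (coinduction arbitrary: u t rule: streams.coinduct)
  case (streams u t)
  let ?i = "choice u t"
  have i: "?i < k" using choice_less[OF streams] .
  have b: "offset u ?i \<le> t" "t < offset u (Suc ?i)"
    using choice_iff[OF streams i, THEN iffD1, OF refl] by (rule conjunct1, rule conjunct2)
  have "path u t = h ?i ## path (u @ [h ?i]) (t - offset u ?i)" by (rule path.code)
  moreover have "u @ [h ?i] \<in> lists S" "0 \<le> t - offset u ?i" "t - offset u ?i < w (u @ [h ?i])"
    using streams h_in[OF i] b by (simp_all add: offset_Suc)
  ultimately show ?case using h_in[OF i] by blast
qed

lemma path_interval:
  "u \<in> lists S \<Longrightarrow> v \<in> lists S \<Longrightarrow>
   \<exists>l. {t. 0 \<le> t \<and> t < w u \<and> stake (length v) (path u t) = v} = {l..<l + w (u @ v)}"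
proof (induction v arbitrary: u)
  case Nil
  then show ?case by (intro exI[of _ 0]) auto
next
  case (Cons a v)
  then have "a \<in> S" by simp
  then obtain i where i: "i < k" "h i = a" using h by (auto simp: bij_betw_def)
  obtain l where l: "{t. 0 \<le> t \<and> t < w (u @ [a]) \<and> stake (length v) (path (u @ [a]) t) = v} = {l..<l + w ((u @ [a]) @ v)}"
    using Cons.IH[of "u @ [a]"] Cons.prems by auto
  have a1: "(0 \<le> t \<and> t < w u \<and> stake (length (a # v)) (path u t) = a # v) \<longleftrightarrow>
    (offset u i \<le> t \<and> t < offset u (Suc i) \<and> stake (length v) (path (u @ [a]) (t - offset u i)) = v)" for t
  proof (cases "0 \<le> t \<and> t < w u")
    case True
    then have e1: "h (choice u t) = a \<longleftrightarrow> choice u t = i"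
      using i choice_less[OF Cons.prems(1), of t] h by (auto simp: bij_betw_def inj_on_def)
    have e2: "choice u t = i \<longleftrightarrow> offset u i \<le> t \<and> t < offset u (Suc i)"
      using True Cons.prems(1) i by (intro choice_iff) auto
    show ?thesis
    proof (cases "choice u t = i")
      case c: True
      then show ?thesis using True e2 i by simp
    next
      case False
      then have "h (choice u t) \<noteq> a" "\<not> (offset u i \<le> t \<and> t < offset u (Suc i))" using e1 e2 by auto
      then show ?thesis by auto
    qed
  next
    case False
    then show ?thesis using offset_bounds[OF Cons.prems(1) i(1)] by auto
  qed
  have a2: "(offset u i \<le> t \<and> t < offset u (Suc i) \<and> stake (length v) (path (u @ [a]) (t - offset u i)) = v)
      \<longleftrightarrow> t - offset u i \<in> {l..<l + w ((u @ [a]) @ v)}" for t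
    unfolding l[symmetric] by (auto simp: offset_Suc i)
  have "{t. 0 \<le> t \<and> t < w u \<and> stake (length (a # v)) (path u t) = a # v} =
    {t. t - offset u i \<in> {l..<l + w ((u @ [a]) @ v)}}"
    unfolding a1 a2 ..
  also have "\<dots> = {offset u i + l..<offset u i + l + w (u @ a # v)}" by auto
  finally show ?case by blast
qed

lemma emeasure_path:
  assumes "v \<in> lists S"
  shows "{t. 0 \<le> t \<and> t < w [] \<and> stake (length v) (path [] t) = v} \<in> sets borel"
    and "emeasure lborel {t. 0 \<le> t \<and> t < w [] \<and> stake (length v) (path [] t) = v} = ennreal (w v)"
proof -
  obtain l where "{t. 0 \<le> t \<and> t < w [] \<and> stake (length v) (path [] t) = v} = {l..<l + w v}"
    using path_interval[of "[]" v] assms by auto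
  then show "{t. 0 \<le> t \<and> t < w [] \<and> stake (length v) (path [] t) = v} \<in> sets borel"
    "emeasure lborel {t. 0 \<le> t \<and> t < w [] \<and> stake (length v) (path [] t) = v} = ennreal (w v)"
    using w0[OF assms] by simp_all
qed

definition \<Omega> where "\<Omega> = restrict_space lborel {0..<w []}"

lemma space_\<Omega>: "space \<Omega> = {0..<w []}" by (simp add: \<Omega>_def space_restrict_space)

lemma sstart_iff_stake: "x \<in> streams S \<Longrightarrow> x \<in> sstart S v \<longleftrightarrow> stake (length v) x = v"
  using sstart_eq[of x S v] by (auto simp: list_eq_iff_nth_eq)

lemma path_measurable: "path [] \<in> measurable \<Omega> (stream_space (count_space S))"
proof (rule measurable_stream_space2)
  fix n
  have f: "finite (words S n)"
    using finite_lists_length_eq[OF finite_S] by (simp add: words_def lists_eq_set Collect_conj_eq)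
  have s: "path [] t \<in> streams S" if "t \<in> space \<Omega>" for t
    using that by (intro path_in_streams) (auto simp: space_\<Omega>)
  show "(\<lambda>t. path [] t !! n) \<in> measurable \<Omega> (count_space S)"
    unfolding measurable_count_space_eq2[OF finite_S]
  proof (intro conjI ballI)
    show "(\<lambda>t. path [] t !! n) \<in> space \<Omega> \<rightarrow> S" using s by (auto simp: streams_iff_snth)
    fix a assume a: "a \<in> S"
    let ?A = "\<lambda>v. {t. 0 \<le> t \<and> t < w [] \<and> stake (length v) (path [] t) = v}"
    have "(\<lambda>t. path [] t !! n) -` {a} \<inter> space \<Omega> = (\<Union>v\<in>words S n. ?A (v @ [a]))"
    proof (intro equalityI subsetI)
      fix t assume t: "t \<in> (\<lambda>t. path [] t !! n) -` {a} \<inter> space \<Omega>"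
      then have "stake n (path [] t) \<in> words S n"
        using s[of t] by (auto simp: words_def in_set_conv_nth streams_iff_snth)
      moreover have "t \<in> ?A (stake n (path [] t) @ [a])"
        using t by (auto simp: space_\<Omega> stake_Suc simp del: stake.simps)
      ultimately show "t \<in> (\<Union>v\<in>words S n. ?A (v @ [a]))" by blast
    qed (auto simp: words_def space_\<Omega> stake_Suc simp del: stake.simps)
    also have "\<dots> \<in> sets lborel"
    proof (rule sets.finite_UN[OF f])
      fix v assume "v \<in> words S n"
      then have "v @ [a] \<in> lists S" using a by (simp add: words_def)
      then show "?A (v @ [a]) \<in> sets lborel" unfolding sets_lborel by (rule emeasure_path(1))
    qed
    finally show "(\<lambda>t. path [] t !! n) -` {a} \<inter> space \<Omega> \<in> sets \<Omega>"
      unfolding \<Omega>_def by (subst sets_restrict_space_iff) (auto simp: space_restrict_space)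
  qed
qed

lemma exists_measure:
  "\<exists>\<nu>. sets \<nu> = sets (stream_space (count_space S)) \<and> (\<forall>v\<in>lists S. emeasure \<nu> (sstart S v) = ennreal (w v))"
proof (intro exI conjI ballI)
  let ?\<nu> = "distr \<Omega> (stream_space (count_space S)) (path [])"
  show "sets ?\<nu> = sets (stream_space (count_space S))" by simp
  fix v assume v: "v \<in> lists S"
  have "sstart S v \<in> sets (stream_space (count_space S))"
    using v sets_stream_space_sstart[OF countable_finite[OF finite_S]]
    by (auto simp: image_subset_iff sstart_in_streams)
  then have "emeasure ?\<nu> (sstart S v) = emeasure \<Omega> (path [] -` sstart S v \<inter> space \<Omega>)"
    by (rule emeasure_distr[OF path_measurable])
  also have "path [] -` sstart S v \<inter> space \<Omega> = {t. 0 \<le> t \<and> t < w [] \<and> stake (length v) (path [] t) = v}"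
    using path_in_streams[of "[]"] by (auto simp: space_\<Omega> sstart_iff_stake)
  also have "emeasure \<Omega> \<dots> = emeasure lborel \<dots>"
    unfolding \<Omega>_def using emeasure_path(1)[OF v] by (intro emeasure_restrict_space) auto
  finally show "emeasure ?\<nu> (sstart S v) = ennreal (w v)" using emeasure_path(2)[OF v] by simp
qed

end

section \<open>The Mandelbrot measure has the prescribed cylinder masses\<close>

lemma sstart_image_subset: "sstart S ` lists S \<subseteq> Pow (streams S)"
  by (intro image_subsetI PowI sstart_in_streams)

lemma extend_measure_cong:
  assumes "\<And>i. i \<in> I \<Longrightarrow> f i = g i"
  shows "extend_measure \<Omega> I G f = extend_measure \<Omega> I G g"
proof -
  have "(\<forall>i\<in>I. m (G i) = f i) = (\<forall>i\<in>I. m (G i) = g i)" "(\<forall>i\<in>I. f i = 0) = (\<forall>i\<in>I. g i = 0)" for m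
    using assms by auto
  then show ?thesis unfolding extend_measure_def by (simp only:)
qed

lemma sets_mandelbrot_measure:
  "finite S \<Longrightarrow> sets (mandelbrot_measure S X \<omega>) = sets (stream_space (count_space S))"
  "space (mandelbrot_measure S X \<omega>) = streams S"
proof -
  have sub: "sstart S ` lists S \<subseteq> Pow (streams S)" by (rule sstart_image_subset)
  show "space (mandelbrot_measure S X \<omega>) = streams S"
    unfolding mandelbrot_measure_def by (rule space_extend_measure[OF sub])
  assume "finite S"
  then have "sets (stream_space (count_space S)) = sigma_sets (streams S) (sstart S ` lists S \<union> {{}})"
    using sub by (subst sets_stream_space_sstart) (auto intro: countable_finite)
  also have "\<dots> = sigma_sets (streams S) (sstart S ` lists S)"
  proof (rule sigma_sets_eqI)
    show "a \<in> sigma_sets (streams S) (sstart S ` lists S)" if "a \<in> sstart S ` lists S \<union> {{}}" for a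
      using that by (auto intro: sigma_sets.Empty sigma_sets.Basic)
    show "b \<in> sigma_sets (streams S) (sstart S ` lists S \<union> {{}})" if "b \<in> sstart S ` lists S" for b
      using that by (auto intro: sigma_sets.Basic)
  qed
  finally show "sets (mandelbrot_measure S X \<omega>) = sets (stream_space (count_space S))"
    unfolding mandelbrot_measure_def by (simp add: sets_extend_measure[OF sub])
qed

text \<open>\<open>extend_measure\<close> takes the prescribed values as soon as some measure does;
  for nonnegative consistent masses, \<open>cylinder_masses\<close> provides one.\<close>

lemma emeasure_mandelbrot_measure:
  assumes fin: "finite S"
    and nn: "\<And>u. u \<in> lists S \<Longrightarrow> 0 \<le> cascade_Q X \<omega> [] u * cascade_Y S X \<omega> u"
    and cons: "\<And>u. u \<in> lists S \<Longrightarrow> cascade_Q X \<omega> [] u * cascade_Y S X \<omega> u =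
      (\<Sum>a\<in>S. cascade_Q X \<omega> [] (u @ [a]) * cascade_Y S X \<omega> (u @ [a]))"
    and v: "v \<in> lists S"
  shows "emeasure (mandelbrot_measure S X \<omega>) (sstart S v) = ennreal (cascade_Q X \<omega> [] v * cascade_Y S X \<omega> v)"
proof -
  obtain h where h: "bij_betw h {..<card S} S"
    using ex_bij_betw_nat_finite[OF fin] by (auto simp: atLeast0LessThan)
  interpret cylinder_masses S "\<lambda>u. cascade_Q X \<omega> [] u * cascade_Y S X \<omega> u" h "card S"
    by standard (fact h nn cons)+
  obtain \<nu> where \<nu>: "sets \<nu> = sets (stream_space (count_space S))"
    "\<And>v. v \<in> lists S \<Longrightarrow> emeasure \<nu> (sstart S v) = ennreal (cascade_Q X \<omega> [] v * cascade_Y S X \<omega> v)"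
    using exists_measure by blast
  have s: "sets (mandelbrot_measure S X \<omega>) = sets \<nu>" using sets_mandelbrot_measure(1)[OF fin] \<nu> by simp
  show ?thesis
  proof (rule emeasure_extend_measure[OF mandelbrot_measure_def[of S X \<omega>], where \<mu>' = "emeasure \<nu>"])
    show "sstart S ` lists S \<subseteq> Pow (streams S)" by (rule sstart_image_subset)
    show "positive (sets (mandelbrot_measure S X \<omega>)) (emeasure \<nu>)" by (simp add: positive_def)
    show "countably_additive (sets (mandelbrot_measure S X \<omega>)) (emeasure \<nu>)"
      unfolding s by (rule emeasure_countably_additive)
  qed (use \<nu> v in auto)
qed

text \<open>Allows the given weights to be exchanged for truncated ones at sample points where both
  agree on all words.\<close>

lemma mandelbrot_measure_cong:
  assumes "\<And>u a. u \<in> lists S \<Longrightarrow> a \<in> S \<Longrightarrow> X u \<omega> a = X' u \<omega> a"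
  shows "mandelbrot_measure S X \<omega> = mandelbrot_measure S X' \<omega>"
proof -
  have Q: "cascade_Q X \<omega> u v = cascade_Q X' \<omega> u v" if "u \<in> lists S" "v \<in> lists S" for u v
    unfolding cascade_Q_def
    by (rule prod.cong[OF refl], rule assms) (use that in \<open>auto dest: in_set_takeD\<close>)
  have Y: "cascade_Y S X \<omega> u = cascade_Y S X' \<omega> u" if "u \<in> lists S" for u
    unfolding cascade_Y_def using Q[OF that] by (simp add: words_def)
  have "ennreal (cascade_Q X \<omega> [] u * cascade_Y S X \<omega> u) = ennreal (cascade_Q X' \<omega> [] u * cascade_Y S X' \<omega> u)"
    if "u \<in> lists S" for u using Q[OF _ that, of "[]"] Y[OF that] by simp
  then show ?thesis unfolding mandelbrot_measure_def by (rule extend_measure_cong)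
qed

subsection \<open>The Mandelbrot measure of a cascade\<close>

definition code :: "('a \<Rightarrow> 'b) list \<Rightarrow> 'a stream \<Rightarrow> 'b list" where
  "code gs y = map2 (\<lambda>g a. g a) gs (stake (length gs) y)"

lemma code_Nil[simp]: "code [] y = []" by (simp add: code_def)

lemma code_Cons[simp]: "code (g # gs) y = g (shd y) # code gs (stl y)" by (simp add: code_def)

lemma length_code[simp]: "length (code gs y) = length gs" by (simp add: code_def)

lemma sstart_eq_stake: "u \<in> lists S \<Longrightarrow> sstart S u = {y \<in> streams S. stake (length u) y = u}"
  using sstart_in_streams[of u S] sstart_eq[of _ S u] by (auto simp: list_eq_iff_nth_eq)

lemma sstart_snoc:
  assumes "u \<in> lists S" "a \<in> S"
  shows "sstart S (u @ [a]) = {y \<in> sstart S u. y !! length u = a}"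
  using assms by (auto simp: sstart_eq_stake stake_Suc simp del: stake.simps(2))

lemma sets_sstart_count_space:
  "finite S \<Longrightarrow> u \<in> lists S \<Longrightarrow> sstart S u \<in> sets (stream_space (count_space S))"
  using sets_stream_space_sstart[of S] sstart_image_subset[of S]
  by (auto simp: countable_finite intro!: sigma_sets.Basic)

context cascade
begin

abbreviation \<mu> :: "'w \<Rightarrow> 'a stream measure" where "\<mu> \<equiv> mandelbrot_measure S X"

lemma sets_\<mu>: "sets (\<mu> \<omega>) = sets (stream_space (count_space S))"
  by (rule sets_mandelbrot_measure(1)[OF finite_S])

lemma space_\<mu>: "space (\<mu> \<omega>) = streams S" by (rule sets_mandelbrot_measure(2))

lemma emeasure_\<mu>_sstart:
  assumes "good \<omega>" "u \<in> lists S"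
  shows "emeasure (\<mu> \<omega>) (sstart S u) = ennreal (Q [] u \<omega> * V u \<omega>)"
proof -
  have "emeasure (\<mu> \<omega>) (sstart S u) = ennreal (Q [] u \<omega> * Y u \<omega>)"
  proof (rule emeasure_mandelbrot_measure[OF finite_S _ _ assms(2)])
    show "0 \<le> Q [] u \<omega> * Y u \<omega>" if "u \<in> lists S" for u
      using that Q_nonneg good_Y_nonneg[OF assms(1)] by simp
    show "Q [] u \<omega> * Y u \<omega> = (\<Sum>a\<in>S. Q [] (u @ [a]) \<omega> * Y (u @ [a]) \<omega>)" if "u \<in> lists S" for u
      by (simp add: cascade_Q_append cascade_Q_Cons good_consistent[OF assms(1) that] sum_distrib_left mult.assoc)
  qed
  then show ?thesis using good_V[OF assms] by simp
qed

text \<open>The first letter splits the set into disjoint pieces below the vertices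
  \<open>u @ [a]\<close> with \<open>g a = c\<close>, in parallel with the recursion of
  \<open>cyl_mass\<close>; hence the generalisation over \<open>u\<close>.\<close>

lemma emeasure_\<mu>_code_aux:
  assumes good: "good \<omega>"
  shows "u \<in> lists S \<Longrightarrow> length cs = length gs \<Longrightarrow>
    {y \<in> sstart S u. code gs (sdrop (length u) y) = cs} \<in> sets (\<mu> \<omega>) \<and>
    emeasure (\<mu> \<omega>) {y \<in> sstart S u. code gs (sdrop (length u) y) = cs} = ennreal (Q [] u \<omega> * cm gs cs u \<omega>)"
proof (induction gs cs arbitrary: u rule: list_induct2')
  case 1
  then show ?case
    using emeasure_\<mu>_sstart[OF good, of u] sets_sstart_count_space[OF finite_S, of u] by (simp add: sets_\<mu>)
next
  case (4 g gs c cs)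
  let ?A = "{a. a \<in> S \<and> g a = c}"
  let ?E = "\<lambda>a. {y \<in> sstart S (u @ [a]). code gs (sdrop (length (u @ [a])) y) = cs}"
  have finA: "finite ?A" using finite_S by simp
  have u: "u \<in> lists S" by fact
  have IH: "?E a \<in> sets (\<mu> \<omega>)" "emeasure (\<mu> \<omega>) (?E a) = ennreal (Q [] (u @ [a]) \<omega> * cm gs cs (u @ [a]) \<omega>)"
    if "a \<in> ?A" for a
    using 4(1)[of "u @ [a]"] that u 4(3) by auto
  have eq: "{y \<in> sstart S u. code (g # gs) (sdrop (length u) y) = c # cs} = (\<Union>a\<in>?A. ?E a)"
  proof (intro equalityI subsetI)
    fix y assume y: "y \<in> {y \<in> sstart S u. code (g # gs) (sdrop (length u) y) = c # cs}"
    then have "y \<in> streams S" using sstart_in_streams[OF u] by auto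
    then have "y !! length u \<in> S" by (simp add: streams_iff_snth)
    moreover have "g (y !! length u) = c" "code gs (sdrop (Suc (length u)) y) = cs"
      using y by (simp_all add: sdrop_simps)
    ultimately show "y \<in> (\<Union>a\<in>?A. ?E a)"
      using y sstart_snoc[OF u, of "y !! length u"] by (intro UN_I[of "y !! length u"]) auto
  next
    fix y assume "y \<in> (\<Union>a\<in>?A. ?E a)"
    then obtain a where "a \<in> ?A" "y \<in> ?E a" by blast
    then show "y \<in> {y \<in> sstart S u. code (g # gs) (sdrop (length u) y) = c # cs}"
      using sstart_snoc[OF u, of a] by (simp add: sdrop_simps)
  qed
  have disj: "disjoint_family_on ?E ?A"
    using sstart_snoc[OF u] by (auto simp: disjoint_family_on_def)
  have "emeasure (\<mu> \<omega>) (\<Union>a\<in>?A. ?E a) = (\<Sum>a\<in>?A. emeasure (\<mu> \<omega>) (?E a))"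
    by (rule sum_emeasure[symmetric]) (use IH disj finA in auto)
  also have "\<dots> = (\<Sum>a\<in>?A. ennreal (Q [] (u @ [a]) \<omega> * cm gs cs (u @ [a]) \<omega>))"
    by (intro sum.cong refl IH)
  also have "\<dots> = ennreal (\<Sum>a\<in>?A. Q [] (u @ [a]) \<omega> * cm gs cs (u @ [a]) \<omega>)"
    using u by (intro sum_ennreal mult_nonneg_nonneg Q_nonneg cm_nonneg) auto
  also have "(\<Sum>a\<in>?A. Q [] (u @ [a]) \<omega> * cm gs cs (u @ [a]) \<omega>) = Q [] u \<omega> * cm (g # gs) (c # cs) u \<omega>"
    by (simp add: cascade_Q_append cascade_Q_Cons sum_distrib_left mult.assoc)
  finally show ?case unfolding eq using IH finA by (auto intro!: sets.finite_UN)
qed auto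

lemma emeasure_\<mu>_code:
  assumes "good \<omega>" "length cs = length gs"
  shows "{y \<in> streams S. code gs y = cs} \<in> sets (\<mu> \<omega>)"
    and "emeasure (\<mu> \<omega>) {y \<in> streams S. code gs y = cs} = ennreal (cm gs cs [] \<omega>)"
  using emeasure_\<mu>_code_aux[OF assms(1) _ assms(2), of "[]"] by simp_all

lemma emeasure_\<mu>_space: "good \<omega> \<Longrightarrow> emeasure (\<mu> \<omega>) (space (\<mu> \<omega>)) = ennreal (V [] \<omega>)"
  using emeasure_\<mu>_sstart[of \<omega> "[]"] by (simp add: space_\<mu>)

end

section \<open>The mean measure and its entropy\<close>

context cascade_moment
begin

definition letter_law :: "('a \<Rightarrow> 'c) \<Rightarrow> 'c measure" where
  "letter_law f = point_measure (f ` S) (\<lambda>c. ennreal (wt f c))"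

lemma sets_letter_law: "sets (letter_law f) = sets (count_space (f ` S))"
  by (simp add: letter_law_def sets_point_measure)

lemma emeasure_letter_law: "c \<in> f ` S \<Longrightarrow> emeasure (letter_law f) {c} = ennreal (wt f c)"
  unfolding letter_law_def using finite_S by (subst emeasure_point_measure_finite) auto

lemma bernoulli_shift_letter_law: "bernoulli_shift (letter_law f) (f ` S)"
proof (intro bernoulli_shift.intro bernoulli_shift_axioms.intro prob_spaceI)
  have "emeasure (letter_law f) (space (letter_law f)) = (\<Sum>c\<in>f ` S. ennreal (wt f c))"
    unfolding letter_law_def space_point_measure using finite_S
    by (subst emeasure_point_measure_finite) auto
  also have "\<dots> = 1" by (simp add: wt_nonneg sum_wt)
  finally show "emeasure (letter_law f) (space (letter_law f)) = 1" .
  show "finite (f ` S)" using finite_S by simp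
  show "sets (letter_law f) = sets (count_space (f ` S))" by (rule sets_letter_law)
qed

text \<open>The mean masses of cylinders are products by \<open>nn_cm_mean\<close>, and cylinders
  form an intersection-stable generator, so the two measures agree on all measurable sets.\<close>

lemma mean_measure_\<mu>:
  assumes S': "f ` S = S'"
  shows "mean_measure M (stream_space (count_space S')) (\<lambda>\<omega>. distr (\<mu> \<omega>) (stream_space (count_space S')) (smap f))
    = stream_space (letter_law f)"
proof -
  interpret p: bernoulli_shift "letter_law f" "f ` S" by (rule bernoulli_shift_letter_law)

  let ?N = "stream_space (count_space S')" and ?\<beta> = "stream_space (letter_law f)"
  let ?G = "sstart S' ` lists S' \<union> {{}}"
  define \<xi> where "\<xi> \<omega> = distr (\<mu> \<omega>) ?N (smap f)" for \<omega>
  have finS': "finite S'" using S' finite_S by auto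
  have sm: "smap f \<in> measurable (\<mu> \<omega>) ?N" for \<omega>
    unfolding measurable_cong_sets[OF sets_\<mu> refl] using S' by (intro measurable_smap) auto
  have sets_\<beta>: "sets ?\<beta> = sets ?N" using sets_letter_law[of f] S' by (intro sets_stream_space_cong) simp
  have sets_N: "sets ?N = sigma_sets (streams S') ?G" using p.sets_\<beta> sets_\<beta> S' by simp
  have space_N: "space ?N = streams S'" by (simp add: space_stream_space)
  have \<xi>: "emeasure (\<xi> \<omega>) A = emeasure (\<mu> \<omega>) (smap f -` A \<inter> streams S)" if "A \<in> sets ?N" for A \<omega>
    unfolding \<xi>_def using emeasure_distr[OF sm that] by (simp add: space_\<mu>)
  have \<xi>_fin: "emeasure (\<xi> \<omega>) A \<le> ennreal (V [] \<omega>)" if "good \<omega>" "A \<in> sets ?N" for A \<omega>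
  proof -
    have "emeasure (\<xi> \<omega>) A \<le> emeasure (\<mu> \<omega>) (space (\<mu> \<omega>))"
      unfolding \<xi>[OF that(2)] by (rule emeasure_space)
    then show ?thesis using emeasure_\<mu>_space[OF that(1)] by simp
  qed
  have GP: "?G \<subseteq> Pow (streams S')" using sstart_image_subset by auto
  have main: "\<exists>h\<in>borel_measurable M. (AE \<omega> in M. emeasure (\<xi> \<omega>) A = h \<omega>) \<and> (\<integral>\<^sup>+\<omega>. h \<omega> \<partial>M) = emeasure ?\<beta> A"
    if "A \<in> sigma_sets (streams S') ?G" for A
    using Int_stable_sstart GP that
  proof (induction rule: sigma_sets_induct_disjoint)
    case (basic A)
    then consider v where "v \<in> lists S'" "A = sstart S' v" | "A = {}" by auto
    then show ?case
    proof cases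
      case 1
      let ?gs = "replicate (length v) f"
      have "stake (length v) (smap f y) = code ?gs y" for y
        by (induction v arbitrary: y) auto
      then have pre: "smap f -` A \<inter> streams S = {y \<in> streams S. code ?gs y = v}"
        using S' unfolding 1(2) sstart_eq_stake[OF 1(1)] by (auto simp: streams_iff_snth)
      have prod: "prod_list (map2 wt ?gs v) = (\<Prod>c\<leftarrow>v. wt f c)" by (induction v) auto
      have "AE \<omega> in M. emeasure (\<xi> \<omega>) A = ennreal (cm ?gs v [] \<omega>)"
        using AE_good
      proof eventually_elim
        case (elim \<omega>)
        have "A \<in> sets ?N" using 1 sets_sstart_count_space[OF finS'] by simp
        then show ?case using emeasure_\<mu>_code(2)[OF elim, of v ?gs] by (simp add: \<xi> pre)
      qed
      moreover have "(\<integral>\<^sup>+\<omega>. ennreal (cm ?gs v [] \<omega>) \<partial>M) = emeasure ?\<beta> A"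
      proof -
        have v: "v \<in> lists (f ` S)" using 1 S' by simp
        have "emeasure ?\<beta> A = (\<Prod>c\<leftarrow>v. emeasure (letter_law f) {c})"
          using p.emeasure_word[OF v] unfolding 1(2) sstart_eq_stake[OF 1(1)] p.space_\<beta> S'
          by (simp add: vimage_def Int_def conj_commute)
        also have "\<dots> = ennreal (\<Prod>c\<leftarrow>v. wt f c)"
          using v by (induction v) (auto simp: emeasure_letter_law ennreal_mult' wt_nonneg)
        finally show ?thesis using nn_cm_mean[of v ?gs] prod by simp
      qed
      ultimately show ?thesis
        by (intro bexI[of _ "\<lambda>\<omega>. ennreal (cm ?gs v [] \<omega>)"] conjI measurable_compose[OF cm_meas measurable_ennreal]) auto
    next
      case 2
      then show ?thesis by (intro bexI[of _ "\<lambda>_. 0"]) auto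
    qed
  next
    case empty
    show ?case by (intro bexI[of _ "\<lambda>_. 0"]) auto
  next
    case (compl A)
    then obtain h where h[measurable]: "h \<in> borel_measurable M" and h1: "AE \<omega> in M. emeasure (\<xi> \<omega>) A = h \<omega>"
      and h2: "(\<integral>\<^sup>+\<omega>. h \<omega> \<partial>M) = emeasure ?\<beta> A" by blast
    have A: "A \<in> sets ?N" using compl sets_N by simp
    have top: "streams S' \<in> sets ?N" using sets.top[of ?N] space_N by simp
    note [measurable] = measurable_compose[OF V_meas[of "[]"] measurable_ennreal, simplified]
    have le: "AE \<omega> in M. h \<omega> \<le> ennreal (V [] \<omega>)"
      using h1 AE_good by eventually_elim (metis \<xi>_fin A)
    have fin: "(\<integral>\<^sup>+\<omega>. h \<omega> \<partial>M) \<noteq> \<top>" unfolding h2 by simp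
    have "AE \<omega> in M. emeasure (\<xi> \<omega>) (streams S' - A) = ennreal (V [] \<omega>) - h \<omega>"
      using h1 AE_good
    proof eventually_elim
      case (elim \<omega>)
      have "smap f -` streams S' \<inter> streams S = space (\<mu> \<omega>)"
        using S' by (auto simp: space_\<mu> streams_iff_snth)
      then have t: "emeasure (\<xi> \<omega>) (streams S') = ennreal (V [] \<omega>)"
        using emeasure_\<mu>_space[OF elim(2)] \<xi>[OF top] by simp
      have "emeasure (\<xi> \<omega>) A \<noteq> \<infinity>" using \<xi>_fin[OF elim(2) A] by (auto simp: top_unique)
      then have "emeasure (\<xi> \<omega>) (streams S' - A) = emeasure (\<xi> \<omega>) (streams S') - emeasure (\<xi> \<omega>) A"
        using A top sets.sets_into_space[OF A] space_N by (intro emeasure_Diff) (auto simp: \<xi>_def)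
      then show ?case by (simp add: t elim)
    qed
    moreover have "(\<integral>\<^sup>+\<omega>. ennreal (V [] \<omega>) - h \<omega> \<partial>M) = emeasure ?\<beta> (streams S' - A)"
    proof -
      have "(\<integral>\<^sup>+\<omega>. ennreal (V [] \<omega>) - h \<omega> \<partial>M) = (\<integral>\<^sup>+\<omega>. ennreal (V [] \<omega>) \<partial>M) - (\<integral>\<^sup>+\<omega>. h \<omega> \<partial>M)"
        by (rule nn_integral_diff) (use fin le in simp_all)
      also have "\<dots> = 1 - emeasure ?\<beta> A" by (simp add: nn_V h2)
      also have "\<dots> = emeasure ?\<beta> (streams S' - A)"
        using p.\<beta>.emeasure_space_1 A sets_\<beta> emeasure_compl[of A ?\<beta>] p.space_\<beta> S' by simp
      finally show ?thesis .
    qed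
    ultimately show ?case by (intro bexI[of _ "\<lambda>\<omega>. ennreal (V [] \<omega>) - h \<omega>"]) auto
  next
    case (union A)
    then have "\<forall>i::nat. \<exists>h. h \<in> borel_measurable M \<and> (AE \<omega> in M. emeasure (\<xi> \<omega>) (A i) = h \<omega>) \<and> (\<integral>\<^sup>+\<omega>. h \<omega> \<partial>M) = emeasure ?\<beta> (A i)"
      by blast
    then obtain h where h[measurable]: "\<And>i. h i \<in> borel_measurable M" and h1: "\<And>i. AE \<omega> in M. emeasure (\<xi> \<omega>) (A i) = h i \<omega>"
      and h2: "\<And>i. (\<integral>\<^sup>+\<omega>. h i \<omega> \<partial>M) = emeasure ?\<beta> (A i)" by metis
    have A: "A i \<in> sets ?N" for i using union sets_N by auto
    have "AE \<omega> in M. \<forall>i. emeasure (\<xi> \<omega>) (A i) = h i \<omega>" using h1 by (simp add: AE_all_countable)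
    then have "AE \<omega> in M. emeasure (\<xi> \<omega>) (\<Union>i. A i) = (\<Sum>i. h i \<omega>)"
    proof eventually_elim
      case (elim \<omega>)
      have "emeasure (\<xi> \<omega>) (\<Union>i. A i) = (\<Sum>i. emeasure (\<xi> \<omega>) (A i))"
        using A union by (intro suminf_emeasure[symmetric]) (auto simp: \<xi>_def)
      then show ?case using elim by simp
    qed
    moreover have "(\<integral>\<^sup>+\<omega>. (\<Sum>i. h i \<omega>) \<partial>M) = emeasure ?\<beta> (\<Union>i. A i)"
    proof -
      have "(\<integral>\<^sup>+\<omega>. (\<Sum>i. h i \<omega>) \<partial>M) = (\<Sum>i. emeasure ?\<beta> (A i))"
        by (subst nn_integral_suminf) (simp_all add: h2)
      also have "\<dots> = emeasure ?\<beta> (\<Union>i. A i)"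
        using A sets_\<beta> union by (intro suminf_emeasure) auto
      finally show ?thesis .
    qed
    ultimately show ?case by (intro bexI[of _ "\<lambda>\<omega>. \<Sum>i. h i \<omega>"]) auto
  qed
  have eq: "(\<integral>\<^sup>+\<omega>. emeasure (\<xi> \<omega>) A \<partial>M) = emeasure ?\<beta> A" if A: "A \<in> sets ?N" for A
  proof -
    obtain h where h: "AE \<omega> in M. emeasure (\<xi> \<omega>) A = h \<omega>" "(\<integral>\<^sup>+\<omega>. h \<omega> \<partial>M) = emeasure ?\<beta> A"
      using main[OF A[unfolded sets_N]] by blast
    show ?thesis using nn_integral_cong_AE[OF h(1)] h(2) by simp
  qed
  have "mean_measure M ?N \<xi> = measure_of (space ?N) (sets ?N) (emeasure ?\<beta>)"
    unfolding mean_measure_def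
    by (rule measure_of_eq) (use sets.space_closed eq in \<open>auto simp: sets.sigma_sets_eq\<close>)
  also have "\<dots> = measure_of (space ?\<beta>) (sets ?\<beta>) (emeasure ?\<beta>)"
    using sets_\<beta> sets_eq_imp_space_eq[OF sets_\<beta>] by simp
  also have "\<dots> = ?\<beta>" by (rule measure_of_of_measure)
  finally show ?thesis by (simp add: \<xi>_def[abs_def])
qed

lemma measure_entropy_letter_law:
  "measure_entropy (stream_space (letter_law f)) stl = ereal (entm f)"
proof -
  interpret p: bernoulli_shift "letter_law f" "f ` S" by (rule bernoulli_shift_letter_law)
  have "p.shift_entropy = entm f"
    unfolding p.shift_entropy_def entm_def entropy_term_def sum_negf[symmetric]
    by (intro sum.cong refl) (simp add: measure_def emeasure_letter_law wt_nonneg)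
  then show ?thesis using p.measure_entropy_bernoulli_shift by simp
qed

end

text \<open>Division by \<open>q - 1 < 0\<close> reverses the inequality between the two functions,
  and the minus signs in the derivatives reverse it once more.\<close>

lemma slope_comparison:
  fixes f g :: "real \<Rightarrow> real"
  assumes f: "(f has_real_derivative - a) (at 1)" "f 1 = 1"
    and g: "(g has_real_derivative - b) (at 1)" "g 1 = 1"
    and le: "\<And>q. 0 < q \<Longrightarrow> q < 1 \<Longrightarrow> f q \<le> g q"
  shows "a \<le> b"
proof -
  have tf: "((\<lambda>q. (f q - 1) / (q - 1)) \<longlongrightarrow> - a) (at_left 1)" and tg: "((\<lambda>q. (g q - 1) / (q - 1)) \<longlongrightarrow> - b) (at_left 1)"
    using f g by (simp_all add: has_field_derivative_iff filterlim_at_split)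
  have "\<forall>\<^sub>F q::real in at_left 1. q \<in> {0<..<1}" by (rule eventually_at_leftI[of 0]) auto
  then have "\<forall>\<^sub>F q in at_left 1. (g q - 1) / (q - 1) \<le> (f q - 1) / (q - 1)"
    by eventually_elim (use le in \<open>auto intro!: divide_right_mono_neg\<close>)
  then have "- b \<le> - a" by (rule tendsto_le[OF _ tf tg, rotated]) simp
  then show ?thesis by simp
qed

section \<open>Partitions into generalised cylinders\<close>

definition cells :: "'a set \<Rightarrow> ('a \<Rightarrow> 'b) list \<Rightarrow> 'a stream set set" where
  "cells S gs = (\<lambda>cs. {y \<in> streams S. code gs y = cs}) ` codes S gs"

lemma code_in_codes: "y \<in> streams S \<Longrightarrow> code gs y \<in> codes S gs"
proof (induction gs arbitrary: y)
  case (Cons g gs)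
  then have "shd y \<in> S" "stl y \<in> streams S" by (auto simp: streams_shd streams_stl)
  then show ?case using Cons.IH[of "stl y"] by (force simp: codes_Cons)
qed simp

lemma codes_subset_image:
  assumes "S \<noteq> {}"
  shows "cs \<in> codes S gs \<Longrightarrow> \<exists>y\<in>streams S. code gs y = cs"
proof (induction gs arbitrary: cs)
  case Nil
  obtain a where "a \<in> S" using assms by auto
  then show ?case using Nil by (intro bexI[of _ "sconst a"]) (auto simp: sconst_streams)
next
  case (Cons g gs)
  then obtain a cs' where a: "a \<in> S" "cs = g a # cs'" "cs' \<in> codes S gs" by (auto simp: codes_Cons)
  obtain y where y: "y \<in> streams S" "code gs y = cs'" using Cons.IH[OF a(3)] by blast
  have "a ## y \<in> streams S" using a(1) y(1) by (simp add: streams_Stream)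
  moreover have "code (g # gs) (a ## y) = cs" using a(2) y(2) by simp
  ultimately show ?case by (rule bexI[rotated])
qed

lemma code_image:
  assumes "S \<noteq> {}"
  shows "code gs ` streams S = codes S gs"
proof (rule antisym)
  show "code gs ` streams S \<subseteq> codes S gs" by (rule image_subsetI) (rule code_in_codes)
  show "codes S gs \<subseteq> code gs ` streams S"
  proof (rule subsetI)
    fix cs assume "cs \<in> codes S gs"
    from codes_subset_image[OF assms this] show "cs \<in> code gs ` streams S" by (elim bexE) (rule image_eqI[OF sym])
  qed
qed

lemma cells_eq: "S \<noteq> {} \<Longrightarrow> cells S gs = (\<lambda>x. {y \<in> streams S. code gs y = code gs x}) ` streams S"
  unfolding cells_def code_image[symmetric] by (simp add: image_image)

text \<open>Every code in \<open>codes S gs\<close> is realised by some point, so its cell is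
  non-empty and determines it. Sums over the set of cells thereby become sums over codes.\<close>

lemma inj_on_cells: "S \<noteq> {} \<Longrightarrow> inj_on (\<lambda>cs. {y \<in> streams S. code gs y = cs}) (codes S gs)"
proof (rule inj_onI)
  fix c d assume S: "S \<noteq> {}" and c: "c \<in> codes S gs" and eq: "{y \<in> streams S. code gs y = c} = {y \<in> streams S. code gs y = d}"
  obtain y where "y \<in> streams S" "code gs y = c" using codes_subset_image[OF S c] by blast
  then show "c = d" using eq by auto
qed

lemma code_replicate_id: "code (replicate n id) y = stake n y"
  by (induction n arbitrary: y) auto

lemma codes_replicate_id: "codes S (replicate n id) = words S n"
  by (induction n) (simp_all add: codes_Cons words_Suc)

lemma cells_replicate_id: "cells S (replicate n id) = sstart S ` words S n"
  unfolding cells_def codes_replicate_id code_replicate_id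
  by (rule image_cong) (auto simp: words_def sstart_eq_stake)

context cascade_moment
begin

text \<open>Merging letters decreases \<open>\<Sum> p\<^sup>q\<close> for \<open>q < 1\<close> by
  subadditivity, and the slopes at 1 inherit the comparison.\<close>

lemma entm_compose_le: "entm (\<lambda>a. h (f a)) \<le> entm f"
proof (rule slope_comparison[OF \<phi>m_has_derivative \<phi>m_1 \<phi>m_has_derivative \<phi>m_1])
  fix q :: real assume q: "0 < q" "q < 1"
  have finI: "finite (f ` S)" using finite_S by simp
  have wt: "wt (\<lambda>a. h (f a)) c = (\<Sum>b | b \<in> f ` S \<and> h b = c. wt f b)" for c
  proof -
    have "wt (\<lambda>a. h (f a)) c = (\<Sum>b\<in>f ` {a \<in> S. h (f a) = c}. \<Sum>a | a \<in> {a \<in> S. h (f a) = c} \<and> f a = b. \<integral>\<omega>. X [] \<omega> a \<partial>M)"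
      unfolding wt_def by (rule sum.image_gen) (use finite_S in simp)
    also have "\<dots> = (\<Sum>b | b \<in> f ` S \<and> h b = c. wt f b)"
      unfolding wt_def by (intro sum.cong) auto
    finally show ?thesis .
  qed
  have "\<phi>m (\<lambda>a. h (f a)) q = (\<Sum>c\<in>h ` f ` S. (\<Sum>b | b \<in> f ` S \<and> h b = c. wt f b) powr q)"
    unfolding \<phi>m_def wt by (simp add: image_image)
  also have "\<dots> \<le> (\<Sum>c\<in>h ` f ` S. \<Sum>b | b \<in> f ` S \<and> h b = c. wt f b powr q)"
    using finI wt_nonneg q by (intro sum_mono powr_sum_le) auto
  also have "\<dots> = \<phi>m f q"
    unfolding \<phi>m_def using sum.image_gen[OF finI, of "\<lambda>b. wt f b powr q" h] by simp
  finally show "\<phi>m (\<lambda>a. h (f a)) q \<le> \<phi>m f q" .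
qed

text \<open>Jensen's inequality gives \<open>\<phi> q \<le> \<phi>m id q\<close> for
  \<open>q < 1\<close>, and the slopes at 1 are compared. Consequently the letters seen through the
  identity contribute \<open>dimen\<close> itself, both to cylinders and to the first block of a
  ball.\<close>

lemma dimen_le_entm_id: "dimen \<le> entm id"
proof (rule slope_comparison[OF \<phi>_has_derivative \<phi>_1 \<phi>m_has_derivative \<phi>m_1])
  fix q :: real assume q: "0 < q" "q < 1"
  have wt: "wt id a = (\<integral>\<omega>. X [] \<omega> a \<partial>M)" if "a \<in> S" for a
  proof -
    have "{b. b \<in> S \<and> id b = a} = {a}" using that by auto
    then show ?thesis by (simp add: wt_def)
  qed
  have "(\<integral>\<omega>. X [] \<omega> a powr q \<partial>M) \<le> wt id a powr q" if a: "a \<in> S" for a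
  proof -
    have "ennreal (\<integral>\<omega>. X [] \<omega> a powr q \<partial>M) = (\<integral>\<^sup>+\<omega>. ennreal (X [] \<omega> a powr q) \<partial>M)"
      using a q q0 by (intro nn_powr[symmetric]) auto
    also have "\<dots> \<le> ennreal (wt id a powr q)"
    proof (rule nn_powr_jensen)
      show "(\<integral>\<^sup>+\<omega>. ennreal (X [] \<omega> a) \<partial>M) = ennreal (wt id a)"
        unfolding wt[OF a] using a nonneg by (intro nn_integral_eq_integral integrable_X) auto
    qed (use a q wt_nonneg nonneg X_Nil_meas in auto)
    finally show ?thesis by simp
  qed
  then show "\<phi> q \<le> \<phi>m id q"
    using q q0 unfolding \<phi>m_def by (subst \<phi>_eq) (auto intro!: sum_mono)
qed

lemma sum_cm: "good \<omega> \<Longrightarrow> (\<Sum>cs\<in>codes S gs. cm gs cs [] \<omega>) = V [] \<omega>"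
proof -
  assume good: "good \<omega>"
  have "u \<in> lists S \<Longrightarrow> (\<Sum>cs\<in>codes S gs. cm gs cs u \<omega>) = V u \<omega>" for u
  proof (induction gs arbitrary: u)
    case (Cons g gs)
    have "(\<Sum>cs\<in>codes S (g # gs). cm (g # gs) cs u \<omega>) =
      (\<Sum>c\<in>g ` S. \<Sum>a | a \<in> S \<and> g a = c. X u \<omega> a * (\<Sum>cs\<in>codes S gs. cm gs cs (u @ [a]) \<omega>))"
    proof -
      have "(\<Sum>cs\<in>codes S gs. cm (g # gs) (c # cs) u \<omega>) =
        (\<Sum>a | a \<in> S \<and> g a = c. X u \<omega> a * (\<Sum>cs\<in>codes S gs. cm gs cs (u @ [a]) \<omega>))" for c
        by (simp add: sum_distrib_left sum.swap[of _ _ "codes S gs"])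
      then show ?thesis unfolding sum_codes_Cons by simp
    qed
    also have "\<dots> = (\<Sum>a\<in>S. X u \<omega> a * (\<Sum>cs\<in>codes S gs. cm gs cs (u @ [a]) \<omega>))" by (rule sum_fibres)
    also have "\<dots> = (\<Sum>a\<in>S. X u \<omega> a * V (u @ [a]) \<omega>)"
      using Cons by (intro sum.cong refl) simp
    finally show ?case using good_V_consistent[OF good Cons.prems] by simp
  qed simp
  then show ?thesis by simp
qed

lemma measure_\<mu>_code:
  "good \<omega> \<Longrightarrow> cs \<in> codes S gs \<Longrightarrow> measure (\<mu> \<omega>) {y \<in> streams S. code gs y = cs} = cm gs cs [] \<omega>"
  by (simp add: measure_def emeasure_\<mu>_code(2)[OF _ codes_length] cm_nonneg)

lemma S_nonempty: "S \<noteq> {}"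
proof
  assume "S = {}"
  then show False using mean1 by simp
qed

lemma sum_cells:
  assumes "good \<omega>"
  shows "(\<Sum>B\<in>cells S gs. F (measure (\<mu> \<omega>) B)) = (\<Sum>cs\<in>codes S gs. F (cm gs cs [] \<omega>))"
  unfolding cells_def
  by (subst sum.reindex[OF inj_on_cells[OF S_nonempty]]) (simp add: measure_\<mu>_code[OF assms])

lemma shannon_entropy_cells:
  assumes good: "good \<omega>" and pos: "0 < V [] \<omega>"
  shows "shannon_entropy (uniform_measure (\<mu> \<omega>) (space (\<mu> \<omega>))) (cells S gs) =
    - (\<Sum>cs\<in>codes S gs. cm gs cs [] \<omega> / V [] \<omega> * ln (cm gs cs [] \<omega> / V [] \<omega>))"
proof -
  have "measure (uniform_measure (\<mu> \<omega>) (space (\<mu> \<omega>))) B = measure (\<mu> \<omega>) B / V [] \<omega>" if B0: "B \<in> cells S gs" for B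
  proof -
    obtain cs where cs: "cs \<in> codes S gs" "B = {y \<in> streams S. code gs y = cs}" using B0 by (auto simp: cells_def)
    have B: "B \<in> sets (\<mu> \<omega>)" unfolding cs(2) by (rule emeasure_\<mu>_code(1)[OF good codes_length[OF cs(1)]])
    have "emeasure (uniform_measure (\<mu> \<omega>) (space (\<mu> \<omega>))) B = emeasure (\<mu> \<omega>) (space (\<mu> \<omega>) \<inter> B) / emeasure (\<mu> \<omega>) (space (\<mu> \<omega>))"
      using B by (intro emeasure_uniform_measure) auto
    also have "space (\<mu> \<omega>) \<inter> B = B" using sets.sets_into_space[OF B] by auto
    also have "emeasure (\<mu> \<omega>) B = ennreal (cm gs cs [] \<omega>)"
      unfolding cs(2) by (rule emeasure_\<mu>_code(2)[OF good codes_length[OF cs(1)]])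
    finally have "emeasure (uniform_measure (\<mu> \<omega>) (space (\<mu> \<omega>))) B = ennreal (cm gs cs [] \<omega> / V [] \<omega>)"
      using pos by (simp add: emeasure_\<mu>_space[OF good] divide_ennreal cm_nonneg)
    then show ?thesis unfolding cs(2) measure_\<mu>_code[OF good cs(1)]
      using pos by (simp add: measure_def cm_nonneg)
  qed
  then have "shannon_entropy (uniform_measure (\<mu> \<omega>) (space (\<mu> \<omega>))) (cells S gs) =
    - (\<Sum>B\<in>cells S gs. (\<lambda>m. m / V [] \<omega> * ln (m / V [] \<omega>)) (measure (\<mu> \<omega>) B))"
    unfolding shannon_entropy_def by simp
  then show ?thesis using sum_cells[OF good, of "\<lambda>m. m / V [] \<omega> * ln (m / V [] \<omega>)" gs] by simp
qed

text \<open>Formulated for arbitrary lists of letter maps because it is applied twice: to the balls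
  of the weighted metric and to ordinary cylinders.\<close>

theorem AE_cells_asymptotics:
  assumes fin: "finite Gs" and gs: "\<And>n. set (gs n) \<subseteq> Gs" "\<And>n. split_sorted (gs n)"
    and len: "\<And>n. real (length (gs n)) \<le> C * real (Suc n)" and C: "0 \<le> C"
    and D: "(\<lambda>n. minent (gs n) / real n) \<longlonglongrightarrow> D" and \<gamma>: "0 < \<gamma>"
  shows "AE \<omega> in M. emeasure (\<mu> \<omega>) (space (\<mu> \<omega>)) \<noteq> 0 \<longrightarrow>
    (\<lambda>n. 1 / real n * shannon_entropy (uniform_measure (\<mu> \<omega>) (space (\<mu> \<omega>))) (cells S (gs n))) \<longlonglongrightarrow> D \<and>
    has_ereal_derivative (\<lambda>q. liminf (\<lambda>n. ereal (- (\<gamma> / real n) * ln (\<Sum>B\<in>cells S (gs n). measure (\<mu> \<omega>) B powr q)))) (\<gamma> * D) 1"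
  using AE_Msum_asymptotics[OF fin gs len C D] AE_good
proof eventually_elim
  case (elim \<omega>)
  note good = elim(2)
  show ?case
  proof
    assume "emeasure (\<mu> \<omega>) (space (\<mu> \<omega>)) \<noteq> 0"
    then have pos: "0 < V [] \<omega>" using emeasure_\<mu>_space[OF good] V_nonneg[of "[]" \<omega>] by (auto simp: less_le)
    interpret slope_bounds "\<lambda>n. codes S (gs n)" "\<lambda>n cs. cm (gs n) cs [] \<omega>" "V [] \<omega>" D
    proof
      fix \<epsilon> :: real assume e: "0 < \<epsilon>"
      show "\<exists>q>1. \<forall>\<^sub>F n in sequentially. (\<Sum>cs\<in>codes S (gs n). cm (gs n) cs [] \<omega> powr q) \<le> exp (- ((D - \<epsilon>) * (q - 1) * real n))"
        using elim(1)[rule_format, OF e] unfolding Msum_def by blast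
      show "\<exists>q\<in>{0<..<1}. \<forall>\<^sub>F n in sequentially. (\<Sum>cs\<in>codes S (gs n). cm (gs n) cs [] \<omega> powr q) \<le> exp ((D + \<epsilon>) * (1 - q) * real n)"
        using elim(1)[rule_format, OF e] unfolding Msum_def by blast
    qed (use pos sum_cm[OF good] finite_codes[OF finite_S] in \<open>auto simp: cm_nonneg\<close>)
    have 1: "(\<lambda>n. 1 / real n * shannon_entropy (uniform_measure (\<mu> \<omega>) (space (\<mu> \<omega>))) (cells S (gs n))) \<longlonglongrightarrow> D"
      using entropy_limit unfolding H_def shannon_entropy_cells[OF good pos] .
    have "\<tau> \<gamma> = (\<lambda>q. liminf (\<lambda>n. ereal (- (\<gamma> / real n) * ln (\<Sum>B\<in>cells S (gs n). measure (\<mu> \<omega>) B powr q))))"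
      unfolding \<tau>_def[OF \<gamma>] sum_cells[OF good, of "\<lambda>m. m powr _"] by (rule ext) simp
    then have 2: "has_ereal_derivative (\<lambda>q. liminf (\<lambda>n. ereal (- (\<gamma> / real n) * ln (\<Sum>B\<in>cells S (gs n). measure (\<mu> \<omega>) B powr q)))) (\<gamma> * D) 1"
      using has_ereal_derivative_\<tau>[OF \<gamma>] by simp
    show "(\<lambda>n. 1 / real n * shannon_entropy (uniform_measure (\<mu> \<omega>) (space (\<mu> \<omega>))) (cells S (gs n))) \<longlonglongrightarrow> D \<and>
    has_ereal_derivative (\<lambda>q. liminf (\<lambda>n. ereal (- (\<gamma> / real n) * ln (\<Sum>B\<in>cells S (gs n). measure (\<mu> \<omega>) B powr q)))) (\<gamma> * D) 1"
      using 1 2 by blast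
  qed
qed

end

subsection \<open>Balls of the weighted metric\<close>

text \<open>A ball of radius \<open>exp (- n / \<gamma> 1)\<close> fixes the letters of the
  \<open>i\<close>-th projection up to the least integer \<open>c\<close> with
  \<open>c / (\<gamma> 1 + ... + \<gamma> i) \<ge> n / \<gamma> 1\<close>, hence the ceiling. The
  empty sum makes level 0 equal to 0.\<close>

definition level :: "(nat \<Rightarrow> real) \<Rightarrow> nat \<Rightarrow> nat \<Rightarrow> nat" where
  "level \<gamma> n i = nat \<lceil>real n * ((\<Sum>j = 1..i. \<gamma> j) / \<gamma> 1)\<rceil>"

text \<open>The maps applied to the successive letters of a point to describe its ball of radius
  \<open>exp (- n / \<gamma> 1)\<close>: the letters of rank between \<open>level \<gamma> n (i - 1)\<close> and \<open>level \<gamma> n i\<close> matter only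
  through \<open>\<Pi>\<^sub>i\<close>.\<close>

primrec block_maps :: "(nat \<Rightarrow> 'a \<Rightarrow> 'a) \<Rightarrow> (nat \<Rightarrow> real) \<Rightarrow> nat \<Rightarrow> nat \<Rightarrow> ('a \<Rightarrow> 'a) list" where
  "block_maps \<pi> \<gamma> n 0 = []"
| "block_maps \<pi> \<gamma> n (Suc i) = block_maps \<pi> \<gamma> n i @
     replicate (level \<gamma> n (Suc i) - level \<gamma> n i) (letter_proj \<pi> (Suc i))"

lemma letter_proj_1[simp]: "letter_proj \<pi> (Suc 0) = id" by (simp add: letter_proj_def)

lemma letter_proj_factor:
  assumes "1 \<le> m" "m \<le> i"
  shows "letter_proj \<pi> i = (\<lambda>a. fold \<pi> [m..<i] (letter_proj \<pi> m a))"
proof -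
  have "[1..<i] = [1..<m] @ [m..<i]" using assms upt_add_eq_append[of 1 m "i - m"] by simp
  then show ?thesis by (simp add: letter_proj_def fun_eq_iff)
qed

lemma letter_proj_image:
  assumes "\<And>i. i \<in> {1..k - 1} \<Longrightarrow> \<pi> i ` \<A> i = \<A> (i + 1)"
  shows "1 \<le> i \<Longrightarrow> i \<le> k \<Longrightarrow> letter_proj \<pi> i ` \<A> 1 = \<A> i"
proof (induction i rule: dec_induct)
  case (step i)
  then have fac: "letter_proj \<pi> (Suc i) = (\<lambda>a. \<pi> i (letter_proj \<pi> i a))"
    using letter_proj_factor[of i "Suc i" \<pi>] by simp
  have "letter_proj \<pi> (Suc i) ` \<A> 1 = \<pi> i ` letter_proj \<pi> i ` \<A> 1"
    unfolding fac image_image ..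
  also have "\<dots> = \<A> (Suc i)" using step assms[of i] by simp
  finally show ?case .
qed simp

lemma set_block_maps: "set (block_maps \<pi> \<gamma> n i) \<subseteq> letter_proj \<pi> ` {1..i}"
  by (induction i) (force simp: atLeastAtMostSuc_conv)+

lemma code_eq_iff:
  "code gs x = code gs y \<longleftrightarrow> (\<forall>j<length gs. (gs ! j) (x !! j) = (gs ! j) (y !! j))"
  unfolding list_eq_iff_nth_eq by (auto simp: code_def)

context
  fixes \<gamma> :: "nat \<Rightarrow> real" and k :: nat
  assumes \<gamma>1: "0 < \<gamma> 1" and \<gamma>: "\<And>i. i \<in> {1..k} \<Longrightarrow> 0 \<le> \<gamma> i"
begin

lemma sum_\<gamma>_pos: "1 \<le> i \<Longrightarrow> i \<le> k \<Longrightarrow> 0 < (\<Sum>j = 1..i. \<gamma> j)"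
proof -
  assume i: "1 \<le> i" "i \<le> k"
  have "\<gamma> 1 \<le> (\<Sum>j = 1..i. \<gamma> j)" using i \<gamma> by (intro member_le_sum) auto
  then show ?thesis using \<gamma>1 by linarith
qed

lemma sum_\<gamma>_nonneg: "i \<le> k \<Longrightarrow> 0 \<le> (\<Sum>j = 1..i. \<gamma> j)"
  using \<gamma> by (intro sum_nonneg) auto

lemma level_mono: "Suc i \<le> k \<Longrightarrow> level \<gamma> n i \<le> level \<gamma> n (Suc i)"
proof -
  assume i: "Suc i \<le> k"
  have "(\<Sum>j = 1..i. \<gamma> j) \<le> (\<Sum>j = 1..Suc i. \<gamma> j)" using \<gamma>[of "Suc i"] i by simp
  then have "real n * ((\<Sum>j = 1..i. \<gamma> j) / \<gamma> 1) \<le> real n * ((\<Sum>j = 1..Suc i. \<gamma> j) / \<gamma> 1)"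
    using \<gamma>1 by (intro mult_left_mono divide_right_mono) auto
  then show ?thesis unfolding level_def by (intro nat_mono ceiling_mono)
qed

lemma level_0: "level \<gamma> n 0 = 0" by (simp add: level_def)

lemma length_block_maps: "i \<le> k \<Longrightarrow> length (block_maps \<pi> \<gamma> n i) = level \<gamma> n i"
proof (induction i)
  case (Suc i)
  then show ?case using level_mono[of i n] by simp
qed (simp add: level_0)

text \<open>Agreement of two letters under an earlier projection implies agreement under every later
  one. So before \<open>level \<gamma> n i\<close> the next projection imposes nothing new, and only
  its own block of ranks has to be added.\<close>

lemma code_block_maps_eq_iff:
  "i \<le> k \<Longrightarrow> code (block_maps \<pi> \<gamma> n i) x = code (block_maps \<pi> \<gamma> n i) y \<longleftrightarrow>
    (\<forall>i'\<in>{1..i}. \<forall>j<level \<gamma> n i'. letter_proj \<pi> i' (x !! j) = letter_proj \<pi> i' (y !! j))"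
proof (induction i)
  case (Suc i)
  let ?b = "block_maps \<pi> \<gamma> n i" and ?P = "letter_proj \<pi> (Suc i)"
  have len: "length ?b = level \<gamma> n i" using Suc.prems by (intro length_block_maps) auto
  have len': "length (block_maps \<pi> \<gamma> n (Suc i)) = level \<gamma> n (Suc i)" using Suc.prems by (intro length_block_maps)
  have lm: "level \<gamma> n i \<le> level \<gamma> n (Suc i)" by (rule level_mono[OF Suc.prems])
  have nth1: "block_maps \<pi> \<gamma> n (Suc i) ! j = ?b ! j" if "j < level \<gamma> n i" for j
    using that len by (simp add: nth_append)
  have nth2: "block_maps \<pi> \<gamma> n (Suc i) ! j = ?P" if "level \<gamma> n i \<le> j" "j < level \<gamma> n (Suc i)" for j
    using that len by (simp add: nth_append)
  have IH: "(\<forall>j<level \<gamma> n i. (?b ! j) (x !! j) = (?b ! j) (y !! j)) \<longleftrightarrow>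
    (\<forall>i'\<in>{1..i}. \<forall>j<level \<gamma> n i'. letter_proj \<pi> i' (x !! j) = letter_proj \<pi> i' (y !! j))"
    using Suc unfolding code_eq_iff len by simp
  have fac: "?P (x !! j) = ?P (y !! j)" if j: "j < level \<gamma> n i" and eq: "(?b ! j) (x !! j) = (?b ! j) (y !! j)" for j
  proof -
    have "?b ! j \<in> set ?b" using j len by simp
    then have "?b ! j \<in> letter_proj \<pi> ` {1..i}" using set_block_maps[of \<pi> \<gamma> n i] by (rule rev_subsetD)
    then obtain m where m: "?b ! j = letter_proj \<pi> m" "m \<in> {1..i}" by (rule imageE)
    show ?thesis using eq letter_proj_factor[of m "Suc i" \<pi>] m by simp
  qed
  have "code (block_maps \<pi> \<gamma> n (Suc i)) x = code (block_maps \<pi> \<gamma> n (Suc i)) y \<longleftrightarrow>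
     (\<forall>j<level \<gamma> n i. (?b ! j) (x !! j) = (?b ! j) (y !! j)) \<and>
     (\<forall>j<level \<gamma> n (Suc i). ?P (x !! j) = ?P (y !! j))" (is "?L \<longleftrightarrow> ?R1 \<and> ?R2")
  proof
    assume ?L
    then have L: "(block_maps \<pi> \<gamma> n (Suc i) ! j) (x !! j) = (block_maps \<pi> \<gamma> n (Suc i) ! j) (y !! j)"
      if "j < level \<gamma> n (Suc i)" for j
      using that unfolding code_eq_iff len' by blast
    have R1: ?R1
    proof (intro allI impI)
      fix j assume j: "j < level \<gamma> n i"
      show "(?b ! j) (x !! j) = (?b ! j) (y !! j)"
        using L[OF less_le_trans[OF j lm]] unfolding nth1[OF j] .
    qed
    moreover have ?R2
    proof (intro allI impI)
      fix j assume j: "j < level \<gamma> n (Suc i)"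
      show "?P (x !! j) = ?P (y !! j)"
      proof (cases "j < level \<gamma> n i")
        case True
        then show ?thesis using fac R1 by blast
      next
        case False
        then have "level \<gamma> n i \<le> j" by simp
        then show ?thesis using L[OF j] unfolding nth2[OF \<open>level \<gamma> n i \<le> j\<close> j] by simp
      qed
    qed
    ultimately show "?R1 \<and> ?R2" ..
  next
    assume R: "?R1 \<and> ?R2"
    show ?L unfolding code_eq_iff len'
    proof (intro allI impI)
      fix j assume j: "j < level \<gamma> n (Suc i)"
      show "(block_maps \<pi> \<gamma> n (Suc i) ! j) (x !! j) = (block_maps \<pi> \<gamma> n (Suc i) ! j) (y !! j)"
      proof (cases "j < level \<gamma> n i")
        case True
        then show ?thesis using R unfolding nth1[OF True] by blast
      next
        case False
        then have "level \<gamma> n i \<le> j" by simp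
        then show ?thesis using R j unfolding nth2[OF \<open>level \<gamma> n i \<le> j\<close> j] by blast
      qed
    qed
  qed
  also have "\<dots> \<longleftrightarrow> (\<forall>i'\<in>{1..Suc i}. \<forall>j<level \<gamma> n i'. letter_proj \<pi> i' (x !! j) = letter_proj \<pi> i' (y !! j))"
    unfolding IH by (auto simp: atLeastAtMostSuc_conv)
  finally show ?case .
qed simp

lemma common_prefix_ge_iff:
  assumes "x \<noteq> (y :: 'b stream)"
  shows "m \<le> common_prefix_length x y \<longleftrightarrow> (\<forall>j<m. x !! j = y !! j)"
proof -
  have "\<exists>n. x !! n \<noteq> y !! n" using assms by (metis smap_alt stream.map_ident)
  then have L: "x !! (LEAST n. x !! n \<noteq> y !! n) \<noteq> y !! (LEAST n. x !! n \<noteq> y !! n)" by (rule LeastI_ex)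
  show ?thesis unfolding common_prefix_length_def
  proof
    assume "m \<le> (LEAST n. x !! n \<noteq> y !! n)"
    then show "\<forall>j<m. x !! j = y !! j" using not_less_Least by (metis (mono_tags, lifting) less_le_trans)
  next
    assume *: "\<forall>j<m. x !! j = y !! j"
    then show "m \<le> (LEAST n. x !! n \<noteq> y !! n)" using L by (meson not_le)
  qed
qed

lemma weighted_dist_le_iff:
  assumes k: "1 \<le> k"
  shows "weighted_dist k \<pi> \<gamma> x y \<le> exp (- (real n / \<gamma> 1)) \<longleftrightarrow>
    code (block_maps \<pi> \<gamma> n k) x = code (block_maps \<pi> \<gamma> n k) y"
proof -
  have trm: "(let x' = smap (letter_proj \<pi> i) x; y' = smap (letter_proj \<pi> i) y
       in if x' = y' then 0 else exp (- (real (common_prefix_length x' y') / (\<Sum>j = 1..i. \<gamma> j)))) \<le> exp (- (real n / \<gamma> 1)) \<longleftrightarrow>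
     (\<forall>j<level \<gamma> n i. letter_proj \<pi> i (x !! j) = letter_proj \<pi> i (y !! j))" if i: "i \<in> {1..k}" for i
  proof (cases "smap (letter_proj \<pi> i) x = smap (letter_proj \<pi> i) y")
    case True
    then have "letter_proj \<pi> i (x !! j) = letter_proj \<pi> i (y !! j)" for j by (metis snth_smap)
    then show ?thesis using True by simp
  next
    case False
    let ?c = "common_prefix_length (smap (letter_proj \<pi> i) x) (smap (letter_proj \<pi> i) y)"
    let ?s = "\<Sum>j = 1..i. \<gamma> j"
    have s: "0 < ?s" using i by (intro sum_\<gamma>_pos) auto
    have "exp (- (real ?c / ?s)) \<le> exp (- (real n / \<gamma> 1)) \<longleftrightarrow> real n / \<gamma> 1 \<le> real ?c / ?s" by simp
    also have "\<dots> \<longleftrightarrow> real n * (?s / \<gamma> 1) \<le> real ?c" using s \<gamma>1 by (simp add: field_simps)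
    also have "\<dots> \<longleftrightarrow> level \<gamma> n i \<le> ?c" unfolding level_def by (simp add: ceiling_le_iff nat_le_iff)
    also have "\<dots> \<longleftrightarrow> (\<forall>j<level \<gamma> n i. letter_proj \<pi> i (x !! j) = letter_proj \<pi> i (y !! j))"
      unfolding common_prefix_ge_iff[OF False] by simp
    finally show ?thesis using False by simp
  qed
  have "weighted_dist k \<pi> \<gamma> x y \<le> exp (- (real n / \<gamma> 1)) \<longleftrightarrow>
    (\<forall>i\<in>{1..k}. \<forall>j<level \<gamma> n i. letter_proj \<pi> i (x !! j) = letter_proj \<pi> i (y !! j))"
    unfolding weighted_dist_def using k trm by (subst Max_le_iff) auto
  then show ?thesis unfolding code_block_maps_eq_iff[OF order_refl] .
qed

lemma ball_partition_eq_cells: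
  assumes "1 \<le> k" "S \<noteq> {}"
  shows "ball_partition k S \<pi> \<gamma> n = cells S (block_maps \<pi> \<gamma> n k)"
  unfolding ball_partition_def cells_eq[OF assms(2)] weighted_dist_le_iff[OF assms(1)]
  by (intro image_cong refl Collect_cong conj_cong eq_commute)

lemma level_bounds:
  "i \<le> k \<Longrightarrow> real n * ((\<Sum>j = 1..i. \<gamma> j) / \<gamma> 1) \<le> real (level \<gamma> n i)"
  "i \<le> k \<Longrightarrow> real (level \<gamma> n i) \<le> real n * ((\<Sum>j = 1..i. \<gamma> j) / \<gamma> 1) + 1"
proof -
  assume i: "i \<le> k"
  have "0 \<le> real n * ((\<Sum>j = 1..i. \<gamma> j) / \<gamma> 1)" using sum_\<gamma>_nonneg[OF i] \<gamma>1 by simp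
  then have "real (level \<gamma> n i) = of_int \<lceil>real n * ((\<Sum>j = 1..i. \<gamma> j) / \<gamma> 1)\<rceil>"
    unfolding level_def by (simp add: ceiling_mono[of 0, simplified])
  then show "real n * ((\<Sum>j = 1..i. \<gamma> j) / \<gamma> 1) \<le> real (level \<gamma> n i)"
    "real (level \<gamma> n i) \<le> real n * ((\<Sum>j = 1..i. \<gamma> j) / \<gamma> 1) + 1" by linarith+
qed

lemma level_limit: "i \<le> k \<Longrightarrow> (\<lambda>n. real (level \<gamma> n i) / real n) \<longlonglongrightarrow> (\<Sum>j = 1..i. \<gamma> j) / \<gamma> 1"
proof (rule tendsto_sandwich)
  assume i: "i \<le> k"
  let ?c = "(\<Sum>j = 1..i. \<gamma> j) / \<gamma> 1"
  show "(\<lambda>n. ?c) \<longlonglongrightarrow> ?c" by (rule tendsto_const)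
  have "(\<lambda>n. ?c + 1 / real n) \<longlonglongrightarrow> ?c + 0" by (intro tendsto_intros lim_1_over_n)
  then show "(\<lambda>n. ?c + 1 / real n) \<longlonglongrightarrow> ?c" by simp
  show "\<forall>\<^sub>F n in sequentially. ?c \<le> real (level \<gamma> n i) / real n"
    using eventually_gt_at_top[of 0]
    by eventually_elim (use level_bounds(1)[OF i] in \<open>simp add: pos_le_divide_eq mult.commute\<close>)
  show "\<forall>\<^sub>F n in sequentially. real (level \<gamma> n i) / real n \<le> ?c + 1 / real n"
    using eventually_gt_at_top[of 0]
  proof eventually_elim
    case (elim n)
    have "real (level \<gamma> n i) / real n \<le> (real n * ?c + 1) / real n"
      using level_bounds(2)[OF i, of n] by (intro divide_right_mono) auto
    also have "\<dots> = ?c + 1 / real n" using elim by (simp add: add_divide_distrib)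
    finally show ?case .
  qed
qed

end

section \<open>Entropy rates of the block maps\<close>

context cascade_moment
begin

lemma entm_letter_proj_antimono: "1 \<le> m \<Longrightarrow> m \<le> i \<Longrightarrow> entm (letter_proj \<pi> i) \<le> entm (letter_proj \<pi> m)"
  unfolding letter_proj_factor[of m i \<pi>] by (rule entm_compose_le)

text \<open>The entropies decrease along the projections. If the last block is still at or above
  \<open>dimen\<close>, so are all earlier ones; otherwise the new block is appended to the second
  part.\<close>

lemma split_sorted_block_maps: "split_sorted (block_maps \<pi> \<gamma> n i)"
proof (induction i)
  case 0
  then show ?case by (simp add: split_sorted_def)
next
  case (Suc i)
  let ?P = "letter_proj \<pi> (Suc i)" and ?b = "block_maps \<pi> \<gamma> n i"
  let ?r = "replicate (level \<gamma> n (Suc i) - level \<gamma> n i) ?P"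
  show ?case
  proof (cases "dimen \<le> entm ?P")
    case True
    have "dimen \<le> entm g" if g: "g \<in> set ?b" for g
    proof -
      have "g \<in> letter_proj \<pi> ` {1..i}" using g set_block_maps[of \<pi> \<gamma> n i] by (rule rev_subsetD)
      then obtain m where "g = letter_proj \<pi> m" "m \<in> {1..i}" by (rule imageE)
      then show ?thesis using True entm_letter_proj_antimono[of m "Suc i" \<pi>] by simp
    qed
    then have "\<forall>g\<in>set (?b @ ?r). dimen \<le> entm g" using True by auto
    then show ?thesis unfolding split_sorted_def block_maps.simps(2)
      by (intro exI[of _ "?b @ ?r"] exI[of _ "[]"]) simp
  next
    case False
    obtain gs1 gs2 where "?b = gs1 @ gs2" "\<forall>g\<in>set gs1. dimen \<le> entm g" "\<forall>g\<in>set gs2. entm g \<le> dimen"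
      using Suc unfolding split_sorted_def by blast
    then show ?thesis unfolding split_sorted_def
      by (intro exI[of _ gs1] exI[of _ "gs2 @ ?r"]) (use False in auto)
  qed
qed

lemma minent_append: "minent (gs @ gs') = minent gs + minent gs'" by (simp add: minent_def)

lemma minent_replicate: "minent (replicate m g) = real m * min dimen (entm g)"
  by (simp add: minent_def sum_list_replicate)

text \<open>The length of block \<open>i\<close> is the difference of two consecutive levels,
  asymptotically \<open>n * \<gamma> i / \<gamma> 1\<close>; the ceilings disappear after division
  by \<open>n\<close>.\<close>

lemma minent_block_maps_limit:
  assumes \<gamma>1: "0 < \<gamma> 1" and \<gamma>: "\<And>i. i \<in> {1..k} \<Longrightarrow> 0 \<le> \<gamma> i"
  shows "i \<le> k \<Longrightarrow> (\<lambda>n. minent (block_maps \<pi> \<gamma> n i) / real n) \<longlonglongrightarrow> (\<Sum>j = 1..i. \<gamma> j / \<gamma> 1 * min dimen (entm (letter_proj \<pi> j)))"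
proof (induction i)
  case 0
  then show ?case by (simp add: minent_def)
next
  case (Suc i)
  let ?e = "min dimen (entm (letter_proj \<pi> (Suc i)))"
  have eq: "minent (block_maps \<pi> \<gamma> n (Suc i)) / real n =
    minent (block_maps \<pi> \<gamma> n i) / real n + (real (level \<gamma> n (Suc i)) / real n - real (level \<gamma> n i) / real n) * ?e" for n
    using level_mono[where \<gamma> = \<gamma> and k = k and n = n, OF \<gamma>1 \<gamma> Suc.prems]
    by (simp add: minent_append minent_replicate of_nat_diff add_divide_distrib diff_divide_distrib left_diff_distrib)
  have "(\<lambda>n. minent (block_maps \<pi> \<gamma> n (Suc i)) / real n) \<longlonglongrightarrow>
     (\<Sum>j = 1..i. \<gamma> j / \<gamma> 1 * min dimen (entm (letter_proj \<pi> j))) +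
     ((\<Sum>j = 1..Suc i. \<gamma> j) / \<gamma> 1 - (\<Sum>j = 1..i. \<gamma> j) / \<gamma> 1) * ?e"
    unfolding eq using Suc.prems by (intro tendsto_intros Suc.IH level_limit[where \<gamma> = \<gamma> and k = k, OF \<gamma>1 \<gamma>]) auto
  moreover have "(\<Sum>j = 1..Suc i. \<gamma> j) / \<gamma> 1 - (\<Sum>j = 1..i. \<gamma> j) / \<gamma> 1 = \<gamma> (Suc i) / \<gamma> 1"
    by (simp add: add_divide_distrib)
  ultimately show ?case by simp
qed

end

subsection \<open>The derivative of the spectrum at 1\<close>

theorem theorem3p1:
  fixes k :: nat
    and \<A> :: "nat \<Rightarrow> 'a set"
    and \<pi> :: "nat \<Rightarrow> 'a \<Rightarrow> 'a"
    and \<gamma> :: "nat \<Rightarrow> real"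
    and M :: "'w measure"
    and A :: "'w \<Rightarrow> 'a set"
    and W :: "'w \<Rightarrow> 'a \<Rightarrow> real"
    and At :: "'a list \<Rightarrow> 'w \<Rightarrow> 'a set"
    and Wt :: "'a list \<Rightarrow> 'w \<Rightarrow> 'a \<Rightarrow> real"
    and \<mu> :: "'w \<Rightarrow> 'a stream measure"
    and \<nu> :: "nat \<Rightarrow> 'a stream measure"
  assumes k: "k \<ge> 2"
    and alphabets: "\<And>i. i \<in> {1..k} \<Longrightarrow> finite (\<A> i) \<and> card (\<A> i) \<ge> 2"
    and factor_maps: "\<And>i. i \<in> {1..k - 1} \<Longrightarrow> \<pi> i ` \<A> i = \<A> (i + 1)"
    and \<gamma>_1: "\<gamma> 1 > 0"
    and \<gamma>_nonneg: "\<And>i. i \<in> {2..k} \<Longrightarrow> \<gamma> i \<ge> 0"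
    and prob: "prob_space M"
    and AW_measurable: "(\<lambda>\<omega>. (A \<omega>, W \<omega>)) \<in> M \<rightarrow>\<^sub>M offspring_space (\<A> 1)"
    and mean_A: "prob_space.expectation M (\<lambda>\<omega>. real (card (A \<omega>))) > 1"
    and W_nonneg: "\<And>\<omega> a. \<omega> \<in> space M \<Longrightarrow> a \<in> \<A> 1 \<Longrightarrow> W \<omega> a \<ge> 0"
    and W_support: "\<And>\<omega> a. \<omega> \<in> space M \<Longrightarrow> a \<in> \<A> 1 \<Longrightarrow> W \<omega> a > 0 \<Longrightarrow> a \<in> A \<omega>"
    and mean_W: "prob_space.expectation M (\<lambda>\<omega>. \<Sum>a\<in>\<A> 1. W \<omega> a) = 1"
    and copies_indep: "prob_space.indep_vars M (\<lambda>_. offspring_space (\<A> 1))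
                         (\<lambda>u \<omega>. (At u \<omega>, Wt u \<omega>)) (lists (\<A> 1))"
    and copies_law: "\<And>u. u \<in> lists (\<A> 1) \<Longrightarrow>
          distr M (offspring_space (\<A> 1)) (\<lambda>\<omega>. (At u \<omega>, Wt u \<omega>)) =
          distr M (offspring_space (\<A> 1)) (\<lambda>\<omega>. (A \<omega>, W \<omega>))"
    and \<mu>_eq: "\<mu> = mandelbrot_measure (\<A> 1) Wt"
    and nondegenerate:
      "prob_space.prob M {\<omega> \<in> space M. emeasure (\<mu> \<omega>) (space (\<mu> \<omega>)) \<noteq> 0} > 0"
    and T_finite: "\<exists>q > 1. cascade_T M (\<A> 1) W q > - \<infinity>"
    and \<nu>_eq: "\<And>i. \<nu> i = mean_measure M (stream_space (count_space (\<A> i)))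
          (\<lambda>\<omega>. distr (\<mu> \<omega>) (stream_space (count_space (\<A> i))) (smap (letter_proj \<pi> i)))"
  shows "(\<forall>i\<in>{2..k}. bernoulli_product (\<A> i) (\<nu> i)) \<and>
    (AE \<omega> in M. emeasure (\<mu> \<omega>) (space (\<mu> \<omega>)) \<noteq> 0 \<longrightarrow>
       (\<exists>d D. has_entropy_dim (\<A> 1) (\<mu> \<omega>) d \<and>
              has_weighted_entropy_dim k (\<A> 1) \<pi> \<gamma> (\<mu> \<omega>) D \<and>
              has_ereal_derivative (Lq_spectrum k (\<A> 1) \<pi> \<gamma> (\<mu> \<omega>)) D 1 \<and>
              ereal D = ereal (\<gamma> 1 * d) +
                (\<Sum>i = 2..k. ereal (\<gamma> i) * min (ereal d) (measure_entropy (\<nu> i) stl))))"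
proof -
  define S where "S = \<A> 1"
  note folded = AW_measurable[folded S_def] W_nonneg[folded S_def] mean_W[folded S_def]
    copies_indep[folded S_def] copies_law[folded S_def] T_finite[folded S_def] \<mu>_eq[folded S_def]
  note AW_measurable = folded(1) and W_nonneg = folded(2) and mean_W = folded(3)
    and copies_indep = folded(4) and copies_law = folded(5) and T_finite = folded(6) and \<mu>_eq = folded(7)
  let ?off = "offspring_space S"
  let ?B = "\<Pi>\<^sub>M a\<in>S. borel :: real measure"
  interpret prob_space M by (rule prob)
  have fS: "finite S" using alphabets[of 1] k by (simp add: S_def)
  \<comment> \<open>The copies \<open>Wt u\<close> are nonnegative only almost surely, through their
    law, while \<open>cascade\<close> asks for it everywhere. Truncation at 0 preserves independence
    and equality in law, and it almost surely leaves the measure unchanged.\<close>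
  define h :: "'a set \<times> ('a \<Rightarrow> real) \<Rightarrow> 'a \<Rightarrow> real" where "h x = (\<lambda>a\<in>S. max 0 (snd x a))" for x
  define X :: "'a list \<Rightarrow> 'w \<Rightarrow> 'a \<Rightarrow> real" where "X u \<omega> = h (At u \<omega>, Wt u \<omega>)" for u \<omega>
  have comp: "(\<lambda>x. snd x a) \<in> borel_measurable ?off" if "a \<in> S" for a
    using that by (intro measurable_compose[OF measurable_snd measurable_component_singleton])
  have h_meas: "h \<in> measurable ?off ?B"
    unfolding h_def[abs_def] by (intro measurable_restrict borel_measurable_max borel_measurable_const comp)
  have AW_u: "(\<lambda>\<omega>. (At u \<omega>, Wt u \<omega>)) \<in> measurable M ?off" if "u \<in> lists S" for u
    using copies_indep that by (auto simp: indep_vars_def)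
  have X_ind: "indep_vars (\<lambda>_. ?B) X (lists S)"
    using indep_vars_compose2[OF copies_indep, of "\<lambda>_. h" "\<lambda>_. ?B"] h_meas by (simp add: X_def[abs_def])
  have X_law: "distr M ?B (X u) = distr (distr M ?off (\<lambda>\<omega>. (A \<omega>, W \<omega>))) ?B h" if "u \<in> lists S" for u
    unfolding copies_law[OF that, symmetric]
    by (subst distr_distr[OF h_meas AW_u[OF that]]) (simp add: X_def[abs_def] comp_def)
  have nn_eq: "(\<integral>\<^sup>+\<omega>. F (At u \<omega>, Wt u \<omega>) \<partial>M) = (\<integral>\<^sup>+\<omega>. F (A \<omega>, W \<omega>) \<partial>M)"
    if u: "u \<in> lists S" and F: "F \<in> borel_measurable ?off" for u and F :: "_ \<Rightarrow> ennreal"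
  proof -
    have "(\<integral>\<^sup>+\<omega>. F (At u \<omega>, Wt u \<omega>) \<partial>M) = (\<integral>\<^sup>+x. F x \<partial>distr M ?off (\<lambda>\<omega>. (At u \<omega>, Wt u \<omega>)))"
      using AW_u[OF u] F by (subst nn_integral_distr) simp_all
    also have "\<dots> = (\<integral>\<^sup>+\<omega>. F (A \<omega>, W \<omega>) \<partial>M)"
      unfolding copies_law[OF u] using AW_measurable F by (subst nn_integral_distr) simp_all
    finally show ?thesis .
  qed
  have X_eq: "X u \<omega> a = max 0 (Wt u \<omega> a)" if "a \<in> S" for u \<omega> a using that by (simp add: X_def h_def)
  have nn_X: "(\<integral>\<^sup>+\<omega>. ennreal (\<Sum>a\<in>S. X [] \<omega> a powr q) \<partial>M) = (\<integral>\<^sup>+\<omega>. ennreal (\<Sum>a\<in>S. W \<omega> a powr q) \<partial>M)" for q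
  proof -
    have "(\<integral>\<^sup>+\<omega>. ennreal (\<Sum>a\<in>S. X [] \<omega> a powr q) \<partial>M) = (\<integral>\<^sup>+\<omega>. (\<lambda>x. ennreal (\<Sum>a\<in>S. max 0 (snd x a) powr q)) (At [] \<omega>, Wt [] \<omega>) \<partial>M)"
      by (simp add: X_eq)
    also have "\<dots> = (\<integral>\<^sup>+\<omega>. (\<lambda>x. ennreal (\<Sum>a\<in>S. max 0 (snd x a) powr q)) (A \<omega>, W \<omega>) \<partial>M)"
      by (rule nn_eq) (auto intro!: measurable_compose[OF _ measurable_ennreal] borel_measurable_sum
          powr_real_measurable borel_measurable_max comp)
    also have "\<dots> = (\<integral>\<^sup>+\<omega>. ennreal (\<Sum>a\<in>S. W \<omega> a powr q) \<partial>M)"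
      using W_nonneg by (intro nn_integral_cong) (simp add: max_def)
    finally show ?thesis .
  qed
  have mean: "(\<integral>\<^sup>+\<omega>. ennreal (\<Sum>a\<in>S. X [] \<omega> a) \<partial>M) = 1"
  proof -
    have "(\<integral>\<^sup>+\<omega>. ennreal (\<Sum>a\<in>S. X [] \<omega> a) \<partial>M) = (\<integral>\<^sup>+\<omega>. ennreal (\<Sum>a\<in>S. X [] \<omega> a powr 1) \<partial>M)"
      by (simp add: X_eq)
    also have "\<dots> = (\<integral>\<^sup>+\<omega>. ennreal (\<Sum>a\<in>S. W \<omega> a) \<partial>M)"
      unfolding nn_X using W_nonneg by (intro nn_integral_cong) simp
    also have "\<dots> = ennreal (\<integral>\<omega>. (\<Sum>a\<in>S. W \<omega> a) \<partial>M)"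
    proof (rule nn_integral_eq_integral)
      \<comment> \<open>Otherwise the integral would be 0 by convention, not 1.\<close>
      show "integrable M (\<lambda>\<omega>. \<Sum>a\<in>S. W \<omega> a)"
        using mean_W not_integrable_integral_eq by fastforce
      show "AE \<omega> in M. 0 \<le> (\<Sum>a\<in>S. W \<omega> a)"
        using W_nonneg by (intro AE_I2 sum_nonneg) auto
    qed
    finally show ?thesis by (simp add: mean_W)
  qed
  have Wt_nonneg: "AE \<omega> in M. \<forall>a\<in>S. 0 \<le> Wt u \<omega> a" if u: "u \<in> lists S" for u
  proof -
    let ?P = "\<lambda>x :: 'a set \<times> ('a \<Rightarrow> real). \<forall>a\<in>S. 0 \<le> snd x a"
    have pm: "{x \<in> space ?off. ?P x} \<in> sets ?off"
    proof (rule sets.sets_Collect_finite_All[OF _ fS])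
      show "{x \<in> space ?off. 0 \<le> snd x a} \<in> sets ?off" if "a \<in> S" for a
        using comp[OF that] by measurable
    qed
    have "AE x in distr M ?off (\<lambda>\<omega>. (A \<omega>, W \<omega>)). ?P x"
      using W_nonneg by (subst AE_distr_iff[OF AW_measurable pm]) (auto intro!: AE_I2)
    then have "AE x in distr M ?off (\<lambda>\<omega>. (At u \<omega>, Wt u \<omega>)). ?P x" by (simp only: copies_law[OF u])
    from AE_distrD[OF AW_u[OF u] this] show ?thesis by simp
  qed
  interpret cascade M S X
  proof
    show "distr M ?B (X u) = distr M ?B (X [])" if "u \<in> lists S" for u
      using X_law[OF that] X_law[of "[]"] by simp
  qed (use fS X_ind mean X_eq in auto)
  have AE_\<mu>: "AE \<omega> in M. \<mu> \<omega> = mandelbrot_measure S X \<omega>"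
  proof -
    have "AE \<omega> in M. \<forall>u\<in>lists S. \<forall>a\<in>S. 0 \<le> Wt u \<omega> a"
      by (subst AE_ball_countable[OF countable_lists]) (use Wt_nonneg in blast)
    then show ?thesis
    proof eventually_elim
      case (elim \<omega>)
      then show ?case unfolding \<mu>_eq
        by (intro mandelbrot_measure_cong) (simp add: X_eq max_def)
    qed
  qed
  obtain q where q: "1 < q" "cascade_T M S W q > - \<infinity>" using T_finite by blast
  have fin_q: "(\<integral>\<^sup>+\<omega>. ennreal (\<Sum>a\<in>S. W \<omega> a powr q) \<partial>M) \<noteq> \<infinity>"
    using q(2) unfolding cascade_T_def Let_def by (auto split: if_splits)
  \<comment> \<open>The moment of order \<open>min q 2\<close> is finite by
    \<open>powr_le_one_plus\<close>, as there are finitely many letters.\<close>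
  interpret cascade_moment M S X "min q 2"
  proof
    show "1 < min q 2" "min q 2 \<le> 2" using q by auto
    have "(\<integral>\<^sup>+\<omega>. ennreal (\<Sum>a\<in>S. X [] \<omega> a powr min q 2) \<partial>M) \<le>
      (\<integral>\<^sup>+\<omega>. ennreal (real (card S)) + ennreal (\<Sum>a\<in>S. X [] \<omega> a powr q) \<partial>M)"
    proof (rule nn_integral_mono)
      fix \<omega>
      have "(\<Sum>a\<in>S. X [] \<omega> a powr min q 2) \<le> (\<Sum>a\<in>S. 1 + X [] \<omega> a powr q)"
        using q by (intro sum_mono powr_le_one_plus) (auto simp: X_eq)
      then have "ennreal (\<Sum>a\<in>S. X [] \<omega> a powr min q 2) \<le> ennreal (real (card S) + (\<Sum>a\<in>S. X [] \<omega> a powr q))"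
        by (intro ennreal_leI) (simp add: sum.distrib)
      then show "ennreal (\<Sum>a\<in>S. X [] \<omega> a powr min q 2) \<le> ennreal (real (card S)) + ennreal (\<Sum>a\<in>S. X [] \<omega> a powr q)"
        by (simp add: sum_nonneg)
    qed
    also have "\<dots> = (\<integral>\<^sup>+\<omega>. ennreal (real (card S)) \<partial>M) + (\<integral>\<^sup>+\<omega>. ennreal (\<Sum>a\<in>S. X [] \<omega> a powr q) \<partial>M)"
      by (rule nn_integral_add) (auto intro!: measurable_compose[OF _ measurable_ennreal] borel_measurable_sum
          powr_real_measurable X_Nil_meas)
    also have "\<dots> < \<infinity>" using fin_q unfolding nn_X by (simp add: emeasure_space_1 less_top)
    finally show "(\<integral>\<^sup>+\<omega>. ennreal (\<Sum>a\<in>S. X [] \<omega> a powr min q 2) \<partial>M) < \<infinity>" .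
    show "\<not> (AE \<omega> in M. cascade_Y S X \<omega> [] = 0)"
    proof
      assume "AE \<omega> in M. cascade_Y S X \<omega> [] = 0"
      then have "AE \<omega> in M. \<not> emeasure (\<mu> \<omega>) (space (\<mu> \<omega>)) \<noteq> 0"
        using AE_\<mu> AE_good
      proof eventually_elim
        case (elim \<omega>)
        then show ?case using emeasure_\<mu>_space[OF elim(3)] by (simp add: V_def)
      qed
      \<comment> \<open>A set outside \<open>sets M\<close> has measure 0, so the positive
        probability also shows that this event is measurable.\<close>
      moreover have "{\<omega> \<in> space M. emeasure (\<mu> \<omega>) (space (\<mu> \<omega>)) \<noteq> 0} \<in> sets M"
        using nondegenerate measure_notin_sets by fastforce
      ultimately have "prob {\<omega> \<in> space M. emeasure (\<mu> \<omega>) (space (\<mu> \<omega>)) \<noteq> 0} = 0"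
        by (subst prob_eq_0) auto
      then show False using nondegenerate by simp
    qed
  qed
  have proj: "letter_proj \<pi> i ` S = \<A> i" if "1 \<le> i" "i \<le> k" for i
    unfolding S_def by (rule letter_proj_image[where k = k and \<pi> = \<pi> and \<A> = \<A>, OF factor_maps that])
  have \<nu>: "\<nu> i = stream_space (letter_law (letter_proj \<pi> i))" if "1 \<le> i" "i \<le> k" for i
  proof -
    let ?N = "stream_space (count_space (\<A> i))" and ?f = "smap (letter_proj \<pi> i)"
    have "\<nu> i = mean_measure M ?N (\<lambda>\<omega>. distr (mandelbrot_measure S X \<omega>) ?N ?f)"
      unfolding \<nu>_eq mean_measure_def
    proof (rule arg_cong[where f = "measure_of (space ?N) (sets ?N)"], rule ext)
      fix C
      show "(\<integral>\<^sup>+\<omega>. emeasure (distr (\<mu> \<omega>) ?N ?f) C \<partial>M) = (\<integral>\<^sup>+\<omega>. emeasure (distr (mandelbrot_measure S X \<omega>) ?N ?f) C \<partial>M)"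
        by (rule nn_integral_cong_AE, use AE_\<mu> in eventually_elim) simp
    qed
    also have "\<dots> = stream_space (letter_law (letter_proj \<pi> i))"
      by (rule mean_measure_\<mu>[OF proj[OF that]])
    finally show ?thesis .
  qed
  have bern: "bernoulli_product (\<A> i) (\<nu> i)" if "i \<in> {2..k}" for i
  proof -
    have i: "1 \<le> i" "i \<le> k" using that by auto
    interpret p: bernoulli_shift "letter_law (letter_proj \<pi> i)" "letter_proj \<pi> i ` S"
      by (rule bernoulli_shift_letter_law)
    show ?thesis unfolding bernoulli_product_def
      using p.prob_space_axioms p.sets_p \<nu>[OF i] proj[OF i] by auto
  qed
  have \<gamma>0: "0 \<le> \<gamma> i" if "i \<in> {1..k}" for i
    using that \<gamma>_1 \<gamma>_nonneg[of i] by (cases "i = 1") auto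
  define D where "D = (\<Sum>j = 1..k. \<gamma> j / \<gamma> 1 * min dimen (entm (letter_proj \<pi> j)))"
  \<comment> \<open>The last level is at most \<open>n * (C - 1) + 1\<close> because of the ceiling,
    thus at most \<open>C * Suc n\<close>, also for \<open>n = 0\<close>.\<close>
  define C where "C = (\<Sum>j = 1..k. \<gamma> j) / \<gamma> 1 + 1"
  have C: "0 \<le> C" unfolding C_def using \<gamma>_1 \<gamma>0 by (intro add_nonneg_nonneg divide_nonneg_nonneg sum_nonneg) auto
  have balls: "AE \<omega> in M. emeasure (mandelbrot_measure S X \<omega>) (space (mandelbrot_measure S X \<omega>)) \<noteq> 0 \<longrightarrow>
    (\<lambda>n. 1 / real n * shannon_entropy (uniform_measure (mandelbrot_measure S X \<omega>) (space (mandelbrot_measure S X \<omega>)))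
       (cells S (block_maps \<pi> \<gamma> n k))) \<longlonglongrightarrow> D \<and>
    has_ereal_derivative (\<lambda>q. liminf (\<lambda>n. ereal (- (\<gamma> 1 / real n) *
       ln (\<Sum>B\<in>cells S (block_maps \<pi> \<gamma> n k). measure (mandelbrot_measure S X \<omega>) B powr q)))) (\<gamma> 1 * D) 1"
  proof (rule AE_cells_asymptotics[where Gs = "letter_proj \<pi> ` {1..k}" and C = C])
    show "(\<lambda>n. minent (block_maps \<pi> \<gamma> n k) / real n) \<longlonglongrightarrow> D"
      unfolding D_def by (rule minent_block_maps_limit[where \<gamma> = \<gamma> and k = k, OF \<gamma>_1 \<gamma>0 order_refl])
    show "real (length (block_maps \<pi> \<gamma> n k)) \<le> C * real (Suc n)" for n
    proof -
      have "real (length (block_maps \<pi> \<gamma> n k)) \<le> real n * ((\<Sum>j = 1..k. \<gamma> j) / \<gamma> 1) + 1"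
      proof -
        have "length (block_maps \<pi> \<gamma> n k) = level \<gamma> n k"
          by (rule length_block_maps[where k = k]) (use \<gamma>_1 \<gamma>0 in auto)
        moreover have "real (level \<gamma> n k) \<le> real n * ((\<Sum>j = 1..k. \<gamma> j) / \<gamma> 1) + 1"
          by (rule level_bounds(2)[where k = k]) (use \<gamma>_1 \<gamma>0 in auto)
        ultimately show ?thesis by simp
      qed
      moreover have "0 \<le> (\<Sum>j = 1..k. \<gamma> j) / \<gamma> 1"
        using \<gamma>_1 \<gamma>0 by (intro divide_nonneg_nonneg sum_nonneg) auto
      moreover have "a \<le> (c + 1) * real (Suc n)" if "a \<le> real n * c + 1" "0 \<le> c" for a c :: real
        using that by (simp add: algebra_simps)
      ultimately show ?thesis unfolding C_def by blast
    qed
    show "set (block_maps \<pi> \<gamma> n k) \<subseteq> letter_proj \<pi> ` {1..k}" for n by (rule set_block_maps)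
    show "split_sorted (block_maps \<pi> \<gamma> n k)" for n by (rule split_sorted_block_maps)
  qed (use \<gamma>_1 C in auto)
  \<comment> \<open>Cylinders of length \<open>n\<close> are the cells of \<open>n\<close> copies of
    the identity; the entropy limit for them identifies the entropy dimension as
    \<open>dimen\<close>.\<close>
  have cyls: "AE \<omega> in M. emeasure (mandelbrot_measure S X \<omega>) (space (mandelbrot_measure S X \<omega>)) \<noteq> 0 \<longrightarrow>
    (\<lambda>n. 1 / real n * shannon_entropy (uniform_measure (mandelbrot_measure S X \<omega>) (space (mandelbrot_measure S X \<omega>)))
       (cells S (replicate n id :: ('a \<Rightarrow> 'a) list))) \<longlonglongrightarrow> dimen \<and>
    has_ereal_derivative (\<lambda>q. liminf (\<lambda>n. ereal (- (1 / real n) *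
       ln (\<Sum>B\<in>cells S (replicate n id :: ('a \<Rightarrow> 'a) list). measure (mandelbrot_measure S X \<omega>) B powr q)))) (1 * dimen) 1"
  proof (rule AE_cells_asymptotics[where Gs = "{id}" and C = 1])
    have m: "minent (replicate n id) = real n * dimen" for n
      unfolding minent_replicate using dimen_le_entm_id by (simp add: min_def)
    have "\<forall>\<^sub>F n in sequentially. dimen = minent (replicate n id) / real n"
      using eventually_gt_at_top[of 0] by eventually_elim (simp add: m)
    then show "(\<lambda>n. minent (replicate n id) / real n) \<longlonglongrightarrow> dimen"
      by (rule Lim_transform_eventually[OF tendsto_const])
    show "split_sorted (replicate n id)" for n
      unfolding split_sorted_def using dimen_le_entm_id
      by (intro exI[of _ "replicate n id"] exI[of _ "[]"]) auto
  qed auto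
  have ball_eq: "ball_partition k S \<pi> \<gamma> n = cells S (block_maps \<pi> \<gamma> n k)" for n
    using k by (intro ball_partition_eq_cells[where \<gamma> = \<gamma> and k = k, OF \<gamma>_1 \<gamma>0] S_nonempty) auto
  have D_eq: "ereal (\<gamma> 1 * D) = ereal (\<gamma> 1 * dimen) +
     (\<Sum>i = 2..k. ereal (\<gamma> i) * min (ereal dimen) (measure_entropy (\<nu> i) stl))"
  proof -
    have split: "{1..k} = insert 1 {2..k}" using k by auto
    have "\<gamma> 1 * D = (\<Sum>j = 1..k. \<gamma> j * min dimen (entm (letter_proj \<pi> j)))"
      unfolding D_def sum_distrib_left using \<gamma>_1 by (intro sum.cong refl) simp
    \<comment> \<open>The first projection is the identity, for which the minimum is
      \<open>dimen\<close> by \<open>dimen_le_entm_id\<close>.\<close>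
    also have "\<dots> = \<gamma> 1 * dimen + (\<Sum>j = 2..k. \<gamma> j * min dimen (entm (letter_proj \<pi> j)))"
      unfolding split using dimen_le_entm_id by (subst sum.insert) (auto simp: min_def)
    finally have "ereal (\<gamma> 1 * D) = ereal (\<gamma> 1 * dimen) + ereal (\<Sum>j = 2..k. \<gamma> j * min dimen (entm (letter_proj \<pi> j)))"
      by simp
    also have "ereal (\<Sum>j = 2..k. \<gamma> j * min dimen (entm (letter_proj \<pi> j))) =
      (\<Sum>i = 2..k. ereal (\<gamma> i) * min (ereal dimen) (measure_entropy (\<nu> i) stl))"
      unfolding sum_ereal[symmetric]
    proof (intro sum.cong refl)
      fix i assume "i \<in> {2..k}"
      then have "measure_entropy (\<nu> i) stl = ereal (entm (letter_proj \<pi> i))"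
        using \<nu>[of i] measure_entropy_letter_law by simp
      then show "ereal (\<gamma> i * min dimen (entm (letter_proj \<pi> i))) =
        ereal (\<gamma> i) * min (ereal dimen) (measure_entropy (\<nu> i) stl)" by (simp add: min_def)
    qed
    finally show ?thesis .
  qed
  have "AE \<omega> in M. emeasure (\<mu> \<omega>) (space (\<mu> \<omega>)) \<noteq> 0 \<longrightarrow>
       (\<exists>d D. has_entropy_dim S (\<mu> \<omega>) d \<and>
              has_weighted_entropy_dim k S \<pi> \<gamma> (\<mu> \<omega>) D \<and>
              has_ereal_derivative (Lq_spectrum k S \<pi> \<gamma> (\<mu> \<omega>)) D 1 \<and>
              ereal D = ereal (\<gamma> 1 * d) +
                (\<Sum>i = 2..k. ereal (\<gamma> i) * min (ereal d) (measure_entropy (\<nu> i) stl)))"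
    using AE_\<mu> balls cyls
  proof eventually_elim
    case (elim \<omega>)
    note \<mu>\<omega> = elim(1)
    show ?case
    proof
      assume "emeasure (\<mu> \<omega>) (space (\<mu> \<omega>)) \<noteq> 0"
      then have nz: "emeasure (mandelbrot_measure S X \<omega>) (space (mandelbrot_measure S X \<omega>)) \<noteq> 0"
        unfolding \<mu>\<omega> .
      note b = elim(2)[rule_format, OF nz] and c = elim(3)[rule_format, OF nz]
      have 1: "has_entropy_dim S (\<mu> \<omega>) dimen"
        using conjunct1[OF c] unfolding has_entropy_dim_def \<mu>\<omega> cells_replicate_id .
      have 2: "has_weighted_entropy_dim k S \<pi> \<gamma> (\<mu> \<omega>) (\<gamma> 1 * D)"
        using tendsto_mult[OF tendsto_const[of "\<gamma> 1"] conjunct1[OF b]]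
        unfolding has_weighted_entropy_dim_def \<mu>\<omega> ball_eq by (simp add: mult.assoc)
      have 3: "has_ereal_derivative (Lq_spectrum k S \<pi> \<gamma> (\<mu> \<omega>)) (\<gamma> 1 * D) 1"
        using conjunct2[OF b] unfolding Lq_spectrum_def[abs_def] \<mu>\<omega> ball_eq .
      show "\<exists>d D. has_entropy_dim S (\<mu> \<omega>) d \<and>
              has_weighted_entropy_dim k S \<pi> \<gamma> (\<mu> \<omega>) D \<and>
              has_ereal_derivative (Lq_spectrum k S \<pi> \<gamma> (\<mu> \<omega>)) D 1 \<and>
              ereal D = ereal (\<gamma> 1 * d) +
                (\<Sum>i = 2..k. ereal (\<gamma> i) * min (ereal d) (measure_entropy (\<nu> i) stl))"
        using 1 2 3 D_eq by blast
    qed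
  qed
  then show ?thesis using bern unfolding S_def by blast
qed

end
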